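(* For each real $L\ge 0$ let $X_L=X_L^{(1)}\sqcup X_L^{(2)}$ be a locally compact Polish space split into two disjoint Borel parts, let $\mu_L$ be a Radon measure on $X_L$, and let $K_L:X_L\times X_L\to\mathbb{C}$ be a $J$-Hermitian kernel (with respect to this splitting and $\mu_L$) such that for every pre-compact Borel set $\Delta\subset X_L$ the operator $K_L\chi_\Delta$ belongs to $\mathscr{L}_{1|2}(L^2(X_L,\mu_L))$, the kernel being chosen so that for all $n\ge 1$ and all bounded measurable compactly supported $g_1,\dots,g_n:X_L\to\mathbb{R}$, $$\mathrm{Tr}(K_Lg_1K_Lg_2\cdots K_Lg_n)=\int_{X_L^n}g_1(x_1)K_L(x_1,x_2)g_2(x_2)K_L(x_2,x_3)\cdots g_n(x_n)K_L(x_n,x_1)\,d\mu_L(x_1)\cdots d\mu_L(x_n).$$ Let $\mathbb{P}_L$ be a determinantal point process on $X_L$ with kernel $K_L$ with respect to $\mu_L$, and let $\mathbb{E}_L$, $\mathrm{Var}_L$ denote expectation and variance with respect to $\mathbb{P}_L$. For each $L\ge 0$ let $f_L:X_L\to\mathbb{R}$ be a bounded measurable function with compact support, and put $S_{f_L}(\xi)=\sum_{x\in\xi}f_L(x)$ and $S_{|f_L|}(\xi)=\sum_{x\in\xi}|f_L(x)|$ for configurations $\xi$ on $X_L$. Suppose that (i) $\mathrm{Var}_L(S_{f_L})\to+\infty$ as $L\to+\infty$; (ii) for every $\varepsilon>0$, $\sup_{x\in X_L}|f_L(x)|=o\big((\mathrm{Var}_L(S_{f_L}))^{\varepsilon}\big)$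 as $L\to+\infty$; (iii) for some $\delta>0$, $\mathbb{E}_LS_{|f_L|}=O\big((\mathrm{Var}_L(S_{f_L}))^{\delta}\big)$ as $L\to+\infty$. Then the random variable $$\frac{S_{f_L}-\mathbb{E}_LS_{f_L}}{\sqrt{\mathrm{Var}_L S_{f_L}}}$$ converges in distribution to the standard normal law $N(0,1)$ as $L\to+\infty$.
   Context: Point processes. For a locally compact Polish space $X$, $\mathrm{Conf}(X)$ is the space of locally finite configurations $\xi=\sum_i\delta_{x_i}$, $x_i\in X$, with $\xi(\Delta)<\infty$ for all pre-compact Borel $\Delta$, equipped with the vague topology and its Borel $\sigma$-algebra. A point process on $X$ is a Borel probability measure $\mathbb{P}$ on $\mathrm{Conf}(X)$; it is simple if almost surely $\xi(\{x\})\le 1$ for all $x\in X$, in which case $\xi$ is identified with a subset of $X$. Given a Radon measure $\mu$ on $X$, the $n$-th correlation function of $\mathbb{P}$ with respect to $\mu$ (if it exists) is a non-negative measurable symmetric function $\rho_n$ on $X^n$ such that for all $m\ge1$, $n_1,\dots,n_m\ge 1$ with $n_1+\cdots+n_m=n$ and all mutually disjoint pre-compact Borel sets $\Delta_1,\dots,\Delta_m$, $$\mathbb{E}_{\mathbb{P}}\Big[\prod_{i=1}^{m}\frac{(\#_{\Delta_i})!}{(\#_{\Delta_i}-n_i)!}\Big]=\int_{\Delta_1^{n_1}\times\cdots\times\Delta_m^{n_m}}\rho_n\,d\mu^{\otimes n},\qquad \#_\Delta(\xi)=\xi(\Delta).$$ A simple point process is determinantal with kernel $K:X\times X\to\mathbb{C}$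 with respect to $\mu$ if it has correlation functions of all orders and $\rho_n(x_1,\dots,x_n)=\det[K(x_i,x_j)]_{1\le i,j\le n}$ for all $n\ge1$ and $\mu^{\otimes n}$-a.e. $(x_1,\dots,x_n)$. $J$-Hermitian kernels. Let $X=X_1\sqcup X_2$ with $X_1,X_2$ Borel. A measurable function $K(x,y)$ on $X\times X$ is identified with the integral operator $Kf(x)=\int_XK(x,y)f(y)\,d\mu(y)$ on $L^2(X,\mu)$. Let $P_i$ be the orthogonal projection of $L^2(X,\mu)$ onto $L^2(X_i,\mu)$, $J=P_1-P_2$, and $[f,g]=\langle Jf,g\rangle$. A bounded linear operator $K$ is $J$-self-adjoint if $[Kf,g]=[f,Kg]$ for all $f,g\in L^2(X,\mu)$. The kernel $K(x,y)$ is called $J$-Hermitian if it induces a bounded $J$-self-adjoint integral operator; in terms of the kernel, for $\mu\otimes\mu$-a.e. $(x,y)$: $K(x,y)=\overline{K(y,x)}$ if $x,y$ lie in the same part $X_i$, and $K(x,y)=-\overline{K(y,x)}$ if $x\in X_1,y\in X_2$. Trace classes. $\mathscr{L}_{1|2}(L^2(X,\mu))$ is the set of bounded operators $A$ on $L^2(X,\mu)$ such that $P_1AP_1+P_2AP_2$ is trace-class and $P_1AP_2+P_2AP_1$ is Hilbert–Schmidt. For such $A$, $\mathrm{Tr}(A):=\mathrm{Tr}(P_1AP_1+P_2AP_2)$. For $n\ge2$ and $A_1,\dots,A_n\in\mathscr{L}_{1|2}$, the product $A_1\cdots A_n$ is trace-class and $\mathrm{Tr}(A_1\cdots A_n)$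 is its usual trace. $\chi_\Delta$ denotes multiplication by the indicator function of $\Delta$, and a bounded function $g$ also denotes the corresponding multiplication operator. *)

theory Defs
  imports "HOL-Probability.Probability" "Jordan_Normal_Form.Determinant"
begin

section \<open>Locally compact Polish spaces and Radon measures\<close>

text \<open>Spaces are values of type \<^typ>\<open>'a topology\<close>, so that a family of different spaces can be
  indexed by a real parameter. Functions on a space are total functions on \<^typ>\<open>'a\<close> of which only
  the values on the \<^const>\<open>topspace\<close> matter.\<close>

definition lc_polish_space :: "'a topology \<Rightarrow> bool" where
  "lc_polish_space X \<longleftrightarrow>
     completely_metrizable_space X \<and> separable_space X \<and> locally_compact_space X"

definition borel_of :: "'a topology \<Rightarrow> 'a measure" where
  "borel_of X = sigma (topspace X) {U. openin X U}"

definition precompactin :: "'a topology \<Rightarrow> 'a set \<Rightarrow> bool" where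
  "precompactin X \<Delta> \<longleftrightarrow> \<Delta> \<subseteq> topspace X \<and> compactin X (X closure_of \<Delta>)"

definition radon_measure :: "'a topology \<Rightarrow> 'a measure \<Rightarrow> bool" where
  "radon_measure X M \<longleftrightarrow>
     sets M = sets (borel_of X) \<and>
     (\<forall>C. compactin X C \<longrightarrow> emeasure M C < \<infinity>) \<and>
     (\<forall>B\<in>sets M. emeasure M B = (SUP C\<in>{C. compactin X C \<and> C \<subseteq> B}. emeasure M C))"

definition compact_support_on :: "'a topology \<Rightarrow> ('a \<Rightarrow> real) \<Rightarrow> bool" where
  "compact_support_on X g \<longleftrightarrow> compactin X (X closure_of {x \<in> topspace X. g x \<noteq> 0})"

definition test_function :: "'a topology \<Rightarrow> ('a \<Rightarrow> real) \<Rightarrow> bool" where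
  "test_function X g \<longleftrightarrow>
     g \<in> borel_measurable (borel_of X) \<and> bounded (g ` topspace X) \<and> compact_support_on X g"

section \<open>Point processes\<close>

text \<open>A configuration, i.e. a locally finite sum \<open>\<xi>\<close> of point masses, is encoded by its
  multiplicity function \<open>x \<mapsto> \<xi>({x})\<close>.\<close>

definition Conf :: "'a topology \<Rightarrow> ('a \<Rightarrow> nat) set" where
  "Conf X = {\<xi>. (\<forall>x. x \<notin> topspace X \<longrightarrow> \<xi> x = 0) \<and>
     (\<forall>\<Delta>\<in>sets (borel_of X). precompactin X \<Delta> \<longrightarrow> finite {x \<in> \<Delta>. \<xi> x \<noteq> 0})}"

definition num_points :: "'a set \<Rightarrow> ('a \<Rightarrow> nat) \<Rightarrow> nat" where
  "num_points \<Delta> \<xi> = (\<Sum>x | x \<in> \<Delta> \<and> \<xi> x \<noteq> 0. \<xi> x)"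

text \<open>The sum of \<open>f\<close> over the points of a configuration (counted with multiplicity), that is
  \<open>\<integral> f d\<xi>\<close>. Points outside the support of \<open>f\<close> are left out to make the index set finite.\<close>

definition linear_statistic :: "('a \<Rightarrow> real) \<Rightarrow> ('a \<Rightarrow> nat) \<Rightarrow> real" where
  "linear_statistic f \<xi> = (\<Sum>x | \<xi> x \<noteq> 0 \<and> f x \<noteq> 0. real (\<xi> x) * f x)"

text \<open>The vague topology is the coarsest one making \<open>\<xi> \<mapsto> \<integral> \<phi> d\<xi>\<close> continuous for all continuous
  compactly supported \<open>\<phi>\<close>.\<close>

definition vague_topology :: "'a topology \<Rightarrow> ('a \<Rightarrow> nat) topology" where
  "vague_topology X = topology_generated_by
     {{\<xi> \<in> Conf X. linear_statistic \<phi> \<xi> \<in> U} | \<phi> U.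
        continuous_map X euclideanreal \<phi> \<and> compact_support_on X \<phi> \<and> open U}"

lemma topspace_vague_topology: "topspace (vague_topology X) = Conf X"
proof -
  have "Conf X \<in> {{\<xi> \<in> Conf X. linear_statistic \<phi> \<xi> \<in> U} | \<phi> U.
        continuous_map X euclideanreal \<phi> \<and> compact_support_on X \<phi> \<and> open U}"
    by (intro CollectI exI[of _ "\<lambda>_. 0"] exI[of _ UNIV]) (auto simp: compact_support_on_def)
  then show ?thesis
    unfolding vague_topology_def by (auto simp: topology_generated_by_topspace)
qed

definition point_process :: "'a topology \<Rightarrow> ('a \<Rightarrow> nat) measure \<Rightarrow> bool" where
  "point_process X P \<longleftrightarrow> prob_space P \<and> sets P = sets (borel_of (vague_topology X))"

definition simple_process :: "'a topology \<Rightarrow> ('a \<Rightarrow> nat) measure \<Rightarrow> bool" where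
  "simple_process X P \<longleftrightarrow> (AE \<xi> in P. \<forall>x\<in>topspace X. \<xi> x \<le> 1)"

text \<open>\<open>k! / (k - n)!\<close>, with the usual convention that this is \<open>0\<close> for \<open>n > k\<close>.\<close>

definition falling_fact :: "nat \<Rightarrow> nat \<Rightarrow> real" where
  "falling_fact k n = (if n \<le> k then fact k / fact (k - n) else 0)"

text \<open>The product of \<open>ns 0\<close> copies of \<open>\<Delta> 0\<close>, followed by \<open>ns 1\<close> copies of \<open>\<Delta> 1\<close>, and so on up to
  \<open>ns (m - 1)\<close> copies of \<open>\<Delta> (m - 1)\<close>.\<close>

definition block_box :: "nat \<Rightarrow> (nat \<Rightarrow> nat) \<Rightarrow> (nat \<Rightarrow> 'a set) \<Rightarrow> (nat \<Rightarrow> 'a) set" where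
  "block_box m ns \<Delta> =
     (\<Pi>\<^sub>E i\<in>{..<\<Sum>j<m. ns j}. concat (map (\<lambda>j. replicate (ns j) (\<Delta> j)) [0..<m]) ! i)"

text \<open>Both sides of the defining identity are integrals of non-negative functions and may be
  infinite.\<close>

definition correlation_function ::
    "'a topology \<Rightarrow> 'a measure \<Rightarrow> ('a \<Rightarrow> nat) measure \<Rightarrow> nat \<Rightarrow> ((nat \<Rightarrow> 'a) \<Rightarrow> real) \<Rightarrow> bool" where
  "correlation_function X M P n \<rho> \<longleftrightarrow>
     \<rho> \<in> borel_measurable (\<Pi>\<^sub>M i\<in>{..<n}. M) \<and>
     (\<forall>x\<in>space (\<Pi>\<^sub>M i\<in>{..<n}. M). 0 \<le> \<rho> x) \<and>
     (\<forall>x\<in>space (\<Pi>\<^sub>M i\<in>{..<n}. M). \<forall>\<sigma>. \<sigma> permutes {..<n} \<longrightarrow> \<rho> (x \<circ> \<sigma>) = \<rho> x) \<and>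
     (\<forall>m ns \<Delta>. 1 \<le> m \<longrightarrow> (\<forall>j<m. 1 \<le> ns j) \<longrightarrow> (\<Sum>j<m. ns j) = n \<longrightarrow>
        (\<forall>j<m. \<Delta> j \<in> sets (borel_of X) \<and> precompactin X (\<Delta> j)) \<longrightarrow>
        disjoint_family_on \<Delta> {..<m} \<longrightarrow>
        (\<integral>\<^sup>+\<xi>. ennreal (\<Prod>j<m. falling_fact (num_points (\<Delta> j) \<xi>) (ns j)) \<partial>P) =
        (\<integral>\<^sup>+x\<in>block_box m ns \<Delta>. ennreal (\<rho> x) \<partial>(\<Pi>\<^sub>M i\<in>{..<n}. M)))"

definition determinantal_process ::
    "'a topology \<Rightarrow> 'a measure \<Rightarrow> ('a \<Rightarrow> 'a \<Rightarrow> complex) \<Rightarrow> ('a \<Rightarrow> nat) measure \<Rightarrow> bool" where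
  "determinantal_process X M K P \<longleftrightarrow>
     point_process X P \<and> simple_process X P \<and>
     (\<exists>\<rho>. \<forall>n\<ge>1. correlation_function X M P n (\<rho> n) \<and>
        (AE x in (\<Pi>\<^sub>M i\<in>{..<n}. M).
           complex_of_real (\<rho> n x) = Determinant.det (mat n n (\<lambda>(i, j). K (x i) (x j)))))"

section \<open>Operators on complex \<open>L\<^sup>2\<close>\<close>

text \<open>Elements of \<open>L\<^sup>2(M)\<close> are given by representatives, and equality in \<open>L\<^sup>2(M)\<close> is equality
  almost everywhere. Operators act on representatives; boundedness and linearity up to null sets
  force them to respect almost everywhere equality.\<close>

type_synonym 'a cfun = "'a \<Rightarrow> complex"

definition L2 :: "'a measure \<Rightarrow> 'a cfun set" where
  "L2 M = {f \<in> borel_measurable M. integrable M (\<lambda>x. (norm (f x))\<^sup>2)}"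

definition L2_inner :: "'a measure \<Rightarrow> 'a cfun \<Rightarrow> 'a cfun \<Rightarrow> complex" where
  "L2_inner M f g = (LINT x|M. f x * cnj (g x))"

definition L2_norm :: "'a measure \<Rightarrow> 'a cfun \<Rightarrow> real" where
  "L2_norm M f = sqrt (LINT x|M. (norm (f x))\<^sup>2)"

definition bounded_operator :: "'a measure \<Rightarrow> ('a cfun \<Rightarrow> 'a cfun) \<Rightarrow> bool" where
  "bounded_operator M A \<longleftrightarrow>
     (\<forall>f\<in>L2 M. A f \<in> L2 M) \<and>
     (\<forall>f\<in>L2 M. \<forall>g\<in>L2 M. AE x in M. A (\<lambda>y. f y + g y) x = A f x + A g x) \<and>
     (\<forall>c. \<forall>f\<in>L2 M. AE x in M. A (\<lambda>y. c * f y) x = c * A f x) \<and>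
     (\<exists>C. \<forall>f\<in>L2 M. L2_norm M (A f) \<le> C * L2_norm M f)"

definition L2_onb :: "'a measure \<Rightarrow> 'a cfun set \<Rightarrow> bool" where
  "L2_onb M E \<longleftrightarrow>
     E \<subseteq> L2 M \<and>
     (\<forall>e\<in>E. \<forall>e'\<in>E. L2_inner M e e' = (if e = e' then 1 else 0)) \<and>
     (\<forall>f\<in>L2 M. (\<forall>e\<in>E. L2_inner M f e = 0) \<longrightarrow> (AE x in M. f x = 0))"

text \<open>\<open>B = \<bar>A\<bar>\<close>, the positive operator with \<open>B\<^sup>2 = A\<^sup>*A\<close>; since \<open>B\<close> is positive, hence
  self-adjoint, the latter means \<open>\<langle>B f, B g\<rangle> = \<langle>A f, A g\<rangle>\<close>.\<close>

definition is_operator_abs ::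
    "'a measure \<Rightarrow> ('a cfun \<Rightarrow> 'a cfun) \<Rightarrow> ('a cfun \<Rightarrow> 'a cfun) \<Rightarrow> bool" where
  "is_operator_abs M A B \<longleftrightarrow>
     bounded_operator M B \<and>
     (\<forall>f\<in>L2 M. L2_inner M (B f) f \<in> \<real>\<^sub>\<ge>\<^sub>0) \<and>
     (\<forall>f\<in>L2 M. \<forall>g\<in>L2 M. L2_inner M (B f) (B g) = L2_inner M (A f) (A g))"

definition trace_class :: "'a measure \<Rightarrow> ('a cfun \<Rightarrow> 'a cfun) \<Rightarrow> bool" where
  "trace_class M A \<longleftrightarrow> bounded_operator M A \<and>
     (\<exists>B E. is_operator_abs M A B \<and> L2_onb M E \<and> (\<lambda>e. L2_inner M (B e) e) summable_on E)"

definition hilbert_schmidt :: "'a measure \<Rightarrow> ('a cfun \<Rightarrow> 'a cfun) \<Rightarrow> bool" where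
  "hilbert_schmidt M A \<longleftrightarrow> bounded_operator M A \<and>
     (\<exists>E. L2_onb M E \<and> (\<lambda>e. (L2_norm M (A e))\<^sup>2) summable_on E)"

text \<open>For trace-class operators the sum does not depend on the orthonormal basis.\<close>

definition op_trace :: "'a measure \<Rightarrow> ('a cfun \<Rightarrow> 'a cfun) \<Rightarrow> complex" where
  "op_trace M A = (\<Sum>\<^sub>\<infinity>e\<in>(SOME E. L2_onb M E). L2_inner M (A e) e)"

definition mult_op :: "('a \<Rightarrow> real) \<Rightarrow> 'a cfun \<Rightarrow> 'a cfun" where
  "mult_op g f = (\<lambda>x. complex_of_real (g x) * f x)"

abbreviation proj_op :: "'a set \<Rightarrow> 'a cfun \<Rightarrow> 'a cfun" where
  "proj_op S \<equiv> mult_op (indicator S)"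

text \<open>The diagonal and off-diagonal parts \<open>P\<^sub>1AP\<^sub>1 + P\<^sub>2AP\<^sub>2\<close> and \<open>P\<^sub>1AP\<^sub>2 + P\<^sub>2AP\<^sub>1\<close>.\<close>

definition diag_part ::
    "'a set \<Rightarrow> 'a set \<Rightarrow> ('a cfun \<Rightarrow> 'a cfun) \<Rightarrow> 'a cfun \<Rightarrow> 'a cfun" where
  "diag_part X1 X2 A f =
     (\<lambda>x. proj_op X1 (A (proj_op X1 f)) x + proj_op X2 (A (proj_op X2 f)) x)"

definition offdiag_part ::
    "'a set \<Rightarrow> 'a set \<Rightarrow> ('a cfun \<Rightarrow> 'a cfun) \<Rightarrow> 'a cfun \<Rightarrow> 'a cfun" where
  "offdiag_part X1 X2 A f =
     (\<lambda>x. proj_op X1 (A (proj_op X2 f)) x + proj_op X2 (A (proj_op X1 f)) x)"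

definition class_1_2 :: "'a measure \<Rightarrow> 'a set \<Rightarrow> 'a set \<Rightarrow> ('a cfun \<Rightarrow> 'a cfun) \<Rightarrow> bool" where
  "class_1_2 M X1 X2 A \<longleftrightarrow> bounded_operator M A \<and>
     trace_class M (diag_part X1 X2 A) \<and> hilbert_schmidt M (offdiag_part X1 X2 A)"

section \<open>\<open>J\<close>-Hermitian kernels\<close>

definition J_op :: "'a set \<Rightarrow> 'a set \<Rightarrow> 'a cfun \<Rightarrow> 'a cfun" where
  "J_op X1 X2 f = (\<lambda>x. proj_op X1 f x - proj_op X2 f x)"

definition J_inner :: "'a measure \<Rightarrow> 'a set \<Rightarrow> 'a set \<Rightarrow> 'a cfun \<Rightarrow> 'a cfun \<Rightarrow> complex" where
  "J_inner M X1 X2 f g = L2_inner M (J_op X1 X2 f) g"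

definition J_self_adjoint :: "'a measure \<Rightarrow> 'a set \<Rightarrow> 'a set \<Rightarrow> ('a cfun \<Rightarrow> 'a cfun) \<Rightarrow> bool" where
  "J_self_adjoint M X1 X2 A \<longleftrightarrow> bounded_operator M A \<and>
     (\<forall>f\<in>L2 M. \<forall>g\<in>L2 M. J_inner M X1 X2 (A f) g = J_inner M X1 X2 f (A g))"

definition kernel_op :: "'a measure \<Rightarrow> ('a \<Rightarrow> 'a \<Rightarrow> complex) \<Rightarrow> 'a cfun \<Rightarrow> 'a cfun" where
  "kernel_op M K f = (\<lambda>x. LINT y|M. K x y * f y)"

text \<open>The integrability clause says that the integral defining the operator exists; it is needed
  because the Bochner integral of a non-integrable function is \<open>0\<close> by convention.\<close>

definition J_Hermitian ::
    "'a measure \<Rightarrow> 'a set \<Rightarrow> 'a set \<Rightarrow> ('a \<Rightarrow> 'a \<Rightarrow> complex) \<Rightarrow> bool" where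
  "J_Hermitian M X1 X2 K \<longleftrightarrow>
     (\<lambda>(x, y). K x y) \<in> borel_measurable (M \<Otimes>\<^sub>M M) \<and>
     (\<forall>f\<in>L2 M. AE x in M. integrable M (\<lambda>y. K x y * f y)) \<and>
     J_self_adjoint M X1 X2 (kernel_op M K)"

text \<open>The operator \<open>K g\<^sub>1 K g\<^sub>2 \<dots> K g\<^sub>n\<close>, and the integrand
  \<open>g\<^sub>1(x\<^sub>1) K(x\<^sub>1,x\<^sub>2) g\<^sub>2(x\<^sub>2) \<dots> g\<^sub>n(x\<^sub>n) K(x\<^sub>n,x\<^sub>1)\<close>; indices are shifted to start at \<open>0\<close>.\<close>

definition chain_op ::
    "'a measure \<Rightarrow> ('a \<Rightarrow> 'a \<Rightarrow> complex) \<Rightarrow> ('a \<Rightarrow> real) list \<Rightarrow> 'a cfun \<Rightarrow> 'a cfun" where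
  "chain_op M K gs = foldr (\<lambda>g A. kernel_op M K \<circ> mult_op g \<circ> A) gs id"

definition cyclic_product ::
    "('a \<Rightarrow> 'a \<Rightarrow> complex) \<Rightarrow> ('a \<Rightarrow> real) list \<Rightarrow> (nat \<Rightarrow> 'a) \<Rightarrow> complex" where
  "cyclic_product K gs x =
     (\<Prod>i<length gs. complex_of_real ((gs ! i) (x i)) * K (x i) (x (Suc i mod length gs)))"

text \<open>For a single factor the trace is the extended one on the class \<open>1|2\<close>; for two or more factors
  the product is trace-class and the trace is the usual one.\<close>

definition trace_formula ::
    "'a topology \<Rightarrow> 'a measure \<Rightarrow> 'a set \<Rightarrow> 'a set \<Rightarrow> ('a \<Rightarrow> 'a \<Rightarrow> complex) \<Rightarrow> bool" where
  "trace_formula X M X1 X2 K \<longleftrightarrow>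
     (\<forall>gs. gs \<noteq> [] \<longrightarrow> (\<forall>g\<in>set gs. test_function X g) \<longrightarrow>
        integrable (\<Pi>\<^sub>M i\<in>{..<length gs}. M) (cyclic_product K gs) \<and>
        (if length gs = 1 then op_trace M (diag_part X1 X2 (chain_op M K gs))
         else op_trace M (chain_op M K gs)) =
        (LINT x|(\<Pi>\<^sub>M i\<in>{..<length gs}. M). cyclic_product K gs x))"

section \<open>Linear statistics and convergence in distribution\<close>

definition expect :: "'b measure \<Rightarrow> ('b \<Rightarrow> real) \<Rightarrow> real" where
  "expect P Y = (LINT \<xi>|P. Y \<xi>)"

definition variance_of :: "'b measure \<Rightarrow> ('b \<Rightarrow> real) \<Rightarrow> real" where
  "variance_of P Y = expect P (\<lambda>\<xi>. (Y \<xi> - expect P Y)\<^sup>2)"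

text \<open>\<^const>\<open>weak_conv_m\<close> along an arbitrary filter.\<close>

definition weak_conv_along :: "('i \<Rightarrow> real measure) \<Rightarrow> real measure \<Rightarrow> 'i filter \<Rightarrow> bool" where
  "weak_conv_along N N0 F \<longleftrightarrow>
     (\<forall>x. isCont (cdf N0) x \<longrightarrow> ((\<lambda>i. cdf (N i) x) \<longlongrightarrow> cdf N0 x) F)"

end

theory Submission
  imports Defs "HOL-Complex_Analysis.Complex_Analysis" "HOL-Combinatorics.Multiset_Permutations"
    "HOL-Real_Asymp.Real_Asymp"
begin

text \<open>The proof is by Laplace transforms in the complex domain. Suppose that the Laplace transforms of
  centred laws of variance \<open>1\<close> have no zeros on discs whose radius \<open>R\<close> tends to infinity and are
  bounded there by \<open>exp (C * R ^ p)\<close> for a fixed \<open>p\<close>. Their logarithms are then, locally uniformly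
  and up to \<open>O(1/R)\<close>, polynomials of degree \<open>p\<close>. Since \<open>\<bar>E e\<^bsup>zY\<^esup>\<bar> \<le> E e\<^bsup>(Re z)Y\<^esup>\<close>, the real part of such a
  logarithm at \<open>z\<close> is at most its value at \<open>Re z\<close>, and a polynomial with this property has degree at
  most two. A rescaling argument turns this rigidity into the statement that the coefficients beyond
  the quadratic one tend to \<open>0\<close>, so that the limit is Gaussian
  (\<open>ridge_functions_coefficients_vanish\<close>, \<open>central_limit_of_zero_free_mgf\<close>).

  It remains to show, for a single process, that \<open>E e\<^bsup>zS\<^esup>\<close> is not \<open>0\<close> and of modulus at most
  \<open>exp (4 \<bar>z\<bar> E S\<^bsub>\<bar>f\<bar>\<^esub>)\<close> whenever \<open>\<bar>z\<bar> sup \<bar>f\<bar> \<le> 1/12\<close> (\<open>mgf_linear_statistic_bound\<close>). For the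
  normalized statistic this concerns the disc of radius \<open>R = sqrt V / (12 sup \<bar>f\<bar>)\<close>, with \<open>V\<close> the
  variance; by hypothesis \<open>R\<close> is eventually at least \<open>V\<^bsup>1/4\<^esup> / 12\<close>, and \<open>E S\<^bsub>\<bar>f\<bar>\<^esub>\<close> is bounded by a power
  of \<open>V\<close>, hence by a power of \<open>R\<close>.

  With \<open>W = e\<^bsup>zf\<^esup> - 1\<close> one has \<open>E e\<^bsup>zS\<^esup> = E (\<Prod>x. 1 + W x)\<close>, the product
  being over the points of the process in the support \<open>\<Delta>\<close> of \<open>f\<close>. The expected elementary symmetric
  functions of the values of \<open>W\<close> are integrals of determinants, hence polynomials in the traces of
  the powers of the weighted kernel (\<open>det_integral_newton\<close>, \<open>expectation_esym_fredholm\<close>), and their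
  sum is the exponential of \<open>\<Sum>m\<ge>1. (-1)\<^bsup>m-1\<^esup> Tr(G\<^sup>m) / m\<close>, with \<open>G\<close> the weighted kernel, as soon
  as this series converges absolutely (\<open>fredholm_series_exp\<close>).

  Convergence with constants that do not depend on the process requires a universal bound for the
  operator norm of the kernel on \<open>\<Delta>\<close>. The kernel \<open>J k\<close> is Hermitian, so the traces of its even
  powers are squared Hilbert-Schmidt norms; consequently, if the logarithm \<open>L\<close> of the Fredholm
  determinant had radius of convergence \<open>r\<close>, then \<open>exp (L t + L (- t)) \<le> 1 - (t / r)\<^sup>2\<close>, which tends to
  \<open>0\<close> as \<open>t\<close> tends to \<open>r\<close>. But the same quantity is a product of expectations of positive random
  variables and stays away from \<open>0\<close>, so \<open>r\<close> cannot be small (\<open>summable_by_continuation\<close>). This argument is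
  used twice: separately on each of the two parts, where it yields exponential moments for the number
  of points, and then with the weight \<open>J\<close>, where it yields the operator norm bound \<open>3\<close>
  (\<open>exponential_moment\<close>, \<open>Jk_opnorm\<close>). The Hilbert-Schmidt norm of \<open>G\<close> is bounded by means of
  \<open>E (\<Sum>x. \<bar>W x\<bar>)\<close> because variances are non-negative (\<open>hs_norm_twist_le\<close>), and
  \<open>expectation_product_bound\<close> puts these bounds together.

  The kernel of an operator is only determined almost everywhere. On \<open>\<Delta>\<close> it is therefore replaced by
  one that is symmetric and square-integrable without exceptional points and has the same determinants
  almost everywhere (\<open>nice_modification\<close>); the trace formula with one and two factors provides the
  integrability.\<close>

section \<open>Zero-free Laplace transforms and the normal limit\<close>

text \<open>The map \<open>w \<mapsto> w / (2 * B - w)\<close> takes the half-plane \<open>Re w < B\<close> into the unit disc and fixes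
  \<open>0\<close>, so that the Schwarz lemma applies to its composition with \<open>f\<close>.\<close>

lemma borel_caratheodory_zero:
  assumes hol: "f holomorphic_on ball 0 R" and f0: "f 0 = 0" and R: "0 < R" 
    and bd: "\<And>z. cmod z < R \<Longrightarrow> Re (f z) < B" and z: "cmod z \<le> R / 2"
  shows "cmod (f z) \<le> 2 * B"
proof -
  have B: "0 < B" using bd[of 0] f0 R by simp
  define g where "g w = f (of_real R * w) / (2 * of_real B - f (of_real R * w))" for w
  have in_ball: "cmod (of_real R * w) < R" if "cmod w < 1" for w
    using that R by (simp add: norm_mult)
  have less: "cmod a < cmod (2 * of_real B - a)" if "Re a < B" for a
  proof -
    have "(cmod a)\<^sup>2 < (cmod (2 * of_real B - a))\<^sup>2"
      unfolding cmod_power2 using mult_strict_left_mono[OF that B] by (simp add: power2_eq_square algebra_simps)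
    then show ?thesis by (simp add: power2_less_imp_less)
  qed
  have holg: "g holomorphic_on ball 0 1"
  proof -
    have 1: "(\<lambda>w. f (of_real R * w)) holomorphic_on ball 0 1"
      using in_ball by (intro holomorphic_on_compose_gen[OF _ hol, unfolded o_def] holomorphic_intros) auto
    have "2 * of_real B - f (of_real R * w) \<noteq> 0" if "w \<in> ball 0 1" for w
      using less[OF bd[OF in_ball[of w]]] that by auto
    then show ?thesis unfolding g_def by (intro holomorphic_intros 1) auto
  qed
  have g1: "cmod (g w) < 1" if "cmod w < 1" for w
    using less[OF bd[OF in_ball[OF that]]] unfolding g_def norm_divide
    by (metis divide_less_eq_1 norm_ge_zero order_le_less_trans)
  define w where "w = z / of_real R"
  have w: "cmod w \<le> 1 / 2" using z R by (simp add: w_def norm_divide field_simps)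
  have zw: "of_real R * w = z" using R by (simp add: w_def)
  have "cmod (g w) \<le> cmod w"
    using Schwarz_Lemma(1)[OF holg _ g1] w by (auto simp: g_def f0)
  then have le: "cmod (g w) \<le> 1/2" using w by linarith
  have "cmod (2 * of_real B - f z) > 0"
    using less[OF bd[of z]] z R norm_ge_zero[of "f z"] by linarith
  then have "cmod (f z) \<le> 1/2 * cmod (2 * of_real B - f z)"
    using le unfolding g_def zw norm_divide by (simp add: field_simps)
  also have "cmod (2 * of_real B - f z) \<le> 2 * B + cmod (f z)"
    using norm_triangle_ineq4[of "2 * of_real B" "f z"] B by simp
  finally show ?thesis by simp
qed

text \<open>The lemma of Borel and Caratheodory turns the one-sided bound into a bound for the modulus,
  and Cauchy's estimates make the coefficient of index \<open>j\<close> of order \<open>R ^ (p - j)\<close>. The terms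
  beyond \<open>p\<close> therefore add up to \<open>O(1/R)\<close> at a fixed point: on large discs a function of this
  growth is a polynomial of degree \<open>p\<close> up to a vanishing error.\<close>

lemma taylor_remainder_of_Re_bound:
  assumes hol: "f holomorphic_on ball 0 R" and f0: "f 0 = 0" and R: "0 < R"
    and bd: "\<And>z. cmod z < R \<Longrightarrow> Re (f z) < C * R ^ p" and z: "cmod z \<le> R / 8"
  defines "c \<equiv> \<lambda>j. (deriv ^^ j) f 0 / fact j"
  shows "cmod (f z - (\<Sum>j\<le>p. c j * z ^ j)) \<le> 4 ^ (p + 2) * C * cmod z ^ (p + 1) / R"
proof -
  define B where "B = C * R ^ p"
  have B: "0 < B" using bd[of 0] f0 R by (simp add: B_def)
  \<comment> \<open>Cauchy's estimates are used on the circle of radius \<open>R/4\<close>; the tail is then geometric with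
    ratio \<open>q \<le> 1/2\<close>.\<close>
  define q where "q = cmod z * 4 / R"
  have q: "0 \<le> q" "q \<le> 1/2" using z R by (auto simp: q_def field_simps)
  have coef: "cmod (c j) \<le> 2 * B / (R/4) ^ j" for j
  proof -
    have "cmod ((deriv ^^ j) f 0) \<le> fact j * (2 * B) / (R/4) ^ j"
    proof (rule Cauchy_inequality)
      show "f holomorphic_on ball 0 (R/4)" using R by (intro holomorphic_on_subset[OF hol]) auto
      show "continuous_on (cball 0 (R/4)) f" 
        using R by (intro holomorphic_on_imp_continuous_on holomorphic_on_subset[OF hol]) auto
      show "cmod (f x) \<le> 2 * B" if "cmod (0 - x) = R / 4" for x
        using that R by (intro borel_caratheodory_zero[OF hol f0 R]) (auto simp: B_def bd)
    qed (use R in auto)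
    then show ?thesis by (simp add: c_def norm_divide field_simps)
  qed
  have s: "(\<lambda>j. c j * z ^ j) sums f z"
    using holomorphic_power_series[OF hol, of z] z R by (auto simp: c_def)
  have "(\<lambda>j. c (j + Suc p) * z ^ (j + Suc p)) sums (f z - (\<Sum>j<Suc p. c j * z ^ j))"
    by (rule sums_split_initial_segment[OF s])
  then have s2: "(\<lambda>j. c (j + Suc p) * z ^ (j + Suc p)) sums (f z - (\<Sum>j\<le>p. c j * z ^ j))"
    by (simp add: lessThan_Suc_atMost)
  have tm: "cmod (c (j + Suc p) * z ^ (j + Suc p)) \<le> 2 * B * q ^ Suc p * (1/2) ^ j" for j
  proof -
    have "cmod (c (j + Suc p) * z ^ (j + Suc p)) \<le> (2 * B / (R/4) ^ (j + Suc p)) * cmod z ^ (j + Suc p)"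
      unfolding norm_mult norm_power by (intro mult_right_mono coef) auto
    also have "\<dots> = 2 * B * q ^ (j + Suc p)" by (simp add: q_def power_divide power_mult_distrib)
    also have "\<dots> = 2 * B * q ^ Suc p * q ^ j" by (simp add: power_add)
    also have "\<dots> \<le> 2 * B * q ^ Suc p * (1/2) ^ j"
      using q B by (intro mult_left_mono power_mono) auto
    finally show ?thesis .
  qed
  have g: "(\<lambda>j. 2 * B * q ^ Suc p * (1/2) ^ j) sums (2 * B * q ^ Suc p * 2)"
    using sums_mult[OF geometric_sums[of "1/2::real"], of "2 * B * q ^ Suc p"] by simp
  have "cmod (f z - (\<Sum>j\<le>p. c j * z ^ j)) \<le> 2 * B * q ^ Suc p * 2"
    using norm_suminf_le[OF tm sums_summable[OF g]] sums_unique[OF s2] sums_unique[OF g] by metis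
  also have "\<dots> = 4 ^ (p + 2) * C * cmod z ^ (p + 1) / R"
    using R by (simp add: B_def q_def power_divide power_mult_distrib field_simps)
  finally show ?thesis .
qed

text \<open>Along the ray through \<open>u\<close> only the leading term \<open>l D * w ^ D\<close> counts, so it inherits the
  inequality: its real part at a unit vector \<open>u\<close> is at most \<open>cmod (l D) * \<bar>Re u\<bar> ^ D\<close>. At the \<open>D\<close>
  directions where \<open>l D * u ^ D\<close> is real and positive this forces \<open>\<bar>Re u\<bar> = 1\<close>, that is, \<open>u\<close> is
  real. Neighbouring ones of these directions enclose the angle \<open>2 * pi / D\<close>, which is less than
  \<open>pi\<close> for \<open>D \<ge> 3\<close>, so not all of them can be real.\<close>

lemma ridge_polynomial_degree_le_2:
  fixes l :: "nat \<Rightarrow> complex"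
  assumes ridge: "\<And>w. Re (\<Sum>j\<le>p. l j * w ^ j) \<le> Re (\<Sum>j\<le>p. l j * of_real (Re w) ^ j)"
    and "3 \<le> j" "j \<le> p"
  shows "l j = 0"
proof (rule ccontr)
  assume lj: "l j \<noteq> 0"
  define D where "D = Max {i. i \<le> p \<and> l i \<noteq> 0}"
  have fin: "finite {i. i \<le> p \<and> l i \<noteq> 0}" by simp
  have "D \<in> {i. i \<le> p \<and> l i \<noteq> 0}" unfolding D_def using lj assms(3) by (intro Max_in[OF fin]) auto
  then have D: "D \<le> p" "l D \<noteq> 0" by auto
  have "j \<le> D" unfolding D_def using lj assms(3) by (intro Max_ge[OF fin]) auto
  then have D3: "3 \<le> D" using assms(2) by simp
  have zero: "l i = 0" if "D < i" "i \<le> p" for i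
    using Max_ge[OF fin, of i] that unfolding D_def by (metis (mono_tags, lifting) leD mem_Collect_eq)
  have lim: "((\<lambda>r. (\<Sum>j\<le>p. l j * (of_real r * u) ^ j) / of_real r ^ D) \<longlongrightarrow> l D * u ^ D) at_top" for u
  proof -
    have "((\<lambda>r. \<Sum>j\<le>p. l j * u ^ j * (of_real r ^ j / of_real r ^ D)) \<longlongrightarrow> (\<Sum>j\<le>p. l j * u ^ j * (if j = D then 1 else 0))) at_top"
    proof (rule tendsto_sum)
      fix i assume i: "i \<in> {..p}"
      show "((\<lambda>r. l i * u ^ i * (of_real r ^ i / of_real r ^ D)) \<longlongrightarrow> l i * u ^ i * (if i = D then 1 else 0)) at_top"
      proof (cases i D rule: linorder_cases)
        case less
        have e: "eventually (\<lambda>r::real. of_real (inverse r ^ (D - i)) = (of_real r ^ i / of_real r ^ D :: complex)) at_top"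
          using eventually_gt_at_top[of 0]
          by eventually_elim (use less in \<open>simp add: power_diff field_simps power_inverse\<close>)
        have "((\<lambda>r::real. inverse r ^ (D - i)) \<longlongrightarrow> 0 ^ (D - i)) at_top"
          by (intro tendsto_power tendsto_inverse_0_at_top filterlim_ident)
        then have "((\<lambda>r::real. of_real (inverse r ^ (D - i)) :: complex) \<longlongrightarrow> of_real 0) at_top"
          using less by (intro tendsto_of_real) (simp add: power_0_left)
        then have "((\<lambda>r::real. of_real r ^ i / of_real r ^ D :: complex) \<longlongrightarrow> 0) at_top"
          using e by (simp add: tendsto_cong)
        from tendsto_mult_right_zero[OF this, of "l i * u ^ i"] show ?thesis using less by simp
      next
        case equal
        have e: "eventually (\<lambda>r::real. l i * u ^ i * (of_real r ^ i / of_real r ^ D :: complex) = l i * u ^ i) at_top"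
          using eventually_gt_at_top[of 0] by eventually_elim (use equal in auto)
        show ?thesis using e equal by (simp add: tendsto_eventually)
      next
        case greater
        then show ?thesis using zero[of i] i by auto
      qed
    qed
    also have "(\<Sum>j\<le>p. l j * u ^ j * (if j = D then 1 else 0)) = l D * u ^ D"
      using D(1) by (simp add: sum.delta if_distrib cong: if_cong)
    finally show ?thesis
      by (simp add: sum_divide_distrib power_mult_distrib mult_ac)
  qed
  have key: "Re (l D * u ^ D) \<le> Re (l D * of_real (Re u) ^ D)" for u
  proof (rule tendsto_le[OF _ tendsto_Re[OF lim] tendsto_Re[OF lim]])
    show "\<forall>\<^sub>F r in at_top. Re ((\<Sum>j\<le>p. l j * (of_real r * u) ^ j) / of_real r ^ D)
            \<le> Re ((\<Sum>j\<le>p. l j * (of_real r * of_real (Re u)) ^ j) / of_real r ^ D)"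
      using eventually_gt_at_top[of 0]
    proof eventually_elim
      case (elim r)
      have "Re (\<Sum>j\<le>p. l j * (of_real r * u) ^ j) \<le> Re (\<Sum>j\<le>p. l j * (of_real r * of_real (Re u)) ^ j)"
        using ridge[of "of_real r * u"] by simp
      then show ?case using elim by (simp add: Re_divide_of_real divide_right_mono flip: of_real_power)
    qed
  qed simp
  \<comment> \<open>The arguments \<open>\<theta> + k * (2 * pi / D)\<close> are the directions in which the leading term is real and
    positive.\<close>
  define \<theta> where "\<theta> = - Arg (l D) / D"
  have sin0: "sin (\<theta> + of_int k * (2 * pi / D)) = 0" for k :: int
  proof -
    define a where "a = \<theta> + of_int k * (2 * pi / D)"
    define u where "u = cis a"
    have "real D * a = - Arg (l D) + of_int k * (2 * pi)"
      using D3 by (simp add: a_def \<theta>_def field_simps)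
    then have "u ^ D = cis (- Arg (l D) + of_int k * (2 * pi))"
      unfolding u_def Complex.DeMoivre by simp
    also have "\<dots> = cis (- Arg (l D)) * cis (2 * pi * of_int k)"
      by (simp add: cis_mult mult_ac)
    also have "\<dots> = cis (- Arg (l D))" by (subst cis_multiple_2pi) auto
    finally have "u ^ D = cis (- Arg (l D))" .
    moreover have "l D = of_real (cmod (l D)) * cis (Arg (l D))"
      by (metis rcis_cmod_Arg rcis_def)
    ultimately have "l D * u ^ D = of_real (cmod (l D)) * (cis (Arg (l D)) * cis (- Arg (l D)))"
      by (metis mult.assoc)
    then have "l D * u ^ D = of_real (cmod (l D))" by (simp add: cis_mult)
    then have "cmod (l D) \<le> Re (l D * of_real (Re u) ^ D)" using key[of u] by simp
    also have "\<dots> \<le> cmod (l D * of_real (Re u) ^ D)" by (rule complex_Re_le_cmod)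
    also have "\<dots> = cmod (l D) * \<bar>cos a\<bar> ^ D" by (simp add: norm_mult norm_power u_def)
    finally have "1 \<le> \<bar>cos a\<bar> ^ D" using D(2) by simp
    then have "\<not> \<bar>cos a\<bar> < 1" using power_less_one_iff[OF abs_ge_zero, of "cos a" D] D3 by auto
    then have "\<bar>cos a\<bar> = 1" using abs_cos_le_one[of a] by linarith
    then have "(cos a)\<^sup>2 = 1" by (metis one_power2 power2_abs)
    then have "(sin a)\<^sup>2 = 0" using sin_cos_squared_add[of a] by linarith
    then show ?thesis by (simp add: a_def)
  qed
  have "sin (2 * pi / D) = sin ((\<theta> + of_int 1 * (2 * pi / D)) - (\<theta> + of_int 0 * (2 * pi / D)))" by simp
  also have "\<dots> = 0" unfolding sin_diff sin0 by simp
  finally have "sin (2 * pi / D) = 0" .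
  moreover have "0 < sin (2 * pi / D)"
    using D3 by (intro sin_gt_zero) (auto simp: field_simps)
  ultimately show False by simp
qed

lemma common_convergent_subsequence:
  fixes d :: "nat \<Rightarrow> nat \<Rightarrow> complex"
  assumes "finite J" and "\<And>j n. j \<in> J \<Longrightarrow> cmod (d n j) \<le> 1"
  shows "\<exists>r l. strict_mono r \<and> (\<forall>j\<in>J. (\<lambda>n. d (r n) j) \<longlonglongrightarrow> l j)"
  using assms
proof (induction J)
  case empty
  then show ?case by (intro exI[of _ id]) (auto simp: strict_mono_def)
next
  case (insert a J)
  then obtain r l where r: "strict_mono r" "\<forall>j\<in>J. (\<lambda>n. d (r n) j) \<longlonglongrightarrow> l j" by auto
  have "seq_compact (cball (0::complex) 1)" by (simp add: compact_imp_seq_compact)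
  then obtain z s where s: "strict_mono s" "((\<lambda>n. d (r n) a) \<circ> s) \<longlonglongrightarrow> z"
    using insert.prems[of a] unfolding seq_compact_def by (metis insertI1 mem_cball_0)
  show ?case
  proof (intro exI[of _ "r \<circ> s"] exI[of _ "l(a := z)"] conjI ballI)
    show "strict_mono (r \<circ> s)" using r(1) s(1) by (rule strict_mono_o)
    fix j assume "j \<in> insert a J"
    show "(\<lambda>n. d ((r \<circ> s) n) j) \<longlonglongrightarrow> (l(a := z)) j"
    proof (cases "j = a")
      case True then show ?thesis using s(2) by (simp add: o_def)
    next
      case False
      then have "((\<lambda>n. d (r n) j) \<circ> s) \<longlonglongrightarrow> l j"
        using r(2) \<open>j \<in> insert a J\<close> s(1) by (intro LIMSEQ_subseq_LIMSEQ) auto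
      then show ?thesis using False by (simp add: o_def)
    qed
  qed
qed

text \<open>Rescaling and compactness. Let \<open>c j\<close> be the Taylor coefficients and \<open>m\<close> the largest of the
  numbers \<open>cmod (c j) powr (1 / (j - 2))\<close>. If \<open>m\<close> did not tend to \<open>0\<close>, consider
  \<open>w \<mapsto> m\<^sup>2 * \<Lambda> (w / m)\<close> along a subsequence with \<open>m \<ge> \<epsilon>\<close>. Its coefficients \<open>c j / m ^ (j - 2)\<close>
  have modulus at most \<open>1\<close>, with equality for some \<open>j\<close>, while the exponent \<open>j - 2\<close> is chosen so
  that the quadratic one remains \<open>1/2\<close>. A limit point is a polynomial with the ridge property and
  with some coefficient of modulus \<open>1\<close> beyond the quadratic one, contrary to
  \<open>ridge_polynomial_degree_le_2\<close>.\<close>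

lemma ridge_functions_coefficients_vanish:
  fixes \<Lambda> :: "nat \<Rightarrow> complex \<Rightarrow> complex" and R :: "nat \<Rightarrow> real"
  assumes R: "filterlim R at_top sequentially" "\<And>n. 0 < R n"
    and hol: "\<And>n. \<Lambda> n holomorphic_on ball 0 (R n)" and zero: "\<And>n. \<Lambda> n 0 = 0"
    and bd: "\<And>n z. cmod z < R n \<Longrightarrow> Re (\<Lambda> n z) < C * R n ^ p"
    and ridge: "\<And>n z. cmod z < R n \<Longrightarrow> Re (\<Lambda> n z) \<le> Re (\<Lambda> n (of_real (Re z)))"
    and c1: "\<And>n. deriv (\<Lambda> n) 0 = 0" and c2: "\<And>n. (deriv ^^ 2) (\<Lambda> n) 0 = 1"
    and j: "3 \<le> j" "j \<le> p"
  shows "(\<lambda>n. (deriv ^^ j) (\<Lambda> n) 0 / fact j) \<longlonglongrightarrow> 0"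
proof -
  define c where "c n j = (deriv ^^ j) (\<Lambda> n) 0 / fact j" for n j
  define m where "m n = Max ((\<lambda>j. root (j - 2) (cmod (c n j))) ` {3..p})" for n
  have fin: "finite ((\<lambda>j. root (j - 2) (cmod (c n j))) ` {3..p})" 
    and ne: "(\<lambda>j. root (j - 2) (cmod (c n j))) ` {3..p} \<noteq> {}" for n
    using j by auto
  have m_ge: "root (i - 2) (cmod (c n i)) \<le> m n" if "i \<in> {3..p}" for n i
    unfolding m_def using that by (intro Max_ge fin) auto
  have m0: "0 \<le> m n" for n
    using m_ge[of j n] j by (auto intro: order_trans[rotated])
  have cm: "cmod (c n i) \<le> m n ^ (i - 2)" if "i \<in> {3..p}" for n i
  proof -
    have "cmod (c n i) = root (i - 2) (cmod (c n i)) ^ (i - 2)"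
      using that by (simp add: real_root_pow_pos2)
    also have "\<dots> \<le> m n ^ (i - 2)" by (intro power_mono m_ge that real_root_ge_zero) auto
    finally show ?thesis .
  qed
  have m_attained: "\<exists>i\<in>{3..p}. cmod (c n i) = m n ^ (i - 2)" for n
  proof -
    have "m n \<in> (\<lambda>j. root (j - 2) (cmod (c n j))) ` {3..p}" unfolding m_def by (rule Max_in[OF fin ne])
    then obtain i where i: "i \<in> {3..p}" "m n = root (i - 2) (cmod (c n i))" by auto
    then show ?thesis by (intro bexI[of _ i]) (auto simp: real_root_pow_pos2)
  qed
  have "m \<longlonglongrightarrow> 0"
  proof (rule ccontr)
    assume "\<not> m \<longlonglongrightarrow> 0"
    then obtain \<epsilon> where \<epsilon>: "0 < \<epsilon>" and freq: "\<And>N. \<exists>n\<ge>N. \<epsilon> \<le> m n"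
      using m0 unfolding LIMSEQ_iff by (auto simp: not_less)
    have "infinite {n. \<epsilon> \<le> m n}" using freq by (auto simp: infinite_nat_iff_unbounded_le)
    then obtain r :: "nat \<Rightarrow> nat" where r: "strict_mono r" "\<And>n. \<epsilon> \<le> m (r n)"
      using infinite_enumerate[of "{n. \<epsilon> \<le> m n}"] by blast
    define d where "d n i = (if i = 2 then 1/2 else if i < 2 then 0 else c (r n) i / of_real (m (r n)) ^ (i - 2))" for n i
    have mpos: "0 < m (r n)" for n using r(2)[of n] \<epsilon> by linarith
    have d1: "cmod (d n i) \<le> 1" if "i \<in> {..p}" for n i
    proof (cases "3 \<le> i")
      case True
      then show ?thesis using cm[of i "r n"] that mpos[of n]
        by (auto simp: d_def norm_divide norm_power divide_simps)
    qed (auto simp: d_def)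
    obtain s l where s: "strict_mono s" "\<And>i. i \<le> p \<Longrightarrow> (\<lambda>n. d (s n) i) \<longlonglongrightarrow> l i"
      using common_convergent_subsequence[of "{..p}" d, OF _ d1] by auto
    have c_low: "c n 0 = 0" "c n (Suc 0) = 0" "c n 2 = 1/2" for n
      using zero c1 c2 by (auto simp: c_def)
    have scale: "of_real (m (r n)) ^ 2 * (c (r n) i * (w / of_real (m (r n))) ^ i) = d n i * w ^ i" for n i w
    proof -
      consider "i = 0" | "i = Suc 0" | "i = 2" | "3 \<le> i" by linarith
      then show ?thesis
      proof cases
        case 4
        have "i = (i - 2) + 2" using 4 by simp
        then have "(w / of_real (m (r n))) ^ i = w ^ i / (of_real (m (r n)) ^ (i - 2) * of_real (m (r n)) ^ 2)"
          by (metis power_add power_divide)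
        then show ?thesis using mpos[of n] 4 by (simp add: d_def)
      qed (use mpos[of n] in \<open>auto simp: d_def c_low power_divide\<close>)
    qed
    define q where "q n w = (\<Sum>i\<le>p. d n i * w ^ i)" for n w
    have q_eq: "of_real (m (r n)) ^ 2 * (\<Sum>i\<le>p. c (r n) i * (w / of_real (m (r n))) ^ i) = q n w" for n w
      unfolding q_def sum_distrib_left scale ..
    have p3: "3 \<le> p" using j by linarith
    \<comment> \<open>Since \<open>m \<ge> \<epsilon>\<close>, the rescaled functions are still defined on discs whose radius tends to
      infinity.\<close>
    define T where "T n w = of_real (m (r n)) ^ 2 * \<Lambda> (r n) (w / of_real (m (r n)))" for n w
    have Rr: "filterlim (\<lambda>n. R (r n)) at_top sequentially"
      by (rule filterlim_compose[OF R(1) filterlim_subseq[OF r(1)]])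
    have big: "\<forall>\<^sub>F n in sequentially. cmod (w / of_real (m (r n))) \<le> R (r n) / 8" for w
    proof -
      have "\<forall>\<^sub>F n in sequentially. 8 * cmod w / \<epsilon> \<le> R (r n)"
        using Rr by (auto simp: filterlim_at_top)
      then show ?thesis
      proof eventually_elim
        case (elim n)
        have "cmod (w / of_real (m (r n))) \<le> cmod w / \<epsilon>"
          using r(2)[of n] \<epsilon> mpos[of n] by (simp add: norm_divide frac_le)
        then show ?case using elim by simp
      qed
    qed
    have Tq: "(\<lambda>n. T n w - q n w) \<longlonglongrightarrow> 0" for w
    proof (rule Lim_null_comparison)
      define A where "A = 4 ^ (p + 2) * C * cmod w ^ (p + 1) / \<epsilon> ^ (p - 1)"
      have C: "0 \<le> C"
        using bd[of 0 0] zero[of 0] R(2)[of 0] by (simp add: zero_less_mult_iff)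
      show "\<forall>\<^sub>F n in sequentially. cmod (T n w - q n w) \<le> A * inverse (R (r n))"
        using big[of w]
      proof eventually_elim
        case (elim n)
        let ?z = "w / of_real (m (r n))"
        have "cmod (T n w - q n w) = m (r n) ^ 2 * cmod (\<Lambda> (r n) ?z - (\<Sum>i\<le>p. c (r n) i * ?z ^ i))"
          unfolding T_def q_eq[symmetric] right_diff_distrib[symmetric] norm_mult norm_power using mpos[of n] by simp
        also have "\<dots> \<le> m (r n) ^ 2 * (4 ^ (p + 2) * C * cmod ?z ^ (p + 1) / R (r n))"
          unfolding c_def
          by (intro mult_left_mono taylor_remainder_of_Re_bound[OF hol zero R(2) bd elim]) auto
        also have "cmod ?z ^ (p + 1) = cmod w ^ (p + 1) / (m (r n) ^ (p - 1) * m (r n) ^ 2)"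
        proof -
          have "p + 1 = (p - 1) + 2" using p3 by simp
          then have "m (r n) ^ (p + 1) = m (r n) ^ (p - 1) * m (r n) ^ 2" by (metis power_add)
          then show ?thesis using mpos[of n] by (simp add: norm_divide power_divide)
        qed
        also have "m (r n) ^ 2 * (4 ^ (p + 2) * C * (cmod w ^ (p + 1) / (m (r n) ^ (p - 1) * m (r n) ^ 2)) / R (r n))
            = 4 ^ (p + 2) * C * cmod w ^ (p + 1) / m (r n) ^ (p - 1) * inverse (R (r n))"
          using mpos[of n] by (simp add: field_simps)
        also have "\<dots> \<le> A * inverse (R (r n))"
          unfolding A_def using R(2)[of "r n"] C r(2)[of n] \<epsilon> mpos[of n]
          by (intro mult_right_mono divide_left_mono power_mono) auto
        finally show ?case .
      qed
      show "(\<lambda>n. A * inverse (R (r n))) \<longlonglongrightarrow> 0"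
        by (intro tendsto_mult_right_zero tendsto_inverse_0_at_top Rr)
    qed
    have qs: "(\<lambda>n. q (s n) w) \<longlonglongrightarrow> (\<Sum>i\<le>p. l i * w ^ i)" for w
      unfolding q_def by (intro tendsto_sum tendsto_mult s tendsto_const) auto
    have Ts: "(\<lambda>n. T (s n) w) \<longlonglongrightarrow> (\<Sum>i\<le>p. l i * w ^ i)" for w
      using tendsto_add[OF LIMSEQ_subseq_LIMSEQ[OF Tq[of w] s(1)] qs[of w]] by (simp add: o_def)
    have "Re (\<Sum>i\<le>p. l i * w ^ i) \<le> Re (\<Sum>i\<le>p. l i * of_real (Re w) ^ i)" for w
    proof (rule tendsto_le[OF _ tendsto_Re[OF Ts] tendsto_Re[OF Ts]])
      have "\<forall>\<^sub>F n in sequentially. cmod (w / of_real (m (r (s n)))) \<le> R (r (s n)) / 8"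
        using big[of w] s(1) by (rule eventually_subseq[rotated])
      then show "\<forall>\<^sub>F n in sequentially. Re (T (s n) w) \<le> Re (T (s n) (of_real (Re w)))"
      proof eventually_elim
        case (elim n)
        have "cmod (w / of_real (m (r (s n)))) < R (r (s n))" using elim R(2)[of "r (s n)"] by linarith
        from ridge[OF this] show ?case
          unfolding T_def by (simp flip: of_real_power add: mult_left_mono Re_divide_of_real)
      qed
    qed simp
    then have l0: "l i = 0" if "i \<in> {3..p}" for i
      using ridge_polynomial_degree_le_2[of l p i] that by simp
    have "(\<lambda>n. \<Sum>i\<in>{3..p}. cmod (d (s n) i)) \<longlonglongrightarrow> (\<Sum>i\<in>{3..p}. cmod (l i))"
      by (intro tendsto_sum tendsto_norm s) auto
    then have lim0: "(\<lambda>n. \<Sum>i\<in>{3..p}. cmod (d (s n) i)) \<longlonglongrightarrow> 0" using l0 by simp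
    have "1 \<le> (\<Sum>i\<in>{3..p}. cmod (d (s n) i))" for n
    proof -
      obtain i where i: "i \<in> {3..p}" "cmod (c (r (s n)) i) = m (r (s n)) ^ (i - 2)"
        using m_attained by blast
      then have "cmod (d (s n) i) = 1" using mpos[of "s n"] by (auto simp: d_def norm_divide norm_power)
      then show ?thesis using member_le_sum[of i "{3..p}" "\<lambda>i. cmod (d (s n) i)"] i by simp
    qed
    then have "1 \<le> (0::real)" by (intro LIMSEQ_le_const[OF lim0]) auto
    then show False by simp
  qed
  then have "(\<lambda>n. m n ^ (j - 2)) \<longlonglongrightarrow> 0 ^ (j - 2)" by (rule tendsto_power)
  then have "(\<lambda>n. m n ^ (j - 2)) \<longlonglongrightarrow> 0" using j by (simp add: power_0_left)
  then show ?thesis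
    by (rule Lim_null_comparison[rotated]) (use cm[of j] j in \<open>auto simp: c_def\<close>)
qed

definition mgf :: "real measure \<Rightarrow> complex \<Rightarrow> complex" where
  "mgf N z = (LINT x|N. exp (z * of_real x))"

text \<open>For \<open>cmod z < r < R\<close> all partial sums of the exponential series are dominated by the
  integrable function \<open>exp (r * x) + exp (- r * x)\<close>.\<close>

lemma mgf_power_series:
  assumes N: "real_distribution N" and R: "0 < R"
    and int: "\<And>s. \<bar>s\<bar> < R \<Longrightarrow> integrable N (\<lambda>x. exp (s * x))" and z: "cmod z < R"
  shows "(\<lambda>j. of_real (LINT x|N. x ^ j) / fact j * z ^ j) sums mgf N z"
    and "integrable N (\<lambda>x::real. x ^ j)" and "integrable N (\<lambda>x. exp (z * of_real x))"
proof -
  interpret real_distribution N by fact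
  define r where "r = (cmod z + R) / 2"
  have r: "cmod z < r" "r < R" "0 < r" using z norm_ge_zero[of z] by (auto simp: r_def simp del: norm_ge_zero)
  have intr: "integrable N (\<lambda>x. exp (r * x) + exp (- r * x))"
    using r by (intro Bochner_Integration.integrable_add int) auto
  have abs_le: "exp (t * \<bar>x\<bar>) \<le> exp (r * x) + exp (- r * x)" if "0 \<le> t" "t \<le> r" for x t :: real
  proof -
    have "exp (t * \<bar>x\<bar>) \<le> exp (r * \<bar>x\<bar>)" using that by (simp add: mult_right_mono)
    also have "\<dots> \<le> exp (r * x) + exp (- r * x)" by (cases "0 \<le> x") auto
    finally show ?thesis .
  qed
  have term_le: "(t * \<bar>x\<bar>) ^ j / fact j \<le> exp (t * \<bar>x\<bar>)" if "0 \<le> t" for x t :: real and j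
  proof -
    have s: "summable (\<lambda>n. (t * \<bar>x\<bar>) ^ n / fact n)" using summable_exp[of "t * \<bar>x\<bar>"] by (simp add: field_simps)
    have "(\<Sum>n\<in>{j}. (t * \<bar>x\<bar>) ^ n / fact n) \<le> (\<Sum>n. (t * \<bar>x\<bar>) ^ n / fact n)"
      using that by (intro sum_le_suminf[OF s]) auto
    then show ?thesis by (simp add: exp_def divide_inverse mult.commute)
  qed
  show pow: "integrable N (\<lambda>x::real. x ^ j)" for j
  proof (rule Bochner_Integration.integrable_bound)
    show "integrable N (\<lambda>x. fact j / r ^ j * (exp (r * x) + exp (- r * x)))"
      by (intro integrable_mult_right intr)
    show "AE x in N. norm (x ^ j) \<le> norm (fact j / r ^ j * (exp (r * x) + exp (- r * x)))"
    proof (intro AE_I2)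
      fix x :: real
      have "(r * \<bar>x\<bar>) ^ j / fact j \<le> exp (r * x) + exp (- r * x)"
        using term_le[of r x j] abs_le[of r x] r by simp
      then have "\<bar>x\<bar> ^ j \<le> fact j / r ^ j * (exp (r * x) + exp (- r * x))"
        using r by (simp add: power_mult_distrib field_simps)
      then show "norm (x ^ j) \<le> norm (fact j / r ^ j * (exp (r * x) + exp (- r * x)))"
        using r by (simp add: power_abs)
    qed
  qed auto
  let ?f = "\<lambda>j x. (z * of_real x) ^ j / fact j"
  have intf: "integrable N (?f j)" for j
  proof -
    have "integrable N (\<lambda>x. z ^ j / fact j * complex_of_real (x ^ j))"
      using integrable_of_real[OF pow[of j], where 'a=complex] by (intro integrable_mult_right) auto
    then show ?thesis by (simp add: power_mult_distrib field_simps)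
  qed
  have norm_f: "cmod (?f j x) = (cmod z * \<bar>x\<bar>) ^ j / fact j" for j x
    by (simp add: norm_divide norm_power norm_mult)
  have sumabs: "(\<lambda>j. (cmod z * \<bar>x\<bar>) ^ j / fact j) sums exp (cmod z * \<bar>x\<bar>)" for x
    using exp_converges[of "cmod z * \<bar>x\<bar>"] by (simp add: field_simps)
  have exp_sums: "(\<lambda>j. ?f j x) sums exp (z * of_real x)" for x
    using exp_converges[of "z * of_real x"] by (simp add: scaleR_conv_of_real field_simps)
  have summ: "summable (\<lambda>j. LINT x|N. norm (?f j x))"
  proof (rule bounded_imp_summable)
    show "0 \<le> (LINT x|N. norm (?f j x))" for j by simp
    fix n
    have "(\<Sum>j\<le>n. LINT x|N. norm (?f j x)) = (LINT x|N. (\<Sum>j\<le>n. norm (?f j x)))"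
      using intf by (subst Bochner_Integration.integral_sum) (auto intro: integrable_norm)
    also have "\<dots> \<le> (LINT x|N. exp (r * x) + exp (- r * x))"
    proof (intro integral_mono intr Bochner_Integration.integrable_sum integrable_norm intf)
      fix x
      have "(\<Sum>j\<le>n. norm (?f j x)) \<le> exp (cmod z * \<bar>x\<bar>)"
        unfolding norm_f sums_unique[OF sumabs] using sums_summable[OF sumabs[of x]]
        by (intro sum_le_suminf) auto
      also have "\<dots> \<le> exp (r * x) + exp (- r * x)" using r by (intro abs_le) auto
      finally show "(\<Sum>j\<le>n. norm (?f j x)) \<le> exp (r * x) + exp (- r * x)" .
    qed
    finally show "(\<Sum>j\<le>n. LINT x|N. norm (?f j x)) \<le> (LINT x|N. exp (r * x) + exp (- r * x))" .
  qed
  have "(\<lambda>j. LINT x|N. ?f j x) sums (LINT x|N. (\<Sum>j. ?f j x))"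
  proof (rule sums_integral[OF intf _ summ])
    show "AE x in N. summable (\<lambda>j. norm (?f j x))"
      unfolding norm_f using sums_summable[OF sumabs] by auto
  qed
  then have "(\<lambda>j. LINT x|N. ?f j x) sums mgf N z"
    unfolding mgf_def sums_unique[OF exp_sums, symmetric] .
  moreover have "(LINT x|N. ?f j x) = of_real (LINT x|N. x ^ j) / fact j * z ^ j" for j
  proof -
    have "(LINT x|N. ?f j x) = (LINT x|N. z ^ j / fact j * complex_of_real (x ^ j))"
      by (simp add: power_mult_distrib field_simps)
    also have "\<dots> = z ^ j / fact j * of_real (LINT x|N. x ^ j)"
      unfolding integral_mult_right_zero integral_complex_of_real ..
    finally show ?thesis by (simp add: mult.commute)
  qed
  ultimately show "(\<lambda>j. of_real (LINT x|N. x ^ j) / fact j * z ^ j) sums mgf N z" by simp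
  show "integrable N (\<lambda>x. exp (z * of_real x))"
  proof (rule Bochner_Integration.integrable_bound[OF intr])
    show "AE x in N. norm (exp (z * of_real x)) \<le> norm (exp (r * x) + exp (- r * x))"
    proof (intro AE_I2)
      fix x :: real
      have "norm (exp (z * of_real x)) \<le> exp (cmod z * \<bar>x\<bar>)"
        by (metis norm_exp norm_mult norm_of_real)
      also have "\<dots> \<le> exp (r * x) + exp (- r * x)" using r by (intro abs_le) auto
      finally show "norm (exp (z * of_real x)) \<le> norm (exp (r * x) + exp (- r * x))" by simp
    qed
  qed auto
qed

lemma mgf_holomorphic:
  assumes N: "real_distribution N" and R: "0 < R"
    and int: "\<And>s. \<bar>s\<bar> < R \<Longrightarrow> integrable N (\<lambda>x. exp (s * x))"
  shows "mgf N holomorphic_on ball 0 R" and "mgf N 0 = 1"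
    and "(deriv ^^ j) (mgf N) 0 = of_real (LINT x|N. x ^ j)"
proof -
  interpret real_distribution N by fact
  let ?a = "\<lambda>j. of_real (LINT x|N. x ^ j) / fact j :: complex"
  have s: "(\<lambda>j. ?a j * (z - 0) ^ j) sums mgf N z" if "z \<in> ball 0 R" for z
    using mgf_power_series(1)[OF N R int, of z] that by simp
  show hol: "mgf N holomorphic_on ball 0 R" by (rule power_series_holomorphic[OF s])
  show "mgf N 0 = 1" using prob_space by (simp add: mgf_def)
  have "mgf N has_fps_expansion Abs_fps ?a"
  proof (rule has_fps_expansionI)
    have "\<forall>\<^sub>F u in nhds 0. u \<in> ball 0 R" by (rule eventually_nhds_in_open) (use R in auto)
    then show "\<forall>\<^sub>F u in nhds 0. (\<lambda>n. fps_nth (Abs_fps ?a) n * u ^ n) sums mgf N u"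
      by eventually_elim (use s in auto)
  qed
  then have "fps_nth (Abs_fps ?a) j = (deriv ^^ j) (mgf N) 0 / fact j"
    by (rule fps_nth_fps_expansion)
  then show "(deriv ^^ j) (mgf N) 0 = of_real (LINT x|N. x ^ j)" by simp
qed

text \<open>The modulus of \<open>exp (z * x)\<close> depends on \<open>Re z\<close> only. In terms of a logarithm of the
  transform this is the ridge property.\<close>

lemma norm_mgf_le:
  assumes N: "real_distribution N" and R: "0 < R"
    and int: "\<And>s. \<bar>s\<bar> < R \<Longrightarrow> integrable N (\<lambda>x. exp (s * x))" and z: "cmod z < R"
  shows "cmod (mgf N z) \<le> cmod (mgf N (of_real (Re z)))"
proof -
  have i: "integrable N (\<lambda>x. exp (z * of_real x))" by (rule mgf_power_series(3)[OF N R int z])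
  have "\<bar>Re z\<bar> < R" using z abs_Re_le_cmod[of z] by linarith
  note iR = int[OF this]
  have "cmod (mgf N z) \<le> (LINT x|N. cmod (exp (z * of_real x)))"
    unfolding mgf_def by (rule integral_norm_bound)
  also have "\<dots> = (LINT x|N. exp (Re z * x))" by simp
  also have "\<dots> = cmod (of_real (LINT x|N. exp (Re z * x)))" by simp
  also have "of_real (LINT x|N. exp (Re z * x)) = mgf N (of_real (Re z))"
    unfolding mgf_def by (subst integral_complex_of_real[symmetric]) (simp add: exp_of_real flip: of_real_mult)
  finally show ?thesis .
qed

text \<open>A quantitative form of Marcinkiewicz's theorem that the logarithm of a characteristic
  function is a polynomial only in the Gaussian case. Absence of zeros provides a logarithm \<open>\<Lambda>\<close>,
  the growth bound makes it asymptotically a polynomial of degree \<open>p\<close>, the ridge property removes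
  the coefficients of index \<open>3\<close> and more, and the first two moments fix the others. On the
  imaginary axis this is convergence of characteristic functions, and Levy's continuity theorem
  applies.\<close>

theorem central_limit_of_zero_free_mgf:
  fixes N :: "nat \<Rightarrow> real measure" and R :: "nat \<Rightarrow> real"
  assumes N: "\<And>n. real_distribution (N n)"
    and R: "filterlim R at_top sequentially" "\<And>n. 0 < R n"
    and int: "\<And>n s. \<bar>s\<bar> < R n \<Longrightarrow> integrable (N n) (\<lambda>x. exp (s * x))"
    and nz: "\<And>n z. cmod z < R n \<Longrightarrow> mgf (N n) z \<noteq> 0"
    and bd: "\<And>n z. cmod z < R n \<Longrightarrow> cmod (mgf (N n) z) < exp (C * R n ^ p)"
    and mean: "\<And>n. (LINT x|N n. x) = 0" and var: "\<And>n. (LINT x|N n. x\<^sup>2) = 1"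
    and p: "2 \<le> p"
  shows "weak_conv_m N std_normal_distribution"
proof (rule levy_continuity[OF N real_dist_normal_dist])
  have "\<exists>\<Lambda>. \<Lambda> holomorphic_on ball 0 (R n) \<and> \<Lambda> 0 = 0 \<and> (\<forall>z\<in>ball 0 (R n). exp (\<Lambda> z) = mgf (N n) z)" for n
  proof -
    obtain g where g: "g holomorphic_on ball 0 (R n)" "\<And>z. z \<in> ball 0 (R n) \<Longrightarrow> exp (g z) = mgf (N n) z"
      by (rule holomorphic_logarithm_exists[of "ball 0 (R n)" "mgf (N n)" 0])
        (use mgf_holomorphic(1)[OF N R(2) int] nz R(2) in auto)
    have "exp (g 0) = 1" using g(2)[of 0] R(2)[of n] mgf_holomorphic(2)[OF N R(2) int] by simp
    then show ?thesis using g
      by (intro exI[of _ "\<lambda>z. g z - g 0"]) (auto simp: exp_diff intro!: holomorphic_intros)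
  qed
  then obtain \<Lambda> where hol: "\<And>n. \<Lambda> n holomorphic_on ball 0 (R n)" and zero: "\<And>n. \<Lambda> n 0 = 0"
    and ex: "\<And>n z. cmod z < R n \<Longrightarrow> exp (\<Lambda> n z) = mgf (N n) z" by (metis mem_ball_0)
  have cm: "cmod (mgf (N n) z) = exp (Re (\<Lambda> n z))" if "cmod z < R n" for n z
    using ex[OF that] by (metis norm_exp_eq_Re)
  have re_bd: "Re (\<Lambda> n z) < C * R n ^ p" if "cmod z < R n" for n z
    using bd[OF that] unfolding cm[OF that] by simp
  have ridge: "Re (\<Lambda> n z) \<le> Re (\<Lambda> n (of_real (Re z)))" if z: "cmod z < R n" for n z
  proof -
    have "cmod (of_real (Re z)) < R n" using z abs_Re_le_cmod[of z] by simp
    from norm_mgf_le[of "N n" "R n" z, OF N R(2) int z] show ?thesis unfolding cm[OF z] cm[OF \<open>cmod (of_real (Re z)) < R n\<close>] by simp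
  qed
  have d: "deriv (mgf (N n)) z = deriv (\<Lambda> n) z * mgf (N n) z" if z: "z \<in> ball 0 (R n)" for n z
  proof -
    have "((\<lambda>z. exp (\<Lambda> n z)) has_field_derivative exp (\<Lambda> n z) * deriv (\<Lambda> n) z) (at z)"
      using holomorphic_derivI[OF hol open_ball z] by (auto intro!: derivative_eq_intros)
    then have "(mgf (N n) has_field_derivative exp (\<Lambda> n z) * deriv (\<Lambda> n) z) (at z)"
      by (rule has_field_derivative_transform_within_open[OF _ open_ball z]) (use ex in auto)
    then show ?thesis using ex z by (simp add: DERIV_imp_deriv mult.commute)
  qed
  have mh: "mgf (N n) holomorphic_on ball 0 (R n)" "mgf (N n) 0 = 1"
    "(deriv ^^ j) (mgf (N n)) 0 = of_real (LINT x|N n. x ^ j)" for n j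
    by (rule mgf_holomorphic[OF N R(2) int], assumption)+
  have c1: "deriv (\<Lambda> n) 0 = 0" for n
    using d[of 0 n] R(2)[of n] mh(2)[of n] mh(3)[of 1 n] mean[of n] by simp
  have c2: "(deriv ^^ 2) (\<Lambda> n) 0 = 1" for n
  proof -
    have 0: "0 \<in> ball 0 (R n)" using R(2)[of n] by simp
    have "(deriv ^^ 2) (mgf (N n)) 0 = deriv (\<lambda>z. deriv (\<Lambda> n) z * mgf (N n) z) 0"
      unfolding numeral_2_eq_2 funpow.simps o_def id_def
      by (intro deriv_cong_ev eventually_mono[OF eventually_nhds_in_open[OF open_ball 0]] refl d)
    also have "\<dots> = (deriv ^^ 2) (\<Lambda> n) 0"
    proof -
      have a: "(deriv (\<Lambda> n) has_field_derivative deriv (deriv (\<Lambda> n)) 0) (at 0)"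
        using holomorphic_derivI[OF holomorphic_deriv[OF hol open_ball] open_ball 0] .
      have b: "(mgf (N n) has_field_derivative deriv (mgf (N n)) 0) (at 0)"
        using holomorphic_derivI[OF mh(1) open_ball 0] .
      show ?thesis using DERIV_imp_deriv[OF DERIV_mult[OF a b]] c1[of n] mh(2)[of n]
        by (simp add: numeral_2_eq_2)
    qed
    finally show ?thesis using mh(3)[of 2 n] var[of n] by simp
  qed
  fix t :: real
  define c where "c n j = (deriv ^^ j) (\<Lambda> n) 0 / fact j" for n j
  have clim: "(\<lambda>n. c n j) \<longlonglongrightarrow> (if j = 2 then 1/2 else 0)" if "j \<le> p" for j
  proof (cases "3 \<le> j")
    case True
    then show ?thesis unfolding c_def
      using ridge_functions_coefficients_vanish[OF R hol zero re_bd ridge c1 c2 True that] by simp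
  next
    case False
    then have "j = 0 \<or> j = 1 \<or> j = 2" by auto
    then show ?thesis using zero c1 c2 by (auto simp: c_def)
  qed
  let ?z = "\<i> * of_real t"
  have ev: "\<forall>\<^sub>F n in sequentially. cmod ?z \<le> R n / 8"
  proof -
    have "\<forall>\<^sub>F n in sequentially. 8 * \<bar>t\<bar> \<le> R n" using R(1) by (auto simp: filterlim_at_top)
    then show ?thesis by eventually_elim (simp add: norm_mult)
  qed
  have lim1: "(\<lambda>n. \<Lambda> n ?z - (\<Sum>j\<le>p. c n j * ?z ^ j)) \<longlonglongrightarrow> 0"
  proof (rule Lim_null_comparison)
    show "\<forall>\<^sub>F n in sequentially. cmod (\<Lambda> n ?z - (\<Sum>j\<le>p. c n j * ?z ^ j)) 
        \<le> 4 ^ (p + 2) * C * cmod ?z ^ (p + 1) * inverse (R n)"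
      using ev
    proof eventually_elim
      case (elim n)
      show ?case unfolding c_def
        using taylor_remainder_of_Re_bound[OF hol zero R(2) re_bd elim] by (simp add: divide_inverse)
    qed
    show "(\<lambda>n. 4 ^ (p + 2) * C * cmod ?z ^ (p + 1) * inverse (R n)) \<longlonglongrightarrow> 0"
      by (intro tendsto_mult_right_zero tendsto_inverse_0_at_top R)
  qed
  have lim2: "(\<lambda>n. (\<Sum>j\<le>p. c n j * ?z ^ j)) \<longlonglongrightarrow> (\<Sum>j\<le>p. (if j = 2 then 1/2 else 0) * ?z ^ j)"
    by (intro tendsto_sum tendsto_mult clim tendsto_const) auto
  have val: "(\<Sum>j\<le>p. (if j = 2 then 1/2 else 0) * ?z ^ j) = of_real (- (t\<^sup>2) / 2)"
    using p by (simp add: if_distrib[of "\<lambda>x. x * _"] sum.delta power_mult_distrib cong: if_cong)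
  have "(\<lambda>n. \<Lambda> n ?z) \<longlonglongrightarrow> of_real (- (t\<^sup>2) / 2)"
    using tendsto_add[OF lim1 lim2] unfolding val by simp
  then have "(\<lambda>n. exp (\<Lambda> n ?z)) \<longlonglongrightarrow> exp (of_real (- (t\<^sup>2) / 2))" by (rule tendsto_exp)
  moreover have "\<forall>\<^sub>F n in sequentially. exp (\<Lambda> n ?z) = char (N n) t"
    using ev
  proof eventually_elim
    case (elim n)
    then have "cmod ?z < R n" using R(2)[of n] by linarith
    then show ?case unfolding ex[OF \<open>cmod ?z < R n\<close>] mgf_def char_def by (simp add: mult.assoc)
  qed
  ultimately have "(\<lambda>n. char (N n) t) \<longlonglongrightarrow> exp (of_real (- (t\<^sup>2) / 2))"
    by (simp add: tendsto_cong)
  then show "(\<lambda>n. char (N n) t) \<longlonglongrightarrow> char std_normal_distribution t"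
    by (simp add: char_std_normal_distribution flip: exp_of_real)
qed

section \<open>Hilbert-Schmidt kernels\<close>

text \<open>The second claim is Cauchy-Schwarz, from \<open>2 * s * t * \<bar>f g\<bar> \<le> s\<^sup>2 * \<bar>f\<bar>\<^sup>2 + t\<^sup>2 * \<bar>g\<bar>\<^sup>2\<close>:
  with \<open>s\<close> and \<open>t\<close> the two norms exchanged in general, and with a large parameter if one of the
  norms is \<open>0\<close>.\<close>

lemma integrable_mult_of_square_integrable:
  fixes f g :: "'a \<Rightarrow> complex"
  assumes [measurable]: "f \<in> borel_measurable M" "g \<in> borel_measurable M"
    and f: "integrable M (\<lambda>x. (cmod (f x))\<^sup>2)" and g: "integrable M (\<lambda>x. (cmod (g x))\<^sup>2)"
  shows "integrable M (\<lambda>x. f x * g x)"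
    and "cmod (LINT x|M. f x * g x) \<le> sqrt (LINT x|M. (cmod (f x))\<^sup>2) * sqrt (LINT x|M. (cmod (g x))\<^sup>2)"
proof -
  have sq: "2 * (a * b) \<le> a\<^sup>2 + b\<^sup>2" for a b :: real using sum_squares_bound[of a b] by simp
  have absint: "integrable M (\<lambda>x. cmod (f x) * cmod (g x))"
  proof (rule Bochner_Integration.integrable_bound[OF Bochner_Integration.integrable_add[OF f g]])
    show "AE x in M. norm (cmod (f x) * cmod (g x)) \<le> norm ((cmod (f x))\<^sup>2 + (cmod (g x))\<^sup>2)"
    proof (intro AE_I2)
      fix x
      have "0 \<le> cmod (f x) * cmod (g x)" by simp
      then have "cmod (f x) * cmod (g x) \<le> (cmod (f x))\<^sup>2 + (cmod (g x))\<^sup>2"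
        using sq[of "cmod (f x)" "cmod (g x)"] by linarith
      then show "norm (cmod (f x) * cmod (g x)) \<le> norm ((cmod (f x))\<^sup>2 + (cmod (g x))\<^sup>2)"
        by simp
    qed
  qed simp
  show int: "integrable M (\<lambda>x. f x * g x)"
    by (rule Bochner_Integration.integrable_bound[OF absint]) (auto simp: norm_mult)
  define a b c where "a = (LINT x|M. (cmod (f x))\<^sup>2)" and "b = (LINT x|M. (cmod (g x))\<^sup>2)"
    and "c = (LINT x|M. cmod (f x) * cmod (g x))"
  have ab: "0 \<le> a" "0 \<le> b" "0 \<le> c" by (auto simp: a_def b_def c_def)
  have ineq: "2 * s * t * c \<le> s\<^sup>2 * a + t\<^sup>2 * b" for s t
  proof -
    have "(LINT x|M. 2 * s * t * (cmod (f x) * cmod (g x))) \<le> (LINT x|M. s\<^sup>2 * (cmod (f x))\<^sup>2 + t\<^sup>2 * (cmod (g x))\<^sup>2)"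
    proof (intro integral_mono Bochner_Integration.integrable_add integrable_mult_right f g absint)
      fix x
      show "2 * s * t * (cmod (f x) * cmod (g x)) \<le> s\<^sup>2 * (cmod (f x))\<^sup>2 + t\<^sup>2 * (cmod (g x))\<^sup>2"
        using sq[of "s * cmod (f x)" "t * cmod (g x)"] by (simp add: power_mult_distrib mult_ac)
    qed
    then show ?thesis
      using f g absint by (simp add: a_def b_def c_def Bochner_Integration.integral_add)
  qed
  have "c \<le> sqrt a * sqrt b"
  proof (cases "a = 0 \<or> b = 0")
    case True
    have "c \<le> 0"
    proof (rule ccontr)
      assume "\<not> c \<le> 0"
      then have c: "0 < c" by simp
      show False
      proof (cases "a = 0")
        case True
        have "2 * ((b + 1) / c) * 1 * c \<le> b" using ineq[of "(b + 1) / c" 1] True by simp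
        then show False using c ab by simp
      next
        case False
        then have "b = 0" using \<open>a = 0 \<or> b = 0\<close> by simp
        have "2 * 1 * ((a + 1) / c) * c \<le> a" using ineq[of 1 "(a + 1) / c"] \<open>b = 0\<close> by simp
        then show False using c ab by simp
      qed
    qed
    then show ?thesis using ab by (meson mult_nonneg_nonneg order_trans real_sqrt_ge_zero)
  next
    case False
    then have pos: "0 < a" "0 < b" using ab by auto
    have "2 * (sqrt a * sqrt b) * c \<le> 2 * (a * b)"
      using ineq[of "sqrt b" "sqrt a"] ab by (simp add: mult_ac)
    then have "sqrt a * sqrt b * c \<le> (sqrt a * sqrt b) * (sqrt a * sqrt b)"
      using ab by (simp add: real_sqrt_mult[symmetric])
    then show ?thesis using pos by simp
  qed
  moreover have "cmod (LINT x|M. f x * g x) \<le> c"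
    unfolding c_def using integral_norm_bound[of M "\<lambda>x. f x * g x"] by (simp add: norm_mult)
  ultimately show "cmod (LINT x|M. f x * g x) \<le> sqrt (LINT x|M. (cmod (f x))\<^sup>2) * sqrt (LINT x|M. (cmod (g x))\<^sup>2)"
    unfolding a_def b_def by linarith
qed

type_synonym 'a kernel = "'a \<Rightarrow> 'a \<Rightarrow> complex"

text \<open>Every row and every column is required to be square-integrable, not just almost every one.
  Compositions are then given by convergent integrals at every point, and the identities between
  them hold pointwise, so that they can be restricted to the diagonal.\<close>

definition hs_kernel :: "'a measure \<Rightarrow> 'a kernel \<Rightarrow> bool" where
  "hs_kernel M A \<longleftrightarrow> (\<lambda>(x, y). A x y) \<in> borel_measurable (M \<Otimes>\<^sub>M M) \<and>
     integrable (M \<Otimes>\<^sub>M M) (\<lambda>(x, y). (cmod (A x y))\<^sup>2) \<and>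
     (\<forall>x\<in>space M. integrable M (\<lambda>y. (cmod (A x y))\<^sup>2)) \<and>
     (\<forall>y\<in>space M. integrable M (\<lambda>x. (cmod (A x y))\<^sup>2))"

definition hs_norm :: "'a measure \<Rightarrow> 'a kernel \<Rightarrow> real" where
  "hs_norm M A = sqrt (integral\<^sup>L (M \<Otimes>\<^sub>M M) (\<lambda>(x, y). (cmod (A x y))\<^sup>2))"

definition kernel_comp :: "'a measure \<Rightarrow> 'a kernel \<Rightarrow> 'a kernel \<Rightarrow> 'a kernel" where
  "kernel_comp M A B = (\<lambda>x y. LINT z|M. A x z * B z y)"

definition kernel_trace :: "'a measure \<Rightarrow> 'a kernel \<Rightarrow> complex" where
  "kernel_trace M A = (LINT x|M. A x x)"

definition kernel_adj :: "'a kernel \<Rightarrow> 'a kernel" where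
  "kernel_adj A = (\<lambda>x y. cnj (A y x))"

lemma hs_norm_nonneg [simp]: "0 \<le> hs_norm M A"
  unfolding hs_norm_def by (intro real_sqrt_ge_zero Bochner_Integration.integral_nonneg) (simp add: case_prod_unfold)

lemma hs_norm_sq: "(hs_norm M A)\<^sup>2 = (integral\<^sup>L (M \<Otimes>\<^sub>M M) (\<lambda>(x, y). (cmod (A x y))\<^sup>2))"
  unfolding hs_norm_def by (intro real_sqrt_pow2 Bochner_Integration.integral_nonneg) (simp add: case_prod_unfold)

context sigma_finite_measure
begin

interpretation P: pair_sigma_finite M M ..

lemma hs_measurable: "hs_kernel M A \<Longrightarrow> (\<lambda>(x, y). A x y) \<in> borel_measurable (M \<Otimes>\<^sub>M M)"
  by (simp add: hs_kernel_def)

lemma hs_measurable_compose: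
  assumes A: "hs_kernel M A" and f: "f \<in> measurable N M" and g: "g \<in> measurable N M"
  shows "(\<lambda>w. A (f w) (g w)) \<in> borel_measurable N"
  using measurable_compose[OF measurable_Pair[OF f g] hs_measurable[OF A]] by simp

lemma hs_row: 
  assumes A: "hs_kernel M A" and x: "x \<in> space M"
  shows "A x \<in> borel_measurable M" "(\<lambda>z. A z x) \<in> borel_measurable M"
    "integrable M (\<lambda>y. (cmod (A x y))\<^sup>2)" "integrable M (\<lambda>y. (cmod (A y x))\<^sup>2)"
proof -
  show "A x \<in> borel_measurable M" "(\<lambda>z. A z x) \<in> borel_measurable M"
    by (rule hs_measurable_compose[OF A measurable_const[OF x] measurable_ident_sets[OF refl], simplified])
       (rule hs_measurable_compose[OF A measurable_ident_sets[OF refl] measurable_const[OF x], simplified])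
  show "integrable M (\<lambda>y. (cmod (A x y))\<^sup>2)" "integrable M (\<lambda>y. (cmod (A y x))\<^sup>2)"
    using A x by (simp_all add: hs_kernel_def)
qed

lemma hs_comp_bound:
  assumes A: "hs_kernel M A" and B: "hs_kernel M B" and x: "x \<in> space M" and y: "y \<in> space M"
  shows "integrable M (\<lambda>z. A x z * B z y)"
    "(cmod (kernel_comp M A B x y))\<^sup>2 \<le> (LINT z|M. (cmod (A x z))\<^sup>2) * (LINT z|M. (cmod (B z y))\<^sup>2)"
proof -
  note cs = integrable_mult_of_square_integrable[OF hs_row(1)[OF A x] hs_row(2)[OF B y] hs_row(3)[OF A x] hs_row(4)[OF B y]]
  show "integrable M (\<lambda>z. A x z * B z y)" by (rule cs(1))
  have "(cmod (kernel_comp M A B x y))\<^sup>2 \<le> (sqrt (LINT z|M. (cmod (A x z))\<^sup>2) * sqrt (LINT z|M. (cmod (B z y))\<^sup>2))\<^sup>2"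
    using cs(2) unfolding kernel_comp_def by (intro power_mono) auto
  then show "(cmod (kernel_comp M A B x y))\<^sup>2 \<le> (LINT z|M. (cmod (A x z))\<^sup>2) * (LINT z|M. (cmod (B z y))\<^sup>2)"
    by (simp add: power_mult_distrib)
qed

lemma hs_row_integral:
  assumes A: "hs_kernel M A"
  shows "integrable M (\<lambda>x. LINT y|M. (cmod (A x y))\<^sup>2)" "(LINT x|M. LINT y|M. (cmod (A x y))\<^sup>2) = (hs_norm M A)\<^sup>2"
    "integrable M (\<lambda>y. LINT x|M. (cmod (A x y))\<^sup>2)" "(LINT y|M. LINT x|M. (cmod (A x y))\<^sup>2) = (hs_norm M A)\<^sup>2"
proof -
  have i: "integrable (M \<Otimes>\<^sub>M M) (\<lambda>(x, y). (cmod (A x y))\<^sup>2)" using A by (simp add: hs_kernel_def)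
  show "integrable M (\<lambda>x. LINT y|M. (cmod (A x y))\<^sup>2)" by (rule P.integrable_fst[OF i])
  show "integrable M (\<lambda>y. LINT x|M. (cmod (A x y))\<^sup>2)" by (rule P.integrable_snd[OF i])
  show "(LINT x|M. LINT y|M. (cmod (A x y))\<^sup>2) = (hs_norm M A)\<^sup>2" 
    unfolding hs_norm_sq by (rule P.integral_fst[OF i])
  show "(LINT y|M. LINT x|M. (cmod (A x y))\<^sup>2) = (hs_norm M A)\<^sup>2" 
    unfolding hs_norm_sq by (rule P.integral_snd[OF i])
qed

lemma integrable_product_fst_snd:
  fixes a b :: "'a \<Rightarrow> real"
  assumes a: "integrable M a" and b: "integrable M b"
  shows "integrable (M \<Otimes>\<^sub>M M) (\<lambda>(x, y). a x * b y)"
    and "(integral\<^sup>L (M \<Otimes>\<^sub>M M) (\<lambda>(x, y). a x * b y)) = (LINT x|M. a x) * (LINT y|M. b y)"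
proof -
  have [measurable]: "a \<in> borel_measurable M" "b \<in> borel_measurable M" using a b by auto
  show i: "integrable (M \<Otimes>\<^sub>M M) (\<lambda>(x, y). a x * b y)"
  proof (rule P.Fubini_integrable)
    show "(\<lambda>(x, y). a x * b y) \<in> borel_measurable (M \<Otimes>\<^sub>M M)" by measurable
    show "integrable M (\<lambda>x. LINT y|M. norm (case (x, y) of (x, y) \<Rightarrow> a x * b y))"
      using a b by (simp add: abs_mult)
    show "AE x in M. integrable M (\<lambda>y. case (x, y) of (x, y) \<Rightarrow> a x * b y)"
      using b by simp
  qed
  show "(integral\<^sup>L (M \<Otimes>\<^sub>M M) (\<lambda>(x, y). a x * b y)) = (LINT x|M. a x) * (LINT y|M. b y)"
    using P.integral_fst[OF i] by simp
qed

lemma hs_comp: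
  assumes A: "hs_kernel M A" and B: "hs_kernel M B"
  shows "hs_kernel M (kernel_comp M A B)" and "hs_norm M (kernel_comp M A B) \<le> hs_norm M A * hs_norm M B"
proof -
  have "(\<lambda>w. A (fst (fst w)) (snd w) * B (snd w) (snd (fst w))) \<in> borel_measurable ((M \<Otimes>\<^sub>M M) \<Otimes>\<^sub>M M)"
    by (intro borel_measurable_times hs_measurable_compose[OF A] hs_measurable_compose[OF B]) measurable
  then have "(\<lambda>p. LINT z|M. A (fst p) z * B z (snd p)) \<in> borel_measurable (M \<Otimes>\<^sub>M M)"
    by (intro borel_measurable_lebesgue_integral) (simp add: case_prod_unfold)
  then have meas: "(\<lambda>(x, y). kernel_comp M A B x y) \<in> borel_measurable (M \<Otimes>\<^sub>M M)"
    by (simp add: kernel_comp_def case_prod_unfold)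
  have meas1: "kernel_comp M A B x \<in> borel_measurable M" if "x \<in> space M" for x
    using measurable_compose[OF measurable_Pair1'[OF that] meas] by simp
  have meas2: "(\<lambda>x. kernel_comp M A B x y) \<in> borel_measurable M" if "y \<in> space M" for y
    using measurable_compose[OF measurable_Pair2'[OF that] meas] by simp
  define a b where "a = (\<lambda>x. LINT z|M. (cmod (A x z))\<^sup>2)" and "b = (\<lambda>y. LINT z|M. (cmod (B z y))\<^sup>2)"
  have le: "(cmod (kernel_comp M A B x y))\<^sup>2 \<le> a x * b y" if "x \<in> space M" "y \<in> space M" for x y
    using hs_comp_bound(2)[OF A B that] by (simp add: a_def b_def)
  have ia: "integrable M a" "integrable M b" unfolding a_def b_def by (rule hs_row_integral A B)+
  have ab: "integrable (M \<Otimes>\<^sub>M M) (\<lambda>(x, y). a x * b y)" "(integral\<^sup>L (M \<Otimes>\<^sub>M M) (\<lambda>(x, y). a x * b y)) = (hs_norm M A * hs_norm M B)\<^sup>2"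
    using integrable_product_fst_snd[OF ia] hs_row_integral[OF A] hs_row_integral[OF B] by (auto simp: a_def b_def power_mult_distrib)
  have int2: "integrable (M \<Otimes>\<^sub>M M) (\<lambda>(x, y). (cmod (kernel_comp M A B x y))\<^sup>2)"
  proof (rule Bochner_Integration.integrable_bound[OF ab(1)])
    show "(\<lambda>(x, y). (cmod (kernel_comp M A B x y))\<^sup>2) \<in> borel_measurable (M \<Otimes>\<^sub>M M)"
      using meas by (simp add: case_prod_unfold)
    show "AE p in M \<Otimes>\<^sub>M M. norm (case p of (x, y) \<Rightarrow> (cmod (kernel_comp M A B x y))\<^sup>2) \<le> norm (case p of (x, y) \<Rightarrow> a x * b y)"
    proof (intro AE_I2)
      fix p assume "p \<in> space (M \<Otimes>\<^sub>M M)"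
      then show "norm (case p of (x, y) \<Rightarrow> (cmod (kernel_comp M A B x y))\<^sup>2) \<le> norm (case p of (x, y) \<Rightarrow> a x * b y)"
        using le[of "fst p" "snd p"] by (auto simp: space_pair_measure)
    qed
  qed
  have row: "integrable M (\<lambda>y. (cmod (kernel_comp M A B x y))\<^sup>2)" if x: "x \<in> space M" for x
  proof (rule Bochner_Integration.integrable_bound[OF integrable_mult_right[OF ia(2), of "a x"]])
    show "(\<lambda>y. (cmod (kernel_comp M A B x y))\<^sup>2) \<in> borel_measurable M"
      using meas1[OF x] by simp
    show "AE y in M. norm ((cmod (kernel_comp M A B x y))\<^sup>2) \<le> norm (a x * b y)"
      using le[OF x] by (intro AE_I2) (auto intro: order_trans[OF _ abs_ge_self])
  qed
  have col: "integrable M (\<lambda>x. (cmod (kernel_comp M A B x y))\<^sup>2)" if y: "y \<in> space M" for y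
  proof (rule Bochner_Integration.integrable_bound[OF integrable_mult_left[OF ia(1), of "b y"]])
    show "(\<lambda>x. (cmod (kernel_comp M A B x y))\<^sup>2) \<in> borel_measurable M"
      using meas2[OF y] by simp
    show "AE x in M. norm ((cmod (kernel_comp M A B x y))\<^sup>2) \<le> norm (a x * b y)"
      using le[OF _ y] by (intro AE_I2) (auto intro: order_trans[OF _ abs_ge_self])
  qed
  show hs: "hs_kernel M (kernel_comp M A B)"
    unfolding hs_kernel_def using meas int2 row col by auto
  have "(hs_norm M (kernel_comp M A B))\<^sup>2 \<le> (hs_norm M A * hs_norm M B)\<^sup>2"
    unfolding hs_norm_sq[of M "kernel_comp M A B"] ab(2)[symmetric]
    using le by (intro integral_mono int2 ab) (auto simp: space_pair_measure)
  then show "hs_norm M (kernel_comp M A B) \<le> hs_norm M A * hs_norm M B"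
    by (rule power2_le_imp_le) simp
qed

lemma hs_adj:
  assumes A: "hs_kernel M A"
  shows "hs_kernel M (kernel_adj A)" and "hs_norm M (kernel_adj A) = hs_norm M A"
proof -
  have m: "(\<lambda>(x, y). kernel_adj A x y) \<in> borel_measurable (M \<Otimes>\<^sub>M M)"
    unfolding kernel_adj_def case_prod_unfold by (intro measurable_compose[OF hs_measurable_compose[OF A]
        borel_measurable_continuous_onI[OF continuous_on_cnj[OF continuous_on_id]]]) auto
  have i: "integrable (M \<Otimes>\<^sub>M M) (\<lambda>(x, y). (cmod (A x y))\<^sup>2)" using A by (simp add: hs_kernel_def)
  show "hs_kernel M (kernel_adj A)"
    using m P.integrable_product_swap[OF i] hs_row[OF A] by (auto simp: hs_kernel_def kernel_adj_def)
  show "hs_norm M (kernel_adj A) = hs_norm M A"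
    unfolding hs_norm_def kernel_adj_def complex_mod_cnj
    using P.integral_product_swap[OF borel_measurable_integrable[OF i]] by simp
qed

text \<open>The trace of a product is the pairing in \<open>L\<^sup>2\<close> of the product space of one kernel with the
  transpose of the other.\<close>

lemma trace_comp:
  assumes A: "hs_kernel M A" and B: "hs_kernel M B"
  shows "integrable (M \<Otimes>\<^sub>M M) (\<lambda>(x, y). A x y * B y x)"
    and "kernel_trace M (kernel_comp M A B) = (integral\<^sup>L (M \<Otimes>\<^sub>M M) (\<lambda>(x, y). A x y * B y x))"
    and "integrable M (\<lambda>x. kernel_comp M A B x x)"
    and "cmod (kernel_trace M (kernel_comp M A B)) \<le> hs_norm M A * hs_norm M B"
proof -
  have B': "hs_kernel M (\<lambda>x y. B y x)"
  proof -
    have "integrable (M \<Otimes>\<^sub>M M) (\<lambda>(x, y). (cmod (B x y))\<^sup>2)" using B by (simp add: hs_kernel_def)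
    from P.integrable_product_swap[OF this] show ?thesis
      using hs_row[OF B] hs_measurable_compose[OF B, of snd _ fst] by (auto simp: hs_kernel_def case_prod_unfold)
  qed
  have nB: "hs_norm M (\<lambda>x y. B y x) = hs_norm M B"
  proof -
    have "integrable (M \<Otimes>\<^sub>M M) (\<lambda>(x, y). (cmod (B x y))\<^sup>2)" using B by (simp add: hs_kernel_def)
    from P.integral_product_swap[OF borel_measurable_integrable[OF this]] show ?thesis
      by (simp add: hs_norm_def)
  qed
  have sqA: "integrable (M \<Otimes>\<^sub>M M) (\<lambda>p. (cmod ((\<lambda>(x, y). A x y) p))\<^sup>2)"
    and sqB: "integrable (M \<Otimes>\<^sub>M M) (\<lambda>p. (cmod ((\<lambda>(x, y). B y x) p))\<^sup>2)"
    using A B' by (auto simp: hs_kernel_def case_prod_unfold)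
  note cs = integrable_mult_of_square_integrable[OF hs_measurable[OF A] hs_measurable[OF B'] sqA sqB]
  show i: "integrable (M \<Otimes>\<^sub>M M) (\<lambda>(x, y). A x y * B y x)" using cs(1) by (simp add: case_prod_unfold)
  show tr: "kernel_trace M (kernel_comp M A B) = (integral\<^sup>L (M \<Otimes>\<^sub>M M) (\<lambda>(x, y). A x y * B y x))"
    unfolding kernel_trace_def kernel_comp_def by (rule P.integral_fst[OF i])
  show "integrable M (\<lambda>x. kernel_comp M A B x x)"
    unfolding kernel_comp_def by (rule P.integrable_fst[OF i])
  show "cmod (kernel_trace M (kernel_comp M A B)) \<le> hs_norm M A * hs_norm M B"
    unfolding tr using cs(2) nB by (simp add: hs_norm_def case_prod_unfold)
qed

lemma comp_assoc:
  assumes A: "hs_kernel M A" and B: "hs_kernel M B" and C: "hs_kernel M C"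
    and x: "x \<in> space M" and y: "y \<in> space M"
  shows "kernel_comp M (kernel_comp M A B) C x y = kernel_comp M A (kernel_comp M B C) x y"
proof -
  have m[measurable]: "A x \<in> borel_measurable M" "(\<lambda>w. C w y) \<in> borel_measurable M"
    using hs_row[OF A x] hs_row[OF C y] by auto
  have "integrable (M \<Otimes>\<^sub>M M) (\<lambda>p. (cmod ((\<lambda>(z, w). A x z * C w y) p))\<^sup>2)"
    using integrable_product_fst_snd(1)[OF hs_row(3)[OF A x] hs_row(4)[OF C y]]
    by (simp add: case_prod_unfold norm_mult power_mult_distrib)
  moreover have "integrable (M \<Otimes>\<^sub>M M) (\<lambda>p. (cmod ((\<lambda>(z, w). B z w) p))\<^sup>2)"
    using B by (simp add: hs_kernel_def case_prod_unfold)
  ultimately have "integrable (M \<Otimes>\<^sub>M M) (\<lambda>p. (\<lambda>(z, w). A x z * C w y) p * (\<lambda>(z, w). B z w) p)"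
    by (intro integrable_mult_of_square_integrable(1) hs_measurable[OF B]) measurable
  then have i: "integrable (M \<Otimes>\<^sub>M M) (\<lambda>(z, w). A x z * B z w * C w y)"
    by (simp add: case_prod_unfold mult_ac)
  have "kernel_comp M (kernel_comp M A B) C x y = (LINT w|M. LINT z|M. A x z * B z w * C w y)"
    unfolding kernel_comp_def by simp
  also have "\<dots> = (LINT z|M. LINT w|M. A x z * B z w * C w y)"
    by (rule P.Fubini_integral[OF i])
  also have "\<dots> = kernel_comp M A (kernel_comp M B C) x y"
    unfolding kernel_comp_def by (simp add: mult.assoc)
  finally show ?thesis .
qed

lemma comp_cong:
  assumes "\<And>x y. x \<in> space M \<Longrightarrow> y \<in> space M \<Longrightarrow> A x y = A' x y" "\<And>x y. x \<in> space M \<Longrightarrow> y \<in> space M \<Longrightarrow> B x y = B' x y"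
    and "x \<in> space M" "y \<in> space M"
  shows "kernel_comp M A B x y = kernel_comp M A' B' x y"
  unfolding kernel_comp_def using assms by (intro Bochner_Integration.integral_cong) auto

lemma trace_cong:
  assumes "\<And>x. x \<in> space M \<Longrightarrow> A x x = B x x"
  shows "kernel_trace M A = kernel_trace M B"
  unfolding kernel_trace_def using assms by (intro Bochner_Integration.integral_cong) auto

lemma hs_norm_trace:
  assumes A: "hs_kernel M A"
  shows "kernel_trace M (kernel_comp M A (kernel_adj A)) = of_real ((hs_norm M A)\<^sup>2)"
  unfolding trace_comp(2)[OF A hs_adj(1)[OF A]] hs_norm_sq integral_complex_of_real[symmetric]
  by (intro Bochner_Integration.integral_cong) (auto simp: kernel_adj_def complex_norm_square[symmetric] simp flip: of_real_power)

lemma adj_comp: "kernel_adj (kernel_comp M A B) = kernel_comp M (kernel_adj B) (kernel_adj A)"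
  unfolding kernel_adj_def kernel_comp_def
  by (intro ext) (simp add: mult.commute flip: integral_cnj complex_cnj_mult)

text \<open>The index is shifted, \<open>kernel_pow M k n\<close> being the power of exponent \<open>n + 1\<close>, because the
  identity has no kernel.\<close>

primrec (in -) kernel_pow :: "'a measure \<Rightarrow> 'a kernel \<Rightarrow> nat \<Rightarrow> 'a kernel" where
  "kernel_pow M k 0 = k"
| "kernel_pow M k (Suc n) = kernel_comp M k (kernel_pow M k n)"

lemma hs_kernel_pow: "hs_kernel M k \<Longrightarrow> hs_kernel M (kernel_pow M k n)"
  by (induction n) (auto intro: hs_comp)

lemma kernel_pow_comp:
  assumes k: "hs_kernel M k" and x: "x \<in> space M" and y: "y \<in> space M"
  shows "kernel_comp M (kernel_pow M k m) (kernel_pow M k n) x y = kernel_pow M k (Suc (m + n)) x y"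
  using x y
proof (induction m arbitrary: x y)
  case (Suc m)
  have "kernel_comp M (kernel_pow M k (Suc m)) (kernel_pow M k n) x y 
      = kernel_comp M k (kernel_comp M (kernel_pow M k m) (kernel_pow M k n)) x y"
    using comp_assoc[OF k hs_kernel_pow[OF k] hs_kernel_pow[OF k] Suc.prems] by simp
  also have "\<dots> = kernel_comp M k (kernel_pow M k (Suc (m + n))) x y"
    using Suc by (intro comp_cong) auto
  finally show ?case by simp
qed simp

lemma kernel_pow_adj:
  assumes k: "hs_kernel M k" and herm: "\<And>x y. x \<in> space M \<Longrightarrow> y \<in> space M \<Longrightarrow> kernel_adj k x y = k x y"
    and x: "x \<in> space M" and y: "y \<in> space M"
  shows "kernel_adj (kernel_pow M k n) x y = kernel_pow M k n x y"
  using x y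
proof (induction n arbitrary: x y)
  case (Suc n)
  have "kernel_adj (kernel_pow M k (Suc n)) x y = kernel_comp M (kernel_adj (kernel_pow M k n)) (kernel_adj k) x y"
    by (simp add: adj_comp)
  also have "\<dots> = kernel_comp M (kernel_pow M k n) (kernel_pow M k 0) x y"
    using Suc herm by (intro comp_cong) auto
  also have "\<dots> = kernel_pow M k (Suc n) x y"
    using kernel_pow_comp[OF k Suc.prems, of n 0] by simp
  finally show ?case .
qed (use herm in auto)

text \<open>For Hermitian \<open>k\<close> a power of even exponent is the product of a power with its adjoint.\<close>

lemma trace_even_pow:
  assumes k: "hs_kernel M k" and herm: "\<And>x y. x \<in> space M \<Longrightarrow> y \<in> space M \<Longrightarrow> kernel_adj k x y = k x y"
  shows "kernel_trace M (kernel_pow M k (Suc (2 * n))) = of_real ((hs_norm M (kernel_pow M k n))\<^sup>2)"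
proof -
  have "kernel_trace M (kernel_pow M k (Suc (n + n))) = kernel_trace M (kernel_comp M (kernel_pow M k n) (kernel_pow M k n))"
    using kernel_pow_comp[OF k] by (intro trace_cong) simp
  also have "\<dots> = kernel_trace M (kernel_comp M (kernel_pow M k n) (kernel_adj (kernel_pow M k n)))"
    using kernel_pow_adj[OF k herm] by (intro trace_cong comp_cong) auto
  also have "\<dots> = of_real ((hs_norm M (kernel_pow M k n))\<^sup>2)"
    by (rule hs_norm_trace[OF hs_kernel_pow[OF k]])
  finally show ?thesis by (simp add: mult_2)
qed

lemma hs_norm_pow_submultiplicative:
  assumes k: "hs_kernel M k"
  shows "hs_norm M (kernel_pow M k (Suc (m + n))) \<le> hs_norm M (kernel_pow M k m) * hs_norm M (kernel_pow M k n)"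
proof -
  have "hs_norm M (kernel_pow M k (Suc (m + n))) = hs_norm M (kernel_comp M (kernel_pow M k m) (kernel_pow M k n))"
    unfolding hs_norm_def using kernel_pow_comp[OF k] 
    by (intro arg_cong[of _ _ sqrt] Bochner_Integration.integral_cong) (auto simp: space_pair_measure)
  then show ?thesis using hs_comp(2)[OF hs_kernel_pow[OF k] hs_kernel_pow[OF k]] by simp
qed

text \<open>Log-convexity says that the ratios of consecutive terms increase; the growth rate of the
  sequence is therefore at least its first ratio.\<close>

lemma (in -) log_convex_first_ratio:
  fixes b :: "nat \<Rightarrow> real"
  assumes nn: "\<And>n. 0 \<le> b n" and lc: "\<And>n. (b (Suc n))\<^sup>2 \<le> b n * b (Suc (Suc n))"
    and bd: "\<And>n. b n \<le> D * c ^ n" and c: "0 < c"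
  shows "b 1 \<le> c * b 0"
proof (rule ccontr)
  assume "\<not> b 1 \<le> c * b 0"
  then have gt: "c * b 0 < b 1" by simp
  have b0: "b 0 > 0"
  proof (rule ccontr)
    assume "\<not> b 0 > 0"
    then have "b 0 = 0" using nn[of 0] by simp
    then have "(b 1)\<^sup>2 \<le> 0" using lc[of 0] unfolding One_nat_def by (metis mult_zero_left)
    then show False using gt \<open>b 0 = 0\<close> by (simp add: power2_le_iff_abs_le)
  qed
  define r where "r = b 1 / b 0"
  have r: "c < r" using gt b0 by (simp add: r_def field_simps)
  have step: "0 < b n \<and> r * b n \<le> b (Suc n)" for n
  proof (induction n)
    case 0
    then show ?case using b0 by (simp add: r_def)
  next
    case (Suc n)
    have "0 < r * b n" using Suc r c by simp
    then have pos: "0 < b (Suc n)" using Suc by linarith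
    have "b (Suc n) * (r * b n) \<le> b (Suc n) * b (Suc n)" using Suc pos by (intro mult_left_mono) auto
    also have "\<dots> \<le> b n * b (Suc (Suc n))" using lc[of n] by (simp add: power2_eq_square)
    finally have "b n * (r * b (Suc n)) \<le> b n * b (Suc (Suc n))" by (simp add: mult_ac)
    then have "r * b (Suc n) \<le> b (Suc (Suc n))" using Suc by (meson mult_le_cancel_left_pos)
    then show ?case using pos by blast
  qed
  have ge: "r ^ n * b 0 \<le> b n" for n
  proof (induction n)
    case (Suc n)
    have "r ^ Suc n * b 0 \<le> r * b n" using Suc r c by (simp add: mult.assoc)
    then show ?case using step[of n] by linarith
  qed simp
  have "(r / c) ^ n \<le> D / b 0" for n
    using order_trans[OF ge[of n] bd[of n]] b0 c by (simp add: field_simps power_divide)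
  moreover have "1 < r / c" using r c by simp
  ultimately show False
    using real_arch_pow[of "r / c" "D / b 0"] by (meson not_le)
qed

text \<open>This bounds the operator norm of \<open>k\<close> by the growth rate of the norms of its powers, without
  spectral theory. The squared norms of \<open>A\<close>, \<open>A k\<close>, \<open>A k\<^sup>2\<close>, ... form a log-convex sequence, by
  Cauchy-Schwarz and because \<open>k\<close> is Hermitian, and they grow at most like those of the powers of
  \<open>k\<close>.\<close>

lemma hs_norm_comp_le_opnorm:
  assumes A: "hs_kernel M A" and k: "hs_kernel M k"
    and herm: "\<And>x y. x \<in> space M \<Longrightarrow> y \<in> space M \<Longrightarrow> kernel_adj k x y = k x y"
    and q: "\<And>n. (hs_norm M (kernel_pow M k n))\<^sup>2 \<le> D * (c\<^sup>2) ^ Suc n" and c: "0 < c"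
  shows "hs_norm M (kernel_comp M A k) \<le> c * hs_norm M A"
proof -
  define B where "B n = (case n of 0 \<Rightarrow> A | Suc m \<Rightarrow> kernel_comp M A (kernel_pow M k m))" for n
  have B: "hs_kernel M (B n)" for n
    by (auto simp: B_def A split: nat.split intro!: hs_comp(1) hs_kernel_pow k)
  have Bs: "B (Suc n) x y = kernel_comp M (B n) k x y" if "x \<in> space M" "y \<in> space M" for n x y
  proof (cases n)
    case (Suc m)
    have "B (Suc n) x y = kernel_comp M A (kernel_pow M k (Suc m)) x y" by (simp add: B_def Suc)
    also have "\<dots> = kernel_comp M A (kernel_comp M (kernel_pow M k m) (kernel_pow M k 0)) x y"
      by (rule comp_cong) (use kernel_pow_comp[OF k, of _ _ m 0] that in auto)
    also have "\<dots> = kernel_comp M (B n) k x y"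
      using comp_assoc[OF A hs_kernel_pow[OF k, of m] hs_kernel_pow[OF k, of 0] that] Suc by (simp add: B_def)
    finally show ?thesis .
  qed (simp add: B_def)
  define b where "b n = (hs_norm M (B n))\<^sup>2" for n
  have "b 1 \<le> c\<^sup>2 * b 0"
  proof (rule log_convex_first_ratio)
    show "0 \<le> b n" for n by (simp add: b_def)
    fix n
    have kk: "kernel_comp M k (kernel_adj (B (Suc n))) x y = kernel_adj (B (Suc (Suc n))) x y"
      if xy: "x \<in> space M" "y \<in> space M" for x y
    proof -
      have "kernel_adj (B (Suc (Suc n))) x y = kernel_adj (kernel_comp M (B (Suc n)) k) x y"
        using Bs xy by (simp add: kernel_adj_def)
      also have "\<dots> = kernel_comp M (kernel_adj k) (kernel_adj (B (Suc n))) x y" by (simp add: adj_comp)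
      also have "\<dots> = kernel_comp M k (kernel_adj (B (Suc n))) x y"
        using herm xy by (intro comp_cong) auto
      finally show ?thesis by simp
    qed
    have "of_real (b (Suc n)) = kernel_trace M (kernel_comp M (B (Suc n)) (kernel_adj (B (Suc n))))"
      unfolding b_def by (rule hs_norm_trace[OF B, symmetric])
    also have "\<dots> = kernel_trace M (kernel_comp M (kernel_comp M (B n) k) (kernel_adj (B (Suc n))))"
      using Bs by (intro trace_cong comp_cong) auto
    also have "\<dots> = kernel_trace M (kernel_comp M (B n) (kernel_comp M k (kernel_adj (B (Suc n)))))"
      by (intro trace_cong comp_assoc B k hs_adj)
    also have "\<dots> = kernel_trace M (kernel_comp M (B n) (kernel_adj (B (Suc (Suc n)))))"
      using kk by (intro trace_cong comp_cong) auto
    finally have "b (Suc n) = cmod (kernel_trace M (kernel_comp M (B n) (kernel_adj (B (Suc (Suc n))))))"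
      by (metis b_def abs_of_nonneg norm_of_real zero_le_power2)
    also have "\<dots> \<le> hs_norm M (B n) * hs_norm M (B (Suc (Suc n)))"
      using trace_comp(4)[OF B[of n] hs_adj(1)[OF B[of "Suc (Suc n)"]]] hs_adj(2)[OF B] by simp
    finally have "(b (Suc n))\<^sup>2 \<le> (hs_norm M (B n) * hs_norm M (B (Suc (Suc n))))\<^sup>2"
      by (intro power_mono) (auto simp: b_def)
    then show "(b (Suc n))\<^sup>2 \<le> b n * b (Suc (Suc n))" by (simp add: b_def power_mult_distrib)
    show "b n \<le> ((hs_norm M A)\<^sup>2 * max 1 D) * (c\<^sup>2) ^ n"
    proof (cases n)
      case 0
      have "(hs_norm M A)\<^sup>2 * 1 \<le> (hs_norm M A)\<^sup>2 * max 1 D" by (intro mult_left_mono) auto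
      then show ?thesis by (simp add: b_def B_def 0)
    next
      case (Suc m)
      have "b n \<le> (hs_norm M A * hs_norm M (kernel_pow M k m))\<^sup>2"
        unfolding b_def B_def Suc nat.case by (intro power_mono hs_comp A hs_kernel_pow k) auto
      also have "\<dots> = (hs_norm M A)\<^sup>2 * (hs_norm M (kernel_pow M k m))\<^sup>2" by (simp add: power_mult_distrib)
      also have "\<dots> \<le> (hs_norm M A)\<^sup>2 * (D * (c\<^sup>2) ^ Suc m)" by (intro mult_left_mono q) auto
      also have "\<dots> \<le> (hs_norm M A)\<^sup>2 * (max 1 D * (c\<^sup>2) ^ Suc m)"
        using c by (intro mult_left_mono mult_right_mono) auto
      finally show ?thesis by (simp add: Suc mult_ac)
    qed
  qed (use c in auto)
  then have "(hs_norm M (B 1))\<^sup>2 \<le> (c * hs_norm M A)\<^sup>2" by (simp add: b_def B_def power_mult_distrib)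
  then have "hs_norm M (B 1) \<le> c * hs_norm M A" using c by (intro power2_le_imp_le[of "hs_norm M (B 1)"]) auto
  then show ?thesis by (simp add: B_def)
qed

end

section \<open>Integrals of determinants as polynomials in traces\<close>

text \<open>A permutation of \<open>insert a I\<close> either fixes \<open>a\<close> or arises from a permutation \<open>q\<close> of \<open>I\<close> by
  inserting \<open>a\<close> into a cycle between some \<open>c\<close> and its successor \<open>q c\<close>.\<close>

lemma permutes_insert_sum:
  fixes F :: "('i \<Rightarrow> 'i) \<Rightarrow> complex"
  assumes I: "finite I" "a \<notin> I"
  shows "(\<Sum>\<sigma> | \<sigma> permutes insert a I. F \<sigma>) =
    (\<Sum>q | q permutes I. F q) + (\<Sum>q | q permutes I. \<Sum>c\<in>I. F (Transposition.transpose a (q c) \<circ> q))"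
proof -
  have "(\<Sum>\<sigma> | \<sigma> permutes insert a I. F \<sigma>) = (\<Sum>b\<in>insert a I. \<Sum>q | q permutes I. F (Transposition.transpose a b \<circ> q))"
    by (rule sum_over_permutations_insert[OF I])
  also have "\<dots> = (\<Sum>q | q permutes I. F q) + (\<Sum>q | q permutes I. \<Sum>b\<in>I. F (Transposition.transpose a b \<circ> q))"
    using I by (simp add: sum.swap[of _ _ I])
  also have "(\<Sum>q | q permutes I. \<Sum>b\<in>I. F (Transposition.transpose a b \<circ> q)) = (\<Sum>q | q permutes I. \<Sum>c\<in>I. F (Transposition.transpose a (q c) \<circ> q))"
  proof (rule sum.cong[OF refl])
    fix q assume "q \<in> {q. q permutes I}"
    then have q: "q permutes I" by simp
    show "(\<Sum>b\<in>I. F (Transposition.transpose a b \<circ> q)) = (\<Sum>c\<in>I. F (Transposition.transpose a (q c) \<circ> q))"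
      using sum.reindex_bij_betw[OF permutes_imp_bij[OF q], of "\<lambda>b. F (Transposition.transpose a b \<circ> q)"] by simp
  qed
  finally show ?thesis .
qed

text \<open>The product of \<open>k\<close> along \<open>\<sigma>\<close>, except that the factor leaving \<open>a\<close> is \<open>A\<close>. Integrating out the
  variable at \<open>a\<close> leads to products of the same shape: either the mark forms a cycle by itself and
  is integrated to its trace, or it is composed with the factor entering \<open>a\<close> and moves to its
  source.\<close>

definition marked_prod :: "'a kernel \<Rightarrow> 'a kernel \<Rightarrow> 'i \<Rightarrow> 'i set \<Rightarrow> ('i \<Rightarrow> 'i) \<Rightarrow> ('i \<Rightarrow> 'a) \<Rightarrow> complex" where
  "marked_prod k A a I \<sigma> x = (\<Prod>i\<in>I. k (x i) (x (\<sigma> i))) * A (x a) (x (\<sigma> a))"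

lemma marked_prod_fixed:
  assumes "a \<notin> I" "q permutes I"
  shows "marked_prod k A a I q (x(a := y)) = (\<Prod>i\<in>I. k (x i) (x (q i))) * A y y"
proof -
  have "q a = a" using assms by (simp add: permutes_not_in)
  moreover have "(\<Prod>i\<in>I. k ((x(a := y)) i) ((x(a := y)) (q i))) = (\<Prod>i\<in>I. k (x i) (x (q i)))"
    using assms permutes_in_image[OF assms(2)] by (intro prod.cong) auto
  ultimately show ?thesis unfolding marked_prod_def by simp
qed

lemma marked_prod_spliced:
  assumes "a \<notin> I" "q permutes I" "c \<in> I" "finite I"
  shows "marked_prod k A a I (Transposition.transpose a (q c) \<circ> q) (x(a := y)) =
    (\<Prod>i\<in>I - {c}. k (x i) (x (q i))) * (k (x c) y * A y (x (q c)))"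
proof -
  have qa: "q a = a" using assms by (simp add: permutes_not_in)
  have qc: "q c \<in> I" "q c \<noteq> a" using assms permutes_in_image[OF assms(2)] by auto
  have "(Transposition.transpose a (q c) \<circ> q) a = q c" using qa by simp
  moreover have c: "(Transposition.transpose a (q c) \<circ> q) c = a" by simp
  moreover have "(\<Prod>i\<in>I - {c}. k ((x(a := y)) i) ((x(a := y)) ((Transposition.transpose a (q c) \<circ> q) i))) = (\<Prod>i\<in>I - {c}. k (x i) (x (q i)))"
  proof (rule prod.cong[OF refl])
    fix i assume i: "i \<in> I - {c}"
    then have "q i \<in> I" "q i \<noteq> q c" using permutes_in_image[OF assms(2)] permutes_inj[OF assms(2)] by (auto dest: injD)
    then show "k ((x(a := y)) i) ((x(a := y)) ((Transposition.transpose a (q c) \<circ> q) i)) = k (x i) (x (q i))"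
      using i assms(1) by (auto simp: Transposition.transpose_def)
  qed
  ultimately show ?thesis
    unfolding marked_prod_def prod.remove[OF assms(4,3)] using qc assms(1,3) by auto
qed

lemma marked_prod_remove:
  assumes "c \<in> I" "finite I"
  shows "marked_prod k k c (I - {c}) q x = (\<Prod>i\<in>I. k (x i) (x (q i)))"
  unfolding marked_prod_def prod.remove[OF assms(2,1)] by (simp add: mult.commute)

text \<open>The recursion for integrated determinants: if \<open>p m\<close> is the trace of the power of \<open>k\<close> of
  exponent \<open>m + 1\<close>, then \<open>newton p n j\<close> is the integral of the determinant in \<open>n + 1\<close> variables in
  which one row is taken from the power of exponent \<open>j + 1\<close>.\<close>

fun newton :: "(nat \<Rightarrow> complex) \<Rightarrow> nat \<Rightarrow> nat \<Rightarrow> complex" where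
  "newton p 0 j = p j"
| "newton p (Suc n) j = p j * newton p n 0 - of_nat (Suc n) * newton p n (Suc j)"

context sigma_finite_measure
begin

interpretation PS: product_sigma_finite "\<lambda>_. M" ..

definition nice_kernel :: "'a kernel \<Rightarrow> bool" where
  "nice_kernel A \<longleftrightarrow> hs_kernel M A \<and> integrable M (\<lambda>x. A x x)"

lemma nice_comp: "hs_kernel M A \<Longrightarrow> hs_kernel M B \<Longrightarrow> nice_kernel (kernel_comp M A B)"
  unfolding nice_kernel_def using hs_comp(1) trace_comp(3) by blast

lemma nice_pow: "nice_kernel k \<Longrightarrow> nice_kernel (kernel_pow M k n)"
  using nice_comp[of k] hs_kernel_pow[of k] by (cases n) (auto simp: nice_kernel_def)

lemma nice_norm: "nice_kernel A \<Longrightarrow> nice_kernel (\<lambda>x y. of_real (cmod (A x y)))"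
  unfolding nice_kernel_def hs_kernel_def
  by (auto simp: case_prod_unfold intro!: borel_measurable_of_real)

lemma marked_prod_measurable:
  assumes k: "hs_kernel M k" and A: "hs_kernel M A" and \<sigma>: "\<sigma> permutes insert a I"
  shows "marked_prod k A a I \<sigma> \<in> borel_measurable (PiM (insert a I) (\<lambda>_. M))"
proof -
  have c: "(\<lambda>x. x i) \<in> measurable (PiM (insert a I) (\<lambda>_. M)) M" if "i \<in> insert a I" for i
    by (rule measurable_component_singleton[OF that])
  have \<sigma>i: "\<sigma> i \<in> insert a I" if "i \<in> insert a I" for i using permutes_in_image[OF \<sigma>] that by blast
  show ?thesis
    unfolding marked_prod_def
    by (intro borel_measurable_times borel_measurable_prod hs_measurable_compose[OF k] hs_measurable_compose[OF A] c \<sigma>i) auto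
qed

lemma space_PiM_component: "x \<in> space (PiM I (\<lambda>_. M)) \<Longrightarrow> i \<in> I \<Longrightarrow> x i \<in> space M"
  by (auto simp: space_PiM)

text \<open>One variable is integrated out at a time. The mark \<open>A\<close> then becomes the composition of \<open>\<bar>k\<bar>\<close>
  and \<open>\<bar>A\<bar>\<close>, whence the generality in \<open>A\<close>; as a product of two Hilbert-Schmidt kernels it has an
  integrable diagonal again.\<close>

lemma marked_prod_nn_integral_finite:
  assumes I: "finite I" "a \<notin> I" and k: "nice_kernel k" and A: "nice_kernel A" and \<sigma>: "\<sigma> permutes insert a I"
  shows "(\<integral>\<^sup>+x. ennreal (cmod (marked_prod k A a I \<sigma> x)) \<partial>PiM (insert a I) (\<lambda>_. M)) < \<infinity>"
  using assms
proof (induction "card I" arbitrary: I a A \<sigma> rule: less_induct)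
  case less
  note I = less.prems(1,2) and k = less.prems(3) and A = less.prems(4) and \<sigma> = less.prems(5)
  have hk: "hs_kernel M k" and hA: "hs_kernel M A" and tA: "integrable M (\<lambda>x. A x x)"
    using k A by (auto simp: nice_kernel_def)
  have meas: "(\<lambda>x. ennreal (cmod (marked_prod k A a I \<sigma> x))) \<in> borel_measurable (PiM (insert a I) (\<lambda>_. M))"
    using marked_prod_measurable[OF hk hA \<sigma>] by simp
  note split = PS.product_nn_integral_insert[OF I meas]
  have "\<sigma> \<in> {p. p permutes insert a I}" using \<sigma> by simp
  then obtain b q where bq: "b \<in> insert a I" "q permutes I" "\<sigma> = Transposition.transpose a b \<circ> q"
    unfolding permutes_insert by auto
  show ?case
  proof (cases "b = a")
    case True
    then have \<sigma>q: "\<sigma> = q" using bq by simp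
    have fin: "(\<integral>\<^sup>+y. ennreal (cmod (A y y)) \<partial>M) < \<infinity>" using tA by (simp add: integrable_iff_bounded)
    have "(\<integral>\<^sup>+x. ennreal (cmod (\<Prod>i\<in>I. k (x i) (x (q i)))) \<partial>PiM I (\<lambda>_. M)) < \<infinity>"
    proof (cases "I = {}")
      case True
      then show ?thesis by (simp add: PiM_empty)
    next
      case False
      then obtain c where c: "c \<in> I" by auto
      have "(\<integral>\<^sup>+x. ennreal (cmod (marked_prod k k c (I - {c}) q x)) \<partial>PiM (insert c (I - {c})) (\<lambda>_. M)) < \<infinity>"
        using c I bq(2) card_Diff1_less[OF I(1) c] by (intro less.hyps k) (auto simp: insert_absorb)
      then show ?thesis using c I by (simp add: marked_prod_remove insert_absorb)
    qed
    moreover have "(\<integral>\<^sup>+x. ennreal (cmod (marked_prod k A a I \<sigma> x)) \<partial>PiM (insert a I) (\<lambda>_. M)) 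
       = (\<integral>\<^sup>+x. ennreal (cmod (\<Prod>i\<in>I. k (x i) (x (q i)))) \<partial>PiM I (\<lambda>_. M)) * (\<integral>\<^sup>+y. ennreal (cmod (A y y)) \<partial>M)"
    proof -
      have [measurable]: "(\<lambda>x. A x x) \<in> borel_measurable M" using tA by simp
      have m: "(\<lambda>x. \<Prod>i\<in>I. k (x i) (x (q i))) \<in> borel_measurable (PiM I (\<lambda>_. M))"
        using permutes_in_image[OF bq(2)]
        by (intro borel_measurable_prod hs_measurable_compose[OF hk] measurable_component_singleton) auto
      show ?thesis
        unfolding split unfolding \<sigma>q marked_prod_fixed[OF I(2) bq(2)] norm_mult ennreal_mult'[OF norm_ge_zero]
        using m by (simp add: nn_integral_cmult nn_integral_multc)
    qed
    ultimately show ?thesis using fin by (simp add: ennreal_mult_less_top)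
  next
    case False
    define c where "c = inv_into UNIV q b"
    have qc: "q c = b" and c: "c \<in> I"
      using bq False permutes_inverses[OF bq(2)] permutes_in_image[OF permutes_inv[OF bq(2)], of b] by (auto simp: c_def)
    define A' where "A' = kernel_comp M (\<lambda>x y. of_real (cmod (k x y))) (\<lambda>x y. of_real (cmod (A x y)))"
    have hk': "hs_kernel M (\<lambda>x y. of_real (cmod (k x y)))" and hA': "hs_kernel M (\<lambda>x y. of_real (cmod (A x y)))"
      using nice_norm[OF k] nice_norm[OF A] by (auto simp: nice_kernel_def)
    have A': "nice_kernel A'" unfolding A'_def by (rule nice_comp[OF hk' hA'])
    have inner: "(\<integral>\<^sup>+y. ennreal (cmod (marked_prod k A a I \<sigma> (x(a := y)))) \<partial>M) = ennreal (cmod (marked_prod k A' c (I - {c}) q x))"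
      if x: "x \<in> space (PiM I (\<lambda>_. M))" for x
    proof -
      have xc: "x c \<in> space M" "x (q c) \<in> space M"
        using space_PiM_component[OF x] c permutes_in_image[OF bq(2)] by auto
      have "integrable M (\<lambda>z. complex_of_real (cmod (k (x c) z)) * of_real (cmod (A z (x (q c)))))"
        by (rule hs_comp_bound(1)[OF hk' hA' xc])
      then have int: "integrable M (\<lambda>z. cmod (k (x c) z) * cmod (A z (x (q c))))"
        by (metis (no_types, lifting) Bochner_Integration.integrable_cong complex_of_real_integrable_eq of_real_mult)
      have "(\<integral>\<^sup>+y. ennreal (cmod (k (x c) y * A y (x (q c)))) \<partial>M) = ennreal (LINT z|M. cmod (k (x c) z) * cmod (A z (x (q c))))"
        unfolding norm_mult by (rule nn_integral_eq_integral[OF int]) auto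
      also have "(LINT z|M. cmod (k (x c) z) * cmod (A z (x (q c)))) = cmod (A' (x c) (x (q c)))"
      proof -
        have "A' (x c) (x (q c)) = of_real (LINT z|M. cmod (k (x c) z) * cmod (A z (x (q c))))"
          unfolding A'_def kernel_comp_def integral_complex_of_real[symmetric] by simp
        moreover have "0 \<le> (LINT z|M. cmod (k (x c) z) * cmod (A z (x (q c))))" by simp
        ultimately show ?thesis by simp
      qed
      finally have e: "(\<integral>\<^sup>+y. ennreal (cmod (k (x c) y * A y (x (q c)))) \<partial>M) = ennreal (cmod (A' (x c) (x (q c))))" .
      have "(\<lambda>y. k (x c) y * A y (x (q c))) \<in> borel_measurable M"
        using hs_row(1)[OF hk xc(1)] hs_row(2)[OF hA xc(2)] by simp
      then show ?thesis
        unfolding bq(3) qc[symmetric] marked_prod_spliced[OF I(2) bq(2) c I(1)]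
        unfolding marked_prod_def norm_mult[of "prod _ _"] ennreal_mult'[OF norm_ge_zero]
        by (subst nn_integral_cmult) (auto simp: e)
    qed
    have "(\<integral>\<^sup>+x. ennreal (cmod (marked_prod k A' c (I - {c}) q x)) \<partial>PiM (insert c (I - {c})) (\<lambda>_. M)) < \<infinity>"
      using c I bq(2) card_Diff1_less[OF I(1) c] by (intro less.hyps k A') (auto simp: insert_absorb)
    then have "(\<integral>\<^sup>+x. ennreal (cmod (marked_prod k A' c (I - {c}) q x)) \<partial>PiM I (\<lambda>_. M)) < \<infinity>"
      using insert_Diff[OF c] by simp
    moreover have "(\<integral>\<^sup>+x. (\<integral>\<^sup>+y. ennreal (cmod (marked_prod k A a I \<sigma> (x(a := y)))) \<partial>M) \<partial>PiM I (\<lambda>_. M))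
        = (\<integral>\<^sup>+x. ennreal (cmod (marked_prod k A' c (I - {c}) q x)) \<partial>PiM I (\<lambda>_. M))"
      by (rule nn_integral_cong) (rule inner)
    ultimately show ?thesis unfolding split by simp
  qed
qed

lemma marked_prod_integrable:
  assumes "finite I" "a \<notin> I" and k: "nice_kernel k" and A: "nice_kernel A" and "\<sigma> permutes insert a I"
  shows "integrable (PiM (insert a I) (\<lambda>_. M)) (marked_prod k A a I \<sigma>)"
  using marked_prod_nn_integral_finite[OF assms] marked_prod_measurable[of k A \<sigma> a I] assms
  by (simp add: integrable_iff_bounded nice_kernel_def)

lemma perm_prod_integrable:
  assumes I: "finite I" and k: "nice_kernel k" and q: "q permutes I"
  shows "integrable (PiM I (\<lambda>_. M)) (\<lambda>x. \<Prod>i\<in>I. k (x i) (x (q i)))"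
proof (cases "I = {}")
  case False
  then obtain c where c: "c \<in> I" by auto
  have "integrable (PiM (insert c (I - {c})) (\<lambda>_. M)) (marked_prod k k c (I - {c}) q)"
    using c I q by (intro marked_prod_integrable k) (auto simp: insert_absorb)
  then show ?thesis using c I by (simp add: marked_prod_remove insert_absorb cong: Bochner_Integration.integrable_cong)
qed (simp add: PiM_empty integrable_count_space)

definition det_integral :: "'a kernel \<Rightarrow> 'i set \<Rightarrow> complex" where
  "det_integral k I = (LINT x|(PiM I (\<lambda>_. M)). (\<Sum>q | q permutes I. of_int (sign q) * (\<Prod>i\<in>I. k (x i) (x (q i)))))"

definition marked_det_integral :: "'a kernel \<Rightarrow> 'a kernel \<Rightarrow> 'i \<Rightarrow> 'i set \<Rightarrow> complex" where
  "marked_det_integral k A a I =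
     (LINT x|(PiM (insert a I) (\<lambda>_. M)). (\<Sum>q | q permutes insert a I. of_int (sign q) * marked_prod k A a I q x))"

lemma det_integral_marked:
  assumes "c \<in> I" "finite I"
  shows "det_integral k I = marked_det_integral k k c (I - {c})"
  using assms by (simp add: det_integral_def marked_det_integral_def marked_prod_remove insert_absorb)

lemma sign_transpose_comp:
  assumes "finite I" "a \<notin> I" "q permutes I" "c \<in> I"
  shows "sign (Transposition.transpose a (q c) \<circ> q) = - sign q"
proof -
  have "q c \<noteq> a" using assms permutes_in_image[OF assms(3)] by auto
  then show ?thesis
    using assms by (subst sign_compose) (auto simp: sign_swap_id permutation_swap_id permutes_imp_permutation)
qed

text \<open>Integration over the marked variable. Permutations fixing \<open>a\<close> contribute the trace of \<open>A\<close>;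
  splicing \<open>a\<close> into a cycle multiplies the permutation by a transposition, which accounts for the
  minus sign.\<close>

lemma marked_det_integral_rec:
  assumes I: "finite I" "a \<notin> I" and k: "nice_kernel k" and A: "nice_kernel A"
  shows "marked_det_integral k A a I = 
    kernel_trace M A * det_integral k I - (\<Sum>c\<in>I. marked_det_integral k (kernel_comp M k A) c (I - {c}))"
proof -
  have hk: "hs_kernel M k" and hA: "hs_kernel M A" and tA: "integrable M (\<lambda>x. A x x)"
    using k A by (auto simp: nice_kernel_def)
  have kA: "nice_kernel (kernel_comp M k A)" by (rule nice_comp[OF hk hA])
  let ?F = "\<lambda>x. \<Sum>q | q permutes insert a I. of_int (sign q) * marked_prod k A a I q x"
  have int: "integrable (PiM (insert a I) (\<lambda>_. M)) ?F"
    using I k A by (intro Bochner_Integration.integrable_sum integrable_mult_right marked_prod_integrable) auto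
  let ?P = "\<lambda>q x. \<Prod>i\<in>I. k (x i) (x (q i))"
  have inner: "(LINT y|M. ?F (x(a := y))) = 
      kernel_trace M A * (\<Sum>q | q permutes I. of_int (sign q) * ?P q x)
      - (\<Sum>c\<in>I. \<Sum>q | q permutes I. of_int (sign q) * marked_prod k (kernel_comp M k A) c (I - {c}) q x)"
    if x: "x \<in> space (PiM I (\<lambda>_. M))" for x
  proof -
    have xs: "x i \<in> space M" "x (q i) \<in> space M" if "i \<in> I" "q permutes I" for i q
      using space_PiM_component[OF x] that permutes_in_image[of q I] by auto
    \<comment> \<open>The first sum is over the permutations that fix \<open>a\<close>, the second over those that send some
      \<open>c\<close> to \<open>a\<close>.\<close>
    have F: "?F (x(a := y)) = (\<Sum>q | q permutes I. of_int (sign q) * (?P q x * A y y)) 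
        - (\<Sum>q | q permutes I. \<Sum>c\<in>I. of_int (sign q) * ((\<Prod>i\<in>I - {c}. k (x i) (x (q i))) * (k (x c) y * A y (x (q c)))))" for y
      unfolding permutes_insert_sum[OF I]
      using I by (simp add: marked_prod_fixed marked_prod_spliced sign_transpose_comp sum_negf)
    have iA: "integrable M (\<lambda>y. of_int (sign q) * (?P q x * A y y))" for q
      using tA by (intro integrable_mult_right)
    have ikA: "integrable M (\<lambda>y. of_int (sign q) * ((\<Prod>i\<in>I - {c}. k (x i) (x (q i))) * (k (x c) y * A y (x (q c)))))"
      if "q permutes I" "c \<in> I" for q c
      using hs_comp_bound(1)[OF hk hA xs(1) xs(2)] that by (intro integrable_mult_right) auto
    have "(LINT y|M. ?F (x(a := y))) = (\<Sum>q | q permutes I. of_int (sign q) * (?P q x * kernel_trace M A))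
      - (\<Sum>q | q permutes I. \<Sum>c\<in>I. of_int (sign q) * ((\<Prod>i\<in>I - {c}. k (x i) (x (q i))) * kernel_comp M k A (x c) (x (q c))))"
      unfolding F using iA ikA
      by (subst Bochner_Integration.integral_diff)
         (auto intro!: Bochner_Integration.integrable_sum simp: Bochner_Integration.integral_sum kernel_trace_def kernel_comp_def)
    also have "(\<Sum>q | q permutes I. \<Sum>c\<in>I. of_int (sign q) * ((\<Prod>i\<in>I - {c}. k (x i) (x (q i))) * kernel_comp M k A (x c) (x (q c))))
       = (\<Sum>c\<in>I. \<Sum>q | q permutes I. of_int (sign q) * marked_prod k (kernel_comp M k A) c (I - {c}) q x)"
      unfolding marked_prod_def by (rule sum.swap)
    also have "(\<Sum>q | q permutes I. of_int (sign q) * (?P q x * kernel_trace M A)) = kernel_trace M A * (\<Sum>q | q permutes I. of_int (sign q) * ?P q x)"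
      by (simp add: sum_distrib_left mult_ac)
    finally show ?thesis .
  qed
  have i1: "integrable (PiM I (\<lambda>_. M)) (\<lambda>x. kernel_trace M A * (\<Sum>q | q permutes I. of_int (sign q) * ?P q x))"
    using I k by (intro integrable_mult_right Bochner_Integration.integrable_sum perm_prod_integrable) auto
  have i2: "integrable (PiM I (\<lambda>_. M)) (\<lambda>x. \<Sum>q | q permutes I. of_int (sign q) * marked_prod k (kernel_comp M k A) c (I - {c}) q x)"
    if c: "c \<in> I" for c
  proof -
    have "integrable (PiM (insert c (I - {c})) (\<lambda>_. M)) (\<lambda>x. \<Sum>q | q permutes I. of_int (sign q) * marked_prod k (kernel_comp M k A) c (I - {c}) q x)"
      using c I by (intro integrable_mult_right Bochner_Integration.integrable_sum marked_prod_integrable k kA) (auto simp: insert_absorb)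
    then show ?thesis using c by (simp add: insert_absorb)
  qed
  have "marked_det_integral k A a I = (LINT x|(PiM I (\<lambda>_. M)). LINT y|M. ?F (x(a := y)))"
    unfolding marked_det_integral_def by (rule PS.product_integral_insert[OF I int])
  also have "\<dots> = (LINT x|(PiM I (\<lambda>_. M)). (kernel_trace M A * (\<Sum>q | q permutes I. of_int (sign q) * ?P q x)
      - (\<Sum>c\<in>I. \<Sum>q | q permutes I. of_int (sign q) * marked_prod k (kernel_comp M k A) c (I - {c}) q x)))"
    by (intro Bochner_Integration.integral_cong inner refl)
  also have "\<dots> = kernel_trace M A * det_integral k I - (\<Sum>c\<in>I. LINT x|(PiM I (\<lambda>_. M)). (\<Sum>q | q permutes I. of_int (sign q) * marked_prod k (kernel_comp M k A) c (I - {c}) q x))"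
    using i1 i2 by (subst Bochner_Integration.integral_diff)
      (auto intro!: Bochner_Integration.integrable_sum simp: Bochner_Integration.integral_sum det_integral_def)
  also have "(\<Sum>c\<in>I. LINT x|(PiM I (\<lambda>_. M)). (\<Sum>q | q permutes I. of_int (sign q) * marked_prod k (kernel_comp M k A) c (I - {c}) q x))
     = (\<Sum>c\<in>I. marked_det_integral k (kernel_comp M k A) c (I - {c}))"
    by (intro sum.cong refl) (simp add: marked_det_integral_def insert_absorb)
  finally show ?thesis .
qed

lemma marked_det_integral_newton:
  assumes "finite I" "a \<notin> I" and k: "nice_kernel k"
  shows "marked_det_integral k (kernel_pow M k j) a I = newton (\<lambda>m. kernel_trace M (kernel_pow M k m)) (card I) j"
  using assms(1,2)
proof (induction "card I" arbitrary: I a j)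
  case 0
  then have "I = {}" by simp
  then show ?case using marked_det_integral_rec[OF _ _ k nice_pow[OF k], of "{}" a j]
    by (simp add: det_integral_def PiM_empty)
next
  case (Suc n)
  then obtain c where c: "c \<in> I" by fastforce
  have card: "card (I - {c}) = n" if "c \<in> I" for c using Suc that by simp
  have IH: "marked_det_integral k (kernel_pow M k j) c (I - {c}) = newton (\<lambda>m. kernel_trace M (kernel_pow M k m)) n j" if "c \<in> I" for c j
    using Suc.hyps(1)[of "I - {c}" c j] card[OF that] Suc.prems by simp
  have "marked_det_integral k (kernel_pow M k j) a I = 
    kernel_trace M (kernel_pow M k j) * det_integral k I - (\<Sum>c\<in>I. marked_det_integral k (kernel_pow M k (Suc j)) c (I - {c}))"
    using marked_det_integral_rec[OF Suc.prems k nice_pow[OF k]] by simp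
  also have "det_integral k I = newton (\<lambda>m. kernel_trace M (kernel_pow M k m)) n 0"
    using det_integral_marked[OF c Suc.prems(1)] IH[OF c, of 0] by simp
  also have "(\<Sum>c\<in>I. marked_det_integral k (kernel_pow M k (Suc j)) c (I - {c}))
      = of_nat (Suc n) * newton (\<lambda>m. kernel_trace M (kernel_pow M k m)) n (Suc j)"
  proof -
    have "(\<Sum>c\<in>I. marked_det_integral k (kernel_pow M k (Suc j)) c (I - {c})) = (\<Sum>c\<in>I. newton (\<lambda>m. kernel_trace M (kernel_pow M k m)) n (Suc j))"
      by (intro sum.cong refl IH)
    then show ?thesis using Suc.hyps(2)[symmetric] by simp
  qed
  finally show ?case using Suc.hyps(2)[symmetric] by simp
qed

theorem det_integral_newton:
  assumes k: "nice_kernel k"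
  shows "det_integral k {..<0::nat} = 1"
    and "det_integral k {..<Suc n} = newton (\<lambda>m. kernel_trace M (kernel_pow M k m)) n 0"
proof -
  show "det_integral k {..<0::nat} = 1" by (simp add: det_integral_def PiM_empty)
  have "{..<Suc n} - {n} = {..<n}" by auto
  then show "det_integral k {..<Suc n} = newton (\<lambda>m. kernel_trace M (kernel_pow M k m)) n 0"
    using det_integral_marked[of n "{..<Suc n}" k] marked_det_integral_newton[of "{..<n}" n k 0] k by simp
qed

end

section \<open>The Fredholm determinant as an exponential\<close>

lemma newton_closed_form:
  "newton p n j / fact n = (\<Sum>i\<le>n. (-1) ^ i * p (j + i) * (case n - i of 0 \<Rightarrow> 1 | Suc m \<Rightarrow> newton p m 0 / fact (Suc m)))"
proof (induction n arbitrary: j)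
  case (Suc n)
  have "newton p (Suc n) j / fact (Suc n) = p j * (newton p n 0 / fact (Suc n)) - newton p n (Suc j) / fact n"
    by (simp add: diff_divide_distrib del: of_nat_Suc)
  also have "newton p n (Suc j) / fact n = (\<Sum>i\<le>n. (-1) ^ i * p (j + Suc i) * (case Suc n - Suc i of 0 \<Rightarrow> 1 | Suc m \<Rightarrow> newton p m 0 / fact (Suc m)))"
    unfolding Suc.IH by simp
  finally show ?case unfolding sum.atMost_Suc_shift by (simp add: sum_negf)
qed simp

text \<open>The coefficients of the Fredholm determinant \<open>det (1 + z k)\<close>, where \<open>p m\<close> is the trace of
  the power of \<open>k\<close> of exponent \<open>m + 1\<close>.\<close>

definition fredholm_coeff :: "(nat \<Rightarrow> complex) \<Rightarrow> nat \<Rightarrow> complex" where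
  "fredholm_coeff p n = (case n of 0 \<Rightarrow> 1 | Suc m \<Rightarrow> newton p m 0 / fact (Suc m))"

lemma fredholm_coeff_rec:
  "fredholm_coeff p 0 = 1"
  "of_nat (Suc n) * fredholm_coeff p (Suc n) = (\<Sum>i\<le>n. (-1) ^ i * p i * fredholm_coeff p (n - i))"
proof -
  have "of_nat (Suc n) * fredholm_coeff p (Suc n) = newton p n 0 / fact n"
    by (simp add: fredholm_coeff_def field_simps del: of_nat_Suc)
  also have "\<dots> = (\<Sum>i\<le>n. (-1) ^ i * p i * fredholm_coeff p (n - i))"
    unfolding newton_closed_form by (simp add: fredholm_coeff_def)
  finally show "of_nat (Suc n) * fredholm_coeff p (Suc n) = (\<Sum>i\<le>n. (-1) ^ i * p i * fredholm_coeff p (n - i))" .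
qed (simp add: fredholm_coeff_def)

text \<open>The series of \<open>ln (det (1 + z k))\<close>.\<close>

definition log_series :: "(nat \<Rightarrow> complex) \<Rightarrow> complex \<Rightarrow> complex" where
  "log_series p z = (\<Sum>i. (-1) ^ i * p i / of_nat (Suc i) * z ^ Suc i)"

lemma log_series_sums:
  assumes summ: "\<And>r. 0 \<le> r \<Longrightarrow> r < R \<Longrightarrow> summable (\<lambda>i. cmod (p i) * r ^ i)" and z: "cmod z < R"
  shows "(\<lambda>i. (-1) ^ i * p i / of_nat (Suc i) * z ^ Suc i) sums log_series p z"
proof -
  have "summable (\<lambda>i. (-1) ^ i * p i / of_nat (Suc i) * z ^ Suc i)"
  proof (rule summable_norm_cancel, rule summable_comparison_test_ev)
    show "\<forall>\<^sub>F i in sequentially. norm (norm ((-1) ^ i * p i / of_nat (Suc i) * z ^ Suc i)) \<le> cmod z * (cmod (p i) * cmod z ^ i)"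
    proof (intro always_eventually allI)
      fix i
      have "cmod (p i) / real (Suc i) \<le> cmod (p i) / 1" by (intro divide_left_mono) auto
      then have "cmod (p i) / real (Suc i) * cmod z ^ Suc i \<le> cmod (p i) * cmod z ^ Suc i"
        by (intro mult_right_mono) auto
      then show "norm (norm ((-1) ^ i * p i / of_nat (Suc i) * z ^ Suc i)) \<le> cmod z * (cmod (p i) * cmod z ^ i)"
        by (simp add: norm_mult norm_divide norm_power mult_ac del: of_nat_Suc)
    qed
    show "summable (\<lambda>i. cmod z * (cmod (p i) * cmod z ^ i))"
      using z by (intro summable_mult summ) auto
  qed
  then show ?thesis unfolding log_series_def by (rule summable_sums)
qed

text \<open>Newton's identities \<open>fredholm_coeff_rec\<close> state that the formal power series \<open>F\<close> of the
  determinant solves \<open>F' = F * L'\<close>, where \<open>L\<close> is the logarithmic series. So does the exponential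
  of \<open>L\<close>, which is holomorphic on the disc where \<open>L\<close> converges; hence the series of the
  determinant is its Taylor series and converges there as well.\<close>

theorem fredholm_series_exp:
  assumes R: "0 < R" and summ: "\<And>r. 0 \<le> r \<Longrightarrow> r < R \<Longrightarrow> summable (\<lambda>i. cmod (p i) * r ^ i)" and z: "cmod z < R"
  shows "(\<lambda>n. fredholm_coeff p n * z ^ n) sums exp (log_series p z)"
proof -
  define a where "a n = (case n of 0 \<Rightarrow> 0 | Suc i \<Rightarrow> (-1) ^ i * p i / of_nat (Suc i))" for n
  have sa: "(\<lambda>n. a n * (w - 0) ^ n) sums log_series p w" if "w \<in> ball 0 R" for w
  proof -
    have "(\<lambda>i. a (Suc i) * w ^ Suc i) sums log_series p w"
      using log_series_sums[OF summ, of R w] that by (simp add: a_def)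
    then show ?thesis using sums_Suc_iff[of "\<lambda>n. a n * w ^ n"] by (simp add: a_def)
  qed
  have holL: "log_series p holomorphic_on ball 0 R" by (rule power_series_holomorphic[OF sa])
  have ev: "\<forall>\<^sub>F u in nhds 0. u \<in> ball (0::complex) R" by (rule eventually_nhds_in_open) (use R in auto)
  have L_exp: "log_series p has_fps_expansion Abs_fps a"
  proof (rule has_fps_expansionI)
    show "\<forall>\<^sub>F u in nhds 0. (\<lambda>n. fps_nth (Abs_fps a) n * u ^ n) sums log_series p u"
      using ev by eventually_elim (use sa in auto)
  qed
  define E where "E w = exp (log_series p w)" for w
  have holE: "E holomorphic_on ball 0 R" unfolding E_def by (intro holomorphic_intros holL)
  have anE: "E analytic_on {0}" using holE R by (meson analytic_at ball_subset_cball centre_in_ball open_ball)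
  define F where "F = fps_expansion E 0"
  have E_exp: "E has_fps_expansion F"
    using analytic_at_imp_has_fps_expansion_0[OF anE] by (simp add: F_def)
  have dE: "deriv E w = E w * deriv (log_series p) w" if "w \<in> ball 0 R" for w
  proof -
    have "(log_series p has_field_derivative deriv (log_series p) w) (at w)"
      using holomorphic_derivI[OF holL open_ball that] .
    then have "(E has_field_derivative E w * deriv (log_series p) w) (at w)"
      unfolding E_def by (auto intro!: derivative_eq_intros)
    then show ?thesis by (rule DERIV_imp_deriv)
  qed
  have x1: "deriv E has_fps_expansion fps_deriv F" by (rule has_fps_expansion_deriv[OF E_exp])
  have x2: "(\<lambda>w. E w * deriv (log_series p) w) has_fps_expansion F * fps_deriv (Abs_fps a)"
    by (intro has_fps_expansion_mult E_exp has_fps_expansion_deriv L_exp)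
  have x3: "\<forall>\<^sub>F w in nhds 0. deriv E w = E w * deriv (log_series p) w"
    using ev by eventually_elim (rule dE)
  have dF: "fps_deriv F = F * fps_deriv (Abs_fps a)"
    by (rule fps_expansion_unique_complex[OF x1 iffD2[OF has_fps_expansion_cong[OF x3 refl] x2]])
  then have rec: "of_nat (Suc n) * fps_nth F (Suc n) = (\<Sum>i\<le>n. (-1) ^ i * p i * fps_nth F (n - i))" for n
  proof -
    have "of_nat (Suc n) * fps_nth F (Suc n) = fps_nth (fps_deriv F) n" by simp
    also have "\<dots> = fps_nth (fps_deriv (Abs_fps a) * F) n" using dF by (simp add: mult.commute)
    also have "\<dots> = (\<Sum>i=0..n. (-1) ^ i * p i * fps_nth F (n - i))"
      unfolding fps_mult_nth by (intro sum.cong refl) (simp add: a_def del: of_nat_Suc)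
    finally show ?thesis by (simp add: atLeast0AtMost)
  qed
  have F0: "fps_nth F 0 = 1"
  proof -
    have "log_series p 0 = 0" by (simp add: log_series_def)
    then show ?thesis using fps_nth_fps_expansion[OF E_exp, of 0] by (simp add: E_def)
  qed
  have Fc: "fps_nth F n = fredholm_coeff p n" for n
  proof (induction n rule: less_induct)
    case (less n)
    show ?case
    proof (cases n)
      case 0
      then show ?thesis using F0 fredholm_coeff_rec(1) by simp
    next
      case (Suc m)
      have "of_nat (Suc m) * fps_nth F (Suc m) = of_nat (Suc m) * fredholm_coeff p (Suc m)"
        unfolding rec fredholm_coeff_rec(2) using less Suc by (intro sum.cong) auto
      then show ?thesis using Suc by (simp del: of_nat_Suc)
    qed
  qed
  have "(\<lambda>n. (deriv ^^ n) E 0 / fact n * (z - 0) ^ n) sums E z"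
    by (rule holomorphic_power_series[OF holE]) (use z in auto)
  then show ?thesis
    unfolding fps_nth_fps_expansion[OF E_exp, symmetric] Fc by (simp add: E_def)
qed

section \<open>Continuation of the logarithm of a Fredholm determinant\<close>

text \<open>A loss by a fixed factor in every \<open>N\<close> steps is geometric decay.\<close>

lemma summable_of_contracting_shift:
  fixes H :: "nat \<Rightarrow> real"
  assumes nn: "\<And>j. 0 \<le> H j" and step: "\<And>j. H (j + N) \<le> c * H j" and c: "0 \<le> c" "c < 1"
  shows "summable H"
proof (rule bounded_imp_summable)
  fix K
  define S where "S K = (\<Sum>j<K. H j)" for K
  have S_mono: "S a \<le> S b" if "a \<le> b" for a b
    unfolding S_def using that nn by (intro sum_mono2) auto
  have split: "S (L + N) = S N + (\<Sum>j<L. H (j + N))" for L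
    unfolding S_def by (induction L) (auto simp: add_ac)
  have "S (L + N) * (1 - c) \<le> S N" for L
  proof -
    have "(\<Sum>j<L. H (j + N)) \<le> c * S L"
      unfolding S_def sum_distrib_left by (intro sum_mono step)
    moreover have "c * S L \<le> c * S (L + N)"
      using S_mono[of L "L + N"] c by (intro mult_left_mono) auto
    ultimately show ?thesis using split[of L] by (simp add: algebra_simps)
  qed
  then have "S (L + N) \<le> S N / (1 - c)" for L using c by (simp add: field_simps)
  moreover have "S (Suc K) \<le> S (Suc K + N)" by (rule S_mono) simp
  ultimately have "S (Suc K) \<le> S N / (1 - c)" by (rule order_trans[rotated])
  then show "sum H {..K} \<le> S N / (1 - c)" by (simp add: S_def lessThan_Suc_atMost)
qed (rule nn)

text \<open>The relations between the Hilbert-Schmidt norm \<open>h n\<close> and the trace \<open>p n\<close> of the power of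
  exponent \<open>n + 1\<close> of a Hermitian kernel. In \<open>p_odd\<close> the index is odd, so the exponent is even.\<close>

locale hermitian_traces =
  fixes h :: "nat \<Rightarrow> real" and p :: "nat \<Rightarrow> complex"
  assumes h_nonneg: "0 \<le> h n" and h_submult: "h (Suc (m + n)) \<le> h m * h n"
    and p_le: "cmod (p (Suc (m + n))) \<le> h m * h n" and p_odd: "p (Suc (2 * n)) = of_real ((h n)\<^sup>2)"
begin

text \<open>Once a single power of \<open>t k\<close> has norm less than \<open>1\<close>, all norms, and with them the traces,
  decay geometrically.\<close>

lemma summable_if_contracting:
  assumes t: "0 \<le> t" and lt: "h n * t ^ Suc n < 1"
  shows "summable (\<lambda>i. cmod (p i) * t ^ i)"
proof -
  define H where "H j = h j * t ^ Suc j" for j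
  have sH: "summable H"
  proof (rule summable_of_contracting_shift[where N = "Suc n" and c = "H n"])
    show "0 \<le> H j" for j using h_nonneg t by (simp add: H_def)
    show "H (j + Suc n) \<le> H n * H j" for j
    proof -
      have "h (Suc (n + j)) * t ^ (Suc n + Suc j) \<le> (h n * h j) * t ^ (Suc n + Suc j)"
        using t by (intro mult_right_mono h_submult) auto
      then show ?thesis by (simp add: H_def power_add add.commute mult_ac)
    qed
  qed (use lt h_nonneg t in \<open>auto simp: H_def\<close>)
  have "summable (\<lambda>i. cmod (p (Suc i)) * t ^ Suc i)"
  proof (rule summable_comparison_test)
    show "\<exists>N. \<forall>i\<ge>N. norm (cmod (p (Suc i)) * t ^ Suc i) \<le> h 0 * H i"
    proof (intro exI allI impI)
      fix i
      have "cmod (p (Suc (0 + i))) * t ^ Suc i \<le> (h 0 * h i) * t ^ Suc i"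
        using t by (intro mult_right_mono p_le) auto
      then show "norm (cmod (p (Suc i)) * t ^ Suc i) \<le> h 0 * H i" using t by (simp add: H_def mult_ac)
    qed
    show "summable (\<lambda>i. h 0 * H i)" by (intro summable_mult sH)
  qed
  then show ?thesis using summable_Suc_iff by blast
qed

text \<open>This is the logarithm of \<open>det (1 + t k) * det (1 - t k)\<close>, in which the traces of odd powers
  cancel.\<close>

lemma log_series_even_part:
  assumes summ: "\<And>t. 0 \<le> t \<Longrightarrow> t < r \<Longrightarrow> summable (\<lambda>i. cmod (p i) * t ^ i)" and t: "0 \<le> t" "t < r"
  shows "(\<lambda>n. - ((h n)\<^sup>2 * (t\<^sup>2) ^ Suc n / real (Suc n))) sums Re (log_series p (of_real t) + log_series p (- of_real t))"
proof -
  let ?z = "complex_of_real t"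
  have 1: "(\<lambda>i. (-1) ^ i * p i / of_nat (Suc i) * ?z ^ Suc i) sums log_series p ?z"
    by (rule log_series_sums[OF summ]) (use t in auto)
  have 2: "(\<lambda>i. (-1) ^ i * p i / of_nat (Suc i) * (- ?z) ^ Suc i) sums log_series p (- ?z)"
    by (rule log_series_sums[OF summ]) (use t in auto)
  let ?f = "\<lambda>i. (-1) ^ i * p i / of_nat (Suc i) * ?z ^ Suc i + (-1) ^ i * p i / of_nat (Suc i) * (- ?z) ^ Suc i"
  have s: "?f sums (log_series p ?z + log_series p (- ?z))" by (rule sums_add[OF 1 2])
  have even0: "?f i = 0" if "i \<notin> range (\<lambda>n. Suc (2 * n))" for i
  proof -
    have "even i" using that by (metis oddE Suc_eq_plus1 rangeI)
    then have "(- ?z) ^ Suc i = - (?z ^ Suc i)" by (simp add: power_minus_odd)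
    then show ?thesis by (simp only: mult_minus_right add.right_inverse)
  qed
  have "(\<lambda>n. ?f (Suc (2 * n))) sums (log_series p ?z + log_series p (- ?z))"
    using sums_mono_reindex[of "\<lambda>n. Suc (2 * n)" ?f] even0 s by (auto simp: strict_mono_def)
  moreover have "?f (Suc (2 * n)) = of_real (- ((h n)\<^sup>2 * (t\<^sup>2) ^ Suc n / real (Suc n)))" for n
  proof -
    have z: "?z ^ Suc (Suc (2 * n)) = of_real ((t\<^sup>2) ^ Suc n)" "(- ?z) ^ Suc (Suc (2 * n)) = of_real ((t\<^sup>2) ^ Suc n)"
      by (simp_all add: power_mult[symmetric] power2_eq_square power_mult power_commutes power_mult_distrib)
    have n2: "of_nat (Suc (Suc (2 * n))) = (2 * of_nat (Suc n) :: complex)" by simp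
    show ?thesis unfolding z p_odd n2 by (simp add: field_simps del: of_nat_Suc power_Suc)
  qed
  ultimately have "(\<lambda>n. complex_of_real (- ((h n)\<^sup>2 * (t\<^sup>2) ^ Suc n / real (Suc n)))) sums (log_series p ?z + log_series p (- ?z))"
    by simp
  from sums_Re[OF this] show ?thesis by simp
qed

text \<open>Let \<open>r\<close> be the radius of convergence of the traces and suppose that \<open>r < T\<close>. By
  \<open>summable_if_contracting\<close>, whose hypothesis is an open condition on \<open>t\<close>, no power of \<open>r k\<close> has
  norm less than \<open>1\<close>. Inserted in \<open>log_series_even_part\<close>, this bounds
  \<open>det (1 + t k) * det (1 - t k)\<close> by
  \<open>exp (- \<Sum>n. (t / r) ^ (2 * n + 2) / (n + 1)) = 1 - (t / r)\<^sup>2\<close>, which tends to \<open>0\<close> as \<open>t\<close> tends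
  to \<open>r\<close>. A positive lower bound is impossible then. Such a bound is asked for only on discs where
  convergence is known already, since the determinant is given by its series there.\<close>

theorem summable_by_continuation:
  assumes pos: "\<And>r. 0 < r \<Longrightarrow> r < T \<Longrightarrow> (\<And>t. 0 \<le> t \<Longrightarrow> t < r \<Longrightarrow> summable (\<lambda>i. cmod (p i) * t ^ i)) \<Longrightarrow>
      \<exists>\<delta>>0. \<forall>t. 0 \<le> t \<and> t < r \<longrightarrow> \<delta> \<le> cmod (exp (log_series p (of_real t)) * exp (log_series p (- of_real t)))"
    and t0: "0 \<le> t0" "t0 < T"
  shows "summable (\<lambda>i. cmod (p i) * t0 ^ i)"
proof (rule ccontr)
  assume not: "\<not> summable (\<lambda>i. cmod (p i) * t0 ^ i)"
  define S where "S = {t. 0 \<le> t \<and> summable (\<lambda>i. cmod (p i) * t ^ i)}"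
  have down: "summable (\<lambda>i. cmod (p i) * s ^ i)" if "0 \<le> s" "s \<le> t" "summable (\<lambda>i. cmod (p i) * t ^ i)" for s t
    using that by (intro summable_comparison_test'[OF that(3), of 0]) (auto simp: power_mono mult_left_mono)
  have S_le: "t \<le> t0" if "t \<in> S" for t
    using not down[of t0 t] that t0 unfolding S_def by force
  have bdd: "bdd_above S" using S_le by (auto simp: bdd_above_def)
  define r where "r = Sup S"
  define t1 where "t1 = 1 / (h 0 + 1) / 2"
  have h0: "0 \<le> h 0" by (rule h_nonneg)
  have t1: "0 < t1" using h0 by (simp add: t1_def)
  have "h 0 * t1 < 1" using h0 by (simp add: t1_def field_simps)
  then have "t1 \<in> S" using summable_if_contracting[of t1 0] t1 by (simp add: S_def)
  then have r0: "0 < r" using cSup_upper[OF _ bdd, of t1] t1 by (simp add: r_def)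
  have "r \<le> t0" unfolding r_def using \<open>t1 \<in> S\<close> S_le by (intro cSup_least) auto
  then have rT: "r < T" using t0 by simp
  have summ: "summable (\<lambda>i. cmod (p i) * t ^ i)" if "0 \<le> t" "t < r" for t
  proof -
    obtain t' where "t' \<in> S" "t < t'" using \<open>t < r\<close> \<open>t1 \<in> S\<close> unfolding r_def by (metis empty_iff less_cSupD)
    then show ?thesis using down[of t t'] that by (auto simp: S_def)
  qed
  obtain \<delta> where \<delta>: "0 < \<delta>" "\<And>t. 0 \<le> t \<Longrightarrow> t < r \<Longrightarrow> \<delta> \<le> cmod (exp (log_series p (of_real t)) * exp (log_series p (- of_real t)))"
    using pos[OF r0 rT summ] by blast
  have ge1: "1 \<le> h n * r ^ Suc n" for n
  proof (rule ccontr)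
    assume "\<not> 1 \<le> h n * r ^ Suc n"
    then have "h n * r ^ Suc n < 1" by simp
    moreover have "((\<lambda>t. h n * t ^ Suc n) \<longlongrightarrow> h n * r ^ Suc n) (at_right r)"
      by (intro tendsto_intros)
    ultimately have "\<forall>\<^sub>F t in at_right r. h n * t ^ Suc n < 1" by (rule order_tendstoD(2)[rotated])
    then have "\<forall>\<^sub>F t in at_right r. h n * t ^ Suc n < 1 \<and> r < t"
      by (intro eventually_conj eventually_at_right_less)
    then obtain t where t: "h n * t ^ Suc n < 1" "r < t"
      by (metis (no_types, lifting) eventually_happens' trivial_limit_at_right_real)
    have "t \<in> S" using summable_if_contracting[OF _ t(1)] t(2) r0 by (simp add: S_def)
    then have "t \<le> r" unfolding r_def by (intro cSup_upper bdd)
    then show False using t(2) by simp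
  qed
  have le: "\<delta> \<le> 1 - (t / r)\<^sup>2" if t: "0 \<le> t" "t < r" for t
  proof -
    define y where "y = (t / r)\<^sup>2"
    have "t / r < 1" "0 \<le> t / r" using t r0 by auto
    then have y: "0 \<le> y" "y < 1" unfolding y_def using power_less_one_iff[of "t / r" 2] by auto
    have "(\<lambda>n. - ((- (- y)) ^ n) / of_nat n) sums ln (1 + (- y))" using y by (intro ln_series') auto
    then have ln: "(\<lambda>n. - (y ^ Suc n) / real (Suc n)) sums ln (1 - y)"
      using sums_Suc_iff[of "\<lambda>n. - (y ^ n) / real n" "ln (1 - y)"] by simp
    have "- ((h n)\<^sup>2 * (t\<^sup>2) ^ Suc n / real (Suc n)) \<le> - (y ^ Suc n) / real (Suc n)" for n
    proof -
      have "1 \<le> (h n * r ^ Suc n)\<^sup>2" using ge1[of n] by (simp add: one_le_power)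
      also have "\<dots> = (h n)\<^sup>2 * (r\<^sup>2) ^ Suc n" by (simp add: power_mult_distrib power_mult[symmetric] mult.commute)
      finally have "(t\<^sup>2) ^ Suc n * 1 \<le> (t\<^sup>2) ^ Suc n * ((h n)\<^sup>2 * (r\<^sup>2) ^ Suc n)" by (intro mult_left_mono) auto
      then have "y ^ Suc n \<le> (h n)\<^sup>2 * (t\<^sup>2) ^ Suc n"
        using r0 by (simp add: y_def power_divide field_simps del: power_Suc)
      then have "y ^ Suc n / real (Suc n) \<le> (h n)\<^sup>2 * (t\<^sup>2) ^ Suc n / real (Suc n)" by (rule divide_right_mono) simp
      then show ?thesis by simp
    qed
    then have "Re (log_series p (of_real t) + log_series p (- of_real t)) \<le> ln (1 - y)"
      by (rule sums_le[OF _ log_series_even_part[OF summ t] ln]) auto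
    then have "exp (Re (log_series p (of_real t) + log_series p (- of_real t))) \<le> exp (ln (1 - y))" by (simp only: exp_le_cancel_iff)
    then have "exp (Re (log_series p (of_real t) + log_series p (- of_real t))) \<le> 1 - y" using y by simp
    then show ?thesis using \<delta>(2)[OF t] by (simp add: exp_add[symmetric] y_def)
  qed
  have "((\<lambda>t. 1 - (t / r)\<^sup>2) \<longlongrightarrow> 1 - (r / r)\<^sup>2) (at_left r)" using r0 by (intro tendsto_intros) auto
  moreover have "\<forall>\<^sub>F t in at_left r. \<delta> \<le> 1 - (t / r)\<^sup>2"
    using eventually_at_left_real[OF r0] by eventually_elim (use le in auto)
  ultimately have "\<delta> \<le> 1 - (r / r)\<^sup>2" by (rule tendsto_lowerbound) simp
  then show False using \<delta>(1) r0 by simp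
qed

end

section \<open>Elementary symmetric functions and falling factorials\<close>

lemma falling_fact_Suc: "falling_fact k (Suc n) = falling_fact k n * (real k - real n)"
proof (cases "n < k")
  case True
  then have "fact (k - n) = real (k - n) * fact (k - Suc n)"
    by (metis Suc_diff_Suc fact_Suc)
  then have "falling_fact k n * (real k - real n) = fact k / (real (k - n) * fact (k - Suc n)) * real (k - n)"
    using True by (simp add: falling_fact_def of_nat_diff)
  also have "\<dots> = fact k / fact (k - Suc n)" using True by simp
  finally show ?thesis using True by (simp add: falling_fact_def)
qed (auto simp: falling_fact_def)

lemma falling_fact_0 [simp]: "falling_fact k 0 = 1"
  by (simp add: falling_fact_def)

lemma falling_fact_nonneg [simp]: "0 \<le> falling_fact k n"
  by (simp add: falling_fact_def)

text \<open>The ordered selections of \<open>n\<close> different points of \<open>A\<close>, the \<open>i\<close>-th one of them from \<open>B i\<close>.\<close>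

definition typed_lists :: "'a set \<Rightarrow> (nat \<Rightarrow> 'a set) \<Rightarrow> nat \<Rightarrow> 'a list set" where
  "typed_lists A B n = {xs. length xs = n \<and> distinct xs \<and> (\<forall>i<n. xs ! i \<in> A \<inter> B i)}"

lemma finite_typed_lists: "finite A \<Longrightarrow> finite (typed_lists A B n)"
  by (rule finite_subset[OF _ finite_lists_length_eq[of A n]]) (auto simp: typed_lists_def set_conv_nth)

text \<open>The entries are chosen one after the other. The choices for the \<open>i\<close>-th one, in \<open>D (s i)\<close>,
  are reduced by the number of earlier entries with the same type; entries of other types lie
  elsewhere since the sets \<open>D c\<close> are disjoint.\<close>

lemma card_typed_lists:
  assumes A: "finite A" and C: "finite C" and D: "disjoint_family_on D C" and s: "\<And>i. i < n \<Longrightarrow> s i \<in> C"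
  shows "real (card (typed_lists A (\<lambda>i. D (s i)) n)) = (\<Prod>c\<in>C. falling_fact (card (A \<inter> D c)) (card {i. i < n \<and> s i = c}))"
  using s
proof (induction n)
  case 0
  have "typed_lists A (\<lambda>i. D (s i)) 0 = {[]}" by (auto simp: typed_lists_def)
  then show ?case by simp
next
  case (Suc n)
  let ?S = "typed_lists A (\<lambda>i. D (s i))"
  define T where "T xs = A \<inter> D (s n) - set xs" for xs
  have "bij_betw (\<lambda>(xs, a). xs @ [a]) (SIGMA xs:?S n. T xs) (?S (Suc n))"
  proof (rule bij_betwI[where g = "\<lambda>ys. (butlast ys, last ys)"])
    show "(\<lambda>(xs, a). xs @ [a]) \<in> (SIGMA xs:?S n. T xs) \<rightarrow> ?S (Suc n)"
      by (auto simp: typed_lists_def T_def nth_append less_Suc_eq)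
    show "(\<lambda>ys. (butlast ys, last ys)) \<in> ?S (Suc n) \<rightarrow> (SIGMA xs:?S n. T xs)"
    proof
      fix ys assume "ys \<in> ?S (Suc n)"
      then have ys: "length ys = Suc n" "distinct ys" "\<forall>i<Suc n. ys ! i \<in> A \<inter> D (s i)" by (auto simp: typed_lists_def)
      obtain xs a where e: "ys = xs @ [a]" using ys(1) by (metis length_Suc_conv_rev)
      show "(butlast ys, last ys) \<in> (SIGMA xs:?S n. T xs)"
        using ys unfolding e by (auto simp: typed_lists_def T_def nth_append less_Suc_eq split: if_splits dest: spec[of _ n])
    qed
  qed (auto simp: typed_lists_def, metis append_butlast_last_id length_0_conv nat.simps(3))
  then have "card (?S (Suc n)) = card (SIGMA xs:?S n. T xs)" by (simp add: bij_betw_same_card)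
  also have "\<dots> = (\<Sum>xs\<in>?S n. card (T xs))"
    using A by (intro card_SigmaI finite_typed_lists) (auto simp: T_def)
  finally have card_eq: "real (card (?S (Suc n))) = (\<Sum>xs\<in>?S n. real (card (T xs)))" by simp
  define k where "k = card {i. i < n \<and> s i = s n}"
  have cT: "real (card (T xs)) = real (card (A \<inter> D (s n))) - real k" if "xs \<in> ?S n" for xs
  proof -
    have xs: "length xs = n" "distinct xs" "\<And>i. i < n \<Longrightarrow> xs ! i \<in> A \<inter> D (s i)" using that by (auto simp: typed_lists_def)
    have "A \<inter> D (s n) \<inter> set xs = (\<lambda>i. xs ! i) ` {i. i < n \<and> s i = s n}"
    proof (intro equalityI subsetI)
      fix x assume x: "x \<in> A \<inter> D (s n) \<inter> set xs"
      then obtain i where i: "i < n" "x = xs ! i" using xs(1) by (auto simp: in_set_conv_nth)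
      have "s i = s n"
      proof (rule ccontr)
        assume "s i \<noteq> s n"
        then have "D (s i) \<inter> D (s n) = {}" using D Suc.prems i by (auto simp: disjoint_family_on_def)
        then show False using xs(3)[OF i(1)] x i by auto
      qed
      then show "x \<in> (\<lambda>i. xs ! i) ` {i. i < n \<and> s i = s n}" using i by auto
    next
      fix x assume "x \<in> (\<lambda>i. xs ! i) ` {i. i < n \<and> s i = s n}"
      then obtain i where i: "i < n" "s i = s n" "x = xs ! i" by auto
      then show "x \<in> A \<inter> D (s n) \<inter> set xs" using xs(3)[OF i(1)] xs(1) by auto
    qed
    moreover have "inj_on (\<lambda>i. xs ! i) {i. i < n \<and> s i = s n}"
      using xs by (auto simp: inj_on_def nth_eq_iff_index_eq)
    ultimately have "card (A \<inter> D (s n) \<inter> set xs) = k" by (simp add: card_image k_def)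
    moreover have "card (T xs) = card (A \<inter> D (s n)) - card (A \<inter> D (s n) \<inter> set xs)"
      unfolding T_def using A by (subst card_Diff_subset_Int) auto
    moreover have "card (A \<inter> D (s n) \<inter> set xs) \<le> card (A \<inter> D (s n))"
      using A by (intro card_mono) auto
    ultimately show ?thesis by simp
  qed
  have "real (card (?S (Suc n))) = real (card (?S n)) * (real (card (A \<inter> D (s n))) - real k)"
    unfolding card_eq using cT by simp
  also have "real (card (?S n)) = (\<Prod>c\<in>C. falling_fact (card (A \<inter> D c)) (card {i. i < n \<and> s i = c}))"
    using Suc by simp
  also have "\<dots> * (real (card (A \<inter> D (s n))) - real k)
      = (\<Prod>c\<in>C. falling_fact (card (A \<inter> D c)) (card {i. i < Suc n \<and> s i = c}))"
  proof -
    have sn: "s n \<in> C" using Suc.prems by simp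
    have "card {i. i < Suc n \<and> s i = s n} = Suc k"
    proof -
      have "{i. i < Suc n \<and> s i = s n} = insert n {i. i < n \<and> s i = s n}" by auto
      then show ?thesis by (simp add: k_def)
    qed
    moreover have "{i. i < Suc n \<and> s i = c} = {i. i < n \<and> s i = c}" if "c \<noteq> s n" for c
      using that by (auto simp: less_Suc_eq)
    ultimately show ?thesis
      unfolding prod.remove[OF C sn] by (simp add: falling_fact_Suc k_def[symmetric] mult_ac)
  qed
  finally show ?case .
qed

text \<open>The elementary symmetric function of degree \<open>n\<close> of the values of \<open>g\<close> on \<open>A\<close>.\<close>

definition esym :: "('a \<Rightarrow> 'b::{real_normed_field}) \<Rightarrow> nat \<Rightarrow> 'a set \<Rightarrow> 'b" where
  "esym g n A = (\<Sum>B | B \<subseteq> A \<and> card B = n. \<Prod>x\<in>B. g x)"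

lemma prod_one_plus_esym:
  assumes "finite A"
  shows "(\<Prod>x\<in>A. 1 + z * g x) = (\<Sum>n\<le>card A. z ^ n * esym g n A)"
proof -
  have "(\<Prod>x\<in>A. 1 + z * g x) = (\<Sum>B\<in>Pow A. \<Prod>x\<in>B. z * g x)"
    using prod_add[OF assms, of "\<lambda>x. z * g x" "\<lambda>_. 1"] by (simp add: add.commute)
  also have "\<dots> = (\<Sum>n\<in>{..card A}. \<Sum>B | B \<in> Pow A \<and> card B = n. \<Prod>x\<in>B. z * g x)"
    using assms by (intro sum.group[symmetric]) (auto intro: card_mono)
  also have "\<dots> = (\<Sum>n\<le>card A. z ^ n * esym g n A)"
    by (intro sum.cong refl) (simp add: esym_def prod.distrib sum_distrib_left)
  finally show ?thesis .
qed

lemma esym_zero: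
  assumes "finite A" "card A < n"
  shows "esym g n A = 0"
proof -
  have "card B \<noteq> n" if "B \<subseteq> A" for B using card_mono[OF assms(1) that] assms(2) by linarith
  then have "{B. B \<subseteq> A \<and> card B = n} = {}" by auto
  then show ?thesis unfolding esym_def by (simp only: sum.empty)
qed

lemma esym_0 [simp]: "finite A \<Longrightarrow> esym g 0 A = 1"
proof -
  assume "finite A"
  then have "B = {}" if "B \<subseteq> A" "card B = 0" for B using finite_subset[OF that(1)] that(2) by simp
  then have "{B. B \<subseteq> A \<and> card B = 0} = {{}}" by (intro equalityI subsetI) (blast, simp)
  then show ?thesis by (simp add: esym_def)
qed

lemma esym_1: "finite A \<Longrightarrow> esym g (Suc 0) A = (\<Sum>x\<in>A. g x)"
proof -
  assume "finite A"
  have "{B. B \<subseteq> A \<and> card B = Suc 0} = (\<lambda>x. {x}) ` A" by (auto simp: card_1_singleton_iff)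
  then show ?thesis by (simp add: esym_def sum.reindex inj_on_def)
qed

lemma norm_esym_le: "norm (esym g n A) \<le> esym (\<lambda>x. norm (g x)) n A"
  unfolding esym_def by (intro order_trans[OF norm_sum] sum_mono) (simp add: prod_norm)

lemma esym_mono:
  fixes g h :: "'a \<Rightarrow> real"
  assumes "\<And>x. x \<in> A \<Longrightarrow> 0 \<le> g x" "\<And>x. x \<in> A \<Longrightarrow> g x \<le> h x"
  shows "esym g n A \<le> esym h n A"
  unfolding esym_def using assms by (intro sum_mono prod_mono) auto

lemma esym_nonneg:
  fixes g :: "'a \<Rightarrow> real"
  assumes "\<And>x. x \<in> A \<Longrightarrow> 0 \<le> g x"
  shows "0 \<le> esym g n A"
  unfolding esym_def using assms by (intro sum_nonneg prod_nonneg) auto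

lemma esym_scale: "esym (\<lambda>x. c * g x) n A = c ^ n * esym g n A"
  unfolding esym_def by (simp add: prod.distrib sum_distrib_left)

lemma esym_of_real: "esym (\<lambda>x. of_real (g x)) n A = of_real (esym g n A)"
  unfolding esym_def by simp

lemma square_sum_esym:
  fixes g :: "'a \<Rightarrow> real"
  assumes "finite A"
  shows "(\<Sum>x\<in>A. g x)\<^sup>2 = (\<Sum>x\<in>A. (g x)\<^sup>2) + 2 * esym g 2 A"
  using assms
proof (induction A)
  case empty
  then show ?case using esym_zero[of "{}" 2 g] by simp
next
  case (insert a A)
  have "{B. B \<subseteq> insert a A \<and> card B = 2} = {B. B \<subseteq> A \<and> card B = 2} \<union> (\<lambda>x. {a, x}) ` A"
  proof (intro equalityI subsetI)
    fix B assume B: "B \<in> {B. B \<subseteq> insert a A \<and> card B = 2}"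
    show "B \<in> {B. B \<subseteq> A \<and> card B = 2} \<union> (\<lambda>x. {a, x}) ` A"
    proof (cases "a \<in> B")
      case True
      then have "card (B - {a}) = 1" using B by (simp add: card_Diff_singleton)
      then obtain x where x: "B - {a} = {x}" by (auto simp: card_1_singleton_iff)
      then have "B = {a, x}" "x \<in> A" using True B by auto
      then show ?thesis by auto
    qed (use B in auto)
  qed (use insert in \<open>auto simp: card_insert_if\<close>)
  moreover have "{B. B \<subseteq> A \<and> card B = 2} \<inter> (\<lambda>x. {a, x}) ` A = {}" using insert by auto
  moreover have "finite {B. B \<subseteq> A \<and> card B = 2}" using insert by simp
  moreover have "inj_on (\<lambda>x. {a, x}) A" using insert by (auto simp: inj_on_def doubleton_eq_iff)
  moreover have "(\<Prod>y\<in>{a, x}. g y) = g a * g x" if "x \<in> A" for x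
  proof -
    have "a \<noteq> x" using that insert by auto
    then show ?thesis by simp
  qed
  ultimately have "esym g 2 (insert a A) = esym g 2 A + (\<Sum>x\<in>A. g a * g x)"
    using insert by (simp add: esym_def sum.union_disjoint sum.reindex)
  also have "(\<Sum>x\<in>A. g a * g x) = g a * sum g A" by (simp add: sum_distrib_left)
  finally show ?case using insert by (simp add: power2_sum algebra_simps)
qed

lemma esym_distinct_lists:
  assumes A: "finite A"
  shows "fact n * esym g n A = (\<Sum>xs\<in>typed_lists A (\<lambda>_. UNIV) n. \<Prod>i<n. g (xs ! i))"
proof -
  have e: "typed_lists A (\<lambda>_. UNIV) n = (\<Union>B\<in>{B. B \<subseteq> A \<and> card B = n}. permutations_of_set B)"
  proof -
    have "typed_lists A (\<lambda>_. UNIV) n = {xs. length xs = n \<and> distinct xs \<and> set xs \<subseteq> A}"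
      by (auto simp: typed_lists_def set_conv_nth)
    then show ?thesis by (auto simp: permutations_of_set_def distinct_card)
  qed
  have fin: "finite B" if "B \<subseteq> A" for B using that A by (rule finite_subset)
  have p: "(\<Prod>i<n. g (xs ! i)) = (\<Prod>x\<in>B. g x)" if "xs \<in> permutations_of_set B" "card B = n" for xs B
  proof -
    have "length xs = n" "distinct xs" "set xs = B" using that by (auto simp: permutations_of_set_def distinct_card[symmetric])
    then have "bij_betw (\<lambda>i. xs ! i) {..<n} B" by (intro bij_betw_nth) auto
    then show ?thesis by (rule prod.reindex_bij_betw)
  qed
  have "(\<Sum>xs\<in>typed_lists A (\<lambda>_. UNIV) n. \<Prod>i<n. g (xs ! i)) 
     = (\<Sum>B | B \<subseteq> A \<and> card B = n. \<Sum>xs\<in>permutations_of_set B. \<Prod>i<n. g (xs ! i))"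
    unfolding e by (intro sum.UNION_disjoint) (use A in simp, simp, auto simp: permutations_of_set_def)
  also have "\<dots> = (\<Sum>B | B \<subseteq> A \<and> card B = n. fact n * (\<Prod>x\<in>B. g x))"
    using fin p by (intro sum.cong refl) simp
  finally show ?thesis by (simp add: esym_def sum_distrib_left)
qed

text \<open>The ordered selections of \<open>n\<close> points are grouped by the sequence \<open>s\<close> of values that \<open>g\<close>
  takes on them. The size of a group is a product of falling factorials of numbers of points, and
  the expectations of such products are what correlation functions describe.\<close>

lemma esym_finite_range:
  fixes g :: "'a \<Rightarrow> 'b::real_normed_field"
  assumes A: "finite A" "A \<subseteq> \<Delta>" and C: "finite C" "g ` A \<subseteq> C"
  shows "fact n * esym g n A = (\<Sum>s\<in>{..<n} \<rightarrow>\<^sub>E C. (\<Prod>i<n. s i) * 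
     of_real (\<Prod>c\<in>C. falling_fact (card (A \<inter> {x \<in> \<Delta>. g x = c})) (card {i. i < n \<and> s i = c})))"
proof -
  let ?L = "typed_lists A (\<lambda>_. UNIV) n"
  have sub: "(\<lambda>xs. restrict (\<lambda>i. g (xs ! i)) {..<n}) ` ?L \<subseteq> {..<n} \<rightarrow>\<^sub>E C"
    by (rule image_subsetI) (use C in \<open>auto simp: typed_lists_def restrict_PiE_iff simp del: restrict_apply\<close>)
  have "(\<Sum>xs\<in>?L. \<Prod>i<n. g (xs ! i)) = (\<Sum>s\<in>{..<n} \<rightarrow>\<^sub>E C. \<Sum>xs | xs \<in> ?L \<and> restrict (\<lambda>i. g (xs ! i)) {..<n} = s. \<Prod>i<n. g (xs ! i))"
    using A C by (intro sum.group[symmetric] finite_typed_lists finite_PiE sub) auto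
  also have "\<dots> = (\<Sum>s\<in>{..<n} \<rightarrow>\<^sub>E C. (\<Prod>i<n. s i) * of_real (\<Prod>c\<in>C. falling_fact (card (A \<inter> {x \<in> \<Delta>. g x = c})) (card {i. i < n \<and> s i = c})))"
  proof (rule sum.cong[OF refl])
    fix s assume s: "s \<in> {..<n} \<rightarrow>\<^sub>E C"
    have h1: "{xs. xs \<in> ?L \<and> restrict (\<lambda>i. g (xs ! i)) {..<n} = s} = typed_lists A (\<lambda>i. {x \<in> \<Delta>. g x = s i}) n"
      using s A(2) by (auto simp: typed_lists_def fun_eq_iff restrict_def PiE_def extensional_def split: if_splits)
    have h2: "(\<Sum>xs\<in>typed_lists A (\<lambda>i. {x \<in> \<Delta>. g x = s i}) n. \<Prod>i<n. g (xs ! i))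
       = (\<Sum>xs\<in>typed_lists A (\<lambda>i. {x \<in> \<Delta>. g x = s i}) n. \<Prod>i<n. s i)"
      by (intro sum.cong prod.cong refl) (auto simp: typed_lists_def)
    have h3: "(\<Sum>xs\<in>typed_lists A (\<lambda>i. {x \<in> \<Delta>. g x = s i}) n. \<Prod>i<n. s i) = (\<Prod>i<n. s i) * of_real (real (card (typed_lists A (\<lambda>i. {x \<in> \<Delta>. g x = s i}) n)))"
      by simp
    have h4: "real (card (typed_lists A (\<lambda>i. {x \<in> \<Delta>. g x = s i}) n)) = (\<Prod>c\<in>C. falling_fact (card (A \<inter> {x \<in> \<Delta>. g x = c})) (card {i. i < n \<and> s i = c}))"
      using s by (intro card_typed_lists A C) (auto simp: disjoint_family_on_def)
    show "(\<Sum>xs | xs \<in> ?L \<and> restrict (\<lambda>i. g (xs ! i)) {..<n} = s. \<Prod>i<n. g (xs ! i)) 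
       = (\<Prod>i<n. s i) * of_real (\<Prod>c\<in>C. falling_fact (card (A \<inter> {x \<in> \<Delta>. g x = c})) (card {i. i < n \<and> s i = c}))"
      unfolding h1 h2 h3 h4 ..
  qed
  finally show ?thesis unfolding esym_distinct_lists[OF A(1)] .
qed

section \<open>Correlation functions on arbitrary boxes\<close>

context sigma_finite_measure
begin

interpretation PS: product_sigma_finite "\<lambda>_. M" ..

lemma distr_PiM_permute:
  assumes \<sigma>: "\<sigma> permutes I" and I: "finite I"
  shows "distr (PiM I (\<lambda>_. M)) (PiM I (\<lambda>_. M)) (\<lambda>x. x \<circ> \<sigma>) = PiM I (\<lambda>_. M)"
proof -
  have meas: "(\<lambda>x. x \<circ> \<sigma>) \<in> measurable (PiM I (\<lambda>_. M)) (PiM I (\<lambda>_. M))"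
  proof (rule measurable_PiM_single')
    show "(\<lambda>x. (x \<circ> \<sigma>) i) \<in> measurable (PiM I (\<lambda>_. M)) M" if "i \<in> I" for i
      using measurable_component_singleton[of "\<sigma> i" I "\<lambda>_. M"] permutes_in_image[OF \<sigma>] that by (simp add: o_def)
    show "(\<lambda>x. x \<circ> \<sigma>) \<in> space (PiM I (\<lambda>_. M)) \<rightarrow> (\<Pi>\<^sub>E i\<in>I. space M)"
      using permutes_in_image[OF \<sigma>] permutes_not_in[OF \<sigma>] by (auto simp: space_PiM PiE_def extensional_def)
  qed
  show ?thesis
  proof (rule PS.PiM_eqI[OF I])
    fix A assume A: "\<And>i. i \<in> I \<Longrightarrow> A i \<in> sets M"
    define B where "B i = A (inv_into UNIV \<sigma> i)" for i
    have inv: "inv_into UNIV \<sigma> i \<in> I" if "i \<in> I" for i using permutes_in_image[OF permutes_inv[OF \<sigma>]] that by simp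
    have pre: "(\<lambda>x. x \<circ> \<sigma>) -` (Pi\<^sub>E I A) \<inter> space (PiM I (\<lambda>_. M)) = Pi\<^sub>E I B"
    proof (intro equalityI subsetI)
      fix x assume x: "x \<in> (\<lambda>x. x \<circ> \<sigma>) -` (Pi\<^sub>E I A) \<inter> space (PiM I (\<lambda>_. M))"
      then have "x (\<sigma> (inv_into UNIV \<sigma> i)) \<in> A (inv_into UNIV \<sigma> i)" if "i \<in> I" for i using inv[OF that] by auto
      then show "x \<in> Pi\<^sub>E I B" using x by (auto simp: B_def space_PiM PiE_iff permutes_inverses[OF \<sigma>])
    next
      fix x assume x: "x \<in> Pi\<^sub>E I B"
      then have "x (\<sigma> i) \<in> A i" if "i \<in> I" for i
        using permutes_in_image[OF \<sigma>] that by (auto simp: B_def PiE_iff permutes_inverses[OF \<sigma>] dest: bspec[of _ _ "\<sigma> i"])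
      moreover have "x i \<in> space M" if "i \<in> I" for i
        using x that sets.sets_into_space[OF A[OF inv[OF that]]] by (auto simp: PiE_iff B_def)
      then have "x \<in> space (PiM I (\<lambda>_. M))"
        using x by (auto simp: space_PiM PiE_iff)
      ultimately show "x \<in> (\<lambda>x. x \<circ> \<sigma>) -` (Pi\<^sub>E I A) \<inter> space (PiM I (\<lambda>_. M))"
        using x permutes_not_in[OF \<sigma>] by (auto simp: PiE_iff extensional_def)
    qed
    have "emeasure (distr (PiM I (\<lambda>_. M)) (PiM I (\<lambda>_. M)) (\<lambda>x. x \<circ> \<sigma>)) (Pi\<^sub>E I A) = emeasure (PiM I (\<lambda>_. M)) (Pi\<^sub>E I B)"
      using A I by (subst emeasure_distr[OF meas]) (auto intro!: sets_PiM_I_finite simp: pre)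
    also have "\<dots> = (\<Prod>i\<in>I. emeasure M (A (inv_into UNIV \<sigma> i)))"
      unfolding B_def using A inv I by (subst PS.emeasure_PiM) auto
    also have "\<dots> = (\<Prod>i\<in>I. emeasure M (A i))"
      using prod.permute[OF permutes_inv[OF \<sigma>], of "\<lambda>i. emeasure M (A i)"] by (simp add: o_def)
    finally show "emeasure (distr (PiM I (\<lambda>_. M)) (PiM I (\<lambda>_. M)) (\<lambda>x. x \<circ> \<sigma>)) (Pi\<^sub>E I A) = (\<Prod>i\<in>I. emeasure M (A i))" .
  qed simp
qed

text \<open>The product measure is invariant under permutations of the coordinates, and \<open>f\<close> does not
  change.\<close>

lemma nn_integral_box_permute:
  assumes \<sigma>: "\<sigma> permutes I" and I: "finite I" and B: "\<And>i. i \<in> I \<Longrightarrow> B i \<in> sets M"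
    and f: "f \<in> borel_measurable (PiM I (\<lambda>_. M))"
    and sym: "\<And>x. x \<in> space (PiM I (\<lambda>_. M)) \<Longrightarrow> f (x \<circ> \<sigma>) = f x"
  shows "(\<integral>\<^sup>+x\<in>Pi\<^sub>E I (\<lambda>i. B (\<sigma> i)). f x \<partial>PiM I (\<lambda>_. M)) = (\<integral>\<^sup>+x\<in>Pi\<^sub>E I B. f x \<partial>PiM I (\<lambda>_. M))"
proof -
  let ?P = "PiM I (\<lambda>_. M)"
  have \<sigma>I: "\<sigma> i \<in> I" if "i \<in> I" for i using permutes_in_image[OF \<sigma>] that by simp
  have B': "Pi\<^sub>E I (\<lambda>i. B (\<sigma> i)) \<in> sets ?P" using B \<sigma>I I by (intro sets_PiM_I_finite) auto
  have meas: "(\<lambda>x. x \<circ> \<sigma>) \<in> measurable ?P ?P"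
  proof (rule measurable_PiM_single')
    show "(\<lambda>x. (x \<circ> \<sigma>) i) \<in> measurable ?P M" if "i \<in> I" for i
      using measurable_component_singleton[of "\<sigma> i" I "\<lambda>_. M"] \<sigma>I[OF that] by (simp add: o_def)
    show "(\<lambda>x. x \<circ> \<sigma>) \<in> space ?P \<rightarrow> (\<Pi>\<^sub>E i\<in>I. space M)"
      using \<sigma>I permutes_not_in[OF \<sigma>] by (auto simp: space_PiM PiE_def extensional_def)
  qed
  have "(\<integral>\<^sup>+x\<in>Pi\<^sub>E I (\<lambda>i. B (\<sigma> i)). f x \<partial>?P) = (\<integral>\<^sup>+x. f x * indicator (Pi\<^sub>E I (\<lambda>i. B (\<sigma> i))) x \<partial>distr ?P ?P (\<lambda>x. x \<circ> \<sigma>))"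
    by (simp only: distr_PiM_permute[OF \<sigma> I])
  also have "\<dots> = (\<integral>\<^sup>+x. f (x \<circ> \<sigma>) * indicator (Pi\<^sub>E I (\<lambda>i. B (\<sigma> i))) (x \<circ> \<sigma>) \<partial>?P)"
    using f B' by (intro nn_integral_distr[OF meas]) auto
  also have "\<dots> = (\<integral>\<^sup>+x\<in>Pi\<^sub>E I B. f x \<partial>?P)"
  proof (rule nn_integral_cong)
    fix x assume x: "x \<in> space ?P"
    have "x \<circ> \<sigma> \<in> Pi\<^sub>E I (\<lambda>i. B (\<sigma> i)) \<longleftrightarrow> x \<in> Pi\<^sub>E I B"
    proof
      assume a: "x \<circ> \<sigma> \<in> Pi\<^sub>E I (\<lambda>i. B (\<sigma> i))"
      have "x i \<in> B i" if "i \<in> I" for i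
      proof -
        have "inv_into UNIV \<sigma> i \<in> I" using permutes_in_image[OF permutes_inv[OF \<sigma>]] that by simp
        then have "(x \<circ> \<sigma>) (inv_into UNIV \<sigma> i) \<in> B (\<sigma> (inv_into UNIV \<sigma> i))" using a by auto
        then show ?thesis by (simp add: permutes_inverses[OF \<sigma>])
      qed
      then show "x \<in> Pi\<^sub>E I B" using x by (auto simp: space_PiM PiE_iff)
    next
      assume "x \<in> Pi\<^sub>E I B"
      then show "x \<circ> \<sigma> \<in> Pi\<^sub>E I (\<lambda>i. B (\<sigma> i))"
        using \<sigma>I permutes_not_in[OF \<sigma>] by (auto simp: PiE_iff extensional_def)
    qed
    then show "f (x \<circ> \<sigma>) * indicator (Pi\<^sub>E I (\<lambda>i. B (\<sigma> i))) (x \<circ> \<sigma>) = f x * indicator (Pi\<^sub>E I B) x"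
      using sym[OF x] by (simp add: indicator_def)
  qed
  finally show ?thesis .
qed

end

text \<open>The boxes in the definition of a correlation function list equal factors consecutively. A
  permutation brings an arbitrary sequence of factors into this form.\<close>

lemma sort_into_blocks:
  fixes s :: "nat \<Rightarrow> 'c"
  obtains cs p where "distinct cs" "set cs = s ` {..<n}" "p permutes {..<n}"
    "concat (map (\<lambda>j. replicate (card {i. i < n \<and> s i = cs ! j}) (cs ! j)) [0..<length cs]) = map (\<lambda>i. s (p i)) [0..<n]"
proof -
  obtain cs where cs: "set cs = s ` {..<n}" "distinct cs" using finite_distinct_list[of "s ` {..<n}"] by auto
  define L where "L = concat (map (\<lambda>j. replicate (card {i. i < n \<and> s i = cs ! j}) (cs ! j)) [0..<length cs])"
  have L': "L = concat (map (\<lambda>c. replicate (card {i. i < n \<and> s i = c}) c) cs)"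
    unfolding L_def by (rule arg_cong[of _ _ concat]) (rule nth_equalityI, auto)
  have "mset L = mset (map s [0..<n])"
  proof (rule multiset_eqI)
    fix c
    have "count (mset L) c = (\<Sum>d\<leftarrow>cs. if d = c then card {i. i < n \<and> s i = c} else 0)"
      unfolding L' by (induction cs) auto
    also have "\<dots> = (\<Sum>d\<in>set cs. if d = c then card {i. i < n \<and> s i = c} else 0)"
      using cs(2) by (rule sum_list_distinct_conv_sum_set)
    also have "\<dots> = card {i. i < n \<and> s i = c}"
    proof (cases "c \<in> set cs")
      case False
      then have "{i. i < n \<and> s i = c} = {}" using cs(1) by auto
      then show ?thesis using False by (auto intro: sum.neutral)
    qed simp
    also have "\<dots> = count (mset (map s [0..<n])) c"
    proof -
      have "count (mset (map s [0..<n])) c = length (filter (\<lambda>i. s i = c) [0..<n])"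
        by (induction n) auto
      also have "\<dots> = card (set (filter (\<lambda>i. s i = c) [0..<n]))" by (rule distinct_card[symmetric]) simp
      also have "set (filter (\<lambda>i. s i = c) [0..<n]) = {i. i < n \<and> s i = c}" by auto
      finally show ?thesis by simp
    qed
    finally show "count (mset L) c = count (mset (map s [0..<n])) c" .
  qed
  then obtain p where p: "p permutes {..<length (map s [0..<n])}" "permute_list p (map s [0..<n]) = L"
    by (rule mset_eq_permutation)
  have "L = map (\<lambda>i. s (p i)) [0..<n]"
    unfolding p(2)[symmetric] permute_list_def using permutes_in_image[OF p(1)] by auto
  then show ?thesis using that[OF cs(2,1), of p] p(1) by (simp add: L_def)
qed

text \<open>The factors \<open>D (s i)\<close> are sorted into blocks, which is harmless because correlation
  functions are symmetric. The blocks in the definition are nonempty, so the \<open>c\<close> that are not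
  values of \<open>s\<close> are left out; they contribute the factor \<open>1\<close>.\<close>

lemma correlation_function_family:
  assumes corr: "correlation_function X M P n \<rho>" and n: "1 \<le> n" and M: "sigma_finite_measure M"
    and sets: "sets M = sets (borel_of X)"
    and C: "finite C" and D: "\<And>c. c \<in> C \<Longrightarrow> D c \<in> sets M \<and> precompactin X (D c)"
    and disj: "disjoint_family_on D C" and s: "\<And>i. i < n \<Longrightarrow> s i \<in> C"
  shows "(\<integral>\<^sup>+\<xi>. ennreal (\<Prod>c\<in>C. falling_fact (num_points (D c) \<xi>) (card {i. i < n \<and> s i = c})) \<partial>P) =
    (\<integral>\<^sup>+x\<in>Pi\<^sub>E {..<n} (\<lambda>i. D (s i)). ennreal (\<rho> x) \<partial>(PiM {..<n} (\<lambda>_. M)))"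
proof -
  interpret sigma_finite_measure M by fact
  obtain cs p where cs: "distinct cs" "set cs = s ` {..<n}" and p: "p permutes {..<n}"
    and L: "concat (map (\<lambda>j. replicate (card {i. i < n \<and> s i = cs ! j}) (cs ! j)) [0..<length cs]) = map (\<lambda>i. s (p i)) [0..<n]"
    by (rule sort_into_blocks)
  define m where "m = length cs"
  define ns where "ns j = card {i. i < n \<and> s i = cs ! j}" for j
  define \<Delta> where "\<Delta> j = D (cs ! j)" for j
  have csC: "cs ! j \<in> C" if "j < m" for j
    using that cs(2) s nth_mem[of j cs] by (auto simp: m_def)
  have "1 \<le> m" using cs(2) n by (cases cs) (auto simp: m_def lessThan_empty_iff)
  moreover have "\<forall>j<m. 1 \<le> ns j"
  proof (intro allI impI)
    fix j assume "j < m"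
    then have "cs ! j \<in> s ` {..<n}" using cs(2) nth_mem[of j cs] by (auto simp: m_def)
    then have "{i. i < n \<and> s i = cs ! j} \<noteq> {}" by auto
    then show "1 \<le> ns j" unfolding ns_def by (simp add: Suc_le_eq card_gt_0_iff)
  qed
  moreover have sum: "(\<Sum>j<m. ns j) = n"
  proof -
    have "length (concat (map (\<lambda>j. replicate (ns j) (cs ! j)) [0..<m])) = n" using L by (simp add: ns_def m_def)
    then show ?thesis by (simp add: length_concat o_def interv_sum_list_conv_sum_set_nat atLeast0LessThan)
  qed
  moreover have "\<forall>j<m. \<Delta> j \<in> sets (borel_of X) \<and> precompactin X (\<Delta> j)"
    using D csC sets by (auto simp: \<Delta>_def)
  moreover have "disjoint_family_on \<Delta> {..<m}"
    using disj csC cs(1) by (auto simp: disjoint_family_on_def \<Delta>_def m_def nth_eq_iff_index_eq)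
  ultimately have main: "(\<integral>\<^sup>+\<xi>. ennreal (\<Prod>j<m. falling_fact (num_points (\<Delta> j) \<xi>) (ns j)) \<partial>P) =
        (\<integral>\<^sup>+x\<in>block_box m ns \<Delta>. ennreal (\<rho> x) \<partial>(PiM {..<n} (\<lambda>_. M)))"
    using corr unfolding correlation_function_def by blast
  have "(\<Prod>j<m. falling_fact (num_points (\<Delta> j) \<xi>) (ns j)) = (\<Prod>c\<in>C. falling_fact (num_points (D c) \<xi>) (card {i. i < n \<and> s i = c}))" for \<xi>
  proof -
    have "(\<Prod>j<m. falling_fact (num_points (\<Delta> j) \<xi>) (ns j)) = (\<Prod>c\<in>set cs. falling_fact (num_points (D c) \<xi>) (card {i. i < n \<and> s i = c}))"
      unfolding \<Delta>_def ns_def m_def using bij_betw_nth[OF cs(1) refl refl]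
      by (rule prod.reindex_bij_betw[where g = "\<lambda>c. falling_fact (num_points (D c) \<xi>) (card {i. i < n \<and> s i = c})"])
    also have "\<dots> = (\<Prod>c\<in>C. falling_fact (num_points (D c) \<xi>) (card {i. i < n \<and> s i = c}))"
    proof (rule prod.mono_neutral_left[OF C])
      show "set cs \<subseteq> C" using cs(2) s by auto
      show "\<forall>c\<in>C - set cs. falling_fact (num_points (D c) \<xi>) (card {i. i < n \<and> s i = c}) = 1"
      proof
        fix c assume "c \<in> C - set cs"
        then have e: "{i. i < n \<and> s i = c} = {}" using cs(2) by auto
        show "falling_fact (num_points (D c) \<xi>) (card {i. i < n \<and> s i = c}) = 1" unfolding e by simp
      qed
    qed
    finally show ?thesis .
  qed
  moreover have "block_box m ns \<Delta> = Pi\<^sub>E {..<n} (\<lambda>i. D (s (p i)))"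
  proof -
    have "concat (map (\<lambda>j. replicate (ns j) (\<Delta> j)) [0..<m]) = map D (concat (map (\<lambda>j. replicate (ns j) (cs ! j)) [0..<m]))"
      by (simp add: map_concat o_def \<Delta>_def)
    also have "\<dots> = map (\<lambda>i. D (s (p i))) [0..<n]" using L by (simp add: ns_def m_def o_def)
    finally show ?thesis unfolding block_box_def sum by (intro PiE_cong) simp
  qed
  moreover have "(\<integral>\<^sup>+x\<in>Pi\<^sub>E {..<n} (\<lambda>i. D (s (p i))). ennreal (\<rho> x) \<partial>(PiM {..<n} (\<lambda>_. M)))
      = (\<integral>\<^sup>+x\<in>Pi\<^sub>E {..<n} (\<lambda>i. D (s i)). ennreal (\<rho> x) \<partial>(PiM {..<n} (\<lambda>_. M)))"
    using corr p D s unfolding correlation_function_def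
    by (intro nn_integral_box_permute[OF p, where B = "\<lambda>i. D (s i)"]) auto
  ultimately show ?thesis using main by simp
qed

section \<open>Random finite sets with joint intensities\<close>

text \<open>A random finite subset of \<open>\<Delta>\<close> with joint intensities \<open>\<rho>\<close>. The index set \<open>C\<close> of the disjoint
  sets consists of complex numbers because these sets will be the level sets of a complex simple
  function.\<close>

locale random_points = prob_space P + M: sigma_finite_measure M
  for P :: "'w measure" and M :: "'a measure" +
  fixes \<Delta> :: "'a set" and pts :: "'w \<Rightarrow> 'a set" and \<rho> :: "nat \<Rightarrow> (nat \<Rightarrow> 'a) \<Rightarrow> real"
  assumes \<Delta>: "\<Delta> \<in> sets M"
    and finite_pts: "\<omega> \<in> space P \<Longrightarrow> finite (pts \<omega>)" and pts_subset: "\<omega> \<in> space P \<Longrightarrow> pts \<omega> \<subseteq> \<Delta>"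
    and card_measurable: "B \<in> sets M \<Longrightarrow> B \<subseteq> \<Delta> \<Longrightarrow> (\<lambda>\<omega>. card (pts \<omega> \<inter> B)) \<in> measurable P (count_space UNIV)"
    and \<rho>_measurable: "\<rho> n \<in> borel_measurable (PiM {..<n} (\<lambda>_. M))"
    and \<rho>_nonneg: "x \<in> space (PiM {..<n} (\<lambda>_. M)) \<Longrightarrow> 0 \<le> \<rho> n x"
    and \<rho>_integrable: "integrable (PiM {..<n} (\<lambda>_. M)) (\<lambda>x. indicator (Pi\<^sub>E {..<n} (\<lambda>_. \<Delta>)) x * \<rho> n x)"
    and intensity: "\<And>(C :: complex set) D s. finite C \<Longrightarrow> disjoint_family_on D C \<Longrightarrow> (\<And>c. c \<in> C \<Longrightarrow> D c \<in> sets M \<and> D c \<subseteq> \<Delta>)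
       \<Longrightarrow> (\<And>i. i < n \<Longrightarrow> s i \<in> C) \<Longrightarrow>
       (\<integral>\<^sup>+\<omega>. ennreal (\<Prod>c\<in>C. falling_fact (card (pts \<omega> \<inter> D c)) (card {i. i < n \<and> s i = c})) \<partial>P) =
       (\<integral>\<^sup>+x\<in>Pi\<^sub>E {..<n} (\<lambda>i. D (s i)). ennreal (\<rho> n x) \<partial>(PiM {..<n} (\<lambda>_. M)))"
begin

definition weight :: "nat \<Rightarrow> (nat \<Rightarrow> 'a) \<Rightarrow> real" where
  "weight n x = indicator (Pi\<^sub>E {..<n} (\<lambda>_. \<Delta>)) x * \<rho> n x"

lemma weight_nonneg: "x \<in> space (PiM {..<n} (\<lambda>_. M)) \<Longrightarrow> 0 \<le> weight n x"
  using \<rho>_nonneg by (simp add: weight_def)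

lemma weight_integrable: "integrable (PiM {..<n} (\<lambda>_. M)) (weight n)"
  using \<rho>_integrable[of n] unfolding weight_def[abs_def] .

lemma intensity_integral:
  assumes C: "finite C" "disjoint_family_on D C" "\<And>c. c \<in> C \<Longrightarrow> D c \<in> sets M \<and> D c \<subseteq> \<Delta>" "\<And>i. i < n \<Longrightarrow> s i \<in> C"
  defines "F \<equiv> \<lambda>\<omega>. \<Prod>c\<in>(C::complex set). falling_fact (card (pts \<omega> \<inter> D c)) (card {i. i < n \<and> s i = c})"
  shows "integrable P F"
    and "expectation F = (LINT x|(PiM {..<n} (\<lambda>_. M)). indicator (Pi\<^sub>E {..<n} (\<lambda>i. D (s i))) x * weight n x)"
    and "integrable (PiM {..<n} (\<lambda>_. M)) (\<lambda>x. indicator (Pi\<^sub>E {..<n} (\<lambda>i. D (s i))) x * weight n x)"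
proof -
  let ?N = "PiM {..<n} (\<lambda>_. M)"
  have sub: "Pi\<^sub>E {..<n} (\<lambda>i. D (s i)) \<subseteq> Pi\<^sub>E {..<n} (\<lambda>_. \<Delta>)" using C by (intro PiE_mono) auto
  have S: "Pi\<^sub>E {..<n} (\<lambda>i. D (s i)) \<in> sets ?N" using C by (intro sets_PiM_I_finite) auto
  show i: "integrable ?N (\<lambda>x. indicator (Pi\<^sub>E {..<n} (\<lambda>i. D (s i))) x * weight n x)"
    using integrable_mult_indicator[OF S weight_integrable] by simp
  have meas: "F \<in> borel_measurable P"
    unfolding F_def using C by (intro borel_measurable_prod measurable_compose[OF card_measurable]) auto
  have "(\<integral>\<^sup>+\<omega>. ennreal (F \<omega>) \<partial>P) = (\<integral>\<^sup>+x\<in>Pi\<^sub>E {..<n} (\<lambda>i. D (s i)). ennreal (\<rho> n x) \<partial>?N)"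
    unfolding F_def by (rule intensity[OF C])
  also have "\<dots> = (\<integral>\<^sup>+x. ennreal (indicator (Pi\<^sub>E {..<n} (\<lambda>i. D (s i))) x * weight n x) \<partial>?N)"
    using sub by (intro nn_integral_cong) (auto simp: weight_def indicator_def)
  also have "\<dots> = ennreal (LINT x|?N. indicator (Pi\<^sub>E {..<n} (\<lambda>i. D (s i))) x * weight n x)"
    using weight_nonneg by (intro nn_integral_eq_integral i AE_I2) auto
  finally have e: "(\<integral>\<^sup>+\<omega>. ennreal (F \<omega>) \<partial>P) = ennreal (LINT x|?N. indicator (Pi\<^sub>E {..<n} (\<lambda>i. D (s i))) x * weight n x)" .
  have nn: "0 \<le> F \<omega>" for \<omega> unfolding F_def by (intro prod_nonneg) auto
  show "integrable P F" using e nn meas by (intro integrableI_nonneg) (auto simp: )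
  have "0 \<le> (LINT x|?N. indicator (Pi\<^sub>E {..<n} (\<lambda>i. D (s i))) x * weight n x)"
    using weight_nonneg by (intro Bochner_Integration.integral_nonneg) auto
  then show "expectation F = (LINT x|?N. indicator (Pi\<^sub>E {..<n} (\<lambda>i. D (s i))) x * weight n x)"
    using e nn meas by (subst integral_eq_nn_integral) auto
qed

text \<open>Taking \<open>D c\<close> to be the level sets of \<open>g\<close>, both sides are sums over the sequences of values
  of \<open>g\<close> at \<open>n\<close> points.\<close>

lemma expectation_esym_simple:
  fixes g :: "'a \<Rightarrow> complex"
  assumes g: "simple_function M g"
  shows "integrable P (\<lambda>\<omega>. esym g n (pts \<omega>))"
    and "fact n * expectation (\<lambda>\<omega>. esym g n (pts \<omega>)) = (LINT x|(PiM {..<n} (\<lambda>_. M)). (\<Prod>i<n. g (x i)) * of_real (weight n x))"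
    and "(\<lambda>\<omega>. esym g n (pts \<omega>)) \<in> borel_measurable P"
proof -
  let ?N = "PiM {..<n} (\<lambda>_. M)"
  define C where "C = g ` space M"
  define D where "D c = {x \<in> \<Delta>. g x = c}" for c
  have C: "finite C" using g by (simp add: simple_function_def C_def)
  have \<Delta>M: "\<Delta> \<subseteq> space M" using \<Delta> by (rule sets.sets_into_space)
  have D: "D c \<in> sets M \<and> D c \<subseteq> \<Delta>" for c
  proof -
    have "g -` {c} \<inter> space M \<inter> \<Delta> \<in> sets M" using simple_functionD(2)[OF g, of "{c}"] \<Delta> by blast
    moreover have "D c = g -` {c} \<inter> space M \<inter> \<Delta>" using \<Delta>M by (auto simp: D_def)
    ultimately show ?thesis by (auto simp: D_def)
  qed
  have disj: "disjoint_family_on D C" by (auto simp: disjoint_family_on_def D_def)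
  let ?S = "{..<n} \<rightarrow>\<^sub>E C"
  have finS: "finite ?S" using C by (simp add: finite_PiE)
  define F where "F s = (\<lambda>\<omega>. \<Prod>c\<in>C. falling_fact (card (pts \<omega> \<inter> D c)) (card {i. i < n \<and> s i = c}))" for s
  have sC: "s i \<in> C" if "s \<in> ?S" "i < n" for s i using that by auto
  have II: "integrable P (F s)" "expectation (F s) = (LINT x|?N. indicator (Pi\<^sub>E {..<n} (\<lambda>i. D (s i))) x * weight n x)"
    "integrable ?N (\<lambda>x. indicator (Pi\<^sub>E {..<n} (\<lambda>i. D (s i))) x * weight n x)" if "s \<in> ?S" for s
    unfolding F_def using intensity_integral[where n = n and s = s, OF C disj D sC[OF that]] by simp_all
  have e: "fact n * esym g n (pts \<omega>) = (\<Sum>s\<in>?S. (\<Prod>i<n. s i) * of_real (F s \<omega>))" if "\<omega> \<in> space P" for \<omega>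
    unfolding F_def D_def using finite_pts[OF that] pts_subset[OF that] C \<Delta>M
    by (intro esym_finite_range) (auto simp: C_def)
  then have e': "esym g n (pts \<omega>) = (\<Sum>s\<in>?S. (\<Prod>i<n. s i) * of_real (F s \<omega>)) / fact n" if "\<omega> \<in> space P" for \<omega>
    using that by (simp add: e[symmetric])
  have int: "integrable P (\<lambda>\<omega>. (\<Prod>i<n. s i) * complex_of_real (F s \<omega>))" if "s \<in> ?S" for s
    using II(1)[OF that] by (intro integrable_mult_right integrable_of_real)
  have "integrable P (\<lambda>\<omega>. (\<Sum>s\<in>?S. (\<Prod>i<n. s i) * complex_of_real (F s \<omega>)) / fact n)"
    by (intro integrable_divide Bochner_Integration.integrable_sum int)
  then show i: "integrable P (\<lambda>\<omega>. esym g n (pts \<omega>))"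
    using e' by (simp cong: Bochner_Integration.integrable_cong)
  then show "(\<lambda>\<omega>. esym g n (pts \<omega>)) \<in> borel_measurable P" by (rule borel_measurable_integrable)
  have "fact n * expectation (\<lambda>\<omega>. esym g n (pts \<omega>)) = expectation (\<lambda>\<omega>. \<Sum>s\<in>?S. (\<Prod>i<n. s i) * complex_of_real (F s \<omega>))"
    unfolding integral_mult_right_zero[symmetric] using e by (intro Bochner_Integration.integral_cong) auto
  also have "\<dots> = (\<Sum>s\<in>?S. (\<Prod>i<n. s i) * of_real (expectation (F s)))"
    using int by (subst Bochner_Integration.integral_sum) auto
  also have "\<dots> = (\<Sum>s\<in>?S. (\<Prod>i<n. s i) * of_real (LINT x|?N. indicator (Pi\<^sub>E {..<n} (\<lambda>i. D (s i))) x * weight n x))"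
    using II(2) by (intro sum.cong) auto
  also have "\<dots> = (\<Sum>s\<in>?S. LINT x|?N. (\<Prod>i<n. s i) * of_real (indicator (Pi\<^sub>E {..<n} (\<lambda>i. D (s i))) x * weight n x))"
    by (intro sum.cong refl) (simp only: integral_mult_right_zero integral_complex_of_real)
  also have "\<dots> = (LINT x|?N. (\<Sum>s\<in>?S. (\<Prod>i<n. s i) * of_real (indicator (Pi\<^sub>E {..<n} (\<lambda>i. D (s i))) x * weight n x)))"
    by (intro Bochner_Integration.integral_sum[symmetric] integrable_mult_right integrable_of_real II(3))
  also have "\<dots> = (LINT x|?N. (\<Prod>i<n. g (x i)) * of_real (weight n x))"
  proof (intro Bochner_Integration.integral_cong refl)
    fix x assume x: "x \<in> space ?N"
    show "(\<Sum>s\<in>?S. (\<Prod>i<n. s i) * complex_of_real (indicator (Pi\<^sub>E {..<n} (\<lambda>i. D (s i))) x * weight n x)) = (\<Prod>i<n. g (x i)) * of_real (weight n x)"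
    proof (cases "x \<in> Pi\<^sub>E {..<n} (\<lambda>_. \<Delta>)")
      case True
      define s0 where "s0 = restrict (\<lambda>i. g (x i)) {..<n}"
      have s0: "s0 \<in> ?S" using True \<Delta>M by (auto simp: s0_def C_def PiE_iff)
      have iff: "x \<in> Pi\<^sub>E {..<n} (\<lambda>i. D (s i)) \<longleftrightarrow> s = s0" if "s \<in> ?S" for s
        using that True by (auto simp: s0_def D_def PiE_iff extensional_def fun_eq_iff)
      have "(\<Sum>s\<in>?S. (\<Prod>i<n. s i) * complex_of_real (indicator (Pi\<^sub>E {..<n} (\<lambda>i. D (s i))) x * weight n x))
         = (\<Sum>s\<in>?S. if s = s0 then (\<Prod>i<n. s i) * of_real (weight n x) else 0)"
        using iff by (intro sum.cong refl) (simp add: indicator_def)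
      also have "\<dots> = (\<Prod>i<n. s0 i) * of_real (weight n x)" using finS s0 by simp
      finally show ?thesis by (simp add: s0_def)
    qed (simp add: weight_def)
  qed
  finally show "fact n * expectation (\<lambda>\<omega>. esym g n (pts \<omega>)) = (LINT x|?N. (\<Prod>i<n. g (x i)) * of_real (weight n x))" .
qed

text \<open>Approximation by simple functions. If these are bounded by \<open>K\<close>, the dominating function on
  the probability space is \<open>K ^ n\<close> times the number of \<open>n\<close>-element sets of points, which is
  integrable by the case of the constant function \<open>1\<close>.\<close>

theorem expectation_esym:
  fixes g :: "'a \<Rightarrow> complex"
  assumes g: "g \<in> borel_measurable M" and bd: "\<And>x. x \<in> space M \<Longrightarrow> cmod (g x) \<le> c"
  shows "integrable P (\<lambda>\<omega>. esym g n (pts \<omega>))"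
    and "fact n * expectation (\<lambda>\<omega>. esym g n (pts \<omega>)) = (LINT x|(PiM {..<n} (\<lambda>_. M)). (\<Prod>i<n. g (x i)) * of_real (weight n x))"
proof -
  let ?N = "PiM {..<n} (\<lambda>_. M)"
  obtain G where G0: "\<forall>j. simple_function M (G j)" "\<forall>x\<in>space M. (\<lambda>j. G j x) \<longlonglongrightarrow> g x"
    "\<forall>j. \<forall>x\<in>space M. dist (G j x) 0 \<le> 2 * dist (g x) 0"
    using borel_measurable_implies_sequence_metric[OF g, of 0] by blast
  then have G: "\<And>j. simple_function M (G j)" "\<And>x. x \<in> space M \<Longrightarrow> (\<lambda>j. G j x) \<longlonglongrightarrow> g x"
    "\<And>j x. x \<in> space M \<Longrightarrow> cmod (G j x) \<le> 2 * cmod (g x)" by auto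
  define K where "K = 2 * max c 0"
  have GK: "cmod (G j x) \<le> K" if "x \<in> space M" for j x
    using G(3)[OF that, of j] bd[OF that] by (auto simp: K_def)
  have K: "0 \<le> K" by (simp add: K_def)
  have sp: "pts \<omega> \<subseteq> space M" if "\<omega> \<in> space P" for \<omega>
    using pts_subset[OF that] sets.sets_into_space[OF \<Delta>] by blast
  note S = expectation_esym_simple[OF G(1)]
  have one: "integrable P (\<lambda>\<omega>. esym (\<lambda>_. 1 :: complex) n (pts \<omega>))"
    by (rule expectation_esym_simple) simp
  have dom: "integrable P (\<lambda>\<omega>. K ^ n * norm (esym (\<lambda>_. 1 :: complex) n (pts \<omega>)))"
    by (intro integrable_mult_right integrable_norm one)
  have lim: "(\<lambda>j. esym (G j) n (pts \<omega>)) \<longlonglongrightarrow> esym g n (pts \<omega>)" if "\<omega> \<in> space P" for \<omega>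
    unfolding esym_def using sp[OF that] by (intro tendsto_sum tendsto_prod G(2)) auto
  have bound: "norm (esym (G j) n (pts \<omega>)) \<le> K ^ n * norm (esym (\<lambda>_. 1 :: complex) n (pts \<omega>))" if \<omega>: "\<omega> \<in> space P" for j \<omega>
  proof -
    have "norm (esym (G j) n (pts \<omega>)) \<le> esym (\<lambda>x. cmod (G j x)) n (pts \<omega>)" by (rule norm_esym_le)
    also have "\<dots> \<le> esym (\<lambda>x. K * 1) n (pts \<omega>)" using GK sp[OF \<omega>] by (intro esym_mono) auto
    also have "\<dots> = K ^ n * esym (\<lambda>_. 1) n (pts \<omega>)" by (rule esym_scale)
    also have "esym (\<lambda>_. 1 :: real) n (pts \<omega>) = norm (esym (\<lambda>_. 1 :: complex) n (pts \<omega>))"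
      by (simp add: esym_def)
    finally show ?thesis .
  qed
  have meas: "(\<lambda>\<omega>. esym g n (pts \<omega>)) \<in> borel_measurable P"
    by (rule borel_measurable_LIMSEQ_metric[OF S(3) lim])
  show "integrable P (\<lambda>\<omega>. esym g n (pts \<omega>))"
    by (rule integrable_dominated_convergence[where s = "\<lambda>j \<omega>. esym (G j) n (pts \<omega>)", OF meas S(3) dom]) (use lim bound in auto)
  have "(\<lambda>j. expectation (\<lambda>\<omega>. esym (G j) n (pts \<omega>))) \<longlonglongrightarrow> expectation (\<lambda>\<omega>. esym g n (pts \<omega>))"
    by (rule integral_dominated_convergence[where s = "\<lambda>j \<omega>. esym (G j) n (pts \<omega>)", OF meas S(3) dom]) (use lim bound in auto)
  then have lim1: "(\<lambda>j. fact n * expectation (\<lambda>\<omega>. esym (G j) n (pts \<omega>))) \<longlonglongrightarrow> fact n * expectation (\<lambda>\<omega>. esym g n (pts \<omega>))"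
    by (intro tendsto_intros)
  have xs: "x i \<in> space M" if "x \<in> space ?N" "i < n" for x i using that by (auto simp: space_PiM)
  have Gm: "G j \<in> borel_measurable M" for j using G(1) by (rule borel_measurable_simple_function)
  have pm: "(\<lambda>x. (\<Prod>i<n. h (x i)) * complex_of_real (weight n x)) \<in> borel_measurable ?N" if h: "h \<in> borel_measurable M" for h :: "'a \<Rightarrow> complex"
  proof -
    have "(\<lambda>x. h (x i)) \<in> borel_measurable ?N" if "i < n" for i
      using measurable_compose[OF measurable_component_singleton[of i "{..<n}" "\<lambda>_. M"] h] that by simp
    then show ?thesis
      using borel_measurable_integrable[OF weight_integrable[of n]] by (intro borel_measurable_times borel_measurable_prod borel_measurable_of_real) auto
  qed
  have "(\<lambda>j. LINT x|?N. (\<Prod>i<n. G j (x i)) * complex_of_real (weight n x)) \<longlonglongrightarrow> (LINT x|?N. (\<Prod>i<n. g (x i)) * of_real (weight n x))"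
  proof (rule integral_dominated_convergence[where w = "\<lambda>x. K ^ n * weight n x"])
    show "integrable ?N (\<lambda>x. K ^ n * weight n x)" by (intro integrable_mult_right weight_integrable)
    show "AE x in ?N. (\<lambda>j. (\<Prod>i<n. G j (x i)) * complex_of_real (weight n x)) \<longlonglongrightarrow> (\<Prod>i<n. g (x i)) * of_real (weight n x)"
      using xs by (intro AE_I2 tendsto_mult tendsto_prod tendsto_const G(2)) auto
    show "AE x in ?N. norm ((\<Prod>i<n. G j (x i)) * complex_of_real (weight n x)) \<le> K ^ n * weight n x" for j
    proof (intro AE_I2)
      fix x assume x: "x \<in> space ?N"
      have "(\<Prod>i<n. cmod (G j (x i))) \<le> (\<Prod>i<n. K)" using xs[OF x] GK by (intro prod_mono) auto
      then show "norm ((\<Prod>i<n. G j (x i)) * complex_of_real (weight n x)) \<le> K ^ n * weight n x"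
        using weight_nonneg[OF x] by (simp add: norm_mult prod_norm[symmetric] mult_right_mono)
    qed
  qed (use pm g Gm in auto)
  then have lim2: "(\<lambda>j. fact n * expectation (\<lambda>\<omega>. esym (G j) n (pts \<omega>))) \<longlonglongrightarrow> (LINT x|?N. (\<Prod>i<n. g (x i)) * of_real (weight n x))"
    by (simp only: S(2))
  show "fact n * expectation (\<lambda>\<omega>. esym g n (pts \<omega>)) = (LINT x|?N. (\<Prod>i<n. g (x i)) * of_real (weight n x))"
    by (rule LIMSEQ_unique[OF lim1 lim2])
qed

end

section \<open>Determinantal intensities with a \<open>J\<close>-symmetric kernel\<close>

lemma (in sigma_finite_measure) hs_mult_right:
  assumes A: "hs_kernel M A" and u: "u \<in> borel_measurable M" and U: "\<And>x. x \<in> space M \<Longrightarrow> cmod (u x) \<le> U" and U0: "0 \<le> U"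
  shows "hs_kernel M (\<lambda>x y. A x y * u y)" and "hs_norm M (\<lambda>x y. A x y * u y) \<le> U * hs_norm M A"
proof -
  have le: "(cmod (A x y * u y))\<^sup>2 \<le> U\<^sup>2 * (cmod (A x y))\<^sup>2" if "y \<in> space M" for x y
  proof -
    have "(cmod (A x y))\<^sup>2 * (cmod (u y))\<^sup>2 \<le> (cmod (A x y))\<^sup>2 * U\<^sup>2"
      using U[OF that] by (intro mult_left_mono power_mono) auto
    then show ?thesis by (simp add: norm_mult power_mult_distrib mult.commute)
  qed
  have iA: "integrable (M \<Otimes>\<^sub>M M) (\<lambda>(x, y). (cmod (A x y))\<^sup>2)" using A by (simp add: hs_kernel_def)
  have iU: "integrable (M \<Otimes>\<^sub>M M) (\<lambda>p. U\<^sup>2 * (case p of (x, y) \<Rightarrow> (cmod (A x y))\<^sup>2))"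
    by (intro integrable_mult_right iA)
  have m: "(\<lambda>(x, y). A x y * u y) \<in> borel_measurable (M \<Otimes>\<^sub>M M)"
    unfolding case_prod_unfold
    by (intro borel_measurable_times hs_measurable_compose[OF A] measurable_compose[OF measurable_snd u]) auto
  have i: "integrable (M \<Otimes>\<^sub>M M) (\<lambda>(x, y). (cmod (A x y * u y))\<^sup>2)"
  proof (rule Bochner_Integration.integrable_bound[OF iU])
    show "(\<lambda>(x, y). (cmod (A x y * u y))\<^sup>2) \<in> borel_measurable (M \<Otimes>\<^sub>M M)"
      using m unfolding case_prod_unfold by measurable
    show "AE p in M \<Otimes>\<^sub>M M. norm (case p of (x, y) \<Rightarrow> (cmod (A x y * u y))\<^sup>2) \<le> norm (U\<^sup>2 * (case p of (x, y) \<Rightarrow> (cmod (A x y))\<^sup>2))"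
      using le by (intro AE_I2) (auto simp: space_pair_measure)
  qed
  have row: "integrable M (\<lambda>y. (cmod (A x y * u y))\<^sup>2)" if x: "x \<in> space M" for x
  proof (rule Bochner_Integration.integrable_bound[OF integrable_mult_right[OF hs_row(3)[OF A x], of "U\<^sup>2"]])
    show "(\<lambda>y. (cmod (A x y * u y))\<^sup>2) \<in> borel_measurable M" using hs_row(1)[OF A x] u by measurable
    show "AE y in M. norm ((cmod (A x y * u y))\<^sup>2) \<le> norm (U\<^sup>2 * (cmod (A x y))\<^sup>2)"
      using le by (intro AE_I2) auto
  qed
  have col: "integrable M (\<lambda>x. (cmod (A x y * u y))\<^sup>2)" if y: "y \<in> space M" for y
    using integrable_mult_left[OF hs_row(4)[OF A y], of "(cmod (u y))\<^sup>2"] by (simp add: norm_mult power_mult_distrib)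
  show "hs_kernel M (\<lambda>x y. A x y * u y)"
    unfolding hs_kernel_def using m i row col by auto
  have "(hs_norm M (\<lambda>x y. A x y * u y))\<^sup>2 \<le> (integral\<^sup>L (M \<Otimes>\<^sub>M M) (\<lambda>p. U\<^sup>2 * (case p of (x, y) \<Rightarrow> (cmod (A x y))\<^sup>2)))"
    unfolding hs_norm_sq using le by (intro integral_mono i iU) (auto simp: space_pair_measure)
  also have "\<dots> = (U * hs_norm M A)\<^sup>2" by (simp add: power_mult_distrib hs_norm_sq)
  finally have sq: "(hs_norm M (\<lambda>x y. A x y * u y))\<^sup>2 \<le> (U * hs_norm M A)\<^sup>2" .
  show "hs_norm M (\<lambda>x y. A x y * u y) \<le> U * hs_norm M A"
    using sq U0 by (intro power2_le_imp_le[OF sq]) auto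
qed

lemma (in sigma_finite_measure) hs_mult_left:
  assumes A: "hs_kernel M A" and u: "u \<in> borel_measurable M" and U: "\<And>x. x \<in> space M \<Longrightarrow> cmod (u x) \<le> U" and U0: "0 \<le> U"
  shows "hs_kernel M (\<lambda>x y. u x * A x y)" and "hs_norm M (\<lambda>x y. u x * A x y) \<le> U * hs_norm M A"
proof -
  have cu: "(\<lambda>x. cnj (u x)) \<in> borel_measurable M"
    by (rule measurable_compose[OF u borel_measurable_continuous_onI[OF continuous_on_cnj[OF continuous_on_id]]])
  have e: "(\<lambda>x y. u x * A x y) = kernel_adj (\<lambda>x y. kernel_adj A x y * cnj (u y))"
    by (simp add: kernel_adj_def mult.commute)
  note r = hs_mult_right[OF hs_adj(1)[OF A] cu, of U]
  show "hs_kernel M (\<lambda>x y. u x * A x y)" unfolding e using U U0 by (intro hs_adj(1) r(1)) auto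
  show "hs_norm M (\<lambda>x y. u x * A x y) \<le> U * hs_norm M A"
    unfolding e using U U0 r hs_adj(2)[of "\<lambda>x y. kernel_adj A x y * cnj (u y)"] hs_adj(2)[OF A] by simp
qed

lemma (in sigma_finite_measure) hermitian_traces_kernel:
  assumes G: "hs_kernel M G" and herm: "\<And>x y. x \<in> space M \<Longrightarrow> y \<in> space M \<Longrightarrow> kernel_adj G x y = G x y"
  shows "hermitian_traces (\<lambda>n. hs_norm M (kernel_pow M G n)) (\<lambda>n. kernel_trace M (kernel_pow M G n))"
proof
  show "0 \<le> hs_norm M (kernel_pow M G n)" for n by simp
  show "hs_norm M (kernel_pow M G (Suc (m + n))) \<le> hs_norm M (kernel_pow M G m) * hs_norm M (kernel_pow M G n)" for m n
    by (rule hs_norm_pow_submultiplicative[OF G])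
  show "kernel_trace M (kernel_pow M G (Suc (2 * n))) = of_real ((hs_norm M (kernel_pow M G n))\<^sup>2)" for n
    by (rule trace_even_pow[OF G herm])
  fix m n
  have "kernel_trace M (kernel_pow M G (Suc (m + n))) = kernel_trace M (kernel_comp M (kernel_pow M G m) (kernel_pow M G n))"
    using kernel_pow_comp[OF G] by (intro trace_cong) simp
  then show "cmod (kernel_trace M (kernel_pow M G (Suc (m + n)))) \<le> hs_norm M (kernel_pow M G m) * hs_norm M (kernel_pow M G n)"
    using trace_comp(4)[OF hs_kernel_pow[OF G] hs_kernel_pow[OF G]] by simp
qed

context random_points
begin

text \<open>For a given finite set of points the expansion of the product into elementary symmetric
  functions is a finite sum. The summability hypothesis is what permits taking expectations term
  by term although the number of points is unbounded.\<close>

lemma expected_product_series: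
  fixes g :: "'a \<Rightarrow> complex"
  assumes g: "g \<in> borel_measurable M" and bd: "\<And>x. x \<in> space M \<Longrightarrow> cmod (g x) \<le> c"
    and summ: "summable (\<lambda>n. s ^ n * expectation (\<lambda>\<omega>. esym (\<lambda>x. cmod (g x)) n (pts \<omega>)))"
    and z: "cmod z \<le> s"
  shows "integrable P (\<lambda>\<omega>. \<Prod>x\<in>pts \<omega>. 1 + z * g x)"
    and "(\<lambda>n. z ^ n * expectation (\<lambda>\<omega>. esym g n (pts \<omega>))) sums expectation (\<lambda>\<omega>. \<Prod>x\<in>pts \<omega>. 1 + z * g x)"
proof -
  let ?f = "\<lambda>n \<omega>. z ^ n * esym g n (pts \<omega>)"
  have gn: "(\<lambda>x. complex_of_real (cmod (g x))) \<in> borel_measurable M" using g by simp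
  have "integrable P (\<lambda>\<omega>. esym (\<lambda>x. complex_of_real (cmod (g x))) n (pts \<omega>))" for n
    using bd by (intro expectation_esym(1)[OF gn, of c]) auto
  then have inn: "integrable P (\<lambda>\<omega>. esym (\<lambda>x. cmod (g x)) n (pts \<omega>))" for n
    unfolding esym_of_real complex_of_real_integrable_eq .
  have int: "integrable P (?f n)" for n by (intro integrable_mult_right expectation_esym(1)[OF g bd])
  have fs: "?f n \<omega> = 0" if "\<omega> \<in> space P" "n \<notin> {..card (pts \<omega>)}" for n \<omega>
    using esym_zero[OF finite_pts[OF that(1)], of n g] that(2) by simp
  have sum_f: "(\<lambda>n. ?f n \<omega>) sums (\<Prod>x\<in>pts \<omega>. 1 + z * g x)" if \<omega>: "\<omega> \<in> space P" for \<omega>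
    unfolding prod_one_plus_esym[OF finite_pts[OF \<omega>]] by (rule sums_finite) (use fs[OF \<omega>] in auto)
  have summ_norm: "summable (\<lambda>n. norm (?f n \<omega>))" if \<omega>: "\<omega> \<in> space P" for \<omega>
    by (rule summable_finite[of "{..card (pts \<omega>)}"]) (use fs[OF \<omega>] in auto)
  have s0: "0 \<le> s" using z norm_ge_zero order_trans by blast
  have summ2: "summable (\<lambda>n. expectation (\<lambda>\<omega>. norm (?f n \<omega>)))"
  proof (rule summable_comparison_test'[OF summ, of 0])
    fix n :: nat
    have "expectation (\<lambda>\<omega>. norm (?f n \<omega>)) \<le> expectation (\<lambda>\<omega>. s ^ n * esym (\<lambda>x. cmod (g x)) n (pts \<omega>))"
    proof (intro integral_mono integrable_norm int integrable_mult_right inn)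
      fix \<omega>
      show "norm (?f n \<omega>) \<le> s ^ n * esym (\<lambda>x. cmod (g x)) n (pts \<omega>)"
        unfolding norm_mult norm_power using z norm_esym_le[of g n "pts \<omega>"] by (intro mult_mono power_mono) (auto intro: zero_le_power[OF s0])
    qed
    then show "norm (expectation (\<lambda>\<omega>. norm (?f n \<omega>))) \<le> s ^ n * expectation (\<lambda>\<omega>. esym (\<lambda>x. cmod (g x)) n (pts \<omega>))"
      by simp
  qed
  have ae: "AE \<omega> in P. summable (\<lambda>n. norm (?f n \<omega>))" using summ_norm by (intro AE_I2)
  have eq: "(\<Sum>n. ?f n \<omega>) = (\<Prod>x\<in>pts \<omega>. 1 + z * g x)" if "\<omega> \<in> space P" for \<omega>
    using sums_unique[OF sum_f[OF that]] by simp
  have "integrable P (\<lambda>\<omega>. \<Sum>n. ?f n \<omega>)" by (rule integrable_suminf[OF int ae summ2])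
  then show "integrable P (\<lambda>\<omega>. \<Prod>x\<in>pts \<omega>. 1 + z * g x)"
    using eq by (simp cong: Bochner_Integration.integrable_cong)
  have "(\<lambda>n. expectation (?f n)) sums expectation (\<lambda>\<omega>. \<Sum>n. ?f n \<omega>)" by (rule sums_integral[OF int ae summ2])
  moreover have "expectation (\<lambda>\<omega>. \<Sum>n. ?f n \<omega>) = expectation (\<lambda>\<omega>. \<Prod>x\<in>pts \<omega>. 1 + z * g x)"
    using eq by (intro Bochner_Integration.integral_cong) auto
  ultimately show "(\<lambda>n. z ^ n * expectation (\<lambda>\<omega>. esym g n (pts \<omega>))) sums expectation (\<lambda>\<omega>. \<Prod>x\<in>pts \<omega>. 1 + z * g x)"
    by simp
qed

lemma esym_real_integrable:
  fixes g :: "'a \<Rightarrow> real"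
  assumes g: "g \<in> borel_measurable M" and bd: "\<And>x. x \<in> space M \<Longrightarrow> \<bar>g x\<bar> \<le> c"
  shows "integrable P (\<lambda>\<omega>. esym g n (pts \<omega>))"
    and "expectation (\<lambda>\<omega>. esym (\<lambda>x. complex_of_real (g x)) n (pts \<omega>)) = of_real (expectation (\<lambda>\<omega>. esym g n (pts \<omega>)))"
proof -
  have gn: "(\<lambda>x. complex_of_real (g x)) \<in> borel_measurable M" using g by simp
  have "integrable P (\<lambda>\<omega>. esym (\<lambda>x. complex_of_real (g x)) n (pts \<omega>))"
    using bd by (intro expectation_esym(1)[OF gn, of c]) auto
  then show "integrable P (\<lambda>\<omega>. esym g n (pts \<omega>))"
    unfolding esym_of_real complex_of_real_integrable_eq .
  show "expectation (\<lambda>\<omega>. esym (\<lambda>x. complex_of_real (g x)) n (pts \<omega>)) = of_real (expectation (\<lambda>\<omega>. esym g n (pts \<omega>)))"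
    unfolding esym_of_real integral_complex_of_real ..
qed

end

text \<open>\<open>J\<close> is the sign that distinguishes the two parts. The symmetry of \<open>k\<close> holds at all points,
  whereas the determinants are related to the intensities only almost everywhere.\<close>

locale det_points = random_points P M \<Delta> pts \<rho>
  for P :: "'w measure" and M :: "'a measure" and \<Delta> pts \<rho> +
  fixes J :: "'a \<Rightarrow> real" and k :: "'a kernel"
  assumes J_measurable: "J \<in> borel_measurable M" and J_sign: "J x = 1 \<or> J x = -1"
    and k_nice: "M.nice_kernel k"
    and k_sym: "x \<in> space M \<Longrightarrow> y \<in> space M \<Longrightarrow> k y x = of_real (J x * J y) * cnj (k x y)"
    and weight_det: "AE x in PiM {..<n} (\<lambda>_. M). of_real (weight n x) = (\<Sum>q | q permutes {..<n}. of_int (sign q) * (\<Prod>i<n. k (x i) (x (q i))))"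
begin

lemma J_abs [simp]: "\<bar>J x\<bar> = 1" and J_sq [simp]: "J x * J x = 1"
  using J_sign[of x] by auto

lemma k_hs: "hs_kernel M k" using k_nice by (simp add: M.nice_kernel_def)

text \<open>A weight \<open>\<theta> * D\<^sup>2\<close> could be attached to one argument of \<open>k\<close>. Distributing the factor \<open>D\<close>
  over both sides leaves all cyclic products unchanged and has the advantage that the kernel is
  Hermitian when \<open>\<theta>\<close> is \<open>J\<close>.\<close>

definition twist :: "('a \<Rightarrow> complex) \<Rightarrow> ('a \<Rightarrow> real) \<Rightarrow> 'a kernel" where
  "twist \<theta> D = (\<lambda>x y. \<theta> x * of_real (D x) * k x y * of_real (D y))"

lemma twist_nice:
  assumes \<theta>: "\<theta> \<in> borel_measurable M" "\<And>x. x \<in> space M \<Longrightarrow> cmod (\<theta> x) \<le> 1"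
    and D: "D \<in> borel_measurable M" "\<And>x. x \<in> space M \<Longrightarrow> \<bar>D x\<bar> \<le> d"
  shows "M.nice_kernel (twist \<theta> D)"
proof -
  have m: "(\<lambda>x. \<theta> x * of_real (D x)) \<in> borel_measurable M" "(\<lambda>x. complex_of_real (D x)) \<in> borel_measurable M"
    using \<theta> D by measurable
  have b: "cmod (\<theta> x * of_real (D x)) \<le> d" if "x \<in> space M" for x
    using mult_mono[OF \<theta>(2)[OF that] D(2)[OF that]] by (simp add: norm_mult)
  have hs: "hs_kernel M (twist \<theta> D)"
    unfolding twist_def using D(2) b
    by (intro M.hs_mult_right(1)[where U = "\<bar>d\<bar>"] M.hs_mult_left(1)[where U = "\<bar>d\<bar>"] k_hs m) (auto intro: order_trans[OF _ abs_ge_self])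
  have tk: "integrable M (\<lambda>x. k x x)" using k_nice by (simp add: M.nice_kernel_def)
  have "integrable M (\<lambda>x. twist \<theta> D x x)"
  proof (rule Bochner_Integration.integrable_bound[OF integrable_mult_right[OF tk, of "complex_of_real (d * d)"]])
    show "(\<lambda>x. twist \<theta> D x x) \<in> borel_measurable M"
      unfolding twist_def using m borel_measurable_integrable[OF tk] by measurable
    show "AE x in M. norm (twist \<theta> D x x) \<le> norm (complex_of_real (d * d) * k x x)"
    proof (intro AE_I2)
      fix x assume x: "x \<in> space M"
      have d: "0 \<le> d" using D(2)[OF x] by linarith
      have "cmod (\<theta> x * of_real (D x)) * cmod (of_real (D x)) \<le> d * d"
        using b[OF x] D(2)[OF x] d by (intro mult_mono) auto
      then have "cmod (\<theta> x * of_real (D x)) * cmod (of_real (D x)) * cmod (k x x) \<le> d * d * cmod (k x x)"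
        by (rule mult_right_mono) simp
      then show "norm (twist \<theta> D x x) \<le> norm (complex_of_real (d * d) * k x x)"
        using d by (simp add: twist_def norm_mult mult_ac)
    qed
  qed
  then show ?thesis using hs by (simp add: M.nice_kernel_def)
qed

text \<open>The weights at the \<open>n\<close> points can be moved into the determinant of \<open>k\<close>, because the factors
  \<open>D (x (q i))\<close> are a rearrangement of the \<open>D (x i)\<close>. The result is the determinant of the twisted
  kernel, to which \<open>det_integral_newton\<close> applies.\<close>

lemma expectation_esym_fredholm:
  assumes \<theta>: "\<theta> \<in> borel_measurable M" "\<And>x. x \<in> space M \<Longrightarrow> cmod (\<theta> x) \<le> 1"
    and D: "D \<in> borel_measurable M" "\<And>x. x \<in> space M \<Longrightarrow> \<bar>D x\<bar> \<le> d"
  shows "expectation (\<lambda>\<omega>. esym (\<lambda>x. \<theta> x * of_real ((D x)\<^sup>2)) n (pts \<omega>))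
    = fredholm_coeff (\<lambda>m. kernel_trace M (kernel_pow M (twist \<theta> D) m)) n"
proof -
  let ?g = "\<lambda>x. \<theta> x * complex_of_real ((D x)\<^sup>2)"
  have g: "?g \<in> borel_measurable M" using \<theta> D by measurable
  have gb: "cmod (?g x) \<le> 1 * d\<^sup>2" if "x \<in> space M" for x
  proof -
    have "\<bar>D x\<bar>\<^sup>2 \<le> d\<^sup>2" using D(2)[OF that] by (intro power_mono) auto
    then show ?thesis unfolding norm_mult using \<theta>(2)[OF that] by (intro mult_mono) (auto simp: norm_power)
  qed
  have "fact n * expectation (\<lambda>\<omega>. esym ?g n (pts \<omega>)) = (LINT x|(PiM {..<n} (\<lambda>_. M)). (\<Prod>i<n. ?g (x i)) * of_real (weight n x))"
    by (rule expectation_esym(2)[OF g gb])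
  also have "\<dots> = (LINT x|(PiM {..<n} (\<lambda>_. M)). (\<Sum>q | q permutes {..<n}. of_int (sign q) * (\<Prod>i<n. twist \<theta> D (x i) (x (q i)))))"
  proof (rule integral_cong_AE)
    have gi: "(\<lambda>x. ?g (x i)) \<in> borel_measurable (PiM {..<n} (\<lambda>_. M))" if "i < n" for i
      using measurable_compose[OF measurable_component_singleton[of i "{..<n}" "\<lambda>_. M"] g] that by simp
    have "(\<lambda>x. \<Prod>i<n. ?g (x i)) \<in> borel_measurable (PiM {..<n} (\<lambda>_. M))"
      by (rule borel_measurable_prod, rule gi, simp)
    then show "(\<lambda>x. (\<Prod>i<n. ?g (x i)) * of_real (weight n x)) \<in> borel_measurable (PiM {..<n} (\<lambda>_. M))"
      by (rule borel_measurable_times[OF _ measurable_compose[OF borel_measurable_integrable[OF weight_integrable] borel_measurable_of_real]])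
    show "(\<lambda>x. \<Sum>q | q permutes {..<n}. of_int (sign q) * (\<Prod>i<n. twist \<theta> D (x i) (x (q i)))) \<in> borel_measurable (PiM {..<n} (\<lambda>_. M))"
      by (intro borel_measurable_integrable Bochner_Integration.integrable_sum integrable_mult_right M.perm_prod_integrable twist_nice[OF assms]) auto
    show "AE x in PiM {..<n} (\<lambda>_. M). (\<Prod>i<n. ?g (x i)) * of_real (weight n x) = (\<Sum>q | q permutes {..<n}. of_int (sign q) * (\<Prod>i<n. twist \<theta> D (x i) (x (q i))))"
      using weight_det[of n]
    proof eventually_elim
      case (elim x)
      have "(\<Prod>i<n. twist \<theta> D (x i) (x (q i))) = (\<Prod>i<n. ?g (x i)) * (\<Prod>i<n. k (x i) (x (q i)))" if q: "q permutes {..<n}" for q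
      proof -
        have "(\<Prod>i<n. complex_of_real (D (x (q i)))) = (\<Prod>i<n. of_real (D (x i)))"
          using prod.permute[OF q, of "\<lambda>i. complex_of_real (D (x i))"] by (simp add: o_def)
        then show ?thesis by (simp add: twist_def prod.distrib power2_eq_square mult_ac)
      qed
      then show ?case unfolding elim sum_distrib_left by (intro sum.cong refl) (simp add: mult_ac)
    qed
  qed
  also have "\<dots> = M.det_integral (twist \<theta> D) {..<n}" by (simp add: M.det_integral_def)
  finally have e: "fact n * expectation (\<lambda>\<omega>. esym ?g n (pts \<omega>)) = M.det_integral (twist \<theta> D) {..<n}" .
  show ?thesis
  proof (cases n)
    case 0
    then show ?thesis using e M.det_integral_newton(1)[OF twist_nice[OF assms]] by (simp add: fredholm_coeff_def)
  next
    case (Suc m)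
    have "expectation (\<lambda>\<omega>. esym ?g n (pts \<omega>)) = M.det_integral (twist \<theta> D) {..<n} / fact n"
      using e by (simp add: field_simps)
    then show ?thesis using M.det_integral_newton(2)[OF twist_nice[OF assms], of m] Suc by (simp add: fredholm_coeff_def)
  qed
qed

end

section \<open>Exponential moments and the operator norm of the kernel\<close>

context det_points
begin

text \<open>The kernel \<open>J x * k x y\<close> is Hermitian, and the twisted kernel is obtained from it by a sign
  and by multiplication with \<open>D\<close> on both sides.\<close>

lemma twist_hermitian:
  assumes \<theta>: "\<And>x. \<theta> x = 0 \<or> \<theta> x = of_real (J x * \<epsilon>)" and \<epsilon>: "\<epsilon> = 1 \<or> \<epsilon> = -1"
    and D: "\<And>x. \<theta> x = 0 \<Longrightarrow> D x = 0"
    and xy: "x \<in> space M" "y \<in> space M"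
  shows "kernel_adj (twist \<theta> D) x y = twist \<theta> D x y"
proof (cases "\<theta> x = 0 \<or> \<theta> y = 0")
  case True
  then show ?thesis using D by (auto simp: kernel_adj_def twist_def)
next
  case False
  then have \<theta>': "\<theta> x = of_real (J x * \<epsilon>)" "\<theta> y = of_real (J y * \<epsilon>)" using \<theta> by auto
  have J: "complex_of_real (J y) * complex_of_real (J y) = 1" by (simp flip: of_real_mult)
  have "kernel_adj (twist \<theta> D) x y = of_real (J y * \<epsilon>) * of_real (D y) * cnj (k y x) * of_real (D x)"
    using \<theta>' by (simp add: kernel_adj_def twist_def)
  also have "cnj (k y x) = of_real (J x * J y) * k x y" unfolding k_sym[OF xy] by simp
  also have "of_real (J y * \<epsilon>) * of_real (D y) * (of_real (J x * J y) * k x y) * of_real (D x)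
     = (complex_of_real (J y) * complex_of_real (J y)) * (of_real (J x * \<epsilon>) * of_real (D x) * k x y * of_real (D y))"
    by (simp add: mult_ac)
  also have "\<dots> = twist \<theta> D x y" unfolding J using \<theta>' by (simp add: twist_def)
  finally show ?thesis .
qed

lemma pos_expectation:
  fixes X :: "'w \<Rightarrow> real"
  assumes "integrable P X" "\<And>\<omega>. \<omega> \<in> space P \<Longrightarrow> 0 < X \<omega>"
  shows "0 < expectation X"
  by (rule expectation_greater[OF assms(1)]) (use assms(2) in \<open>auto intro: AE_I2\<close>)

lemma power_card_measurable: "S \<in> sets M \<Longrightarrow> S \<subseteq> \<Delta> \<Longrightarrow> (\<lambda>\<omega>. (a::real) ^ card (pts \<omega> \<inter> S)) \<in> borel_measurable P"
  by (rule measurable_compose[OF card_measurable]) auto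

lemma power_card_integrable_le1:
  assumes "S \<in> sets M" "S \<subseteq> \<Delta>" "0 \<le> a" "a \<le> 1"
  shows "integrable P (\<lambda>\<omega>. (a::real) ^ card (pts \<omega> \<inter> S))"
proof (rule integrable_const_bound[where B = 1])
  show "AE \<omega> in P. norm (a ^ card (pts \<omega> \<inter> S)) \<le> 1"
    using assms by (intro AE_I2) (simp add: power_le_one)
qed (rule power_card_measurable[OF assms(1,2)])

lemma prod_indicator_power:
  fixes z :: "'b::comm_semiring_1"
  assumes "finite A"
  shows "(\<Prod>x\<in>A. 1 + z * indicator S x) = (1 + z) ^ card (A \<inter> S)"
proof -
  have "(\<Prod>x\<in>A. 1 + z * indicator S x) = (\<Prod>x\<in>A. if x \<in> S then 1 + z else 1)"
    by (intro prod.cong refl) (auto simp: indicator_def)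
  also have "\<dots> = (1 + z) ^ card (A \<inter> S)" using assms by (simp add: prod.If_cases Int_def)
  finally show ?thesis .
qed

text \<open>On a set \<open>S\<close> where \<open>J\<close> is constant, \<open>k\<close> itself is Hermitian, and its Fredholm determinant on
  \<open>S\<close> is \<open>E (1 + z)\<^sup>N\<close>, with \<open>N\<close> the number of points in \<open>S\<close>. At \<open>t \<ge> 0\<close> it is at least \<open>1\<close>, since
  its coefficients are expectations of non-negative quantities, and at \<open>- t\<close> it equals
  \<open>E (1 - t)\<^sup>N\<close>, which is at least \<open>E (1 - r)\<^sup>N > 0\<close> for \<open>t \<le> r < 1\<close>. The continuation principle
  \<open>summable_by_continuation\<close> then reaches every \<open>t < 1\<close>.\<close>

lemma exponential_moment_one_part:
  assumes S: "S \<in> sets M" "S \<subseteq> \<Delta>" and JS: "\<And>x y. x \<in> S \<Longrightarrow> y \<in> S \<Longrightarrow> J x = J y"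
    and t: "0 \<le> t" "t < (1::real)"
  shows "integrable P (\<lambda>\<omega>. (1 + t) ^ card (pts \<omega> \<inter> S))"
proof -
  define \<theta> where "\<theta> x = (indicator S x :: complex)" for x
  define D where "D x = (indicator S x :: real)" for x
  define G where "G = twist \<theta> D"
  define p where "p m = kernel_trace M (kernel_pow M G m)" for m
  have \<theta>: "\<theta> \<in> borel_measurable M" "\<And>x. x \<in> space M \<Longrightarrow> cmod (\<theta> x) \<le> 1"
    and D: "D \<in> borel_measurable M" "\<And>x. x \<in> space M \<Longrightarrow> \<bar>D x\<bar> \<le> 1"
    using S by (auto simp: \<theta>_def[abs_def] D_def[abs_def] indicator_def)
  obtain \<epsilon> where \<epsilon>: "\<epsilon> = 1 \<or> \<epsilon> = (-1::real)" "\<And>x. x \<in> S \<Longrightarrow> J x = \<epsilon>"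
    using JS J_sign by (metis (full_types))
  have Gnice: "M.nice_kernel G" unfolding G_def by (rule twist_nice[OF \<theta> D])
  then have Ghs: "hs_kernel M G" by (simp add: M.nice_kernel_def)
  have Gherm: "kernel_adj G x y = G x y" if "x \<in> space M" "y \<in> space M" for x y
    unfolding G_def
  proof (rule twist_hermitian[where \<epsilon> = \<epsilon>])
    show "\<theta> x = 0 \<or> \<theta> x = complex_of_real (J x * \<epsilon>)" for x
      using \<epsilon> by (cases "x \<in> S") (auto simp: \<theta>_def)
  qed (use \<epsilon> that in \<open>auto simp: \<theta>_def D_def indicator_def split: if_splits\<close>)
  interpret H: hermitian_traces "\<lambda>n. hs_norm M (kernel_pow M G n)" p
    unfolding p_def[abs_def] by (rule M.hermitian_traces_kernel[OF Ghs Gherm])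
  define a where "a n = expectation (\<lambda>\<omega>. esym (indicator S :: 'a \<Rightarrow> real) n (pts \<omega>))" for n
  have indm: "(indicator S :: 'a \<Rightarrow> real) \<in> borel_measurable M" using S by simp
  have indb: "\<bar>indicator S x\<bar> \<le> (1::real)" for x by (simp add: indicator_def)
  have a_nonneg: "0 \<le> a n" for n
    unfolding a_def by (intro Bochner_Integration.integral_nonneg esym_nonneg) auto
  have a0: "a 0 = 1"
  proof -
    have "a 0 = expectation (\<lambda>\<omega>. 1)" unfolding a_def using finite_pts by (intro Bochner_Integration.integral_cong) auto
    then show ?thesis by (simp add: prob_space)
  qed
  have a_cplx: "expectation (\<lambda>\<omega>. esym (indicator S :: 'a \<Rightarrow> complex) n (pts \<omega>)) = of_real (a n)" for n
    using esym_real_integrable(2)[OF indm, of 1 n] indb unfolding a_def by (simp add: of_real_indicator)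
  have a_fred: "of_real (a n) = fredholm_coeff p n" for n
  proof -
    have "(\<lambda>x. \<theta> x * complex_of_real ((D x)\<^sup>2)) = indicator S" by (auto simp: \<theta>_def D_def indicator_def)
    then show ?thesis using expectation_esym_fredholm[OF \<theta> D, of n] a_cplx[of n] unfolding p_def[abs_def] G_def by simp
  qed
  have norm_ind: "cmod (indicator S x) = (indicator S x :: real)" for x by (simp add: indicator_def)
  have indc: "(indicator S :: 'a \<Rightarrow> complex) \<in> borel_measurable M" using S by simp
  have cm1: "cmod (indicator S x) \<le> 1" for x by (simp add: indicator_def)
  have series: "(\<lambda>n. of_real (a n) * z ^ n) sums exp (log_series p z)"
    if r: "0 < r" "\<And>t. 0 \<le> t \<Longrightarrow> t < r \<Longrightarrow> summable (\<lambda>i. cmod (p i) * t ^ i)" "cmod z < r" for r z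
    using fredholm_series_exp[OF r] by (simp only: a_fred)
  have real_summ: "summable (\<lambda>n. t ^ n * a n)" if r: "0 < r" "\<And>t. 0 \<le> t \<Longrightarrow> t < r \<Longrightarrow> summable (\<lambda>i. cmod (p i) * t ^ i)" "0 \<le> t" "t < r" for r t
  proof -
    have "(\<lambda>n. complex_of_real (a n) * of_real t ^ n) sums exp (log_series p (of_real t))"
      by (rule series[OF r(1,2)]) (use r in auto)
    then have "summable (\<lambda>n. complex_of_real (t ^ n * a n))" by (simp add: sums_iff mult.commute)
    then show ?thesis by (simp only: summable_complex_of_real)
  qed
  note EP = expected_product_series[OF indc cm1, unfolded norm_ind, folded a_def]
  have summ_p: "summable (\<lambda>i. cmod (p i) * t ^ i)" if "0 \<le> t" "t < 1" for t
  proof (rule H.summable_by_continuation[OF _ that])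
    fix r :: real assume r: "0 < r" "r < 1" and sm: "\<And>t. 0 \<le> t \<Longrightarrow> t < r \<Longrightarrow> summable (\<lambda>i. cmod (p i) * t ^ i)"
    \<comment> \<open>This is positive because \<open>r < 1\<close>, however many points there are.\<close>
    define \<delta> where "\<delta> = expectation (\<lambda>\<omega>. (1 - r) ^ card (pts \<omega> \<inter> S))"
    have "0 < \<delta>" unfolding \<delta>_def using r S by (intro pos_expectation power_card_integrable_le1) auto
    moreover have "\<delta> \<le> cmod (exp (log_series p (of_real t)) * exp (log_series p (- of_real t)))" if t: "0 \<le> t" "t < r" for t
    proof -
      have s1: "(\<lambda>n. complex_of_real (t ^ n * a n)) sums exp (log_series p (of_real t))"
        using series[OF r(1) sm, of "of_real t"] t by (simp add: mult.commute)
      have sR: "(\<lambda>n. t ^ n * a n) sums Re (exp (log_series p (of_real t)))"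
        using sums_Re[OF s1] by simp
      have nn: "0 \<le> t ^ n * a n" for n
        using t a_nonneg by (intro mult_nonneg_nonneg zero_le_power) auto
      have "(\<Sum>n\<in>{0}. t ^ n * a n) \<le> (\<Sum>n. t ^ n * a n)"
        by (rule sum_le_suminf[OF sums_summable[OF sR] _ nn]) simp
      then have "(\<Sum>n\<in>{0}. t ^ n * a n) \<le> Re (exp (log_series p (of_real t)))"
        using sums_unique[OF sR] by simp
      then have "1 \<le> Re (exp (log_series p (of_real t)))" using a0 by simp
      then have ge1: "1 \<le> cmod (exp (log_series p (of_real t)))"
        using complex_Re_le_cmod by (rule order_trans)
      have s2: "(\<lambda>n. (- of_real t) ^ n * complex_of_real (a n)) sums exp (log_series p (- of_real t))"
        using series[OF r(1) sm, of "- of_real t"] t by (simp add: mult.commute)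
      have "(\<lambda>n. (- of_real t) ^ n * complex_of_real (a n)) sums expectation (\<lambda>\<omega>. \<Prod>x\<in>pts \<omega>. 1 + (- complex_of_real t) * indicator S x)"
        using EP(2)[OF real_summ[OF r(1) sm t], of "- of_real t"] t by (simp add: a_cplx)
      from sums_unique2[OF s2 this] have "exp (log_series p (- of_real t)) = expectation (\<lambda>\<omega>. \<Prod>x\<in>pts \<omega>. 1 + (- complex_of_real t) * indicator S x)" .
      also have "\<dots> = expectation (\<lambda>\<omega>. complex_of_real ((1 - t) ^ card (pts \<omega> \<inter> S)))"
        using prod_indicator_power[OF finite_pts, of _ "- complex_of_real t" S]
        by (intro Bochner_Integration.integral_cong refl) simp
      also have "\<dots> = of_real (expectation (\<lambda>\<omega>. (1 - t) ^ card (pts \<omega> \<inter> S)))" by (rule integral_complex_of_real)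
      finally have e: "exp (log_series p (- of_real t)) = of_real (expectation (\<lambda>\<omega>. (1 - t) ^ card (pts \<omega> \<inter> S)))" .
      have "\<delta> \<le> expectation (\<lambda>\<omega>. (1 - t) ^ card (pts \<omega> \<inter> S))"
        unfolding \<delta>_def using r t S by (intro integral_mono power_card_integrable_le1 power_mono) auto
      then have "\<delta> \<le> cmod (exp (log_series p (- of_real t)))" unfolding e norm_of_real by linarith
      then have "1 * \<delta> \<le> cmod (exp (log_series p (of_real t))) * cmod (exp (log_series p (- of_real t)))"
        using ge1 \<open>0 < \<delta>\<close> by (intro mult_mono) auto
      then show ?thesis by (simp add: norm_mult)
    qed
    ultimately show "\<exists>\<delta>>0. \<forall>t. 0 \<le> t \<and> t < r \<longrightarrow> \<delta> \<le> cmod (exp (log_series p (of_real t)) * exp (log_series p (- of_real t)))"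
      by blast
  qed
  have "integrable P (\<lambda>\<omega>. \<Prod>x\<in>pts \<omega>. 1 + complex_of_real t * indicator S x)"
    by (rule EP(1)[OF real_summ[OF _ summ_p t]]) (use t in auto)
  then have "integrable P (\<lambda>\<omega>. complex_of_real ((1 + t) ^ card (pts \<omega> \<inter> S)))"
    using finite_pts by (simp add: prod_indicator_power cong: Bochner_Integration.integrable_cong)
  then show ?thesis by (simp only: complex_of_real_integrable_eq)
qed

text \<open>The two parts are combined by \<open>a b \<le> a\<^sup>2 + b\<^sup>2\<close>. The constant comes from
  \<open>(1 + 2/5)\<^sup>2 = 1 + 24/25\<close>, where \<open>24/25 < 1\<close> is admissible in \<open>exponential_moment_one_part\<close>.\<close>

lemma exponential_moment:
  "integrable P (\<lambda>\<omega>. (1 + 2/5 :: real) ^ card (pts \<omega>))"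
proof -
  define S1 where "S1 = {x \<in> \<Delta>. J x = 1}"
  define S2 where "S2 = {x \<in> \<Delta>. J x = -1}"
  have \<Delta>M: "\<Delta> \<subseteq> space M" using \<Delta> by (rule sets.sets_into_space)
  have S: "S1 \<in> sets M" "S2 \<in> sets M"
  proof -
    have "S1 = (J -` {1} \<inter> space M) \<inter> \<Delta>" "S2 = (J -` {-1} \<inter> space M) \<inter> \<Delta>" using \<Delta>M by (auto simp: S1_def S2_def)
    then show "S1 \<in> sets M" "S2 \<in> sets M" using measurable_sets[OF J_measurable] \<Delta> by auto
  qed
  have sub: "S1 \<subseteq> \<Delta>" "S2 \<subseteq> \<Delta>" by (auto simp: S1_def S2_def)
  have i1: "integrable P (\<lambda>\<omega>. (1 + 24/25 :: real) ^ card (pts \<omega> \<inter> S1))" "integrable P (\<lambda>\<omega>. (1 + 24/25 :: real) ^ card (pts \<omega> \<inter> S2))"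
    by (rule exponential_moment_one_part[OF S(1) sub(1)]; simp add: S1_def) (rule exponential_moment_one_part[OF S(2) sub(2)]; simp add: S2_def)
  have card: "card (pts \<omega>) = card (pts \<omega> \<inter> S1) + card (pts \<omega> \<inter> S2)" if \<omega>: "\<omega> \<in> space P" for \<omega>
  proof -
    have "pts \<omega> = (pts \<omega> \<inter> S1) \<union> (pts \<omega> \<inter> S2)" using pts_subset[OF \<omega>] J_sign by (auto simp: S1_def S2_def)
    moreover have "(pts \<omega> \<inter> S1) \<inter> (pts \<omega> \<inter> S2) = {}" by (auto simp: S1_def S2_def)
    ultimately show ?thesis using finite_pts[OF \<omega>] by (metis card_Un_disjoint finite_Int)
  qed
  show ?thesis
  proof (rule Bochner_Integration.integrable_bound[OF Bochner_Integration.integrable_add[OF i1]])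
    have "(\<lambda>\<omega>. (1 + 2/5 :: real) ^ card (pts \<omega> \<inter> \<Delta>)) \<in> borel_measurable P" by (rule power_card_measurable[OF \<Delta>]) simp
    moreover have "pts \<omega> \<inter> \<Delta> = pts \<omega>" if "\<omega> \<in> space P" for \<omega> using pts_subset[OF that] by auto
    ultimately show "(\<lambda>\<omega>. (1 + 2/5 :: real) ^ card (pts \<omega>)) \<in> borel_measurable P" by (simp cong: measurable_cong)
    show "AE \<omega> in P. norm ((1 + 2/5 :: real) ^ card (pts \<omega>)) \<le> norm ((1 + 24/25) ^ card (pts \<omega> \<inter> S1) + (1 + 24/25) ^ card (pts \<omega> \<inter> S2) :: real)"
    proof (intro AE_I2)
      fix \<omega> assume \<omega>: "\<omega> \<in> space P"
      let ?a = "(7/5::real) ^ card (pts \<omega> \<inter> S1)" and ?b = "(7/5::real) ^ card (pts \<omega> \<inter> S2)"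
      have sq: "((7/5::real) ^ m)\<^sup>2 = (1 + 24/25) ^ m" for m
      proof -
        have "((7/5::real) ^ m)\<^sup>2 = ((7/5)\<^sup>2) ^ m" unfolding power2_eq_square power_mult_distrib ..
        then show ?thesis by (simp add: power2_eq_square)
      qed
      have pos: "0 \<le> ?a * ?b" by simp
      have "2 * ?a * ?b \<le> ?a\<^sup>2 + ?b\<^sup>2" by (rule sum_squares_bound)
      then have "?a * ?b \<le> (1 + 24/25) ^ card (pts \<omega> \<inter> S1) + (1 + 24/25) ^ card (pts \<omega> \<inter> S2)"
        using pos unfolding sq by linarith
      then show "norm ((1 + 2/5 :: real) ^ card (pts \<omega>)) \<le> norm ((1 + 24/25) ^ card (pts \<omega> \<inter> S1) + (1 + 24/25) ^ card (pts \<omega> \<inter> S2) :: real)"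
        unfolding card[OF \<omega>] by (simp add: power_add)
    qed
  qed
qed

lemma summable_esym_one:
  "summable (\<lambda>n. (2/5) ^ n * expectation (\<lambda>\<omega>. esym (\<lambda>_. 1 :: real) n (pts \<omega>)))"
proof (rule bounded_imp_summable)
  have i: "integrable P (\<lambda>\<omega>. esym (\<lambda>_. 1 :: real) n (pts \<omega>))" for n
    by (rule esym_real_integrable(1)[where c = 1]) auto
  show "0 \<le> (2/5) ^ n * expectation (\<lambda>\<omega>. esym (\<lambda>_. 1 :: real) n (pts \<omega>))" for n
    by (intro mult_nonneg_nonneg Bochner_Integration.integral_nonneg esym_nonneg) auto
  fix K
  have "(\<Sum>n\<le>K. (2/5) ^ n * expectation (\<lambda>\<omega>. esym (\<lambda>_. 1 :: real) n (pts \<omega>))) = expectation (\<lambda>\<omega>. \<Sum>n\<le>K. (2/5) ^ n * esym (\<lambda>_. 1 :: real) n (pts \<omega>))"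
    using i by (subst Bochner_Integration.integral_sum) auto
  also have "\<dots> \<le> expectation (\<lambda>\<omega>. (1 + 2/5) ^ card (pts \<omega>))"
  proof (intro integral_mono exponential_moment Bochner_Integration.integrable_sum integrable_mult_right i)
    fix \<omega> assume \<omega>: "\<omega> \<in> space P"
    have nn: "0 \<le> (2/5) ^ n * esym (\<lambda>_. 1 :: real) n (pts \<omega>)" for n by (intro mult_nonneg_nonneg esym_nonneg) auto
    have "(\<Sum>n\<le>K. (2/5) ^ n * esym (\<lambda>_. 1 :: real) n (pts \<omega>)) \<le> (\<Sum>n\<le>max K (card (pts \<omega>)). (2/5) ^ n * esym (\<lambda>_. 1 :: real) n (pts \<omega>))"
      using nn by (intro sum_mono2) auto
    also have "\<dots> = (\<Sum>n\<le>card (pts \<omega>). (2/5) ^ n * esym (\<lambda>_. 1 :: real) n (pts \<omega>))"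
    proof (rule sum.mono_neutral_right)
      show "\<forall>n\<in>{..max K (card (pts \<omega>))} - {..card (pts \<omega>)}. (2/5) ^ n * esym (\<lambda>_. 1 :: real) n (pts \<omega>) = 0"
      proof
        fix n assume "n \<in> {..max K (card (pts \<omega>))} - {..card (pts \<omega>)}"
        then have "card (pts \<omega>) < n" by auto
        then show "(2/5) ^ n * esym (\<lambda>_. 1 :: real) n (pts \<omega>) = 0" by (simp add: esym_zero[OF finite_pts[OF \<omega>]])
      qed
    qed auto
    also have "\<dots> = (1 + 2/5) ^ card (pts \<omega>)"
      using prod_one_plus_esym[OF finite_pts[OF \<omega>], of "2/5" "\<lambda>_. 1 :: real"] by simp
    finally show "(\<Sum>n\<le>K. (2/5) ^ n * esym (\<lambda>_. 1 :: real) n (pts \<omega>)) \<le> (1 + 2/5) ^ card (pts \<omega>)" .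
  qed
  finally show "(\<Sum>n\<le>K. (2/5) ^ n * expectation (\<lambda>\<omega>. esym (\<lambda>_. 1 :: real) n (pts \<omega>))) \<le> expectation (\<lambda>\<omega>. (1 + 2/5) ^ card (pts \<omega>))" .
qed

definition Jk :: "'a kernel" where "Jk = twist (\<lambda>x. of_real (J x)) (\<lambda>_. 1)"

lemma \<theta>J: "(\<lambda>x. complex_of_real (J x)) \<in> borel_measurable M" "cmod (complex_of_real (J x)) \<le> 1"
  using J_measurable by auto

lemma Jk_nice: "M.nice_kernel Jk"
  unfolding Jk_def by (rule twist_nice[where d = 1]) (use \<theta>J in auto)

lemma Jk_hs: "hs_kernel M Jk" using Jk_nice by (simp add: M.nice_kernel_def)

lemma J_nonzero: "J x \<noteq> 0"
  using J_sign[of x] by auto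

lemma Jk_hermitian: "x \<in> space M \<Longrightarrow> y \<in> space M \<Longrightarrow> kernel_adj Jk x y = Jk x y"
  unfolding Jk_def by (rule twist_hermitian[where \<epsilon> = 1]) (auto simp: J_nonzero)

text \<open>The Fredholm determinant of \<open>J k\<close> at real \<open>t\<close> is \<open>E (\<Prod>x. 1 + t * J x)\<close>; the exponential
  moment justifies the expansion for \<open>\<bar>t\<bar> < 2/5\<close>. As each factor is at least \<open>1 - \<bar>t\<bar>\<close>, whatever
  the sign of \<open>J x\<close>, the determinant is bounded below, and the continuation principle gives
  convergence at \<open>t = 1/3\<close>. Hence the traces grow at most like \<open>3 ^ n\<close>.\<close>

lemma Jk_powers_bound: "\<exists>D. \<forall>n. (hs_norm M (kernel_pow M Jk n))\<^sup>2 \<le> D * (3\<^sup>2) ^ Suc n"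
proof -
  define p where "p m = kernel_trace M (kernel_pow M Jk m)" for m
  interpret H: hermitian_traces "\<lambda>n. hs_norm M (kernel_pow M Jk n)" p
    unfolding p_def[abs_def] by (rule M.hermitian_traces_kernel[OF Jk_hs Jk_hermitian])
  let ?g = "\<lambda>x. complex_of_real (J x)"
  define a where "a n = expectation (\<lambda>\<omega>. esym ?g n (pts \<omega>))" for n
  have a_fred: "a n = fredholm_coeff p n" for n
    using expectation_esym_fredholm[where D = "\<lambda>_. 1" and d = 1 and n = n, OF \<theta>J] unfolding p_def[abs_def] Jk_def a_def by simp
  have norm1: "cmod (complex_of_real (J x)) = 1" for x by simp
  note EP = expected_product_series[where g = ?g and c = 1, OF \<theta>J, unfolded norm1, OF summable_esym_one, folded a_def]
  have "summable (\<lambda>i. cmod (p i) * (1/3) ^ i)"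
  proof (rule H.summable_by_continuation[where T = "2/5"])
    fix r :: real assume r: "0 < r" "r < 2/5" and sm: "\<And>t. 0 \<le> t \<Longrightarrow> t < r \<Longrightarrow> summable (\<lambda>i. cmod (p i) * t ^ i)"
    define \<delta> where "\<delta> = expectation (\<lambda>\<omega>. (1 - r) ^ card (pts \<omega> \<inter> \<Delta>))"
    have \<delta>: "0 < \<delta>" unfolding \<delta>_def using r \<Delta> by (intro pos_expectation power_card_integrable_le1) auto
    have ge: "\<delta> \<le> cmod (exp (log_series p (of_real t)))" if t: "\<bar>t\<bar> < r" for t
    proof -
      have s1: "(\<lambda>n. of_real t ^ n * a n) sums exp (log_series p (of_real t))"
        using fredholm_series_exp[OF r(1) sm, of "of_real t"] t by (simp add: a_fred mult.commute)
      have s2: "(\<lambda>n. of_real t ^ n * a n) sums expectation (\<lambda>\<omega>. \<Prod>x\<in>pts \<omega>. 1 + complex_of_real t * of_real (J x))"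
        and ii: "integrable P (\<lambda>\<omega>. \<Prod>x\<in>pts \<omega>. 1 + complex_of_real t * of_real (J x))"
        using EP[of "of_real t"] t r by auto
      have re: "(\<Prod>x\<in>pts \<omega>. 1 + complex_of_real t * of_real (J x)) = of_real (\<Prod>x\<in>pts \<omega>. 1 + t * J x)" for \<omega> by simp
      have ii': "integrable P (\<lambda>\<omega>. \<Prod>x\<in>pts \<omega>. 1 + t * J x)" using ii unfolding re complex_of_real_integrable_eq .
      have e: "exp (log_series p (of_real t)) = of_real (expectation (\<lambda>\<omega>. \<Prod>x\<in>pts \<omega>. 1 + t * J x))"
        using sums_unique2[OF s1 s2] unfolding re integral_complex_of_real .
      have "\<delta> \<le> expectation (\<lambda>\<omega>. \<Prod>x\<in>pts \<omega>. 1 + t * J x)"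
        unfolding \<delta>_def
      proof (intro integral_mono ii' power_card_integrable_le1 \<Delta>)
        fix \<omega> assume \<omega>: "\<omega> \<in> space P"
        have "pts \<omega> \<inter> \<Delta> = pts \<omega>" using pts_subset[OF \<omega>] by auto
        then have "(1 - r) ^ card (pts \<omega> \<inter> \<Delta>) = (\<Prod>x\<in>pts \<omega>. 1 - r)" by simp
        also have "\<dots> \<le> (\<Prod>x\<in>pts \<omega>. 1 + t * J x)"
        proof (rule prod_mono)
          fix x
          show "0 \<le> 1 - r \<and> 1 - r \<le> 1 + t * J x" using r t J_sign[of x] by auto
        qed
        finally show "(1 - r) ^ card (pts \<omega> \<inter> \<Delta>) \<le> (\<Prod>x\<in>pts \<omega>. 1 + t * J x)" .
      qed (use r in auto)
      then show ?thesis unfolding e norm_of_real by linarith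
    qed
    show "\<exists>\<delta>>0. \<forall>t. 0 \<le> t \<and> t < r \<longrightarrow> \<delta> \<le> cmod (exp (log_series p (of_real t)) * exp (log_series p (- of_real t)))"
    proof (intro exI[of _ "\<delta> * \<delta>"] conjI allI impI)
      fix t assume t: "0 \<le> t \<and> t < r"
      have "\<delta> \<le> cmod (exp (log_series p (of_real t)))" "\<delta> \<le> cmod (exp (log_series p (- of_real t)))"
        using ge[of t] ge[of "- t"] t by auto
      then show "\<delta> * \<delta> \<le> cmod (exp (log_series p (of_real t)) * exp (log_series p (- of_real t)))"
        unfolding norm_mult using \<delta> by (intro mult_mono) auto
    qed (use \<delta> in auto)
  qed auto
  then have "Bseq (\<lambda>i. cmod (p i) * (1/3) ^ i)" by (intro convergent_imp_Bseq convergentI[OF summable_LIMSEQ_zero])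
  then obtain B where B: "\<forall>i. norm (cmod (p i) * (1/3) ^ i) \<le> B" unfolding Bseq_def by metis
  show ?thesis
  proof (intro exI allI)
    fix n
    have "(hs_norm M (kernel_pow M Jk n))\<^sup>2 * (1/3) ^ Suc (2 * n) \<le> B"
      using B[rule_format, of "Suc (2 * n)"] unfolding H.p_odd by (simp add: norm_power)
    then have "(hs_norm M (kernel_pow M Jk n))\<^sup>2 \<le> B * 3 ^ Suc (2 * n)" by (simp add: power_divide divide_le_eq del: power_Suc)
    also have "\<dots> = (B / 3) * (3\<^sup>2) ^ Suc n" by (simp add: power_mult power_mult[symmetric])
    finally show "(hs_norm M (kernel_pow M Jk n))\<^sup>2 \<le> (B / 3) * (3\<^sup>2) ^ Suc n" .
  qed
qed

lemma Jk_opnorm: "hs_kernel M A \<Longrightarrow> hs_norm M (kernel_comp M A Jk) \<le> 3 * hs_norm M A"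
  using Jk_powers_bound M.hs_norm_comp_le_opnorm[OF _ Jk_hs Jk_hermitian, of A _ 3] by auto

end

section \<open>Multiplicative functionals close to one\<close>

context det_points
begin

lemma sum_pts_integrable:
  fixes g :: "'a \<Rightarrow> real"
  assumes g: "g \<in> borel_measurable M" and bd: "\<And>x. x \<in> space M \<Longrightarrow> \<bar>g x\<bar> \<le> c"
  shows "integrable P (\<lambda>\<omega>. \<Sum>x\<in>pts \<omega>. g x)"
    and "expectation (\<lambda>\<omega>. esym g 1 (pts \<omega>)) = expectation (\<lambda>\<omega>. \<Sum>x\<in>pts \<omega>. g x)"
proof -
  have e: "esym g 1 (pts \<omega>) = (\<Sum>x\<in>pts \<omega>. g x)" if "\<omega> \<in> space P" for \<omega>
    using esym_1[OF finite_pts[OF that]] by simp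
  show "integrable P (\<lambda>\<omega>. \<Sum>x\<in>pts \<omega>. g x)"
    using esym_real_integrable(1)[OF g bd, of 1] e by (simp cong: Bochner_Integration.integrable_cong)
  show "expectation (\<lambda>\<omega>. esym g 1 (pts \<omega>)) = expectation (\<lambda>\<omega>. \<Sum>x\<in>pts \<omega>. g x)"
    using e by (intro Bochner_Integration.integral_cong) auto
qed

text \<open>With \<open>u = J * D\<^sup>2\<close>, the formulas for the first two factorial moments give the variance of
  the sum of \<open>u\<close> over the points as \<open>E (\<Sum>x. (u x)\<^sup>2)\<close> minus the trace of the square of the
  Hermitian kernel \<open>J D k D\<close>. This trace is its squared Hilbert-Schmidt norm, and a variance is
  non-negative. Replacing \<open>J\<close> by another \<open>\<theta>\<close> of modulus at most \<open>1\<close> does not increase the norm.\<close>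

lemma hs_norm_twist_le:
  assumes \<theta>: "\<theta> \<in> borel_measurable M" "\<And>x. x \<in> space M \<Longrightarrow> cmod (\<theta> x) \<le> 1"
    and D: "D \<in> borel_measurable M" "\<And>x. x \<in> space M \<Longrightarrow> \<bar>D x\<bar> \<le> d"
  shows "(hs_norm M (twist \<theta> D))\<^sup>2 \<le> d\<^sup>2 * expectation (\<lambda>\<omega>. \<Sum>x\<in>pts \<omega>. (D x)\<^sup>2)"
proof -
  let ?\<theta>J = "\<lambda>x. complex_of_real (J x)"
  define G where "G = twist ?\<theta>J D"
  define p where "p m = kernel_trace M (kernel_pow M G m)" for m
  have Gnice: "M.nice_kernel G" unfolding G_def by (rule twist_nice[where d = d]) (use \<theta>J D in auto)
  then have Ghs: "hs_kernel M G" by (simp add: M.nice_kernel_def)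
  have Gherm: "kernel_adj G x y = G x y" if "x \<in> space M" "y \<in> space M" for x y
    unfolding G_def by (rule twist_hermitian[where \<epsilon> = 1]) (auto simp: J_nonzero that)
  have ths: "hs_kernel M (twist \<theta> D)" using twist_nice[OF \<theta> D] by (simp add: M.nice_kernel_def)
  have "(hs_norm M (twist \<theta> D))\<^sup>2 \<le> (hs_norm M G)\<^sup>2"
    unfolding hs_norm_sq
  proof (rule integral_mono)
    show "integrable (M \<Otimes>\<^sub>M M) (\<lambda>(x, y). (cmod (twist \<theta> D x y))\<^sup>2)" "integrable (M \<Otimes>\<^sub>M M) (\<lambda>(x, y). (cmod (G x y))\<^sup>2)"
      using ths Ghs by (simp_all add: hs_kernel_def)
    fix z assume "z \<in> space (M \<Otimes>\<^sub>M M)"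
    then obtain x y where z: "z = (x, y)" "x \<in> space M" by (auto simp: space_pair_measure)
    have "cmod (\<theta> x) * (\<bar>D x\<bar> * cmod (k x y) * \<bar>D y\<bar>) \<le> 1 * (\<bar>D x\<bar> * cmod (k x y) * \<bar>D y\<bar>)"
      using \<theta>(2)[OF z(2)] by (intro mult_right_mono) auto
    then have "cmod (twist \<theta> D x y) \<le> cmod (G x y)" by (simp add: G_def twist_def norm_mult mult_ac)
    then show "(case z of (x, y) \<Rightarrow> (cmod (twist \<theta> D x y))\<^sup>2) \<le> (case z of (x, y) \<Rightarrow> (cmod (G x y))\<^sup>2)"
      using z by (simp add: power_mono)
  qed
  also have "\<dots> \<le> d\<^sup>2 * expectation (\<lambda>\<omega>. \<Sum>x\<in>pts \<omega>. (D x)\<^sup>2)"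
  proof -
    define u where "u x = J x * (D x)\<^sup>2" for x
    have u: "u \<in> borel_measurable M" unfolding u_def using J_measurable D by measurable
    have D2: "(D x)\<^sup>2 \<le> d\<^sup>2" if "x \<in> space M" for x
    proof -
      have "\<bar>D x\<bar>\<^sup>2 \<le> d\<^sup>2" using D(2)[OF that] by (intro power_mono) auto
      then show ?thesis by simp
    qed
    have ub: "\<bar>u x\<bar> \<le> d\<^sup>2" if "x \<in> space M" for x using D2[OF that] by (simp add: u_def abs_mult)
    have u2b: "\<bar>(u x)\<^sup>2\<bar> \<le> (d\<^sup>2)\<^sup>2" if "x \<in> space M" for x
      using ub[OF that] power_mono[OF ub[OF that], of 2] by (simp add: power2_abs)
    have D2m: "(\<lambda>x. (D x)\<^sup>2) \<in> borel_measurable M" "(\<lambda>x. (u x)\<^sup>2) \<in> borel_measurable M" using D u by measurable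
    have D2b: "\<bar>(D x)\<^sup>2\<bar> \<le> d\<^sup>2" if "x \<in> space M" for x using D2[OF that] by simp
    have fred: "of_real (expectation (\<lambda>\<omega>. esym u n (pts \<omega>))) = fredholm_coeff p n" for n
    proof -
      have "of_real (expectation (\<lambda>\<omega>. esym u n (pts \<omega>))) = expectation (\<lambda>\<omega>. esym (\<lambda>x. complex_of_real (u x)) n (pts \<omega>))"
        by (rule esym_real_integrable(2)[OF u ub, symmetric])
      also have "\<dots> = expectation (\<lambda>\<omega>. esym (\<lambda>x. complex_of_real (J x) * complex_of_real ((D x)\<^sup>2)) n (pts \<omega>))"
        by (simp add: u_def)
      also have "\<dots> = fredholm_coeff p n"
        unfolding p_def[abs_def] G_def by (rule expectation_esym_fredholm) (use \<theta>J D in auto)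
      finally show ?thesis .
    qed
    define S where "S \<omega> = (\<Sum>x\<in>pts \<omega>. u x)" for \<omega>
    have ES: "of_real (expectation S) = p 0"
      using fred[of 1] sum_pts_integrable(2)[OF u ub] by (simp add: S_def[abs_def] fredholm_coeff_def)
    have E2: "2 * complex_of_real (expectation (\<lambda>\<omega>. esym u 2 (pts \<omega>))) = p 0 * p 0 - p 1"
      using fred[of 2] by (simp add: fredholm_coeff_def numeral_2_eq_2 mult.commute)
    have p1: "p 1 = of_real ((hs_norm M G)\<^sup>2)"
      using M.trace_even_pow[OF Ghs Gherm, of 0] by (simp add: p_def)
    have sq: "(S \<omega>)\<^sup>2 = (\<Sum>x\<in>pts \<omega>. (u x)\<^sup>2) + 2 * esym u 2 (pts \<omega>)" if "\<omega> \<in> space P" for \<omega>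
      unfolding S_def by (rule square_sum_esym[OF finite_pts[OF that]])
    have iS: "integrable P S" unfolding S_def[abs_def] by (rule sum_pts_integrable(1)[OF u ub])
    have iu2: "integrable P (\<lambda>\<omega>. \<Sum>x\<in>pts \<omega>. (u x)\<^sup>2)" by (rule sum_pts_integrable(1)[OF D2m(2) u2b])
    have ie2: "integrable P (\<lambda>\<omega>. 2 * esym u 2 (pts \<omega>))" by (intro integrable_mult_right esym_real_integrable(1)[OF u ub])
    have iS2: "integrable P (\<lambda>\<omega>. (S \<omega>)\<^sup>2)"
      using Bochner_Integration.integrable_add[OF iu2 ie2] sq by (simp cong: Bochner_Integration.integrable_cong)
    have "expectation (\<lambda>\<omega>. (S \<omega>)\<^sup>2) = expectation (\<lambda>\<omega>. (\<Sum>x\<in>pts \<omega>. (u x)\<^sup>2) + 2 * esym u 2 (pts \<omega>))"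
      using sq by (intro Bochner_Integration.integral_cong) auto
    also have "\<dots> = expectation (\<lambda>\<omega>. \<Sum>x\<in>pts \<omega>. (u x)\<^sup>2) + 2 * expectation (\<lambda>\<omega>. esym u 2 (pts \<omega>))"
      using iu2 ie2 by simp
    finally have ES2: "expectation (\<lambda>\<omega>. (S \<omega>)\<^sup>2) = expectation (\<lambda>\<omega>. \<Sum>x\<in>pts \<omega>. (u x)\<^sup>2) + 2 * expectation (\<lambda>\<omega>. esym u 2 (pts \<omega>))" .
    have e2: "2 * expectation (\<lambda>\<omega>. esym u 2 (pts \<omega>)) = (expectation S)\<^sup>2 - (hs_norm M G)\<^sup>2"
    proof -
      have "complex_of_real (2 * expectation (\<lambda>\<omega>. esym u 2 (pts \<omega>))) = of_real ((expectation S)\<^sup>2 - (hs_norm M G)\<^sup>2)"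
        using E2 unfolding ES[symmetric] p1 by (simp add: power2_eq_square)
      then show ?thesis by (simp only: of_real_eq_iff)
    qed
    have "0 \<le> variance S" by (rule variance_positive)
    also have "variance S = expectation (\<lambda>\<omega>. (S \<omega>)\<^sup>2) - (expectation S)\<^sup>2" by (rule variance_eq[OF iS iS2])
    finally have "(hs_norm M G)\<^sup>2 \<le> expectation (\<lambda>\<omega>. \<Sum>x\<in>pts \<omega>. (u x)\<^sup>2)" using ES2 e2 by linarith
    also have "\<dots> \<le> expectation (\<lambda>\<omega>. d\<^sup>2 * (\<Sum>x\<in>pts \<omega>. (D x)\<^sup>2))"
    proof (intro integral_mono iu2 integrable_mult_right sum_pts_integrable(1)[OF D2m(1) D2b])
      fix \<omega> assume \<omega>: "\<omega> \<in> space P"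
      show "(\<Sum>x\<in>pts \<omega>. (u x)\<^sup>2) \<le> d\<^sup>2 * (\<Sum>x\<in>pts \<omega>. (D x)\<^sup>2)"
        unfolding sum_distrib_left
      proof (rule sum_mono)
        fix x assume "x \<in> pts \<omega>"
        then have x: "x \<in> space M" using pts_subset[OF \<omega>] sets.sets_into_space[OF \<Delta>] by auto
        have J2: "(J x)\<^sup>2 = 1" by (simp add: power2_eq_square)
        have "(u x)\<^sup>2 = (D x)\<^sup>2 * (D x)\<^sup>2" by (simp add: u_def power_mult_distrib J2 power2_eq_square)
        also have "\<dots> \<le> d\<^sup>2 * (D x)\<^sup>2" using D2[OF x] by (intro mult_right_mono) auto
        finally show "(u x)\<^sup>2 \<le> d\<^sup>2 * (D x)\<^sup>2" .
      qed
    qed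
    also have "\<dots> = d\<^sup>2 * expectation (\<lambda>\<omega>. \<Sum>x\<in>pts \<omega>. (D x)\<^sup>2)" by (rule integral_mult_right_zero)
    finally show ?thesis .
  qed
  finally show ?thesis .
qed

text \<open>As \<open>J\<^sup>2 = 1\<close>, the kernel \<open>\<theta> D k D\<close> is \<open>J k\<close> between multiplications by \<open>\<theta> * D * J\<close> and \<open>D\<close>,
  both of which are bounded by \<open>d\<close>.\<close>

lemma comp_twist_le:
  assumes \<theta>: "\<theta> \<in> borel_measurable M" "\<And>x. x \<in> space M \<Longrightarrow> cmod (\<theta> x) \<le> 1"
    and D: "D \<in> borel_measurable M" "\<And>x. x \<in> space M \<Longrightarrow> \<bar>D x\<bar> \<le> d" and d: "0 \<le> d" and A: "hs_kernel M A"
  shows "hs_norm M (kernel_comp M A (twist \<theta> D)) \<le> 3 * d\<^sup>2 * hs_norm M A"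
proof -
  define u where "u x = \<theta> x * of_real (D x) * of_real (J x)" for x
  have u: "u \<in> borel_measurable M" unfolding u_def using \<theta> D J_measurable by measurable
  have ub: "cmod (u x) \<le> d" if "x \<in> space M" for x
    using mult_mono[OF \<theta>(2)[OF that] D(2)[OF that]] by (simp add: u_def norm_mult)
  define A' where "A' x y = A x y * u y" for x y
  have A': "hs_kernel M A'" "hs_norm M A' \<le> d * hs_norm M A"
    unfolding A'_def[abs_def] using M.hs_mult_right[OF A u ub d] by auto
  have JJ: "complex_of_real (J z) * complex_of_real (J z) = 1" for z by (simp flip: of_real_mult)
  have e: "kernel_comp M A (twist \<theta> D) = (\<lambda>x y. kernel_comp M A' Jk x y * of_real (D y))"
  proof (intro ext)
    fix x y
    have pt: "A x z * twist \<theta> D z y = A' x z * Jk z y * of_real (D y)" for z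
    proof -
      have "A' x z * Jk z y * of_real (D y) = (complex_of_real (J z) * complex_of_real (J z)) * (A x z * twist \<theta> D z y)"
        by (simp add: A'_def Jk_def u_def twist_def mult_ac)
      then show ?thesis unfolding JJ by simp
    qed
    show "kernel_comp M A (twist \<theta> D) x y = kernel_comp M A' Jk x y * of_real (D y)"
      unfolding kernel_comp_def pt by (rule integral_mult_left_zero)
  qed
  have Dm: "(\<lambda>x. complex_of_real (D x)) \<in> borel_measurable M" using D by measurable
  have Db: "cmod (complex_of_real (D x)) \<le> d" if "x \<in> space M" for x using D(2)[OF that] by simp
  have "hs_norm M (kernel_comp M A (twist \<theta> D)) \<le> d * hs_norm M (kernel_comp M A' Jk)"
    unfolding e by (rule M.hs_mult_right(2)[OF M.hs_comp(1)[OF A'(1) Jk_hs] Dm Db d])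
  also have "\<dots> \<le> d * (3 * (d * hs_norm M A))"
    using Jk_opnorm[OF A'(1)] A'(2) d by (intro mult_left_mono) auto
  finally show ?thesis by (simp add: power2_eq_square mult_ac)
qed

text \<open>Write \<open>W = \<theta> * D\<^sup>2\<close> with \<open>D = sqrt \<bar>W\<bar>\<close>. Since \<open>D\<^sup>2 \<le> 1/6\<close>, composition with the twisted
  kernel \<open>G\<close> contracts Hilbert-Schmidt norms by \<open>3 * (1/6) = 1/2\<close>. The trace of the power of \<open>G\<close>
  of exponent \<open>m + 2\<close> is thus at most \<open>2 ^ (- m)\<close> times the squared norm of \<open>G\<close>, which is at most
  \<open>1/6 * E (\<Sum>x. \<bar>W x\<bar>)\<close> by \<open>hs_norm_twist_le\<close>; the trace of \<open>G\<close> itself is \<open>E (\<Sum>x. W x)\<close>. The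
  logarithmic series converges at \<open>z = 1\<close>, and the sum of these bounds is its estimate.\<close>

theorem expectation_product_bound:
  fixes W :: "'a \<Rightarrow> complex"
  assumes W: "W \<in> borel_measurable M" and Wb: "\<And>x. x \<in> space M \<Longrightarrow> cmod (W x) \<le> 1/6"
  shows "integrable P (\<lambda>\<omega>. \<Prod>x\<in>pts \<omega>. 1 + W x)"
    and "\<exists>\<Phi>. expectation (\<lambda>\<omega>. \<Prod>x\<in>pts \<omega>. 1 + W x) = exp \<Phi> \<and> cmod \<Phi> \<le> 2 * expectation (\<lambda>\<omega>. \<Sum>x\<in>pts \<omega>. cmod (W x))"
proof -
  define D where "D x = sqrt (cmod (W x))" for x
  \<comment> \<open>At zeros of \<open>W\<close> this is \<open>0\<close>, by convention, and the factorization below holds there too.\<close>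
  define \<theta> where "\<theta> x = W x / of_real (cmod (W x))" for x
  define d where "d = sqrt (1/6 :: real)"
  have d: "0 \<le> d" "d\<^sup>2 = 1/6" by (auto simp: d_def)
  have \<theta>: "\<theta> \<in> borel_measurable M" "cmod (\<theta> x) \<le> 1" for x
    unfolding \<theta>_def using W by (measurable, simp add: norm_divide)
  have D: "D \<in> borel_measurable M" "\<And>x. x \<in> space M \<Longrightarrow> \<bar>D x\<bar> \<le> d"
    unfolding D_def d_def using W Wb by (measurable, simp)
  have D2: "(D x)\<^sup>2 = cmod (W x)" for x by (simp add: D_def)
  have WW: "(\<lambda>x. \<theta> x * of_real ((D x)\<^sup>2)) = W" by (auto simp: \<theta>_def D2)
  define G where "G = twist \<theta> D"
  define p where "p m = kernel_trace M (kernel_pow M G m)" for m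
  define s where "s = expectation (\<lambda>\<omega>. \<Sum>x\<in>pts \<omega>. cmod (W x))"
  have Gnice: "M.nice_kernel G" unfolding G_def by (rule twist_nice[OF \<theta> D])
  then have Ghs: "hs_kernel M G" by (simp add: M.nice_kernel_def)
  have fred: "expectation (\<lambda>\<omega>. esym W n (pts \<omega>)) = fredholm_coeff p n" for n
    using expectation_esym_fredholm[OF \<theta> D, of n] unfolding WW p_def[abs_def] G_def .
  have Gsq: "(hs_norm M G)\<^sup>2 \<le> 1/6 * s"
    using hs_norm_twist_le[OF \<theta> D] unfolding D2 G_def d(2) s_def .
  have powG: "hs_norm M (kernel_pow M G m) \<le> (1/2) ^ m * hs_norm M G" for m
  proof (induction m)
    case (Suc m)
    have "hs_norm M (kernel_pow M G (Suc m)) = hs_norm M (kernel_comp M (kernel_pow M G m) G)"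
      unfolding hs_norm_def using M.kernel_pow_comp[OF Ghs, of _ _ m 0]
      by (intro arg_cong[of _ _ sqrt] Bochner_Integration.integral_cong) (auto simp: space_pair_measure)
    also have "\<dots> \<le> 3 * d\<^sup>2 * hs_norm M (kernel_pow M G m)"
      using comp_twist_le[OF \<theta> D d(1) M.hs_kernel_pow[OF Ghs, of m]] unfolding G_def .
    also have "\<dots> \<le> 1/2 * ((1/2) ^ m * hs_norm M G)" using Suc unfolding d(2) by simp
    finally show ?case by simp
  qed simp
  have p_bound: "cmod (p (Suc m)) \<le> (hs_norm M G)\<^sup>2 * (1/2) ^ m" for m
  proof -
    have "cmod (p (Suc m)) \<le> hs_norm M G * hs_norm M (kernel_pow M G m)"
      unfolding p_def kernel_pow.simps by (rule M.trace_comp(4)[OF Ghs M.hs_kernel_pow[OF Ghs]])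
    also have "\<dots> \<le> hs_norm M G * ((1/2) ^ m * hs_norm M G)" by (intro mult_left_mono powG) auto
    finally show ?thesis by (simp add: power2_eq_square mult_ac)
  qed
  have p0: "cmod (p 0) \<le> s"
  proof -
    have "p 0 = expectation (\<lambda>\<omega>. esym W 1 (pts \<omega>))" using fred[of 1] by (simp add: fredholm_coeff_def)
    also have "cmod \<dots> \<le> expectation (\<lambda>\<omega>. cmod (esym W 1 (pts \<omega>)))" by (rule integral_norm_bound)
    also have "\<dots> \<le> s"
      unfolding s_def
    proof (intro integral_mono integrable_norm expectation_esym(1)[OF W Wb])
      show "integrable P (\<lambda>\<omega>. \<Sum>x\<in>pts \<omega>. cmod (W x))"
        by (rule sum_pts_integrable(1)[where c = "1/6"]) (use W Wb in auto)
      fix \<omega> assume \<omega>: "\<omega> \<in> space P"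
      show "cmod (esym W 1 (pts \<omega>)) \<le> (\<Sum>x\<in>pts \<omega>. cmod (W x))"
        using esym_1[OF finite_pts[OF \<omega>], of W] norm_sum[of W "pts \<omega>"] by simp
    qed auto
    finally show ?thesis .
  qed
  have summ: "summable (\<lambda>i. cmod (p i) * r ^ i)" if r: "0 \<le> r" "r < 3/2" for r
  proof -
    have "summable (\<lambda>m. cmod (p (Suc m)) * r ^ Suc m)"
    proof (rule summable_comparison_test')
      show "summable (\<lambda>m. (hs_norm M G)\<^sup>2 * r * (r / 2) ^ m)"
        using r by (intro summable_mult summable_geometric) auto
      fix m :: nat
      have "cmod (p (Suc m)) * r ^ Suc m \<le> (hs_norm M G)\<^sup>2 * (1/2) ^ m * r ^ Suc m"
        using r by (intro mult_right_mono p_bound) auto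
      then show "norm (cmod (p (Suc m)) * r ^ Suc m) \<le> (hs_norm M G)\<^sup>2 * r * (r / 2) ^ m"
        using r by (simp add: power_divide mult_ac)
    qed
    then show ?thesis using summable_Suc_iff by blast
  qed
  have ser1: "(\<lambda>n. fredholm_coeff p n * 1 ^ n) sums exp (log_series p 1)"
    by (rule fredholm_series_exp[of "3/2"]) (use summ in auto)
  have summ1: "summable (\<lambda>n. 1 ^ n * expectation (\<lambda>\<omega>. esym (\<lambda>x. cmod (W x)) n (pts \<omega>)))"
  proof (rule summable_comparison_test'[OF summable_esym_one, of 0])
    fix n :: nat
    have "expectation (\<lambda>\<omega>. esym (\<lambda>x. cmod (W x)) n (pts \<omega>)) \<le> expectation (\<lambda>\<omega>. (2/5) ^ n * esym (\<lambda>_. 1 :: real) n (pts \<omega>))"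
    proof (intro integral_mono integrable_mult_right)
      show "integrable P (\<lambda>\<omega>. esym (\<lambda>x. cmod (W x)) n (pts \<omega>))"
        by (rule esym_real_integrable(1)[where c = "1/6"]) (use W Wb in auto)
      show "integrable P (\<lambda>\<omega>. esym (\<lambda>_. 1 :: real) n (pts \<omega>))"
        by (rule esym_real_integrable(1)[where c = 1]) auto
      fix \<omega> assume \<omega>: "\<omega> \<in> space P"
      have "cmod (W x) \<le> 2/5 * 1" if "x \<in> pts \<omega>" for x
      proof -
        have "x \<in> space M" using that pts_subset[OF \<omega>] sets.sets_into_space[OF \<Delta>] by auto
        from Wb[OF this] show ?thesis by linarith
      qed
      then have "esym (\<lambda>x. cmod (W x)) n (pts \<omega>) \<le> esym (\<lambda>x. 2/5 * 1) n (pts \<omega>)"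
        by (intro esym_mono) auto
      then show "esym (\<lambda>x. cmod (W x)) n (pts \<omega>) \<le> (2/5) ^ n * esym (\<lambda>_. 1 :: real) n (pts \<omega>)"
        by (simp only: esym_scale)
    qed
    moreover have "0 \<le> expectation (\<lambda>\<omega>. esym (\<lambda>x. cmod (W x)) n (pts \<omega>))"
      by (intro Bochner_Integration.integral_nonneg esym_nonneg) auto
    ultimately show "norm (1 ^ n * expectation (\<lambda>\<omega>. esym (\<lambda>x. cmod (W x)) n (pts \<omega>))) \<le> (2/5) ^ n * expectation (\<lambda>\<omega>. esym (\<lambda>_. 1 :: real) n (pts \<omega>))"
      by simp
  qed
  note EP = expected_product_series[OF W Wb summ1, of 1]
  show "integrable P (\<lambda>\<omega>. \<Prod>x\<in>pts \<omega>. 1 + W x)" using EP(1) by simp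
  have ser2: "(\<lambda>n. fredholm_coeff p n * 1 ^ n) sums expectation (\<lambda>\<omega>. \<Prod>x\<in>pts \<omega>. 1 + W x)"
    using EP(2) by (simp add: fred)
  have "expectation (\<lambda>\<omega>. \<Prod>x\<in>pts \<omega>. 1 + W x) = exp (log_series p 1)" by (rule sums_unique2[OF ser2 ser1])
  moreover have "cmod (log_series p 1) \<le> 2 * s"
  proof -
    define f where "f i = (-1) ^ i * p i / of_nat (Suc i) * 1 ^ Suc i" for i
    have f: "f sums log_series p 1" unfolding f_def by (rule log_series_sums[of "3/2"]) (use summ in auto)
    have f1: "(\<lambda>i. f (Suc i)) sums (log_series p 1 - f 0)"
      using sums_Suc_iff[of f] f by simp
    have fb: "norm (f (Suc i)) \<le> (hs_norm M G)\<^sup>2 / 2 * (1/2) ^ i" for i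
    proof -
      have "norm (f (Suc i)) = cmod (p (Suc i)) / real (Suc (Suc i))" by (simp add: f_def norm_mult norm_divide norm_power del: of_nat_Suc)
      also have "\<dots> \<le> cmod (p (Suc i)) / 2" by (intro divide_left_mono) auto
      also have "\<dots> \<le> (hs_norm M G)\<^sup>2 * (1/2) ^ i / 2" by (intro divide_right_mono p_bound) auto
      finally show ?thesis by simp
    qed
    have g: "(\<lambda>i. (hs_norm M G)\<^sup>2 / 2 * (1/2) ^ i) sums ((hs_norm M G)\<^sup>2 / 2 * 2)"
      using sums_mult[OF geometric_sums[of "1/2::real"], of "(hs_norm M G)\<^sup>2 / 2"] by simp
    have "norm (log_series p 1 - f 0) \<le> (hs_norm M G)\<^sup>2"
      using norm_suminf_le[OF fb sums_summable[OF g]] sums_unique[OF f1] sums_unique[OF g] by simp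
    moreover have "norm (f 0) = cmod (p 0)" by (simp add: f_def)
    moreover have "norm (log_series p 1) \<le> norm (log_series p 1 - f 0) + norm (f 0)" by (metis diff_add_cancel norm_triangle_ineq)
    moreover have "0 \<le> s" using p0 norm_ge_zero order_trans by blast
    ultimately show ?thesis using Gsq p0 by linarith
  qed
  ultimately show "\<exists>\<Phi>. expectation (\<lambda>\<omega>. \<Prod>x\<in>pts \<omega>. 1 + W x) = exp \<Phi> \<and> cmod \<Phi> \<le> 2 * expectation (\<lambda>\<omega>. \<Sum>x\<in>pts \<omega>. cmod (W x))"
    unfolding s_def by blast
qed

end

section \<open>Configurations on locally compact Polish spaces\<close>

lemma borel_of_space: "space (borel_of X) = topspace X"
  unfolding borel_of_def by (rule space_measure_of) (auto dest: openin_subset)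

lemma borel_of_sets: "sets (borel_of X) = sigma_sets (topspace X) {U. openin X U}"
  unfolding borel_of_def by (rule sets_measure_of) (auto dest: openin_subset)

lemma borel_of_open: "openin X U \<Longrightarrow> U \<in> sets (borel_of X)"
  by (auto simp: borel_of_sets)

lemma borel_of_closed: "closedin X C \<Longrightarrow> C \<in> sets (borel_of X)"
proof -
  assume C: "closedin X C"
  then have "topspace X - (topspace X - C) \<in> sets (borel_of X)"
    using borel_of_open[of X "topspace X - C"] borel_of_space[of X] by (metis openin_closedin_eq closedin_def sets.compl_sets)
  then show ?thesis using closedin_subset[OF C] by (simp add: double_diff)
qed

lemma precompactin_subset: "precompactin X B \<Longrightarrow> A \<subseteq> B \<Longrightarrow> precompactin X A"
  unfolding precompactin_def by (meson closed_compactin closedin_closure_of closure_of_mono order_trans)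

lemma precompactin_if_subset_compact:
  assumes "Hausdorff_space X" "compactin X K" "A \<subseteq> K"
  shows "precompactin X A"
proof -
  have "closedin X K" using assms(1,2) by (rule compactin_imp_closedin)
  then have "X closure_of A \<subseteq> K" using assms(3) by (rule closure_of_minimal[rotated])
  then show ?thesis unfolding precompactin_def
    using assms compactin_subset_topspace closed_compactin[OF assms(2)] by (metis closedin_closure_of order_trans)
qed

lemma num_points_as_sum:
  assumes "finite {x \<in> U. \<xi> x \<noteq> 0}" "A \<subseteq> U"
  shows "real (num_points A \<xi>) = (\<Sum>x | x \<in> U \<and> \<xi> x \<noteq> 0. real (\<xi> x) * indicator A x)"
proof -
  have "real (num_points A \<xi>) = (\<Sum>x | x \<in> A \<and> \<xi> x \<noteq> 0. real (\<xi> x))" by (simp add: num_points_def)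
  also have "\<dots> = (\<Sum>x | x \<in> U \<and> \<xi> x \<noteq> 0. real (\<xi> x) * indicator A x)"
    using assms by (intro sum.mono_neutral_cong_left) (auto split: split_indicator_asm)
  finally show ?thesis .
qed

locale lc_polish =
  fixes X :: "'a topology"
  assumes lcp: "lc_polish_space X"
begin

lemma metrizable: "metrizable_space X"
  using lcp by (simp add: lc_polish_space_def completely_metrizable_imp_metrizable_space)

lemma hausdorff: "Hausdorff_space X"
  by (rule metrizable_imp_Hausdorff_space[OF metrizable])

lemma compact_subset_open_precompact:
  assumes K: "compactin X K"
  obtains U where "openin X U" "K \<subseteq> U" "precompactin X U"
proof -
  have "\<exists>U C. openin X U \<and> compactin X C \<and> x \<in> U \<and> U \<subseteq> C" if "x \<in> K" for x
    using lcp that compactin_subset_topspace[OF K] by (auto simp: lc_polish_space_def locally_compact_space_def)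
  then obtain U C where UC: "\<And>x. x \<in> K \<Longrightarrow> openin X (U x) \<and> compactin X (C x) \<and> x \<in> U x \<and> U x \<subseteq> C x" by metis
  have "\<forall>\<U>. Ball \<U> (openin X) \<and> K \<subseteq> \<Union>\<U> \<longrightarrow> (\<exists>F. finite F \<and> F \<subseteq> \<U> \<and> K \<subseteq> \<Union>F)"
    using K unfolding compactin_def by (rule conjunct2)
  moreover have "Ball (U ` K) (openin X) \<and> K \<subseteq> \<Union>(U ` K)" using UC by auto
  ultimately have "\<exists>F. finite F \<and> F \<subseteq> U ` K \<and> K \<subseteq> \<Union>F" by blast
  then obtain I where I: "finite I" "I \<subseteq> K" "K \<subseteq> \<Union>(U ` I)" by (metis finite_subset_image)
  have "compactin X (\<Union>(C ` I))" using I UC by (intro compactin_Union) auto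
  moreover have "\<Union>(U ` I) \<subseteq> \<Union>(C ` I)" using I UC by blast
  ultimately have "precompactin X (\<Union>(U ` I))" using hausdorff by (rule precompactin_if_subset_compact[rotated])
  moreover have "openin X (\<Union>(U ` I))" using I UC by (intro openin_Union) auto
  ultimately show ?thesis using that I by blast
qed

lemma measurable_linear_statistic_continuous:
  assumes P: "sets P = sets (borel_of (vague_topology X))"
    and \<phi>: "continuous_map X euclideanreal \<phi>" "compact_support_on X \<phi>"
  shows "linear_statistic \<phi> \<in> borel_measurable P"
proof (rule borel_measurableI)
  fix S :: "real set" assume S: "open S"
  have sp: "space P = Conf X"
    using sets_eq_imp_space_eq[OF P] by (simp add: borel_of_space topspace_vague_topology)
  have "openin (vague_topology X) {\<xi> \<in> Conf X. linear_statistic \<phi> \<xi> \<in> S}"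
    unfolding vague_topology_def using \<phi> S by (intro topology_generated_by_Basis) blast
  moreover have "linear_statistic \<phi> -` S \<inter> space P = {\<xi> \<in> Conf X. linear_statistic \<phi> \<xi> \<in> S}" by (auto simp: sp)
  ultimately show "linear_statistic \<phi> -` S \<inter> space P \<in> sets P" by (simp add: P borel_of_open)
qed

lemma finite_points_open:
  assumes "openin X U" "precompactin X U" "\<xi> \<in> Conf X"
  shows "finite {x \<in> U. \<xi> x \<noteq> 0}"
  using assms borel_of_open[of X U] by (auto simp: Conf_def)

text \<open>An open set \<open>U\<close> is the union of an increasing sequence of closed sets. The Urysohn functions
  that are \<open>1\<close> on these and \<open>0\<close> outside \<open>U\<close> have compact support because \<open>U\<close> is pre-compact, so
  their linear statistics are vaguely continuous; these converge to the number of points in \<open>U\<close>.\<close>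

lemma measurable_num_points_open:
  assumes P: "sets P = sets (borel_of (vague_topology X))"
    and U: "openin X U" "precompactin X U"
  shows "(\<lambda>\<xi>. real (num_points U \<xi>)) \<in> borel_measurable P"
proof -
  have sp: "space P = Conf X"
    using sets_eq_imp_space_eq[OF P] by (simp add: borel_of_space topspace_vague_topology)
  obtain C where C: "\<And>n. closedin X (C n)" "\<And>n. C n \<subseteq> C (Suc n)" "\<Union>(range C) = U"
    using open_imp_fsigma_in[OF metrizable U(1)] unfolding fsigma_in_ascending by blast
  have C_mono: "C m \<subseteq> C n" if "m \<le> n" for m n using C(2) that by (rule lift_Suc_mono_le)
  have clo: "closedin X (topspace X - U)" using U(1) by (simp add: closedin_diff)
  have "\<exists>f. continuous_map X euclideanreal f \<and> f ` (topspace X - U) \<subseteq> {0} \<and> f ` C n \<subseteq> {1}" for n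
  proof -
    have "disjnt (topspace X - U) (C n)" using C(3) by (auto simp: disjnt_def)
    then show ?thesis using metrizable_imp_normal_space[OF metrizable] clo C(1)[of n]
      unfolding normal_space_iff_Urysohn_alt by blast
  qed
  then obtain f where f: "\<And>n. continuous_map X euclideanreal (f n)" "\<And>n. f n ` (topspace X - U) \<subseteq> {0}" "\<And>n. f n ` C n \<subseteq> {1 :: real}" by metis
  have supp: "compact_support_on X (f n)" for n
  proof -
    have "{x \<in> topspace X. f n x \<noteq> 0} \<subseteq> U" using f(2)[of n] by auto
    from precompactin_subset[OF U(2) this] show ?thesis by (simp add: precompactin_def compact_support_on_def)
  qed
  have m: "linear_statistic (f n) \<in> borel_measurable P" for n
    by (rule measurable_linear_statistic_continuous[OF P f(1) supp])
  have lim: "(\<lambda>n. linear_statistic (f n) \<xi>) \<longlonglongrightarrow> real (num_points U \<xi>)" if "\<xi> \<in> space P" for \<xi>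
  proof -
    have \<xi>: "\<xi> \<in> Conf X" using that sp by simp
    have fin: "finite {x \<in> U. \<xi> x \<noteq> 0}" by (rule finite_points_open[OF U \<xi>])
    have e: "linear_statistic (f n) \<xi> = (\<Sum>x | x \<in> U \<and> \<xi> x \<noteq> 0. real (\<xi> x) * f n x)" for n
      unfolding linear_statistic_def
    proof (rule sum.mono_neutral_left[OF fin])
      show "{x. \<xi> x \<noteq> 0 \<and> f n x \<noteq> 0} \<subseteq> {x \<in> U. \<xi> x \<noteq> 0}"
      proof
        fix x assume x: "x \<in> {x. \<xi> x \<noteq> 0 \<and> f n x \<noteq> 0}"
        then have "x \<in> topspace X" using \<xi> by (auto simp: Conf_def)
        then show "x \<in> {x \<in> U. \<xi> x \<noteq> 0}" using f(2)[of n] x by auto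
      qed
    qed auto
    have "(\<lambda>n. f n x) \<longlonglongrightarrow> 1" if xU: "x \<in> U" for x
    proof -
      obtain n0 where "x \<in> C n0" using xU C(3) by auto
      then have "f n x = 1" if "n \<ge> n0" for n using C_mono[OF that] f(3)[of n] by auto
      then show ?thesis by (intro tendsto_eventually eventually_sequentiallyI[of n0])
    qed
    then have "(\<lambda>n. \<Sum>x | x \<in> U \<and> \<xi> x \<noteq> 0. real (\<xi> x) * f n x) \<longlonglongrightarrow> (\<Sum>x | x \<in> U \<and> \<xi> x \<noteq> 0. real (\<xi> x) * 1)"
      by (intro tendsto_sum tendsto_mult tendsto_const) auto
    then show ?thesis unfolding e by (simp add: num_points_def)
  qed
  show ?thesis by (rule borel_measurable_LIMSEQ_metric[OF m lim])
qed

text \<open>A Dynkin class argument for the sets \<open>A \<inter> U\<close>, where \<open>U\<close> is a pre-compact open set containing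
  \<open>B\<close>: intersecting with \<open>U\<close> keeps all numbers finite, so that complements correspond to
  differences.\<close>

lemma measurable_num_points:
  assumes P: "sets P = sets (borel_of (vague_topology X))"
    and B: "B \<in> sets (borel_of X)" "precompactin X B"
  shows "(\<lambda>\<xi>. real (num_points B \<xi>)) \<in> borel_measurable P"
proof -
  have sp: "space P = Conf X"
    using sets_eq_imp_space_eq[OF P] by (simp add: borel_of_space topspace_vague_topology)
  obtain U where U: "openin X U" "X closure_of B \<subseteq> U" "precompactin X U"
    using B(2) compact_subset_open_precompact unfolding precompactin_def by blast
  have UX: "U \<subseteq> topspace X" using U(1) by (rule openin_subset)
  have fin: "finite {x \<in> U. \<xi> x \<noteq> 0}" if "\<xi> \<in> space P" for \<xi>
    using finite_points_open[OF U(1,3)] that sp by simp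
  have main: "(\<lambda>\<xi>. real (num_points (A \<inter> U) \<xi>)) \<in> borel_measurable P" if "A \<in> sigma_sets (topspace X) {U. openin X U}" for A
  proof (rule sigma_sets_induct_disjoint[OF _ _ that])
    show "Int_stable {U. openin X U}" by (auto simp: Int_stable_def)
    show "{U. openin X U} \<subseteq> Pow (topspace X)" by (auto dest: openin_subset)
    show "(\<lambda>\<xi>. real (num_points (A \<inter> U) \<xi>)) \<in> borel_measurable P" if "A \<in> {U. openin X U}" for A
      using that U precompactin_subset[OF U(3), of "A \<inter> U"] by (intro measurable_num_points_open[OF P]) auto
    show "(\<lambda>\<xi>. real (num_points ({} \<inter> U) \<xi>)) \<in> borel_measurable P" by (simp add: num_points_def)
  next
    fix A assume IH: "(\<lambda>\<xi>. real (num_points (A \<inter> U) \<xi>)) \<in> borel_measurable P"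
    have "(\<lambda>\<xi>. real (num_points U \<xi>) - real (num_points (A \<inter> U) \<xi>)) \<in> borel_measurable P"
      by (intro borel_measurable_diff IH measurable_num_points_open[OF P U(1,3)])
    moreover have "real (num_points U \<xi>) - real (num_points (A \<inter> U) \<xi>) = real (num_points ((topspace X - A) \<inter> U) \<xi>)" if "\<xi> \<in> space P" for \<xi>
      using UX unfolding num_points_as_sum[OF fin[OF that] Int_lower2] num_points_as_sum[OF fin[OF that] order_refl] sum_subtractf[symmetric]
      by (intro sum.cong refl) (auto simp: indicator_def)
    ultimately show "(\<lambda>\<xi>. real (num_points ((topspace X - A) \<inter> U) \<xi>)) \<in> borel_measurable P"
      by (simp cong: measurable_cong)
  next
    fix A :: "nat \<Rightarrow> 'a set" assume disj: "disjoint_family A" and IH: "\<And>i. (\<lambda>\<xi>. real (num_points (A i \<inter> U) \<xi>)) \<in> borel_measurable P"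
    have s: "(\<lambda>i. real (num_points (A i \<inter> U) \<xi>)) sums real (num_points ((\<Union>i. A i) \<inter> U) \<xi>)" if "\<xi> \<in> space P" for \<xi>
    proof -
      have "(\<lambda>i. indicator (A i \<inter> U) x :: real) sums indicator (\<Union>i. A i \<inter> U) x" for x
        using disj by (intro indicator_sums) (auto simp: disjoint_family_on_def)
      then show ?thesis
        unfolding num_points_as_sum[OF fin[OF that] Int_lower2] by (intro sums_sum sums_mult) simp
    qed
    have "(\<lambda>\<xi>. \<Sum>i. real (num_points (A i \<inter> U) \<xi>)) \<in> borel_measurable P"
      by (intro borel_measurable_suminf IH)
    then show "(\<lambda>\<xi>. real (num_points ((\<Union>i. A i) \<inter> U) \<xi>)) \<in> borel_measurable P"
      using sums_unique[OF s] by (simp cong: measurable_cong)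
  qed
  have "B \<subseteq> U" using U(2) B(2) closure_of_subset[of B X] unfolding precompactin_def by blast
  then show ?thesis using main[of B] B(1) by (simp add: borel_of_sets Int_absorb2)
qed

text \<open>By local compactness and separability, the balls of radius \<open>1 / n\<close> around the points of a
  countable dense set that lie in some compact set form a countable cover.\<close>

lemma radon_sigma_finite:
  assumes M: "radon_measure X M"
  shows "sigma_finite_measure M"
proof -
  have setsM: "sets M = sets (borel_of X)" and finK: "\<And>C. compactin X C \<Longrightarrow> emeasure M C < \<infinity>"
    using M by (auto simp: radon_measure_def)
  have sp: "space M = topspace X" using sets_eq_imp_space_eq[OF setsM] by (simp add: borel_of_space)
  obtain S d where Sd: "Metric_space S d" "X = Metric_space.mtopology S d"
    using metrizable unfolding metrizable_space_def by blast
  interpret Metric_space S d by fact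
  have X: "X = mtopology" by (fact Sd(2))
  have tX: "topspace X = S" unfolding X by simp
  obtain D where D: "countable D" "D \<subseteq> S" "X closure_of D = S"
    using lcp tX by (auto simp: lc_polish_space_def separable_space_def)
  define F where "F = {mball c (inverse (real (Suc n))) | c n. c \<in> D \<and> (\<exists>K. compactin X K \<and> mball c (inverse (real (Suc n))) \<subseteq> K)}"
  have "F \<subseteq> (\<lambda>(c, n). mball c (inverse (real (Suc n)))) ` (D \<times> UNIV)" by (auto simp: F_def)
  then have cF: "countable F" by (rule countable_subset) (use D(1) in simp)
  have open_F: "openin X A" if "A \<in> F" for A using that by (auto simp: F_def X)
  have cover: "\<Union>F = space M"
  proof
    show "\<Union>F \<subseteq> space M" using open_F openin_subset unfolding sp by blast
    show "space M \<subseteq> \<Union>F"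
    proof
      fix x assume "x \<in> space M"
      then have x: "x \<in> topspace X" "x \<in> S" by (auto simp: sp tX)
      obtain U K where U: "openin X U" "compactin X K" "x \<in> U" "U \<subseteq> K"
        using lcp x(1) unfolding lc_polish_space_def locally_compact_space_def by blast
      obtain r where r: "r > 0" "mball x r \<subseteq> U" using U(1,3) unfolding X openin_mtopology by blast
      obtain n where n: "inverse (real (Suc n)) < r / 2" using reals_Archimedean[of "r / 2"] r(1) by (metis half_gt_zero)
      have "x \<in> mtopology closure_of D" using D(3) x X by simp
      then have "\<forall>r>0. \<exists>y\<in>D. y \<in> mball x r" unfolding metric_closure_of by blast
      moreover have "0 < inverse (real (Suc n))" by simp
      ultimately obtain c where c: "c \<in> D" "c \<in> mball x (inverse (real (Suc n)))" by blast
      have xc: "x \<in> mball c (inverse (real (Suc n)))" using c(2) by (simp add: commute)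
      have "mball c (inverse (real (Suc n))) \<subseteq> mball x r"
      proof
        fix y assume y: "y \<in> mball c (inverse (real (Suc n)))"
        have "d x y \<le> d x c + d c y" using y c(2) x(2) by (intro triangle) auto
        also have "\<dots> < r" using y c(2) n by simp
        finally show "y \<in> mball x r" using y x(2) by simp
      qed
      then have "mball c (inverse (real (Suc n))) \<in> F" using c(1) r(2) U unfolding F_def by blast
      then show "x \<in> \<Union>F" using xc by blast
    qed
  qed
  show ?thesis
  proof
    show "\<exists>A. countable A \<and> A \<subseteq> sets M \<and> \<Union>A = space M \<and> (\<forall>a\<in>A. emeasure M a \<noteq> \<infinity>)"
    proof (intro exI[of _ F] conjI ballI cF cover)
      show "F \<subseteq> sets M" using open_F borel_of_open setsM by blast
      fix A assume "A \<in> F"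
      then obtain K where K: "compactin X K" "A \<subseteq> K" by (auto simp: F_def)
      have "K \<in> sets M" using compactin_imp_closedin[OF hausdorff K(1)] borel_of_closed setsM by blast
      then have "emeasure M A \<le> emeasure M K" using K(2) by (intro emeasure_mono)
      then show "emeasure M A \<noteq> \<infinity>" using finK[OF K(1)] by (simp add: order_le_less_trans less_top)
    qed
  qed
qed

lemma precompact_finite_measure:
  assumes M: "radon_measure X M" and \<Delta>: "precompactin X \<Delta>"
  shows "emeasure M \<Delta> < \<infinity>"
proof -
  have setsM: "sets M = sets (borel_of X)" using M by (simp add: radon_measure_def)
  have "emeasure M \<Delta> \<le> emeasure M (X closure_of \<Delta>)"
    using \<Delta> closure_of_subset[of \<Delta> X] borel_of_closed[OF closedin_closure_of, of X \<Delta>] setsM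
    by (intro emeasure_mono) (auto simp: precompactin_def)
  also have "\<dots> < \<infinity>" using M \<Delta> by (simp add: radon_measure_def precompactin_def)
  finally show ?thesis .
qed

end

section \<open>Pointwise symmetry of \<open>J\<close>-Hermitian kernels\<close>

context sigma_finite_measure
begin

interpretation PM: pair_sigma_finite M M ..

interpretation PS: product_sigma_finite "\<lambda>_. M" ..

text \<open>Rectangles are an intersection-stable generator, and the sets over which \<open>F\<close> has integral
  \<open>0\<close> form a Dynkin class.\<close>

lemma AE_zero_of_rectangles:
  fixes F :: "'a \<times> 'a \<Rightarrow> complex"
  assumes F: "integrable (M \<Otimes>\<^sub>M M) F"
    and rect: "\<And>A B. A \<in> sets M \<Longrightarrow> B \<in> sets M \<Longrightarrow> (LINT z:A \<times> B|M \<Otimes>\<^sub>M M. F z) = 0"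
  shows "AE z in M \<Otimes>\<^sub>M M. F z = 0"
proof (rule PM.density_zero[OF F])
  fix E assume "E \<in> sets (M \<Otimes>\<^sub>M M)"
  then have E: "E \<in> sigma_sets (space M \<times> space M) {a \<times> b |a b. a \<in> sets M \<and> b \<in> sets M}"
    by (simp add: sets_pair_measure)
  have SE: "sigma_sets (space M \<times> space M) {a \<times> b |a b. a \<in> sets M \<and> b \<in> sets M} = sets (M \<Otimes>\<^sub>M M)"
    by (simp add: sets_pair_measure)
  have setF: "set_integrable (M \<Otimes>\<^sub>M M) S F" if "S \<in> sets (M \<Otimes>\<^sub>M M)" for S
    unfolding set_integrable_def by (rule integrable_mult_indicator[OF that F])
  show "(LINT z:E|M \<Otimes>\<^sub>M M. F z) = 0"
  proof (rule sigma_sets_induct_disjoint[OF Int_stable_pair_measure_generator _ E])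
    show "{a \<times> b |a b. a \<in> sets M \<and> b \<in> sets M} \<subseteq> Pow (space M \<times> space M)"
      using sets.sets_into_space by fast
    show "(LINT z:S|M \<Otimes>\<^sub>M M. F z) = 0" if "S \<in> {a \<times> b |a b. a \<in> sets M \<and> b \<in> sets M}" for S
      using that rect by auto
    show "(LINT z:{}|M \<Otimes>\<^sub>M M. F z) = 0" by (simp add: set_lebesgue_integral_def)
    fix S assume S: "S \<in> sigma_sets (space M \<times> space M) {a \<times> b |a b. a \<in> sets M \<and> b \<in> sets M}"
      and S0: "(LINT z:S|M \<Otimes>\<^sub>M M. F z) = 0"
    have SM: "S \<in> sets (M \<Otimes>\<^sub>M M)" using S SE by simp
    have SS: "S \<subseteq> space M \<times> space M" using sets.sets_into_space[OF SM] by (simp add: space_pair_measure)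
    have tot: "(LINT z:(space M \<times> space M)|M \<Otimes>\<^sub>M M. F z) = 0" by (rule rect) auto
    have full: "space M \<times> space M = S \<union> (space M \<times> space M - S)" using SS by auto
    have comp: "space M \<times> space M - S \<in> sets (M \<Otimes>\<^sub>M M)" using sets.compl_sets[OF SM] by (simp add: space_pair_measure)
    have "(LINT z:(S \<union> (space M \<times> space M - S))|M \<Otimes>\<^sub>M M. F z) = (LINT z:S|M \<Otimes>\<^sub>M M. F z) + (LINT z:(space M \<times> space M - S)|M \<Otimes>\<^sub>M M. F z)"
      by (intro set_integral_Un setF SM comp) auto
    then show "(LINT z:(space M \<times> space M - S)|M \<Otimes>\<^sub>M M. F z) = 0" using tot S0 full by simp
  next
    fix S :: "nat \<Rightarrow> ('a \<times> 'a) set"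
    assume disj: "disjoint_family S" and S: "range S \<subseteq> sigma_sets (space M \<times> space M) {a \<times> b |a b. a \<in> sets M \<and> b \<in> sets M}"
      and S0: "\<And>i. (LINT z:S i|M \<Otimes>\<^sub>M M. F z) = 0"
    have SM: "S i \<in> sets (M \<Otimes>\<^sub>M M)" for i using S SE by auto
    have "(LINT z:(\<Union>i. S i)|M \<Otimes>\<^sub>M M. F z) = (\<Sum>i. (LINT z:S i|M \<Otimes>\<^sub>M M. F z))"
      using disj SM by (intro lebesgue_integral_countable_add setF sets.countable_UN) (auto simp: disjoint_family_on_def)
    then show "(LINT z:(\<Union>i. S i)|M \<Otimes>\<^sub>M M. F z) = 0" by (simp add: S0)
  qed
qed

lemma AE_pair_swap:
  assumes "AE z in M \<Otimes>\<^sub>M M. R z"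
  shows "AE z in M \<Otimes>\<^sub>M M. R (snd z, fst z)"
proof -
  have "AE z in distr (M \<Otimes>\<^sub>M M) (M \<Otimes>\<^sub>M M) (\<lambda>(x, y). (y, x)). R z"
    using assms by (subst PM.distr_pair_swap[symmetric])
  then have "AE z in M \<Otimes>\<^sub>M M. R ((\<lambda>(x, y). (y, x)) z)"
    by (rule AE_distrD[OF measurable_pair_swap'])
  then show ?thesis by (simp add: case_prod_unfold)
qed

text \<open>Testing \<open>J\<close>-self-adjointness on indicators of \<open>A\<close> and \<open>B\<close> shows that \<open>J x * K x y\<close> and its
  adjoint have the same integral over \<open>A \<times> B\<close>, provided that Fubini's theorem is applicable. As
  \<open>K\<close> need not be integrable over \<open>\<Delta> \<times> \<Delta>\<close>, this is done inside the sets \<open>D n\<close> of those \<open>x \<in> \<Delta>\<close> for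
  which the integral of \<open>\<bar>K x y\<bar>\<close> over \<open>y \<in> \<Delta>\<close> is at most \<open>n\<close>. They exhaust \<open>\<Delta>\<close> up to a null set,
  because the integral operator is defined on the indicator of \<open>\<Delta>\<close>.\<close>

lemma J_Hermitian_pointwise:
  assumes X12: "X1 \<in> sets M" "X2 \<in> sets M" "X1 \<inter> X2 = {}" "X1 \<union> X2 = space M"
    and K: "J_Hermitian M X1 X2 K" and \<Delta>: "\<Delta> \<in> sets M" "emeasure M \<Delta> < \<infinity>"
  defines "J \<equiv> \<lambda>x. if x \<in> X1 then 1 else (-1::real)"
  shows "AE z in M \<Otimes>\<^sub>M M. fst z \<in> \<Delta> \<longrightarrow> snd z \<in> \<Delta> \<longrightarrow> 
     of_real (J (fst z)) * K (fst z) (snd z) = of_real (J (snd z)) * cnj (K (snd z) (fst z))"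
proof -
  have Km: "(\<lambda>(x, y). K x y) \<in> borel_measurable (M \<Otimes>\<^sub>M M)" using K by (simp add: J_Hermitian_def)
  have Kmc: "(\<lambda>w. K (f w) (g w)) \<in> borel_measurable N" if "f \<in> measurable N M" "g \<in> measurable N M" for f g N
    using measurable_compose[OF measurable_Pair[OF that] Km] by simp
  have Jm: "J \<in> borel_measurable M" unfolding J_def using X12(1) by measurable
  define a where "a x = (\<integral>\<^sup>+y. ennreal (cmod (K x y)) * indicator \<Delta> y \<partial>M)" for x
  have a_meas: "a \<in> borel_measurable M"
  proof -
    have "(\<lambda>(x, y). ennreal (cmod (K x y)) * indicator \<Delta> y) \<in> borel_measurable (M \<Otimes>\<^sub>M M)"
      unfolding case_prod_unfold using Kmc[OF measurable_fst measurable_snd] \<Delta>(1) by measurable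
    then show ?thesis unfolding a_def[abs_def] by (rule borel_measurable_nn_integral)
  qed
  define D where "D n = {x \<in> \<Delta>. a x \<le> of_nat n}" for n
  have Dm: "D n \<in> sets M" for n
  proof -
    have "D n = \<Delta> \<inter> {x \<in> space M. a x \<le> of_nat n}" using sets.sets_into_space[OF \<Delta>(1)] by (auto simp: D_def)
    then show ?thesis using \<Delta>(1) a_meas by simp
  qed
  have D\<Delta>: "D n \<subseteq> \<Delta>" for n by (auto simp: D_def)
  have Dfin: "emeasure M (D n) < \<infinity>" for n
    using emeasure_mono[OF D\<Delta> \<Delta>(1)] \<Delta>(2) by (rule order_le_less_trans)
  have indL2: "indicator A \<in> L2 M" if "A \<in> sets M" "emeasure M A < \<infinity>" for A
  proof -
    have "(\<lambda>x. (norm (indicator A x :: complex))\<^sup>2) = (indicator A :: 'a \<Rightarrow> real)" by (auto simp: indicator_def)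
    then show ?thesis using that by (simp add: L2_def)
  qed
  have cover: "AE x in M. x \<in> \<Delta> \<longrightarrow> (\<exists>n. x \<in> D n)"
  proof -
    have "AE x in M. integrable M (\<lambda>y. K x y * indicator \<Delta> y)"
      using K indL2[OF \<Delta>] by (simp add: J_Hermitian_def)
    then show ?thesis
    proof eventually_elim
      case (elim x)
      have "a x = (\<integral>\<^sup>+y. ennreal (norm (K x y * indicator \<Delta> y)) \<partial>M)"
        unfolding a_def by (intro nn_integral_cong) (auto simp: indicator_def)
      also have "\<dots> < \<infinity>" using elim by (simp add: integrable_iff_bounded)
      finally obtain n :: nat where "a x \<le> of_nat n" using ennreal_Ex_less_of_nat[of "a x"] by (auto intro: less_imp_le)
      then show ?case by (auto simp: D_def)
    qed
  qed
  have main: "AE z in M \<Otimes>\<^sub>M M. fst z \<in> D n \<longrightarrow> snd z \<in> D n \<longrightarrow> 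
     of_real (J (fst z)) * K (fst z) (snd z) = of_real (J (snd z)) * cnj (K (snd z) (fst z))" for n
  proof -
    define F where "F x y = indicator (D n) x * indicator (D n) y * (of_real (J x) * K x y)" for x y
    have Fm: "(\<lambda>(x, y). F x y) \<in> borel_measurable (M \<Otimes>\<^sub>M M)"
    proof -
      have [measurable]: "(\<lambda>z. K (fst z) (snd z)) \<in> borel_measurable (M \<Otimes>\<^sub>M M)" by (rule Kmc) auto
      note Jm[measurable] Dm[measurable]
      show ?thesis unfolding F_def case_prod_unfold by measurable
    qed
    have Fi: "integrable (M \<Otimes>\<^sub>M M) (\<lambda>(x, y). F x y)"
    proof (rule integrableI_bounded[OF Fm])
      have "(\<integral>\<^sup>+z. ennreal (norm (case z of (x, y) \<Rightarrow> F x y)) \<partial>(M \<Otimes>\<^sub>M M)) = (\<integral>\<^sup>+x. \<integral>\<^sup>+y. ennreal (norm (F x y)) \<partial>M \<partial>M)"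
        using nn_integral_fst[of "\<lambda>z. ennreal (norm (case z of (x, y) \<Rightarrow> F x y))" M] Fm by simp
      also have "\<dots> \<le> (\<integral>\<^sup>+x. of_nat n * indicator (D n) x \<partial>M)"
      proof (intro nn_integral_mono)
        fix x
        show "(\<integral>\<^sup>+y. ennreal (norm (F x y)) \<partial>M) \<le> of_nat n * indicator (D n) x"
        proof (cases "x \<in> D n")
          case True
          have "(\<integral>\<^sup>+y. ennreal (norm (F x y)) \<partial>M) \<le> a x"
            unfolding a_def using D\<Delta>[of n] by (intro nn_integral_mono) (auto simp: F_def norm_mult J_def indicator_def)
          then show ?thesis using True by (auto simp: D_def)
        qed (simp add: F_def)
      qed
      also have "\<dots> = of_nat n * emeasure M (D n)" using Dm by (simp add: nn_integral_cmult_indicator)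
      also have "\<dots> < \<infinity>" using Dfin[of n] by (simp add: ennreal_mult_less_top of_nat_less_top)
      finally show "(\<integral>\<^sup>+z. ennreal (norm (case z of (x, y) \<Rightarrow> F x y)) \<partial>(M \<Otimes>\<^sub>M M)) < \<infinity>" .
    qed
    have Fi': "integrable (M \<Otimes>\<^sub>M M) (\<lambda>(x, y). cnj (F y x))"
    proof -
      have "integrable (M \<Otimes>\<^sub>M M) (\<lambda>(x, y). F y x)"
        using PM.integrable_product_swap[OF Fi] by simp
      then have "integrable (M \<Otimes>\<^sub>M M) (\<lambda>z. cnj (case z of (x, y) \<Rightarrow> F y x))" by (simp add: integrable_cnj)
      then show ?thesis by (simp add: case_prod_unfold)
    qed
    have "AE z in M \<Otimes>\<^sub>M M. (case z of (x, y) \<Rightarrow> F x y) - (case z of (x, y) \<Rightarrow> cnj (F y x)) = 0"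
    proof (rule AE_zero_of_rectangles[OF Bochner_Integration.integrable_diff[OF Fi Fi']])
      fix A B assume A: "A \<in> sets M" and B: "B \<in> sets M"
      have L: "indicator (D n \<inter> A) \<in> L2 M" "indicator (D n \<inter> B) \<in> L2 M"
        using Dm[of n] A B emeasure_mono[OF Int_lower1 Dm, of n A] emeasure_mono[OF Int_lower1 Dm, of n B] Dfin[of n]
        by (auto intro!: indL2 intro: order_le_less_trans)
      have Jop: "J_op X1 X2 f x = of_real (J x) * f x" if "x \<in> space M" for f x
        using that X12 by (auto simp: J_op_def mult_op_def J_def indicator_def)
      have jj: "J_inner M X1 X2 (kernel_op M K (indicator (D n \<inter> B))) (indicator (D n \<inter> A))
          = J_inner M X1 X2 (indicator (D n \<inter> B)) (kernel_op M K (indicator (D n \<inter> A)))"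
        using K L unfolding J_Hermitian_def J_self_adjoint_def by blast
      have AB: "A \<times> B \<in> sets (M \<Otimes>\<^sub>M M)" using A B by simp
      have i1: "integrable (M \<Otimes>\<^sub>M M) (\<lambda>z. indicator (A \<times> B) z *\<^sub>R (case z of (x, y) \<Rightarrow> F x y))"
        by (rule integrable_mult_indicator[OF AB Fi])
      have i2: "integrable (M \<Otimes>\<^sub>M M) (\<lambda>z. indicator (A \<times> B) z *\<^sub>R (case z of (x, y) \<Rightarrow> cnj (F y x)))"
        by (rule integrable_mult_indicator[OF AB Fi'])
      have "(LINT z:A \<times> B|M \<Otimes>\<^sub>M M. (case z of (x, y) \<Rightarrow> F x y)) = (LINT x|M. LINT y|M. indicator (A \<times> B) (x, y) *\<^sub>R F x y)"
        unfolding set_lebesgue_integral_def using PM.integral_fst'[OF i1] by simp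
      also have "\<dots> = J_inner M X1 X2 (kernel_op M K (indicator (D n \<inter> B))) (indicator (D n \<inter> A))"
        unfolding J_inner_def L2_inner_def
      proof (intro Bochner_Integration.integral_cong refl)
        fix x assume x: "x \<in> space M"
        have "(LINT y|M. indicator (A \<times> B) (x, y) *\<^sub>R F x y) = (LINT y|M. (indicator (D n \<inter> A) x * of_real (J x)) * (K x y * indicator (D n \<inter> B) y))"
          by (intro Bochner_Integration.integral_cong refl) (auto simp: F_def indicator_def)
        also have "\<dots> = (indicator (D n \<inter> A) x * of_real (J x)) * kernel_op M K (indicator (D n \<inter> B)) x"
          unfolding kernel_op_def by (rule integral_mult_right_zero)
        also have "\<dots> = J_op X1 X2 (kernel_op M K (indicator (D n \<inter> B))) x * cnj (indicator (D n \<inter> A) x)"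
          unfolding Jop[OF x] by (simp add: indicator_def)
        finally show "(LINT y|M. indicator (A \<times> B) (x, y) *\<^sub>R F x y) = J_op X1 X2 (kernel_op M K (indicator (D n \<inter> B))) x * cnj (indicator (D n \<inter> A) x)" .
      qed
      also have "\<dots> = J_inner M X1 X2 (indicator (D n \<inter> B)) (kernel_op M K (indicator (D n \<inter> A)))" by (rule jj)
      also have "\<dots> = (LINT y|M. LINT x|M. indicator (A \<times> B) (x, y) *\<^sub>R cnj (F y x))"
        unfolding J_inner_def L2_inner_def
      proof (intro Bochner_Integration.integral_cong refl)
        fix y assume y: "y \<in> space M"
        have "(LINT x|M. indicator (A \<times> B) (x, y) *\<^sub>R cnj (F y x)) = (LINT x|M. (indicator (D n \<inter> B) y * of_real (J y)) * cnj (K y x * indicator (D n \<inter> A) x))"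
          by (intro Bochner_Integration.integral_cong refl) (auto simp: F_def indicator_def)
        also have "\<dots> = (indicator (D n \<inter> B) y * of_real (J y)) * (LINT x|M. cnj (K y x * indicator (D n \<inter> A) x))"
          by (rule integral_mult_right_zero)
        also have "(LINT x|M. cnj (K y x * indicator (D n \<inter> A) x)) = cnj (kernel_op M K (indicator (D n \<inter> A)) y)"
          unfolding kernel_op_def by (simp flip: integral_cnj complex_cnj_mult)
        also have "(indicator (D n \<inter> B) y * of_real (J y)) * cnj (kernel_op M K (indicator (D n \<inter> A)) y)
           = J_op X1 X2 (indicator (D n \<inter> B)) y * cnj (kernel_op M K (indicator (D n \<inter> A)) y)"
          unfolding Jop[OF y] by (simp add: mult.commute)
        finally show "J_op X1 X2 (indicator (D n \<inter> B)) y * cnj (kernel_op M K (indicator (D n \<inter> A)) y) = (LINT x|M. indicator (A \<times> B) (x, y) *\<^sub>R cnj (F y x))" by simp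
      qed
      also have "\<dots> = (LINT z:A \<times> B|M \<Otimes>\<^sub>M M. (case z of (x, y) \<Rightarrow> cnj (F y x)))"
        unfolding set_lebesgue_integral_def using PM.integral_snd[of "\<lambda>x y. indicator (A \<times> B) (x, y) *\<^sub>R cnj (F y x)"] i2
        by (simp add: case_prod_unfold)
      finally have e: "(LINT z:A \<times> B|M \<Otimes>\<^sub>M M. (case z of (x, y) \<Rightarrow> F x y)) = (LINT z:A \<times> B|M \<Otimes>\<^sub>M M. (case z of (x, y) \<Rightarrow> cnj (F y x)))" .
      show "(LINT z:A \<times> B|M \<Otimes>\<^sub>M M. (case z of (x, y) \<Rightarrow> F x y) - (case z of (x, y) \<Rightarrow> cnj (F y x))) = 0"
        using i1 i2 e unfolding set_lebesgue_integral_def scaleR_diff_right by (simp add: Bochner_Integration.integral_diff)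
    qed
    then show ?thesis
    proof eventually_elim
      case (elim z)
      then show ?case by (auto simp: F_def case_prod_unfold)
    qed
  qed
  have c1: "AE z in M \<Otimes>\<^sub>M M. fst z \<in> \<Delta> \<longrightarrow> (\<exists>n. fst z \<in> D n)"
  proof -
    obtain N where N: "N \<in> null_sets M" "{x \<in> space M. \<not> (x \<in> \<Delta> \<longrightarrow> (\<exists>n. x \<in> D n))} \<subseteq> N"
      using cover unfolding eventually_ae_filter by auto
    have "emeasure (M \<Otimes>\<^sub>M M) (N \<times> space M) = 0"
      using N(1) by (subst emeasure_pair_measure_Times) auto
    then have "N \<times> space M \<in> null_sets (M \<Otimes>\<^sub>M M)" using N(1) by (auto simp: null_sets_def)
    then show ?thesis
      by (rule AE_I') (use N(2) in \<open>auto simp: space_pair_measure\<close>)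
  qed
  have c2: "AE z in M \<Otimes>\<^sub>M M. snd z \<in> \<Delta> \<longrightarrow> (\<exists>n. snd z \<in> D n)"
    using AE_pair_swap[OF c1] by simp
  have D_mono: "D m \<subseteq> D n" if "m \<le> n" for m n
    using that by (auto simp: D_def intro: order_trans)
  have all: "AE z in M \<Otimes>\<^sub>M M. \<forall>n. fst z \<in> D n \<longrightarrow> snd z \<in> D n \<longrightarrow> 
     of_real (J (fst z)) * K (fst z) (snd z) = of_real (J (snd z)) * cnj (K (snd z) (fst z))"
    unfolding AE_all_countable using main by blast
  show ?thesis
    using all c1 c2
  proof eventually_elim
    case (elim z)
    show ?case
    proof (intro impI)
      assume "fst z \<in> \<Delta>" "snd z \<in> \<Delta>"
      then obtain m n where "fst z \<in> D m" "snd z \<in> D n" using elim by auto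
      then have "fst z \<in> D (max m n)" "snd z \<in> D (max m n)" using D_mono[of m "max m n"] D_mono[of n "max m n"] by auto
      then show "of_real (J (fst z)) * K (fst z) (snd z) = of_real (J (snd z)) * cnj (K (snd z) (fst z))" using elim(1) by blast
    qed
  qed
qed

end

section \<open>Modification of the kernel on null sets\<close>

context sigma_finite_measure
begin

interpretation PM: pair_sigma_finite M M ..
interpretation PS: product_sigma_finite "\<lambda>_. M" ..

lemma AE_PiM_component:
  assumes R: "AE y in M. R y" and I: "finite I" "i \<in> I"
  shows "AE x in PiM I (\<lambda>_. M). R (x i)"
proof -
  obtain N where N: "N \<in> null_sets M" "{y \<in> space M. \<not> R y} \<subseteq> N"
    using R unfolding eventually_ae_filter by auto
  have Nm: "N \<in> sets M" using N by auto
  have m: "(\<lambda>x. indicator N (x i) :: ennreal) \<in> borel_measurable (PiM I (\<lambda>_. M))"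
    using measurable_compose[OF measurable_component_singleton[of i I "\<lambda>_. M"], of "indicator N :: 'a \<Rightarrow> ennreal" borel] I Nm by simp
  have "(\<integral>\<^sup>+x. indicator N (x i) \<partial>PiM I (\<lambda>_. M)) = (\<integral>\<^sup>+x. \<integral>\<^sup>+y. indicator N y \<partial>M \<partial>PiM (I - {i}) (\<lambda>_. M))"
    using PS.product_nn_integral_insert[of "I - {i}" i "\<lambda>x. indicator N (x i)"] I m by (simp add: insert_absorb)
  also have "\<dots> = 0" using N Nm by (simp add: null_setsD1)
  finally have "AE x in PiM I (\<lambda>_. M). (indicator N (x i) :: ennreal) = 0" using nn_integral_0_iff_AE[OF m] by simp
  then show ?thesis
  proof (rule AE_mp, intro AE_I2 impI)
    fix x assume x: "x \<in> space (PiM I (\<lambda>_. M))" "(indicator N (x i) :: ennreal) = 0"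
    then show "R (x i)" using N(2) space_PiM_component[OF x(1) I(2)] by (auto simp: indicator_def split: if_splits)
  qed
qed

lemma AE_PiM_pair:
  assumes R: "AE z in M \<Otimes>\<^sub>M M. R z" and I: "finite I" "i \<in> I" "j \<in> I" "i \<noteq> j"
  shows "AE x in PiM I (\<lambda>_. M). R (x i, x j)"
proof -
  obtain N where N: "N \<in> null_sets (M \<Otimes>\<^sub>M M)" "{z \<in> space (M \<Otimes>\<^sub>M M). \<not> R z} \<subseteq> N"
    using R unfolding eventually_ae_filter by auto
  have Nm: "N \<in> sets (M \<Otimes>\<^sub>M M)" using N by auto
  have mi: "(\<lambda>x. (x i, x j)) \<in> measurable (PiM I (\<lambda>_. M)) (M \<Otimes>\<^sub>M M)"
    using I by (intro measurable_Pair measurable_component_singleton)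
  have m: "(\<lambda>x. indicator N (x i, x j) :: ennreal) \<in> borel_measurable (PiM I (\<lambda>_. M))"
    using measurable_compose[OF mi, of "indicator N :: _ \<Rightarrow> ennreal" borel] Nm by simp
  define h where "h w = (\<integral>\<^sup>+y. indicator N (w, y) \<partial>M)" for w
  have "AE z in M \<Otimes>\<^sub>M M. z \<notin> N" using N(1) by (rule AE_not_in)
  then have "AE w in M. AE y in M. (w, y) \<notin> N" by (rule PM.AE_pair)
  then have "AE w in M. h w = 0"
  proof (rule AE_mp, intro AE_I2 impI)
    fix w assume w: "w \<in> space M" "AE y in M. (w, y) \<notin> N"
    have "h w = (\<integral>\<^sup>+y. 0 \<partial>M)" unfolding h_def by (rule nn_integral_cong_AE) (use w(2) in \<open>eventually_elim, auto simp: indicator_def\<close>)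
    then show "h w = 0" by simp
  qed
  then have hz: "AE x in PiM (I - {j}) (\<lambda>_. M). h (x i) = 0"
    using I by (intro AE_PiM_component) auto
  have "(\<integral>\<^sup>+x. indicator N (x i, x j) \<partial>PiM I (\<lambda>_. M)) = (\<integral>\<^sup>+x. h (x i) \<partial>PiM (I - {j}) (\<lambda>_. M))"
    using PS.product_nn_integral_insert[of "I - {j}" j "\<lambda>x. indicator N (x i, x j)"] I m by (simp add: insert_absorb h_def)
  also have "\<dots> = (\<integral>\<^sup>+x. 0 \<partial>PiM (I - {j}) (\<lambda>_. M))" by (rule nn_integral_cong_AE[OF hz])
  finally have "AE x in PiM I (\<lambda>_. M). (indicator N (x i, x j) :: ennreal) = 0" using nn_integral_0_iff_AE[OF m] by simp
  then show ?thesis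
  proof (rule AE_mp, intro AE_I2 impI)
    fix x assume x: "x \<in> space (PiM I (\<lambda>_. M))" "(indicator N (x i, x j) :: ennreal) = 0"
    then show "R (x i, x j)" using N(2) space_PiM_component[OF x(1) I(2)] space_PiM_component[OF x(1) I(3)]
      by (auto simp: indicator_def space_pair_measure split: if_splits)
  qed
qed

text \<open>The kernel is replaced by \<open>0\<close> outside \<open>\<Delta> \<times> \<Delta>\<close>, at the pairs where the symmetry fails, and in
  the rows and columns that are not square-integrable. This is a symmetric set of pairs, so the
  symmetry survives, and inside \<open>\<Delta> \<times> \<Delta>\<close> it is a null set, so the determinants are the same almost
  everywhere. Where the symmetry holds, \<open>\<bar>K x y\<bar>\<^sup>2\<close> equals \<open>\<bar>K x y * K y x\<bar>\<close>, which is how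
  \<open>pair_int\<close> yields square-integrability. A statement almost everywhere on pairs says nothing
  about the diagonal, whence the separate hypothesis \<open>diag_real\<close>.\<close>

lemma nice_modification:
  assumes X12: "X1 \<in> sets M" "X2 \<in> sets M" "X1 \<inter> X2 = {}" "X1 \<union> X2 = space M"
    and K: "J_Hermitian M X1 X2 K" and \<Delta>: "\<Delta> \<in> sets M" "emeasure M \<Delta> < \<infinity>"
    and diag_int: "integrable M (\<lambda>x. indicator \<Delta> x * K x x)"
    and pair_int: "integrable (M \<Otimes>\<^sub>M M) (\<lambda>z. indicator \<Delta> (fst z) * K (fst z) (snd z) * (indicator \<Delta> (snd z) * K (snd z) (fst z)))"
    and diag_real: "AE x in M. x \<in> \<Delta> \<longrightarrow> cnj (K x x) = K x x"
  defines "J \<equiv> \<lambda>x. if x \<in> X1 then 1 else (-1::real)"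
  obtains k where "nice_kernel k" "\<And>x y. k y x = of_real (J x * J y) * cnj (k x y)"
    "\<And>x y. x \<notin> \<Delta> \<Longrightarrow> k x y = 0"
    "\<And>n. AE x in PiM {..<n::nat} (\<lambda>_. M). (\<forall>i<n. x i \<in> \<Delta>) \<longrightarrow> (\<forall>i<n. \<forall>j<n. k (x i) (x j) = K (x i) (x j))"
proof -
  have Km: "(\<lambda>(x, y). K x y) \<in> borel_measurable (M \<Otimes>\<^sub>M M)" using K by (simp add: J_Hermitian_def)
  have Kmc: "(\<lambda>w. K (f w) (g w)) \<in> borel_measurable N" if "f \<in> measurable N M" "g \<in> measurable N M" for f g N
    using measurable_compose[OF measurable_Pair[OF that] Km] by simp
  have Jm[measurable]: "J \<in> borel_measurable M" unfolding J_def using X12(1) by measurable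
  have J2: "complex_of_real (J x) * complex_of_real (J x) = 1" for x by (simp add: J_def)
  have J1: "cmod (complex_of_real (J x)) = 1" for x by (simp add: J_def)
  \<comment> \<open>\<open>E\<close> is the set of pairs where the kernel is kept; \<open>G\<close> below consists of the points whose row
    is square-integrable.\<close>
  define E where "E x y \<longleftrightarrow> x \<in> \<Delta> \<and> y \<in> \<Delta> \<and> K y x = of_real (J x * J y) * cnj (K x y)" for x y
  have E_sym: "E x y \<Longrightarrow> E y x" for x y
  proof -
    assume e: "E x y"
    have "of_real (J y * J x) * cnj (K y x) = (complex_of_real (J x) * of_real (J x)) * (complex_of_real (J y) * of_real (J y)) * K x y"
      using e by (simp add: E_def mult_ac)
    then show "E y x" using e by (simp add: E_def J2)
  qed
  define k0 where "k0 x y = (if E x y then K x y else 0)" for x y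
  have k0_sym: "k0 y x = of_real (J x * J y) * cnj (k0 x y)" for x y
    using E_sym[of x y] E_sym[of y x] by (auto simp: k0_def E_def)
  have k0_norm_sym: "cmod (k0 y x) = cmod (k0 x y)" for x y
    unfolding k0_sym[of x y] by (simp add: norm_mult J1 del: of_real_mult) (simp add: J_def)
  have K1[measurable]: "(\<lambda>z. K (fst z) (snd z)) \<in> borel_measurable (M \<Otimes>\<^sub>M M)" by (rule Kmc) auto
  have K2[measurable]: "(\<lambda>z. K (snd z) (fst z)) \<in> borel_measurable (M \<Otimes>\<^sub>M M)" by (rule Kmc) auto
  have K3[measurable]: "(\<lambda>z. cnj (K (fst z) (snd z))) \<in> borel_measurable (M \<Otimes>\<^sub>M M)"
    by (rule measurable_compose[OF K1 borel_measurable_continuous_onI[OF continuous_on_cnj[OF continuous_on_id]]])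
  note \<Delta>(1)[measurable]
  have Em: "{z \<in> space (M \<Otimes>\<^sub>M M). E (fst z) (snd z)} \<in> sets (M \<Otimes>\<^sub>M M)"
    unfolding E_def of_real_mult by measurable
  have k0m: "(\<lambda>z. k0 (fst z) (snd z)) \<in> borel_measurable (M \<Otimes>\<^sub>M M)"
    unfolding k0_def by (intro measurable_If K1 measurable_const Em) simp
  define n2 where "n2 x = (\<integral>\<^sup>+y. ennreal ((cmod (k0 x y))\<^sup>2) \<partial>M)" for x
  have k02m: "(\<lambda>z. ennreal ((cmod (k0 (fst z) (snd z)))\<^sup>2)) \<in> borel_measurable (M \<Otimes>\<^sub>M M)" using k0m by measurable
  have n2m: "n2 \<in> borel_measurable M"
    using borel_measurable_nn_integral[of "\<lambda>x y. ennreal ((cmod (k0 x y))\<^sup>2)" M] k02m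
    by (simp add: n2_def[abs_def] case_prod_unfold)
  have tot: "(\<integral>\<^sup>+z. ennreal ((cmod (k0 (fst z) (snd z)))\<^sup>2) \<partial>(M \<Otimes>\<^sub>M M)) < \<infinity>"
  proof -
    have "(\<integral>\<^sup>+z. ennreal ((cmod (k0 (fst z) (snd z)))\<^sup>2) \<partial>(M \<Otimes>\<^sub>M M))
      \<le> (\<integral>\<^sup>+z. ennreal (norm (indicator \<Delta> (fst z) * K (fst z) (snd z) * (indicator \<Delta> (snd z) * K (snd z) (fst z)))) \<partial>(M \<Otimes>\<^sub>M M))"
    proof (intro nn_integral_mono ennreal_leI)
      fix z :: "'a \<times> 'a"
      show "(cmod (k0 (fst z) (snd z)))\<^sup>2 \<le> norm (indicator \<Delta> (fst z) * K (fst z) (snd z) * (indicator \<Delta> (snd z) * K (snd z) (fst z)))"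
      proof (cases "E (fst z) (snd z)")
        case True
        then have c: "cmod (K (snd z) (fst z)) = cmod (K (fst z) (snd z))"
          unfolding E_def by (simp add: norm_mult J_def)
        have "fst z \<in> \<Delta>" "snd z \<in> \<Delta>" using True by (auto simp: E_def)
        then show ?thesis using True c by (simp add: k0_def norm_mult power2_eq_square)
      qed (simp add: k0_def)
    qed
    also have "\<dots> < \<infinity>" using pair_int by (simp add: integrable_iff_bounded)
    finally show ?thesis .
  qed
  have n2int: "(\<integral>\<^sup>+x. n2 x \<partial>M) < \<infinity>"
    using nn_integral_fst[OF k02m] tot by (simp add: n2_def)
  define G where "G = {x \<in> space M. n2 x \<noteq> \<infinity>}"
  have Gm[measurable]: "G \<in> sets M" unfolding G_def using n2m by measurable
  have G_ae: "AE x in M. x \<in> G"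
    using nn_integral_PInf_AE[OF n2m] n2int by (auto simp: G_def)
  define k where "k x y = (if x \<in> G \<and> y \<in> G then k0 x y else 0)" for x y
  have km: "(\<lambda>(x, y). k x y) \<in> borel_measurable (M \<Otimes>\<^sub>M M)"
  proof -
    have "{z \<in> space (M \<Otimes>\<^sub>M M). fst z \<in> G \<and> snd z \<in> G} \<in> sets (M \<Otimes>\<^sub>M M)" by measurable
    then have "(\<lambda>z. if fst z \<in> G \<and> snd z \<in> G then k0 (fst z) (snd z) else 0) \<in> borel_measurable (M \<Otimes>\<^sub>M M)"
      by (intro measurable_If k0m measurable_const) auto
    then show ?thesis by (simp add: k_def case_prod_unfold)
  qed
  have krow: "k x \<in> borel_measurable M" if "x \<in> space M" for x
    using measurable_compose[OF measurable_Pair1'[OF that] km] by simp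
  have kle: "cmod (k x y) \<le> cmod (k0 x y)" for x y by (simp add: k_def)
  have k_sym: "k y x = of_real (J x * J y) * cnj (k x y)" for x y
    using k0_sym[of y x] by (auto simp: k_def)
  have k_norm_sym: "cmod (k y x) = cmod (k x y)" for x y
    using k0_norm_sym[of x y] by (simp add: k_def conj_commute)
  have row: "integrable M (\<lambda>y. (cmod (k x y))\<^sup>2)" if x: "x \<in> space M" for x
  proof (cases "x \<in> G")
    case True
    have "(\<integral>\<^sup>+y. ennreal (norm ((cmod (k x y))\<^sup>2)) \<partial>M) \<le> n2 x"
      unfolding n2_def using kle by (intro nn_integral_mono ennreal_leI) (simp add: power_mono)
    also have "\<dots> < \<infinity>" using True by (simp add: G_def less_top)
    finally show ?thesis using krow[OF x] by (intro integrableI_bounded) auto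
  qed (simp add: k_def)
  have int2: "integrable (M \<Otimes>\<^sub>M M) (\<lambda>(x, y). (cmod (k x y))\<^sup>2)"
  proof (rule integrableI_bounded)
    show "(\<lambda>(x, y). (cmod (k x y))\<^sup>2) \<in> borel_measurable (M \<Otimes>\<^sub>M M)"
      using km unfolding case_prod_unfold by measurable
    have "(\<integral>\<^sup>+z. ennreal (norm (case z of (x, y) \<Rightarrow> (cmod (k x y))\<^sup>2)) \<partial>(M \<Otimes>\<^sub>M M)) \<le> (\<integral>\<^sup>+z. ennreal ((cmod (k0 (fst z) (snd z)))\<^sup>2) \<partial>(M \<Otimes>\<^sub>M M))"
      using kle by (intro nn_integral_mono ennreal_leI) (simp add: power_mono case_prod_unfold)
    then show "(\<integral>\<^sup>+z. ennreal (norm (case z of (x, y) \<Rightarrow> (cmod (k x y))\<^sup>2)) \<partial>(M \<Otimes>\<^sub>M M)) < \<infinity>" using tot by (rule order_le_less_trans)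
  qed
  have hs: "hs_kernel M k"
    unfolding hs_kernel_def
  proof (intro conjI ballI km int2 row)
    show "integrable M (\<lambda>x. (cmod (k x y))\<^sup>2)" if "y \<in> space M" for y
      using row[OF that] unfolding k_norm_sym[of y] .
  qed
  have diag: "integrable M (\<lambda>x. k x x)"
  proof (rule Bochner_Integration.integrable_bound[OF diag_int])
    show "(\<lambda>x. k x x) \<in> borel_measurable M"
      using measurable_compose[OF measurable_Pair[OF measurable_ident_sets[OF refl] measurable_ident_sets[OF refl]] km] by simp
    show "AE x in M. norm (k x x) \<le> norm (indicator \<Delta> x * K x x)"
      by (intro AE_I2) (simp add: k_def k0_def E_def)
  qed
  have herm: "AE z in M \<Otimes>\<^sub>M M. fst z \<in> \<Delta> \<longrightarrow> snd z \<in> \<Delta> \<longrightarrow>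
     of_real (J (fst z)) * K (fst z) (snd z) = of_real (J (snd z)) * cnj (K (snd z) (fst z))"
    unfolding J_def by (rule J_Hermitian_pointwise[OF X12 K \<Delta>])
  have Epair: "AE z in M \<Otimes>\<^sub>M M. fst z \<in> \<Delta> \<longrightarrow> snd z \<in> \<Delta> \<longrightarrow> E (fst z) (snd z)"
    using herm
  proof (rule AE_mp, intro AE_I2 impI)
    fix z assume z: "fst z \<in> \<Delta> \<longrightarrow> snd z \<in> \<Delta> \<longrightarrow> of_real (J (fst z)) * K (fst z) (snd z) = of_real (J (snd z)) * cnj (K (snd z) (fst z))"
      and zz: "fst z \<in> \<Delta>" "snd z \<in> \<Delta>"
    let ?x = "fst z" and ?y = "snd z"
    have "cnj (of_real (J ?x) * K ?x ?y) = cnj (of_real (J ?y) * cnj (K ?y ?x))" using z zz by simp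
    then have "of_real (J ?x) * cnj (K ?x ?y) = of_real (J ?y) * K ?y ?x" by simp
    then have "of_real (J ?y) * (of_real (J ?x) * cnj (K ?x ?y)) = (complex_of_real (J ?y) * of_real (J ?y)) * K ?y ?x" by (simp add: mult_ac)
    then show "E ?x ?y" using zz by (simp add: E_def J2 mult_ac)
  qed
  have det: "AE x in PiM {..<n::nat} (\<lambda>_. M). (\<forall>i<n. x i \<in> \<Delta>) \<longrightarrow> (\<forall>i<n. \<forall>j<n. k (x i) (x j) = K (x i) (x j))" for n
  proof -
    have a1: "AE x in PiM {..<n} (\<lambda>_. M). \<forall>i\<in>{..<n}. x i \<in> G"
      by (intro AE_finite_allI AE_PiM_component[OF G_ae]) auto
    have a2: "AE x in PiM {..<n} (\<lambda>_. M). \<forall>i\<in>{..<n}. x i \<in> \<Delta> \<longrightarrow> cnj (K (x i) (x i)) = K (x i) (x i)"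
      by (intro AE_finite_allI AE_PiM_component[OF diag_real]) auto
    have a3: "AE x in PiM {..<n} (\<lambda>_. M). \<forall>i\<in>{..<n}. \<forall>j\<in>{..<n} - {i}. x i \<in> \<Delta> \<longrightarrow> x j \<in> \<Delta> \<longrightarrow> E (x i) (x j)"
    proof (intro AE_finite_allI)
      fix i j assume ij: "i \<in> {..<n}" "j \<in> {..<n} - {i}"
      show "AE x in PiM {..<n} (\<lambda>_. M). x i \<in> \<Delta> \<longrightarrow> x j \<in> \<Delta> \<longrightarrow> E (x i) (x j)"
        using AE_PiM_pair[OF Epair, of "{..<n}" i j] ij by simp
    qed auto
    show ?thesis
      using a1 a2 a3
    proof eventually_elim
      case (elim x)
      show ?case
      proof (intro impI allI)
        fix i j assume x: "\<forall>i<n. x i \<in> \<Delta>" and ij: "i < n" "j < n"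
        have "E (x i) (x j)"
        proof (cases "i = j")
          case True
          then show ?thesis using elim(2) x ij by (simp add: E_def J2)
        qed (use elim(3) x ij in auto)
        then show "k (x i) (x j) = K (x i) (x j)" using elim(1) ij by (simp add: k_def k0_def)
      qed
    qed
  qed
  show ?thesis
  proof (rule that)
    show "nice_kernel k" using hs diag by (simp add: nice_kernel_def)
    show "k x y = 0" if "x \<notin> \<Delta>" for x y using that by (simp add: k_def k0_def E_def)
    show "k y x = of_real (J x * J y) * cnj (k x y)" for x y by (rule k_sym)
    show "AE x in PiM {..<n::nat} (\<lambda>_. M). (\<forall>i<n. x i \<in> \<Delta>) \<longrightarrow> (\<forall>i<n. \<forall>j<n. k (x i) (x j) = K (x i) (x j))" for n
      by (rule det)
  qed
qed

end

section \<open>Restriction of the process to a pre-compact set\<close>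

lemma test_function_indicator:
  assumes "\<Delta> \<in> sets (borel_of X)" "precompactin X \<Delta>"
  shows "test_function X (indicator \<Delta>)"
proof -
  have "{x \<in> topspace X. indicator \<Delta> x \<noteq> (0::real)} = \<Delta>"
    using sets.sets_into_space[OF assms(1)] by (auto simp: borel_of_space indicator_def)
  moreover have "bounded ((indicator \<Delta> :: _ \<Rightarrow> real) ` topspace X)"
    by (rule boundedI[where B = 1]) (auto simp: indicator_def)
  ultimately show ?thesis using assms by (auto simp: test_function_def compact_support_on_def precompactin_def)
qed

context sigma_finite_measure
begin

interpretation PS: product_sigma_finite "\<lambda>_. M" ..
interpretation PM: pair_sigma_finite M M ..

text \<open>The trace formula for one and for two equal factors. For an indicator these are
  integrability along the diagonal and, in view of the symmetry of the kernel,
  square-integrability.\<close>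

lemma trace_formula_integrable:
  assumes sp: "sets M = sets (borel_of X)" and Km: "(\<lambda>(x, y). K x y) \<in> borel_measurable (M \<Otimes>\<^sub>M M)"
    and tf: "trace_formula X M X1 X2 K" and g: "test_function X g"
  shows "integrable M (\<lambda>x. of_real (g x) * K x x)"
    and "integrable (M \<Otimes>\<^sub>M M) (\<lambda>z. of_real (g (fst z)) * K (fst z) (snd z) * (of_real (g (snd z)) * K (snd z) (fst z)))"
proof -
  have gm[measurable]: "g \<in> borel_measurable M" 
    using g measurable_cong_sets[OF sp refl] by (auto simp: test_function_def)
  have Kmc: "(\<lambda>w. K (f w) (h w)) \<in> borel_measurable N" if "f \<in> measurable N M" "h \<in> measurable N M" for f h N
    using measurable_compose[OF measurable_Pair[OF that] Km] by simp
  have [measurable]: "(\<lambda>x. K x x) \<in> borel_measurable M" by (rule Kmc) (auto intro: measurable_ident_sets)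
  have [measurable]: "(\<lambda>z. K (fst z) (snd z)) \<in> borel_measurable (M \<Otimes>\<^sub>M M)" "(\<lambda>z. K (snd z) (fst z)) \<in> borel_measurable (M \<Otimes>\<^sub>M M)"
    by (rule Kmc; simp)+
  have all: "\<forall>gs. gs \<noteq> [] \<longrightarrow> (\<forall>g\<in>set gs. test_function X g) \<longrightarrow> integrable (\<Pi>\<^sub>M i\<in>{..<length gs}. M) (cyclic_product K gs)"
    using tf unfolding trace_formula_def by blast
  have i1: "integrable (\<Pi>\<^sub>M i\<in>{..<length [g]}. M) (cyclic_product K [g])"
    using all[rule_format, of "[g]"] g by simp
  have i2: "integrable (\<Pi>\<^sub>M i\<in>{..<length [g, g]}. M) (cyclic_product K [g, g])"
    using all[rule_format, of "[g, g]"] g by simp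
  let ?f = "\<lambda>x. of_real (g x) * K x x"
  have s1: "{..<length [g]} = {0::nat}" by auto
  have "(\<integral>\<^sup>+x. ennreal (norm (?f x)) \<partial>M) = (\<integral>\<^sup>+x. ennreal (norm (?f (x 0))) \<partial>(PiM {0::nat} (\<lambda>_. M)))"
    by (rule PS.product_nn_integral_singleton[symmetric]) measurable
  also have "\<dots> = (\<integral>\<^sup>+x. ennreal (norm (cyclic_product K [g] x)) \<partial>(PiM {0::nat} (\<lambda>_. M)))"
    by (simp add: cyclic_product_def)
  also have "\<dots> < \<infinity>" using i1 unfolding s1 by (simp add: integrable_iff_bounded)
  finally show "integrable M ?f" by (intro integrableI_bounded) auto
  let ?h = "\<lambda>x y. of_real (g x) * K x y * (of_real (g y) * K y x)"
  have s2: "{..<length [g, g]} = {0::nat, 1}" by auto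
  have "(\<integral>\<^sup>+z. ennreal (norm (?h (fst z) (snd z))) \<partial>(M \<Otimes>\<^sub>M M)) = (\<integral>\<^sup>+x. ennreal (norm (?h (x 0) (x 1))) \<partial>(PiM {0::nat, 1} (\<lambda>_. M)))"
  proof (rule PS.product_nn_integral_pair[symmetric, where f = "\<lambda>x y. ennreal (norm (?h x y))"])
    show "(\<lambda>(x, y). ennreal (norm (?h x y))) \<in> borel_measurable (M \<Otimes>\<^sub>M M)"
      unfolding case_prod_unfold by measurable
  qed simp
  also have "\<dots> = (\<integral>\<^sup>+x. ennreal (norm (cyclic_product K [g, g] x)) \<partial>(PiM {0::nat, 1} (\<lambda>_. M)))"
    by (simp add: cyclic_product_def lessThan_Suc numeral_2_eq_2 mult_ac)
  also have "\<dots> < \<infinity>" using i2 unfolding s2 by (simp add: integrable_iff_bounded)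
  finally show "integrable (M \<Otimes>\<^sub>M M) (\<lambda>z. ?h (fst z) (snd z))" by (intro integrableI_bounded) auto
qed

lemma AE_of_AE_PiM_singleton:
  assumes "AE x in PiM {..<1::nat} (\<lambda>_. M). R (x 0)"
  shows "AE y in M. R y"
proof -
  have s: "{..<1::nat} = {0}" by auto
  obtain N where N: "N \<in> null_sets (PiM {0::nat} (\<lambda>_. M))" "{x \<in> space (PiM {0::nat} (\<lambda>_. M)). \<not> R (x 0)} \<subseteq> N"
    using assms unfolding s eventually_ae_filter by auto
  have m: "(\<lambda>y. \<lambda>i\<in>{0::nat}. y) \<in> measurable M (PiM {0::nat} (\<lambda>_. M))"
    by (rule measurable_restrict) (auto intro: measurable_ident_sets)
  have d: "distr M (PiM {0::nat} (\<lambda>_. M)) (\<lambda>y. \<lambda>i\<in>{0::nat}. y) = PiM {0::nat} (\<lambda>_. M)"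
  proof (rule PS.PiM_eqI)
    fix A :: "nat \<Rightarrow> 'a set" assume A: "\<And>i. i \<in> {0} \<Longrightarrow> A i \<in> sets M"
    have "(\<lambda>y. \<lambda>i\<in>{0::nat}. y) -` Pi\<^sub>E {0} A \<inter> space M = A 0"
      using sets.sets_into_space[OF A[of 0]] by (auto simp: PiE_iff)
    then show "emeasure (distr M (PiM {0::nat} (\<lambda>_. M)) (\<lambda>y. \<lambda>i\<in>{0::nat}. y)) (Pi\<^sub>E {0} A) = (\<Prod>i\<in>{0}. emeasure M (A i))"
      using A by (subst emeasure_distr[OF m]) (auto intro!: sets_PiM_I_finite)
  qed auto
  have "AE x in PiM {0::nat} (\<lambda>_. M). R (x 0)" using assms unfolding s .
  then have "AE x in distr M (PiM {0::nat} (\<lambda>_. M)) (\<lambda>y. \<lambda>i\<in>{0::nat}. y). R (x 0)" unfolding d .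
  from AE_distrD[OF m this] show ?thesis by simp
qed

end

lemma jnf_det_eq_sum:
  fixes a :: "nat \<Rightarrow> nat \<Rightarrow> complex"
  shows "Determinant.det (mat n n (\<lambda>(i, j). a i j)) = (\<Sum>q | q permutes {..<n}. of_int (sign q) * (\<Prod>i<n. a i (q i)))"
proof -
  have "Determinant.det (mat n n (\<lambda>(i, j). a i j)) = (\<Sum>q | q permutes {0..<n}. of_int (sign q) * (\<Prod>i = 0..<n. mat n n (\<lambda>(i, j). a i j) $$ (i, q i)))"
    by (rule det_def') simp
  also have "\<dots> = (\<Sum>q | q permutes {..<n}. of_int (sign q) * (\<Prod>i<n. a i (q i)))"
    unfolding atLeast0LessThan
  proof (intro sum.cong refl arg_cong2[where f = "(*)"] prod.cong)
    fix q i assume "q \<in> {q. q permutes {..<n}}" "i \<in> {..<n}"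
    then have "i < n" "q i < n" using permutes_in_image[of q "{..<n}" i] by auto
    then show "mat n n (\<lambda>(i, j). a i j) $$ (i, q i) = a i (q i)" by simp
  qed
  finally show ?thesis .
qed

locale j_det_process = lc_polish X for X :: "'a topology" +
  fixes X1 X2 :: "'a set" and M :: "'a measure" and K :: "'a \<Rightarrow> 'a \<Rightarrow> complex" and P :: "('a \<Rightarrow> nat) measure"
  assumes X12: "X1 \<in> sets (borel_of X)" "X2 \<in> sets (borel_of X)" "X1 \<inter> X2 = {}" "X1 \<union> X2 = topspace X"
    and radon: "radon_measure X M" and J_herm: "J_Hermitian M X1 X2 K"
    and trace: "trace_formula X M X1 X2 K" and det_proc: "determinantal_process X M K P"
begin

lemma sets_M: "sets M = sets (borel_of X)" using radon by (simp add: radon_measure_def)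
lemma space_M: "space M = topspace X" using sets_eq_imp_space_eq[OF sets_M] by (simp add: borel_of_space)
lemma sets_P: "sets P = sets (borel_of (vague_topology X))" using det_proc by (simp add: determinantal_process_def point_process_def)
lemma space_P: "space P = Conf X" using sets_eq_imp_space_eq[OF sets_P] by (simp add: borel_of_space topspace_vague_topology)
lemma prob_P: "prob_space P" using det_proc by (simp add: determinantal_process_def point_process_def)

text \<open>The points are those of the configuration in \<open>\<Delta>\<close>; on a null set outside of which all
  multiplicities are at most \<open>1\<close> they are replaced by the empty set. The diagonal of \<open>K\<close> is real
  almost everywhere because it is the first correlation function.\<close>

lemma restrict_to_precompact:
  assumes \<Delta>: "\<Delta> \<in> sets (borel_of X)" "precompactin X \<Delta>"
  obtains pts \<rho> J k N where "det_points P M \<Delta> pts \<rho> J k" "N \<in> null_sets P"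
    "\<And>\<xi>. \<xi> \<in> space P - N \<Longrightarrow> pts \<xi> = {x \<in> \<Delta>. \<xi> x \<noteq> 0} \<and> (\<forall>x\<in>topspace X. \<xi> x \<le> 1)"
proof -
  interpret P: prob_space P by (rule prob_P)
  interpret M: sigma_finite_measure M by (rule radon_sigma_finite[OF radon])
  have \<Delta>M: "\<Delta> \<in> sets M" using \<Delta>(1) sets_M by simp
  have \<Delta>fin: "emeasure M \<Delta> < \<infinity>" by (rule precompact_finite_measure[OF radon \<Delta>(2)])
  have Km: "(\<lambda>(x, y). K x y) \<in> borel_measurable (M \<Otimes>\<^sub>M M)" using J_herm by (simp add: J_Hermitian_def)
  have "simple_process X P" using det_proc by (simp add: determinantal_process_def)
  then obtain N where N: "N \<in> null_sets P" "{\<xi> \<in> space P. \<not> (\<forall>x\<in>topspace X. \<xi> x \<le> 1)} \<subseteq> N"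
    unfolding simple_process_def eventually_ae_filter by auto
  obtain \<rho>0 where \<rho>0: "\<And>n. 1 \<le> n \<Longrightarrow> correlation_function X M P n (\<rho>0 n)"
    "\<And>n. 1 \<le> n \<Longrightarrow> AE x in PiM {..<n} (\<lambda>_. M). complex_of_real (\<rho>0 n x) = Determinant.det (mat n n (\<lambda>(i, j). K (x i) (x j)))"
    using det_proc unfolding determinantal_process_def by blast
  \<comment> \<open>Correlation functions start at \<open>n = 1\<close>; the empty determinant has the value \<open>1\<close>.\<close>
  define \<rho> where "\<rho> n = (if n = 0 then (\<lambda>_. 1) else \<rho>0 n)" for n
  define pts where "pts \<xi> = (if \<xi> \<in> N then {} else {x \<in> \<Delta>. \<xi> x \<noteq> 0})" for \<xi>
  define J where "J x = (if x \<in> X1 then 1 else (-1::real))" for x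
  have diag_real: "AE x in M. x \<in> \<Delta> \<longrightarrow> cnj (K x x) = K x x"
  proof -
    have "AE x in PiM {..<1::nat} (\<lambda>_. M). cnj (K (x 0) (x 0)) = K (x 0) (x 0)"
    proof (rule AE_mp)
      show "AE x in PiM {..<1} (\<lambda>_. M). complex_of_real (\<rho>0 1 x) = Determinant.det (mat 1 1 (\<lambda>(i, j). K (x i) (x j)))"
        by (rule \<rho>0(2)[of 1, OF order_refl])
      show "AE x in PiM {..<1} (\<lambda>_. M). complex_of_real (\<rho>0 1 x) = Determinant.det (mat 1 1 (\<lambda>(i, j). K (x i) (x j))) \<longrightarrow> cnj (K (x 0) (x 0)) = K (x 0) (x 0)"
      proof (intro AE_I2 impI)
        fix x assume "complex_of_real (\<rho>0 1 x) = Determinant.det (mat 1 1 (\<lambda>(i, j). K (x i) (x j)))"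
        then have "K (x 0) (x 0) = of_real (\<rho>0 1 x)" unfolding jnf_det_eq_sum by (simp add: lessThan_Suc)
        then show "cnj (K (x 0) (x 0)) = K (x 0) (x 0)" by simp
      qed
    qed
    then have "AE x in M. cnj (K x x) = K x x" by (rule M.AE_of_AE_PiM_singleton)
    then show ?thesis by eventually_elim simp
  qed
  note tf = M.trace_formula_integrable[OF sets_M Km trace test_function_indicator[OF \<Delta>], unfolded of_real_indicator]
  obtain k where k: "M.nice_kernel k" "\<And>x y. k y x = of_real (J x * J y) * cnj (k x y)"
    "\<And>x y. x \<notin> \<Delta> \<Longrightarrow> k x y = 0"
    "\<And>n. AE x in PiM {..<n::nat} (\<lambda>_. M). (\<forall>i<n. x i \<in> \<Delta>) \<longrightarrow> (\<forall>i<n. \<forall>j<n. k (x i) (x j) = K (x i) (x j))"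
    using M.nice_modification[OF X12(1,2)[folded sets_M] X12(3) X12(4)[folded space_M] J_herm \<Delta>M \<Delta>fin tf diag_real]
    unfolding J_def by blast
  have \<rho>m: "\<rho> n \<in> borel_measurable (PiM {..<n} (\<lambda>_. M))" for n
    using \<rho>0(1)[of n] by (cases n) (auto simp: \<rho>_def correlation_function_def)
  have \<rho>nn: "0 \<le> \<rho> n x" if "x \<in> space (PiM {..<n} (\<lambda>_. M))" for n x
    using \<rho>0(1)[of n] that by (cases n) (auto simp: \<rho>_def correlation_function_def)
  have wdet: "AE x in PiM {..<n} (\<lambda>_. M). complex_of_real (indicator (Pi\<^sub>E {..<n} (\<lambda>_. \<Delta>)) x * \<rho> n x)
      = (\<Sum>q | q permutes {..<n}. of_int (sign q) * (\<Prod>i<n. k (x i) (x (q i))))" for n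
  proof (cases "n = 0")
    case True
    then show ?thesis by (intro AE_I2) (auto simp: \<rho>_def space_PiM)
  next
    case False
    then have "AE x in PiM {..<n} (\<lambda>_. M). complex_of_real (\<rho>0 n x) = Determinant.det (mat n n (\<lambda>(i, j). K (x i) (x j)))"
      by (intro \<rho>0(2)) simp
    from this k(4)[of n] AE_space show ?thesis
    proof eventually_elim
      case (elim x)
      show ?case
      proof (cases "x \<in> Pi\<^sub>E {..<n} (\<lambda>_. \<Delta>)")
        case True
        then have "\<forall>i<n. x i \<in> \<Delta>" by auto
        then have kK: "k (x i) (x j) = K (x i) (x j)" if "i < n" "j < n" for i j using elim(2) that by blast
        have "complex_of_real (\<rho>0 n x) = (\<Sum>q | q permutes {..<n}. of_int (sign q) * (\<Prod>i<n. K (x i) (x (q i))))"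
          using elim(1) unfolding jnf_det_eq_sum .
        also have "\<dots> = (\<Sum>q | q permutes {..<n}. of_int (sign q) * (\<Prod>i<n. k (x i) (x (q i))))"
        proof (intro sum.cong refl arg_cong2[where f = "(*)"] prod.cong)
          fix q i assume "q \<in> {q. q permutes {..<n}}" "i \<in> {..<n}"
          then have "i < n" "q i < n" using permutes_in_image[of q "{..<n}" i] by auto
          then show "K (x i) (x (q i)) = k (x i) (x (q i))" using kK by simp
        qed
        finally show ?thesis using True False by (simp add: \<rho>_def)
      next
        case out: False
        then obtain i where i: "i < n" "x i \<notin> \<Delta>" using elim(3) by (auto simp: space_PiM PiE_iff)
        have p0: "(\<Prod>i<n. k (x i) (x (q i))) = 0" for q
          using i k(3)[OF i(2)] by (intro prod_zero) auto
        have "(\<Sum>q | q permutes {..<n}. of_int (sign q) * (\<Prod>i<n. k (x i) (x (q i)))) = 0"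
          by (simp only: p0 mult_zero_right sum.neutral_const)
        then show ?thesis using out by simp
      qed
    qed
  qed
  have \<rho>int: "integrable (PiM {..<n} (\<lambda>_. M)) (\<lambda>x. indicator (Pi\<^sub>E {..<n} (\<lambda>_. \<Delta>)) x * \<rho> n x)" for n
  proof -
    have S: "Pi\<^sub>E {..<n} (\<lambda>_. \<Delta>) \<in> sets (PiM {..<n} (\<lambda>_. M))" using \<Delta>M by (intro sets_PiM_I_finite) auto
    have rhs: "integrable (PiM {..<n} (\<lambda>_. M)) (\<lambda>x. \<Sum>q | q permutes {..<n}. of_int (sign q) * (\<Prod>i<n. k (x i) (x (q i))))"
      by (intro Bochner_Integration.integrable_sum integrable_mult_right M.perm_prod_integrable k) auto
    have m: "(\<lambda>x. indicator (Pi\<^sub>E {..<n} (\<lambda>_. \<Delta>)) x * \<rho> n x) \<in> borel_measurable (PiM {..<n} (\<lambda>_. M))"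
      using S \<rho>m by (intro borel_measurable_times borel_measurable_indicator)
    have "integrable (PiM {..<n} (\<lambda>_. M)) (\<lambda>x. complex_of_real (indicator (Pi\<^sub>E {..<n} (\<lambda>_. \<Delta>)) x * \<rho> n x))"
      using integrable_cong_AE[OF measurable_compose[OF m borel_measurable_of_real] borel_measurable_integrable[OF rhs] wdet] rhs by blast
    then show ?thesis by (simp only: complex_of_real_integrable_eq)
  qed
  have fin: "finite {x \<in> \<Delta>. \<xi> x \<noteq> 0}" if "\<xi> \<in> space P" for \<xi>
    using that \<Delta> by (simp add: space_P Conf_def)
  have \<Delta>X: "\<Delta> \<subseteq> topspace X" using \<Delta>(2) by (simp add: precompactin_def)
  have card_num: "card (pts \<xi> \<inter> B) = (if \<xi> \<in> N then 0 else num_points B \<xi>)" if \<xi>: "\<xi> \<in> space P" and B: "B \<subseteq> \<Delta>" for \<xi> B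
  proof (cases "\<xi> \<in> N")
    case False
    then have one: "\<xi> x \<le> 1" if "x \<in> topspace X" for x using N(2) \<xi> that by auto
    have "num_points B \<xi> = (\<Sum>x | x \<in> B \<and> \<xi> x \<noteq> 0. 1)"
      unfolding num_points_def using one B \<Delta>X by (intro sum.cong refl) (force simp: le_Suc_eq)
    also have "\<dots> = card {x. x \<in> B \<and> \<xi> x \<noteq> 0}" by simp
    also have "{x. x \<in> B \<and> \<xi> x \<noteq> 0} = pts \<xi> \<inter> B" using False B by (auto simp: pts_def)
    finally show ?thesis using False by simp
  qed (simp add: pts_def)
  have rp: "random_points P M \<Delta> pts \<rho>"
  proof
    show "\<Delta> \<in> sets M" by fact
    show "finite (pts \<xi>)" "pts \<xi> \<subseteq> \<Delta>" if "\<xi> \<in> space P" for \<xi>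
      using fin[OF that] by (auto simp: pts_def)
    show "(\<lambda>\<xi>. card (pts \<xi> \<inter> B)) \<in> measurable P (count_space UNIV)" if B: "B \<in> sets M" "B \<subseteq> \<Delta>" for B
    proof -
      have num: "(\<lambda>\<xi>. real (num_points B \<xi>)) \<in> borel_measurable P"
        using B \<Delta> sets_M precompactin_subset[OF \<Delta>(2) B(2)] by (intro measurable_num_points[OF sets_P]) auto
      have "(\<lambda>\<xi>. if \<xi> \<in> N then 0 else real (num_points B \<xi>)) \<in> borel_measurable P"
        using N(1) by (intro measurable_If_set measurable_const num) auto
      then have "(\<lambda>\<xi>. real (card (pts \<xi> \<inter> B))) \<in> borel_measurable P"
        by (rule measurable_cong[THEN iffD1, rotated]) (simp add: card_num[OF _ B(2)])
      then have "(\<lambda>\<xi>. nat \<lfloor>real (card (pts \<xi> \<inter> B))\<rfloor>) \<in> measurable P (count_space UNIV)" by measurable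
      then show ?thesis by simp
    qed
    show "\<rho> n \<in> borel_measurable (PiM {..<n} (\<lambda>_. M))" for n by (rule \<rho>m)
    show "0 \<le> \<rho> n x" if "x \<in> space (PiM {..<n} (\<lambda>_. M))" for n x using that by (rule \<rho>nn)
    show "integrable (PiM {..<n} (\<lambda>_. M)) (\<lambda>x. indicator (Pi\<^sub>E {..<n} (\<lambda>_. \<Delta>)) x * \<rho> n x)" for n by (rule \<rho>int)
    fix n :: nat and C :: "complex set" and D s
    assume C: "finite C" "disjoint_family_on D C" "\<And>c. c \<in> C \<Longrightarrow> D c \<in> sets M \<and> D c \<subseteq> \<Delta>" "\<And>i. i < n \<Longrightarrow> s i \<in> C"
    show "(\<integral>\<^sup>+\<xi>. ennreal (\<Prod>c\<in>C. falling_fact (card (pts \<xi> \<inter> D c)) (card {i. i < n \<and> s i = c})) \<partial>P) =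
       (\<integral>\<^sup>+x\<in>Pi\<^sub>E {..<n} (\<lambda>i. D (s i)). ennreal (\<rho> n x) \<partial>(PiM {..<n} (\<lambda>_. M)))"
    proof (cases "n = 0")
      case True
      then show ?thesis by (simp add: PiM_empty \<rho>_def P.emeasure_space_1 nn_integral_count_space_finite indicator_def)
    next
      case False
      have "(\<integral>\<^sup>+\<xi>. ennreal (\<Prod>c\<in>C. falling_fact (card (pts \<xi> \<inter> D c)) (card {i. i < n \<and> s i = c})) \<partial>P)
        = (\<integral>\<^sup>+\<xi>. ennreal (\<Prod>c\<in>C. falling_fact (num_points (D c) \<xi>) (card {i. i < n \<and> s i = c})) \<partial>P)"
      proof (rule nn_integral_cong_AE)
        have "AE \<xi> in P. \<xi> \<notin> N" using N(1) by (rule AE_not_in)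
        then show "AE \<xi> in P. ennreal (\<Prod>c\<in>C. falling_fact (card (pts \<xi> \<inter> D c)) (card {i. i < n \<and> s i = c}))
          = ennreal (\<Prod>c\<in>C. falling_fact (num_points (D c) \<xi>) (card {i. i < n \<and> s i = c}))"
          using AE_space
        proof eventually_elim
          case (elim \<xi>)
          then show ?case using card_num[OF elim(2)] C(3) by (intro arg_cong[of _ _ ennreal] prod.cong refl) simp
        qed
      qed
      also have "\<dots> = (\<integral>\<^sup>+x\<in>Pi\<^sub>E {..<n} (\<lambda>i. D (s i)). ennreal (\<rho>0 n x) \<partial>(PiM {..<n} (\<lambda>_. M)))"
      proof (rule correlation_function_family[OF \<rho>0(1) _ M.sigma_finite_measure_axioms sets_M C(1) _ C(2) C(4)])
        show "D c \<in> sets M \<and> precompactin X (D c)" if "c \<in> C" for c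
          using C(3)[OF that] precompactin_subset[OF \<Delta>(2)] by blast
      qed (use False in auto)
      finally show ?thesis using False by (simp add: \<rho>_def)
    qed
  qed
  interpret random_points P M \<Delta> pts \<rho> by (rule rp)
  have "det_points P M \<Delta> pts \<rho> J k"
  proof
    show "J \<in> borel_measurable M" unfolding J_def using X12(1)[folded sets_M] by measurable
    show "J x = 1 \<or> J x = - 1" for x by (simp add: J_def)
    show "M.nice_kernel k" by (rule k)
    show "k y x = of_real (J x * J y) * cnj (k x y)" for x y by (rule k)
    show "AE x in PiM {..<n} (\<lambda>_. M). complex_of_real (weight n x) = (\<Sum>q | q permutes {..<n}. of_int (sign q) * (\<Prod>i<n. k (x i) (x (q i))))" for n
      unfolding weight_def by (rule wdet)
  qed
  moreover have "pts \<xi> = {x \<in> \<Delta>. \<xi> x \<noteq> 0} \<and> (\<forall>x\<in>topspace X. \<xi> x \<le> 1)" if "\<xi> \<in> space P - N" for \<xi>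
    using that N(2) by (auto simp: pts_def)
  ultimately show ?thesis using that N(1) by blast
qed

end

section \<open>The Laplace transform of a linear statistic\<close>

lemma norm_exp_minus_one_le:
  fixes w :: complex
  assumes "cmod w \<le> 1"
  shows "cmod (exp w - 1) \<le> 2 * cmod w"
proof -
  have s: "(\<lambda>n. w ^ n /\<^sub>R fact n) sums exp w" by (rule exp_converges)
  have s1: "(\<lambda>n. w ^ Suc n /\<^sub>R fact (Suc n)) sums (exp w - 1)"
    using sums_Suc_iff[of "\<lambda>n. w ^ n /\<^sub>R fact n" "exp w - 1"] s by simp
  have r: "(\<lambda>n. cmod w ^ n /\<^sub>R fact n) sums exp (cmod w)" by (rule exp_converges)
  have r1: "(\<lambda>n. cmod w ^ Suc n /\<^sub>R fact (Suc n)) sums (exp (cmod w) - 1)"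
    using sums_Suc_iff[of "\<lambda>n. cmod w ^ n /\<^sub>R fact n" "exp (cmod w) - 1"] r by simp
  have "cmod (\<Sum>n. w ^ Suc n /\<^sub>R fact (Suc n)) \<le> (\<Sum>n. cmod w ^ Suc n /\<^sub>R fact (Suc n))"
    by (rule norm_suminf_le[OF _ sums_summable[OF r1]]) (simp add: norm_power norm_mult norm_divide del: fact_Suc)
  then have "cmod (exp w - 1) \<le> exp (cmod w) - 1" using sums_unique[OF s1] sums_unique[OF r1] by simp
  also have "exp (cmod w) \<le> 1 + cmod w + (cmod w)\<^sup>2" using assms by (intro exp_bound) auto
  also have "(cmod w)\<^sup>2 \<le> cmod w * 1" unfolding power2_eq_square using assms by (intro mult_left_mono) auto
  finally show ?thesis by simp
qed

context j_det_process
begin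

lemma support_of_test_function:
  assumes f: "test_function X f"
  defines "\<Delta> \<equiv> {x \<in> topspace X. f x \<noteq> 0}"
  shows "\<Delta> \<in> sets (borel_of X)" and "precompactin X \<Delta>"
proof -
  have "f \<in> borel_measurable (borel_of X)" using f by (simp add: test_function_def)
  then have "f -` (UNIV - {0}) \<inter> space (borel_of X) \<in> sets (borel_of X)" by (rule measurable_sets) simp
  moreover have "f -` (UNIV - {0}) \<inter> space (borel_of X) = \<Delta>" by (auto simp: \<Delta>_def borel_of_space)
  ultimately show "\<Delta> \<in> sets (borel_of X)" by simp
  show "precompactin X \<Delta>" using f by (auto simp: test_function_def compact_support_on_def precompactin_def \<Delta>_def)
qed

text \<open>Pointwise approximation of \<open>f\<close> by simple functions, whose linear statistics are finite
  combinations of numbers of points in measurable sets.\<close>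

lemma linear_statistic_measurable:
  assumes f: "test_function X f"
  shows "linear_statistic f \<in> borel_measurable P"
proof -
  define \<Delta> where "\<Delta> = {x \<in> topspace X. f x \<noteq> 0}"
  have \<Delta>: "\<Delta> \<in> sets (borel_of X)" "precompactin X \<Delta>" unfolding \<Delta>_def by (rule support_of_test_function[OF f])+
  have fm: "f \<in> borel_measurable (borel_of X)" using f by (simp add: test_function_def)
  obtain G where G: "\<forall>j. simple_function (borel_of X) (G j)" "\<forall>x\<in>space (borel_of X). (\<lambda>j. G j x) \<longlonglongrightarrow> f x"
    using borel_measurable_implies_sequence_metric[OF fm, of 0] by blast
  have fin: "finite {x \<in> \<Delta>. \<xi> x \<noteq> 0}" if "\<xi> \<in> space P" for \<xi>
    using that \<Delta> by (simp add: space_P Conf_def)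
  define T where "T j \<xi> = (\<Sum>c\<in>G j ` topspace X. c * real (num_points {x \<in> \<Delta>. G j x = c} \<xi>))" for j \<xi>
  have Gfin: "finite (G j ` topspace X)" for j using G(1) by (simp add: simple_function_def borel_of_space)
  have Tm: "T j \<in> borel_measurable P" for j
    unfolding T_def
  proof (intro borel_measurable_sum borel_measurable_times borel_measurable_const measurable_num_points[OF sets_P])
    fix c
    have "G j -` {c} \<inter> space (borel_of X) \<in> sets (borel_of X)" using G(1) by (auto intro: simple_functionD)
    moreover have "{x \<in> \<Delta>. G j x = c} = \<Delta> \<inter> (G j -` {c} \<inter> space (borel_of X))" by (auto simp: borel_of_space \<Delta>_def)
    ultimately show "{x \<in> \<Delta>. G j x = c} \<in> sets (borel_of X)" using \<Delta>(1) by auto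
    show "precompactin X {x \<in> \<Delta>. G j x = c}" by (rule precompactin_subset[OF \<Delta>(2)]) auto
  qed
  have lim: "(\<lambda>j. T j \<xi>) \<longlonglongrightarrow> linear_statistic f \<xi>" if \<xi>: "\<xi> \<in> space P" for \<xi>
  proof -
    have T: "T j \<xi> = (\<Sum>x | x \<in> \<Delta> \<and> \<xi> x \<noteq> 0. real (\<xi> x) * G j x)" for j
    proof -
      have "T j \<xi> = (\<Sum>c\<in>G j ` topspace X. \<Sum>x | x \<in> \<Delta> \<and> \<xi> x \<noteq> 0. c * (real (\<xi> x) * indicator {x \<in> \<Delta>. G j x = c} x))"
        unfolding T_def using num_points_as_sum[OF fin[OF \<xi>]] by (intro sum.cong refl) (simp add: sum_distrib_left)
      also have "\<dots> = (\<Sum>x | x \<in> \<Delta> \<and> \<xi> x \<noteq> 0. \<Sum>c\<in>G j ` topspace X. c * (real (\<xi> x) * indicator {x \<in> \<Delta>. G j x = c} x))"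
        by (rule sum.swap)
      also have "\<dots> = (\<Sum>x | x \<in> \<Delta> \<and> \<xi> x \<noteq> 0. real (\<xi> x) * G j x)"
      proof (intro sum.cong refl)
        fix x assume x: "x \<in> {x. x \<in> \<Delta> \<and> \<xi> x \<noteq> 0}"
        then have xX: "G j x \<in> G j ` topspace X" by (auto simp: \<Delta>_def)
        have "(\<Sum>c\<in>G j ` topspace X. c * (real (\<xi> x) * indicator {x \<in> \<Delta>. G j x = c} x)) = (\<Sum>c\<in>G j ` topspace X. if c = G j x then c * real (\<xi> x) else 0)"
          using x by (intro sum.cong refl) (auto simp: indicator_def)
        also have "\<dots> = G j x * real (\<xi> x)" using Gfin xX by simp
        finally show "(\<Sum>c\<in>G j ` topspace X. c * (real (\<xi> x) * indicator {x \<in> \<Delta>. G j x = c} x)) = real (\<xi> x) * G j x" by simp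
      qed
      finally show ?thesis .
    qed
    have "(\<lambda>j. \<Sum>x | x \<in> \<Delta> \<and> \<xi> x \<noteq> 0. real (\<xi> x) * G j x) \<longlonglongrightarrow> (\<Sum>x | x \<in> \<Delta> \<and> \<xi> x \<noteq> 0. real (\<xi> x) * f x)"
      using G(2) by (intro tendsto_sum tendsto_mult tendsto_const) (auto simp: \<Delta>_def borel_of_space)
    moreover have "{x. x \<in> \<Delta> \<and> \<xi> x \<noteq> 0} = {x. \<xi> x \<noteq> 0 \<and> f x \<noteq> 0}"
      using \<xi> by (auto simp: \<Delta>_def space_P Conf_def)
    ultimately show ?thesis unfolding T linear_statistic_def by simp
  qed
  show ?thesis by (rule borel_measurable_LIMSEQ_metric[OF Tm lim])
qed

lemma test_function_abs: "test_function X f \<Longrightarrow> test_function X (\<lambda>x. \<bar>f x\<bar>)"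
  unfolding test_function_def compact_support_on_def bounded_iff by (auto intro: borel_measurable_abs)

text \<open>The exponential of \<open>z\<close> times the statistic is the product of \<open>1 + W x\<close> over the points, with
  \<open>W = exp (z * f) - 1\<close>. Where \<open>cmod z * \<bar>f x\<bar> \<le> 1/12\<close> one has
  \<open>cmod (W x) \<le> 2 * cmod z * \<bar>f x\<bar> \<le> 1/6\<close>, so that \<open>expectation_product_bound\<close> applies; the two
  factors \<open>2\<close> make up the \<open>4\<close> in the exponent.\<close>

theorem mgf_linear_statistic_bound:
  assumes f: "test_function X f" and m: "\<forall>x\<in>topspace X. \<bar>f x\<bar> \<le> m"
  shows "integrable P (linear_statistic f)"
    and "\<bar>expect P (linear_statistic f)\<bar> \<le> expect P (linear_statistic (\<lambda>x. \<bar>f x\<bar>))"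
    and "cmod z * m \<le> 1/12 \<Longrightarrow> integrable P (\<lambda>\<xi>. exp (z * of_real (linear_statistic f \<xi>)))"
    and "cmod z * m \<le> 1/12 \<Longrightarrow> (LINT \<xi>|P. exp (z * of_real (linear_statistic f \<xi>))) \<noteq> 0"
    and "cmod z * m \<le> 1/12 \<Longrightarrow> cmod (LINT \<xi>|P. exp (z * of_real (linear_statistic f \<xi>)))
      \<le> exp (4 * cmod z * expect P (linear_statistic (\<lambda>x. \<bar>f x\<bar>)))"
proof -
  define \<Delta> where "\<Delta> = {x \<in> topspace X. f x \<noteq> 0}"
  have \<Delta>: "\<Delta> \<in> sets (borel_of X)" "precompactin X \<Delta>" unfolding \<Delta>_def by (rule support_of_test_function[OF f])+
  obtain pts \<rho> J k N where dp: "det_points P M \<Delta> pts \<rho> J k" and N: "N \<in> null_sets P"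
    and pts: "\<And>\<xi>. \<xi> \<in> space P - N \<Longrightarrow> pts \<xi> = {x \<in> \<Delta>. \<xi> x \<noteq> 0} \<and> (\<forall>x\<in>topspace X. \<xi> x \<le> 1)"
    by (rule restrict_to_precompact[OF \<Delta>]) auto
  interpret det_points P M \<Delta> pts \<rho> J k by (rule dp)
  have fM: "f \<in> borel_measurable M"
    using f measurable_cong_sets[OF sets_M refl] by (auto simp: test_function_def)
  have fb: "\<bar>f x\<bar> \<le> m" if "x \<in> space M" for x using m that by (simp add: space_M)
  have ae: "AE \<xi> in P. \<xi> \<in> space P - N" using AE_not_in[OF N] AE_space by eventually_elim auto
  have lin: "linear_statistic h \<xi> = (\<Sum>x\<in>pts \<xi>. h x)" if "\<xi> \<in> space P - N" and h: "\<And>x. h x \<noteq> 0 \<longleftrightarrow> f x \<noteq> 0" for h \<xi>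
  proof -
    have p: "pts \<xi> = {x \<in> \<Delta>. \<xi> x \<noteq> 0}" "\<forall>x\<in>topspace X. \<xi> x \<le> 1" using pts[OF that(1)] by auto
    have "\<xi> \<in> Conf X" using that(1) by (simp add: space_P)
    then have e: "{x. \<xi> x \<noteq> 0 \<and> h x \<noteq> 0} = pts \<xi>" unfolding p(1) using h by (auto simp: \<Delta>_def Conf_def)
    have "real (\<xi> x) * h x = h x" if "x \<in> pts \<xi>" for x
    proof -
      have "\<xi> x \<noteq> 0" "\<xi> x \<le> 1" using that p by (auto simp: \<Delta>_def)
      then have "\<xi> x = 1" by linarith
      then show ?thesis by simp
    qed
    then show ?thesis unfolding linear_statistic_def e by (intro sum.cong refl)
  qed
  let ?S = "linear_statistic f" and ?A = "linear_statistic (\<lambda>x. \<bar>f x\<bar>)"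
  have Sm: "?S \<in> borel_measurable P" "?A \<in> borel_measurable P"
    using linear_statistic_measurable f test_function_abs[OF f] by blast+
  have lf: "AE \<xi> in P. ?S \<xi> = (\<Sum>x\<in>pts \<xi>. f x)"
    using ae by eventually_elim (rule lin, auto)
  have la: "AE \<xi> in P. ?A \<xi> = (\<Sum>x\<in>pts \<xi>. \<bar>f x\<bar>)"
    using ae by eventually_elim (rule lin, auto)
  have if1: "integrable P (\<lambda>\<xi>. \<Sum>x\<in>pts \<xi>. f x)" by (rule sum_pts_integrable(1)[OF fM fb])
  have ia1: "integrable P (\<lambda>\<xi>. \<Sum>x\<in>pts \<xi>. \<bar>f x\<bar>)" by (rule sum_pts_integrable(1)[where c = m]) (use fM fb in auto)
  show iS: "integrable P ?S" using integrable_cong_AE[OF Sm(1) borel_measurable_integrable[OF if1] lf] if1 by simp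
  have iA: "integrable P ?A" using integrable_cong_AE[OF Sm(2) borel_measurable_integrable[OF ia1] la] ia1 by simp
  have EA: "expect P ?A = expectation (\<lambda>\<xi>. \<Sum>x\<in>pts \<xi>. \<bar>f x\<bar>)"
    unfolding expect_def by (rule integral_cong_AE[OF Sm(2) borel_measurable_integrable[OF ia1] la])
  show "\<bar>expect P ?S\<bar> \<le> expect P ?A"
  proof -
    have "\<bar>expect P ?S\<bar> \<le> expectation (\<lambda>\<xi>. \<bar>?S \<xi>\<bar>)" unfolding expect_def using integral_norm_bound[of P ?S] by simp
    also have "\<dots> \<le> expect P ?A"
      unfolding expect_def
    proof (rule integral_mono_AE)
      show "AE \<xi> in P. \<bar>?S \<xi>\<bar> \<le> ?A \<xi>" using lf la by eventually_elim (auto intro: sum_abs)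
    qed (use iS iA in auto)
    finally show ?thesis .
  qed
  assume z: "cmod z * m \<le> 1/12"
  define W where "W x = exp (z * of_real (f x)) - 1" for x
  have Wm: "W \<in> borel_measurable M" unfolding W_def using fM by measurable
  have W2: "cmod (W x) \<le> 2 * (cmod z * \<bar>f x\<bar>)" and Wb: "cmod (W x) \<le> 1/6" if x: "x \<in> space M" for x
  proof -
    have zf: "cmod z * \<bar>f x\<bar> \<le> 1/12" using mult_left_mono[OF fb[OF x], of "cmod z"] z by simp
    show w: "cmod (W x) \<le> 2 * (cmod z * \<bar>f x\<bar>)"
      unfolding W_def using norm_exp_minus_one_le[of "z * of_real (f x)"] zf by (simp add: norm_mult)
    show "cmod (W x) \<le> 1/6" using w zf by linarith
  qed
  note EP = expectation_product_bound[OF Wm Wb]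
  have prodW: "(\<Prod>x\<in>pts \<xi>. 1 + W x) = exp (z * of_real (\<Sum>x\<in>pts \<xi>. f x))" if "\<xi> \<in> space P" for \<xi>
    using finite_pts[OF that] by (simp add: W_def exp_sum sum_distrib_left)
  have aeq: "AE \<xi> in P. exp (z * of_real (?S \<xi>)) = (\<Prod>x\<in>pts \<xi>. 1 + W x)"
    using lf AE_space by eventually_elim (simp add: prodW)
  have em: "(\<lambda>\<xi>. exp (z * of_real (?S \<xi>))) \<in> borel_measurable P" using Sm by measurable
  show "integrable P (\<lambda>\<xi>. exp (z * of_real (?S \<xi>)))"
    using integrable_cong_AE[OF em borel_measurable_integrable[OF EP(1)] aeq] EP(1) by simp
  have eq: "(LINT \<xi>|P. exp (z * of_real (?S \<xi>))) = expectation (\<lambda>\<xi>. \<Prod>x\<in>pts \<xi>. 1 + W x)"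
    by (rule integral_cong_AE[OF em borel_measurable_integrable[OF EP(1)] aeq])
  obtain \<Phi> where \<Phi>: "expectation (\<lambda>\<xi>. \<Prod>x\<in>pts \<xi>. 1 + W x) = exp \<Phi>" "cmod \<Phi> \<le> 2 * expectation (\<lambda>\<xi>. \<Sum>x\<in>pts \<xi>. cmod (W x))"
    using EP(2) by blast
  show "(LINT \<xi>|P. exp (z * of_real (?S \<xi>))) \<noteq> 0" unfolding eq \<Phi>(1) by simp
  have "expectation (\<lambda>\<xi>. \<Sum>x\<in>pts \<xi>. cmod (W x)) \<le> expectation (\<lambda>\<xi>. 2 * cmod z * (\<Sum>x\<in>pts \<xi>. \<bar>f x\<bar>))"
  proof (intro integral_mono integrable_mult_right ia1)
    show "integrable P (\<lambda>\<xi>. \<Sum>x\<in>pts \<xi>. cmod (W x))" by (rule sum_pts_integrable(1)[where c = "1/6"]) (use Wm Wb in auto)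
    fix \<xi> assume \<xi>: "\<xi> \<in> space P"
    have "x \<in> space M" if "x \<in> pts \<xi>" for x using that pts_subset[OF \<xi>] by (auto simp: \<Delta>_def space_M)
    then show "(\<Sum>x\<in>pts \<xi>. cmod (W x)) \<le> 2 * cmod z * (\<Sum>x\<in>pts \<xi>. \<bar>f x\<bar>)"
      unfolding sum_distrib_left using W2 by (intro sum_mono) (simp add: mult.assoc)
  qed
  also have "\<dots> = 2 * cmod z * expect P ?A" unfolding EA by (rule integral_mult_right_zero)
  finally have "cmod \<Phi> \<le> 4 * cmod z * expect P ?A" using \<Phi>(2) by linarith
  then show "cmod (LINT \<xi>|P. exp (z * of_real (?S \<xi>))) \<le> exp (4 * cmod z * expect P ?A)"
    unfolding eq \<Phi>(1) norm_exp_eq_Re using complex_Re_le_cmod[of \<Phi>] by simp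
qed

end

section \<open>The central limit theorem\<close>

text \<open>The shift \<open>k\<close> allows for estimates that only hold from some point on.\<close>

lemma std_normal_limit_from_sequences:
  fixes N :: "real \<Rightarrow> real measure"
  assumes "\<And>s. filterlim s at_top sequentially \<Longrightarrow>
    \<exists>k. weak_conv_m (\<lambda>n. N (s (n + k))) std_normal_distribution"
  shows "weak_conv_along N std_normal_distribution at_top"
  unfolding weak_conv_along_def
proof (intro allI impI tendsto_at_topI_sequentially)
  fix x and s :: "nat \<Rightarrow> real"
  assume x: "isCont (cdf std_normal_distribution) x" and s: "filterlim s at_top sequentially"
  obtain k where "weak_conv_m (\<lambda>n. N (s (n + k))) std_normal_distribution" using assms[OF s] by blast
  then have "(\<lambda>n. cdf (N (s (n + k))) x) \<longlonglongrightarrow> cdf std_normal_distribution x"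
    using x by (simp add: weak_conv_m_def weak_conv_def)
  then show "(\<lambda>n. cdf (N (s n)) x) \<longlonglongrightarrow> cdf std_normal_distribution x"
    by (rule LIMSEQ_offset)
qed

context j_det_process
begin

lemma abs_le_SUP_abs:
  assumes "test_function X f" "x \<in> topspace X"
  shows "\<bar>f x\<bar> \<le> (SUP x\<in>topspace X. \<bar>f x\<bar>)"
proof (rule cSUP_upper[OF assms(2)])
  have "bounded (f ` topspace X)" using assms(1) by (simp add: test_function_def)
  then obtain c where "\<And>x. x \<in> topspace X \<Longrightarrow> \<bar>f x\<bar> \<le> c" unfolding bounded_iff by auto
  then show "bdd_above ((\<lambda>x. \<bar>f x\<bar>) ` topspace X)" by (intro bdd_aboveI[of _ c]) auto
qed

lemma SUP_abs_pos:
  assumes f: "test_function X f" and V: "0 < variance_of P (linear_statistic f)"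
  shows "0 < (SUP x\<in>topspace X. \<bar>f x\<bar>)"
proof -
  have "\<exists>x\<in>topspace X. f x \<noteq> 0"
  proof (rule ccontr)
    assume z: "\<not> (\<exists>x\<in>topspace X. f x \<noteq> 0)"
    have "linear_statistic f \<xi> = 0" if "\<xi> \<in> space P" for \<xi>
    proof -
      have "{x. \<xi> x \<noteq> 0 \<and> f x \<noteq> 0} = {}" using that z by (auto simp: space_P Conf_def)
      then show ?thesis by (simp only: linear_statistic_def sum.empty)
    qed
    then have "variance_of P (linear_statistic f) = 0"
      unfolding variance_of_def expect_def by (simp cong: Bochner_Integration.integral_cong)
    then show False using V by simp
  qed
  then obtain x where x: "x \<in> topspace X" "f x \<noteq> 0" by blast
  then have "0 < \<bar>f x\<bar>" by simp
  also have "\<dots> \<le> (SUP x\<in>topspace X. \<bar>f x\<bar>)" by (rule abs_le_SUP_abs[OF f x(1)])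
  finally show ?thesis .
qed

text \<open>The radius \<open>R\<close> is what becomes of the condition \<open>cmod z * m \<le> 1/12\<close> when \<open>z\<close> is divided by
  the standard deviation. Centring multiplies the transform by the exponential of
  \<open>- z * E S / sqrt V\<close>, and as \<open>\<bar>E S\<bar> \<le> A\<close> this turns the constant \<open>4\<close> of
  \<open>mgf_linear_statistic_bound\<close> into \<open>5\<close>.\<close>

lemma normalized_statistic:
  fixes f :: "'a \<Rightarrow> real"
  assumes f: "test_function X f"
  defines "S \<equiv> linear_statistic f"
  defines "V \<equiv> variance_of P S" and "m \<equiv> SUP x\<in>topspace X. \<bar>f x\<bar>"
    and "A \<equiv> expect P (linear_statistic (\<lambda>x. \<bar>f x\<bar>))"
  defines "R \<equiv> sqrt V / (12 * m)"
    and "N \<equiv> distr P borel (\<lambda>\<xi>. (S \<xi> - expect P S) / sqrt V)"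
  assumes V: "0 < V"
  shows "0 < m" and "0 \<le> A" and "real_distribution N"
    and "\<bar>s\<bar> < R \<Longrightarrow> integrable N (\<lambda>x. exp (s * x))"
    and "cmod z < R \<Longrightarrow> mgf N z \<noteq> 0"
    and "cmod z < R \<Longrightarrow> cmod (mgf N z) \<le> exp (5 * cmod z * A / sqrt V)"
    and "(LINT x|N. x) = 0" and "(LINT x|N. x\<^sup>2) = 1"
proof -
  interpret P: prob_space P by (rule prob_P)
  show m: "0 < m" unfolding m_def by (rule SUP_abs_pos[OF f V[unfolded V_def S_def]])
  have fm: "\<forall>x\<in>topspace X. \<bar>f x\<bar> \<le> m" unfolding m_def using abs_le_SUP_abs[OF f] by blast
  note B = mgf_linear_statistic_bound[OF f fm, folded S_def A_def]
  show A: "0 \<le> A" using B(2) by linarith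
  have Sm[measurable]: "S \<in> borel_measurable P" unfolding S_def by (rule linear_statistic_measurable[OF f])
  define Y where "Y \<xi> = (S \<xi> - expect P S) / sqrt V" for \<xi>
  have Ym[measurable]: "Y \<in> borel_measurable P" unfolding Y_def by measurable
  have NY: "N = distr P borel Y" by (simp add: N_def Y_def[abs_def])
  show "real_distribution N" unfolding NY by (rule P.real_distribution_distr) simp
  have small: "cmod (z / of_real (sqrt V)) * m \<le> 1/12" if "cmod z < R" for z
  proof -
    have "cmod z / sqrt V * m \<le> R / sqrt V * m"
      using that V m by (intro mult_right_mono divide_right_mono) auto
    also have "\<dots> = 1/12" using V m by (simp add: R_def)
    finally show ?thesis using V by (simp add: norm_divide)
  qed
  have split: "exp (z * of_real (Y \<xi>)) = exp (- (z / of_real (sqrt V)) * of_real (expect P S)) * exp (z / of_real (sqrt V) * of_real (S \<xi>))" for z :: complex and \<xi>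
    unfolding exp_add[symmetric] Y_def by (simp add: algebra_simps diff_divide_distrib)
  have expY: "integrable P (\<lambda>\<xi>. exp (z * of_real (Y \<xi>)))" if "cmod z < R" for z
    unfolding split by (intro integrable_mult_right B(3) small that)
  show "integrable N (\<lambda>x. exp (s * x))" if "\<bar>s\<bar> < R"
  proof -
    have "integrable P (\<lambda>\<xi>. cmod (exp (of_real s * of_real (Y \<xi>))))"
      using that by (intro integrable_norm expY) simp
    then have "integrable P (\<lambda>\<xi>. exp (s * Y \<xi>))" by (simp add: norm_exp_eq_Re)
    then show ?thesis unfolding NY by (subst integrable_distr_eq) simp_all
  qed
  have mgfN: "mgf N z = exp (- (z / of_real (sqrt V)) * of_real (expect P S)) * (LINT \<xi>|P. exp (z / of_real (sqrt V) * of_real (S \<xi>)))" for z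
  proof -
    have "mgf N z = (LINT \<xi>|P. exp (z * of_real (Y \<xi>)))"
      unfolding mgf_def NY by (rule integral_distr) measurable
    then show ?thesis unfolding split by (simp only: integral_mult_right_zero)
  qed
  show "mgf N z \<noteq> 0" if "cmod z < R" unfolding mgfN using B(4)[OF small[OF that]] by simp
  show "cmod (mgf N z) \<le> exp (5 * cmod z * A / sqrt V)" if "cmod z < R"
  proof -
    let ?w = "z / of_real (sqrt V)"
    have "cmod (- ?w * of_real (expect P S)) \<le> cmod ?w * A"
      unfolding norm_mult norm_minus_cancel using B(2) by (intro mult_left_mono) auto
    then have "Re (- ?w * of_real (expect P S)) \<le> cmod ?w * A"
      using complex_Re_le_cmod[of "- ?w * of_real (expect P S)"] by linarith
    then have "cmod (mgf N z) \<le> exp (cmod ?w * A) * exp (4 * cmod ?w * A)"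
      unfolding mgfN norm_mult norm_exp_eq_Re by (intro mult_mono B(5) small that) auto
    also have "\<dots> = exp (5 * cmod ?w * A)" unfolding exp_add[symmetric] by (simp add: algebra_simps)
    also have "5 * cmod ?w * A = 5 * cmod z * A / sqrt V" using V by (simp add: norm_divide)
    finally show ?thesis .
  qed
  have "(LINT x|N. x) = (LINT \<xi>|P. Y \<xi>)" unfolding NY by (rule integral_distr) measurable
  also have "\<dots> = (LINT \<xi>|P. S \<xi> - expect P S) / sqrt V" unfolding Y_def by simp
  also have "(LINT \<xi>|P. S \<xi> - expect P S) = 0"
    using B(1) by (simp add: expect_def P.prob_space)
  finally show "(LINT x|N. x) = 0" by simp
  have "(LINT x|N. x\<^sup>2) = (LINT \<xi>|P. (Y \<xi>)\<^sup>2)" unfolding NY by (rule integral_distr) measurable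
  also have "\<dots> = (LINT \<xi>|P. (S \<xi> - expect P S)\<^sup>2 / V)" using V by (simp add: Y_def power_divide)
  also have "\<dots> = V / V" by (simp add: V_def variance_of_def expect_def)
  finally show "(LINT x|N. x\<^sup>2) = 1" using V by simp
qed

end

lemma quarter_powr_le:
  fixes V m :: real
  assumes V: "1 \<le> V" and m: "0 < m" "m \<le> V powr (1/4)"
  shows "V powr (1/4) \<le> 12 * (sqrt V / (12 * m))"
proof -
  have sq: "sqrt V = V powr (1/4) * V powr (1/4)"
    using V by (simp add: powr_half_sqrt[symmetric] powr_add[symmetric])
  have "V powr (1/4) * m \<le> V powr (1/4) * V powr (1/4)" using m by (intro mult_left_mono) auto
  then show ?thesis using m by (simp add: sq[symmetric] field_simps)
qed

text \<open>As \<open>V powr (1/4) \<le> 12 * R\<close> for the radius \<open>R = sqrt V / (12 * m)\<close>, every power of \<open>V\<close> is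
  bounded by a power of \<open>R\<close>. The summand \<open>1\<close> in the constant makes the inequality strict.\<close>

lemma polynomial_exponent_bound:
  fixes A V m :: real
  assumes V: "1 \<le> V" and m: "0 < m" "m \<le> V powr (1/4)" and A: "0 \<le> A" "A \<le> c * V powr \<delta>" and c: "0 \<le> c"
    and k: "4 * \<delta> \<le> real k" and r: "0 \<le> r" "r < sqrt V / (12 * m)"
  shows "5 * r * A / sqrt V < (5 * c * 12 ^ k + 1) * (sqrt V / (12 * m)) ^ Suc k"
proof -
  define R where "R = sqrt V / (12 * m)"
  have q: "V powr (1/4) \<le> 12 * R" unfolding R_def by (rule quarter_powr_le[OF V m])
  have q1: "1 \<le> V powr (1/4)" using V by (simp add: ge_one_powr_ge_zero)
  have R0: "0 < R" using q q1 by linarith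
  have "V powr \<delta> \<le> V powr (1/4 * real k)" using V k by (intro powr_mono) auto
  also have "\<dots> = (V powr (1/4)) powr real k" by (simp only: powr_powr)
  also have "\<dots> = (V powr (1/4)) ^ k" using q1 by (intro powr_realpow) linarith
  also have "\<dots> \<le> (12 * R) ^ k" using q q1 by (intro power_mono) auto
  finally have Ak: "A \<le> c * (12 * R) ^ k" using A c by (meson mult_left_mono order_trans)
  have s1: "1 \<le> sqrt V" using V by simp
  have "5 * r * A / sqrt V \<le> 5 * r * A / 1" using s1 r A by (intro divide_left_mono) auto
  also have "\<dots> = 5 * r * A" by simp
  also have "\<dots> \<le> 5 * R * (c * (12 * R) ^ k)"
    using Ak r A R0 by (intro mult_mono) (auto simp: R_def)
  also have "\<dots> = (5 * c * 12 ^ k) * R ^ Suc k" by (simp add: power_mult_distrib)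
  also have "\<dots> < (5 * c * 12 ^ k + 1) * R ^ Suc k" using R0 by (simp add: algebra_simps)
  finally show ?thesis unfolding R_def .
qed

theorem theorem1p1:
  fixes X :: "real \<Rightarrow> 'a topology"
    and X1 X2 :: "real \<Rightarrow> 'a set"
    and \<mu> :: "real \<Rightarrow> 'a measure"
    and K :: "real \<Rightarrow> 'a \<Rightarrow> 'a \<Rightarrow> complex"
    and P :: "real \<Rightarrow> ('a \<Rightarrow> nat) measure"
    and f :: "real \<Rightarrow> 'a \<Rightarrow> real"
  defines "S \<equiv> \<lambda>L. linear_statistic (f L)"
    and "Sabs \<equiv> \<lambda>L. linear_statistic (\<lambda>x. \<bar>f L x\<bar>)"
  defines "V \<equiv> \<lambda>L. variance_of (P L) (S L)"
  assumes "\<And>L. 0 \<le> L \<Longrightarrow> lc_polish_space (X L)"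
    and "\<And>L. 0 \<le> L \<Longrightarrow> X1 L \<in> sets (borel_of (X L)) \<and> X2 L \<in> sets (borel_of (X L))"
    and "\<And>L. 0 \<le> L \<Longrightarrow> X1 L \<inter> X2 L = {} \<and> X1 L \<union> X2 L = topspace (X L)"
    and "\<And>L. 0 \<le> L \<Longrightarrow> radon_measure (X L) (\<mu> L)"
    and "\<And>L. 0 \<le> L \<Longrightarrow> J_Hermitian (\<mu> L) (X1 L) (X2 L) (K L)"
    and "\<And>L \<Delta>. 0 \<le> L \<Longrightarrow> \<Delta> \<in> sets (borel_of (X L)) \<Longrightarrow> precompactin (X L) \<Delta> \<Longrightarrow>
           class_1_2 (\<mu> L) (X1 L) (X2 L) (kernel_op (\<mu> L) (K L) \<circ> mult_op (indicator \<Delta>))"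
    and "\<And>L. 0 \<le> L \<Longrightarrow> trace_formula (X L) (\<mu> L) (X1 L) (X2 L) (K L)"
    and "\<And>L. 0 \<le> L \<Longrightarrow> determinantal_process (X L) (\<mu> L) (K L) (P L)"
    and "\<And>L. 0 \<le> L \<Longrightarrow> test_function (X L) (f L)"
    and "filterlim V at_top at_top"
    and "\<And>\<epsilon>. 0 < \<epsilon> \<Longrightarrow>
           (\<lambda>L. SUP x\<in>topspace (X L). \<bar>f L x\<bar>) \<in> o[at_top](\<lambda>L. V L powr \<epsilon>)"
    and "\<exists>\<delta>>0. (\<lambda>L. expect (P L) (Sabs L)) \<in> O[at_top](\<lambda>L. V L powr \<delta>)"
  shows "weak_conv_along
           (\<lambda>L. distr (P L) borel (\<lambda>\<xi>. (S L \<xi> - expect (P L) (S L)) / sqrt (V L)))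
           std_normal_distribution at_top"
proof -
  define m where "m L = (SUP x\<in>topspace (X L). \<bar>f L x\<bar>)" for L
  define A where "A L = expect (P L) (Sabs L)" for L
  define R where "R L = sqrt (V L) / (12 * m L)" for L
  define N where "N L = distr (P L) borel (\<lambda>\<xi>. (S L \<xi> - expect (P L) (S L)) / sqrt (V L))" for L
  have J: "j_det_process (X L) (X1 L) (X2 L) (\<mu> L) (K L) (P L)" if "0 \<le> L" for L
    using assms(4-8,10,11)[OF that] by (simp add: j_det_process_def j_det_process_axioms_def lc_polish_def)
  have sv: "linear_statistic (f L) = S L" "linear_statistic (\<lambda>x. \<bar>f L x\<bar>) = Sabs L" "variance_of (P L) (S L) = V L" for L
    by (simp_all add: S_def Sabs_def V_def)
  note NS = j_det_process.normalized_statistic[OF J assms(12), unfolded sv, folded m_def, folded A_def R_def N_def]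
  obtain \<delta> where \<delta>: "0 < \<delta>" "A \<in> O[at_top](\<lambda>L. V L powr \<delta>)"
    using assms(15) unfolding A_def[abs_def] by blast
  then obtain c where c: "0 < c" "\<forall>\<^sub>F L in at_top. norm (A L) \<le> c * norm (V L powr \<delta>)"
    by (elim landau_o.bigE)
  have "m \<in> o[at_top](\<lambda>L. V L powr (1/4))" unfolding m_def[abs_def] by (rule assms(14)) simp
  from landau_o.smallD[OF this, of 1] have mV: "\<forall>\<^sub>F L in at_top. norm (m L) \<le> 1 * norm (V L powr (1/4))" by simp
  have V1: "\<forall>\<^sub>F L in at_top. 1 \<le> V L" using assms(13) by (simp add: filterlim_at_top)
  \<comment> \<open>What has to hold for \<open>L\<close> to be large enough; the hypothesis on the supremum is used with
    \<open>\<epsilon> = 1/4\<close>.\<close>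
  define good where "good L \<longleftrightarrow> 0 \<le> L \<and> 1 \<le> V L \<and> m L \<le> V L powr (1/4) \<and> A L \<le> c * V L powr \<delta>" for L
  have good: "\<forall>\<^sub>F L in at_top. good L"
    using c(2) mV V1 eventually_ge_at_top[of 0] by eventually_elim (auto simp: good_def)
  \<comment> \<open>The transforms will be bounded by \<open>exp (C * R ^ Suc k)\<close>; \<open>k \<ge> 1\<close> ensures that \<open>Suc k \<ge> 2\<close>.\<close>
  obtain k where k: "1 \<le> k" "4 * \<delta> \<le> real k"
    using real_arch_simple[of "max 1 (4 * \<delta>)"] by (metis max.bounded_iff of_nat_1 of_nat_le_iff)
  have R_ge: "V L powr (1/4) / 12 \<le> R L" if "good L" for L
  proof -
    have "0 < m L" using NS(1)[of L] that by (simp add: good_def)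
    then have "V L powr (1/4) \<le> 12 * R L" unfolding R_def using that by (intro quarter_powr_le) (auto simp: good_def)
    then show ?thesis by simp
  qed
  have Rlim: "filterlim R at_top at_top"
  proof (rule filterlim_at_top_mono)
    show "\<forall>\<^sub>F L in at_top. V L powr (1/4) / 12 \<le> R L" using good by eventually_elim (rule R_ge)
    have "filterlim (\<lambda>v::real. v powr (1/4) / 12) at_top at_top" by real_asymp
    then show "filterlim (\<lambda>L. V L powr (1/4) / 12) at_top at_top" by (rule filterlim_compose) (rule assms(13))
  qed
  show ?thesis
    unfolding N_def[symmetric]
  proof (rule std_normal_limit_from_sequences)
    fix s :: "nat \<Rightarrow> real" assume s: "filterlim s at_top sequentially"
    have "\<forall>\<^sub>F n in sequentially. good (s n)" using eventually_compose_filterlim[OF good s] .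
    then obtain n0 where n0: "\<And>n. n0 \<le> n \<Longrightarrow> good (s n)" unfolding eventually_sequentially by blast
    have g: "good (s (n + n0))" for n by (rule n0) simp
    have s0: "0 \<le> s (n + n0)" for n using g[of n] by (simp add: good_def)
    have sV: "0 < V (s (n + n0))" for n
      using g[of n] unfolding good_def by linarith
    note NSn = NS[OF s0 s0 sV]
    have "weak_conv_m (\<lambda>n. N (s (n + n0))) std_normal_distribution"
    proof (rule central_limit_of_zero_free_mgf[where R = "\<lambda>n. R (s (n + n0))" and C = "5 * c * 12 ^ k + 1" and p = "Suc k"])
      show "filterlim (\<lambda>n. R (s (n + n0))) at_top sequentially"
        by (intro filterlim_compose[OF Rlim] filterlim_compose[OF s] filterlim_add_const_nat_at_top)
      show "0 < R (s (n + n0))" for n using NSn(1) sV by (simp add: R_def)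
      show "cmod (mgf (N (s (n + n0))) z) < exp ((5 * c * 12 ^ k + 1) * R (s (n + n0)) ^ Suc k)"
        if z: "cmod z < R (s (n + n0))" for n z
      proof -
        have "5 * cmod z * A (s (n + n0)) / sqrt (V (s (n + n0))) < (5 * c * 12 ^ k + 1) * R (s (n + n0)) ^ Suc k"
          unfolding R_def using g[of n] z NSn(1,2) by (intro polynomial_exponent_bound[where \<delta> = \<delta>] k less_imp_le[OF c(1)]) (auto simp: good_def R_def)
        with NSn(6)[OF z] show ?thesis by (meson exp_less_cancel_iff le_less_trans)
      qed
      show "2 \<le> Suc k" using k by simp
    qed (fact NSn)+
    then show "\<exists>k. weak_conv_m (\<lambda>n. N (s (n + k))) std_normal_distribution" by blast
  qed
qed

end
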